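(* Let $1<p<\infty$. Assume that $u_0\in W^{1,p}_{\rm per}(I)$ satisfies $$\int_I\cos(u_0+\phi)\,ds=\int_I\sin(u_0+\phi)\,ds=0 .$$ Then there exists $T>0$ such that problem (P) (defined in the context) possesses a weak solution in $[0,T)$.
   Context: Fix $L>0$ and a positive integer $\eta$; let $I=(0,L)$ and $\phi(s)=2\pi\eta s/L$. Function spaces: $C_{\rm per}(I)=\{u\in C(\mathbb R): u(s+kL)=u(s)\ \text{for all } s\in\bar I,\ k\in\mathbb Z\}$ and $W^{1,p}_{\rm per}(I)=\{u\in W^{1,p}(I): u\in C_{\rm per}(I)\}$. Convention: $|0|^{p-2}0=0$. For $\theta=u+\phi$ with $u\in W^{1,p}_{\rm per}(I)$ let $$A_T(\theta)=\begin{pmatrix}\int_I\sin^2\theta\,ds&-\int_I\sin\theta\cos\theta\,ds\\-\int_I\sin\theta\cos\theta\,ds&\int_I\cos^2\theta\,ds\end{pmatrix},$$ $$\tilde\lambda_1(u)=\frac{1}{\det A_T(\theta)}\Big[\int_I|\theta_s|^p\cos\theta\,ds\int_I\cos^2\theta\,ds+\int_I|\theta_s|^p\sin\theta\,ds\int_I\sin\theta\cos\theta\,ds\Big],$$ $$\tilde\lambda_2(u)=\frac{1}{\det A_T(\theta)}\Big[\int_I|\theta_s|^p\cos\theta\,ds\int_I\sin\theta\cos\theta\,ds+\int_I|\theta_s|^p\sin\theta\,ds\int_I\sin^2\theta\,ds\Big].$$ Problem (P) is, formally, $$\partial_tu=\partial_s\big(|\partial_s(u+\phi)|^{p-2}\partial_s(u+\phi)\big)+\tilde\lambda_1(u)\sin(u+\phi)-\tilde\lambda_2(u)\cos(u+\phi),\qquad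 u(\cdot,0)=u_0 .$$ Definition of weak solution. $u:I\times[0,T)\to\mathbb R$ is a weak solution of (P) (on $[0,T)$) if: (i) $u\in L^\infty(0,T;W^{1,p}_{\rm per}(I))\cap H^1(0,T;L^2(I))$; (ii) there exist $\lambda_1,\lambda_2\in L^2(0,T)$ such that for every $\varphi\in L^\infty(0,T;W^{1,p}_{\rm per}(I))$ $$\int_0^T\!\!\int_I\Big[\big\{\partial_tu-\lambda_1\sin(u+\phi)+\lambda_2\cos(u+\phi)\big\}\varphi+|\partial_s(u+\phi)|^{p-2}\partial_s(u+\phi)\,\partial_s\varphi\Big]ds\,dt=0;$$ (iii) for every $t\in[0,T)$, $\int_I\cos(u(\cdot,t)+\phi)\,ds=\int_I\sin(u(\cdot,t)+\phi)\,ds=0$; (iv) $u(0)=u_0$ in $W^{1,p}_{\rm per}(I)$. *)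

theory Defs
  imports "HOL-Analysis.Analysis"
begin

section \<open>Lebesgue and Sobolev spaces on an interval\<close>

text \<open>Elements of a Lebesgue space are represented by functions rather than by classes;
  \<open>Lp_norm\<close> is then a seminorm, and it is only meaningful on \<open>Lp_space\<close>.\<close>

definition Lp_space :: "real \<Rightarrow> real \<Rightarrow> real \<Rightarrow> (real \<Rightarrow> real) set" where
  "Lp_space p a b = {f \<in> borel_measurable (lebesgue_on {a<..<b}).
     integrable (lebesgue_on {a<..<b}) (\<lambda>x. \<bar>f x\<bar> powr p)}"

definition Lp_norm :: "real \<Rightarrow> real \<Rightarrow> real \<Rightarrow> (real \<Rightarrow> real) \<Rightarrow> real" where
  "Lp_norm p a b f = (LINT x|lebesgue_on {a<..<b}. \<bar>f x\<bar> powr p) powr (1 / p)"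

definition test_function :: "real \<Rightarrow> real \<Rightarrow> (real \<Rightarrow> real) \<Rightarrow> bool" where
  "test_function a b \<psi> \<longleftrightarrow>
     (\<forall>n x. ((deriv ^^ n) \<psi>) differentiable (at x)) \<and>
     (\<exists>K. compact K \<and> K \<subseteq> {a<..<b} \<and> (\<forall>x. x \<notin> K \<longrightarrow> \<psi> x = 0))"

definition locally_integrable :: "real \<Rightarrow> real \<Rightarrow> (real \<Rightarrow> real) \<Rightarrow> bool" where
  "locally_integrable a b f \<longleftrightarrow>
     (\<forall>K. compact K \<and> K \<subseteq> {a<..<b} \<longrightarrow> integrable (lebesgue_on K) f)"

definition has_weak_deriv ::
  "real \<Rightarrow> real \<Rightarrow> (real \<Rightarrow> real) \<Rightarrow> (real \<Rightarrow> real) \<Rightarrow> bool" where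
  "has_weak_deriv a b f g \<longleftrightarrow>
     locally_integrable a b f \<and> locally_integrable a b g \<and>
     (\<forall>\<psi>. test_function a b \<psi> \<longrightarrow>
        (LINT x|lebesgue_on {a<..<b}. f x * deriv \<psi> x)
          = - (LINT x|lebesgue_on {a<..<b}. g x * \<psi> x))"

text \<open>The weak derivative is unique up to null sets; it is only used under integrals over
  \<open>(a, b)\<close>, where the choice of the representative is immaterial.\<close>

definition weak_deriv :: "real \<Rightarrow> real \<Rightarrow> (real \<Rightarrow> real) \<Rightarrow> real \<Rightarrow> real" where
  "weak_deriv a b f = (SOME g. has_weak_deriv a b f g)"

definition W1p :: "real \<Rightarrow> real \<Rightarrow> real \<Rightarrow> (real \<Rightarrow> real) set" where
  "W1p p a b = {f \<in> Lp_space p a b. \<exists>g \<in> Lp_space p a b. has_weak_deriv a b f g}"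

definition W1p_norm :: "real \<Rightarrow> real \<Rightarrow> real \<Rightarrow> (real \<Rightarrow> real) \<Rightarrow> real" where
  "W1p_norm p a b f = Lp_norm p a b f + Lp_norm p a b (weak_deriv a b f)"

definition C_per :: "real \<Rightarrow> (real \<Rightarrow> real) set" where
  "C_per L = {u. continuous_on UNIV u \<and>
     (\<forall>s \<in> {0..L}. \<forall>k::int. u (s + of_int k * L) = u s)}"

definition W1p_per :: "real \<Rightarrow> real \<Rightarrow> (real \<Rightarrow> real) set" where
  "W1p_per p L = {u \<in> W1p p 0 L. u \<in> C_per L}"


section \<open>Bochner spaces on \<open>(0, T)\<close>\<close>

text \<open>The target space is a vector space \<open>X\<close> of real functions with a seminorm \<open>N\<close>. It depends
  on the real parameters \<open>p\<close> and \<open>L\<close>, so it cannot be a type of class \<^class>\<open>banach\<close>; the notions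
  below are the usual ones (compare \<^const>\<open>has_bochner_integral\<close>) relative to \<open>X\<close> and \<open>N\<close>.
  A function of time and space is written \<open>u t s\<close>, with time as the first argument.\<close>

definition simple_in :: "(real \<Rightarrow> real) set \<Rightarrow> real \<Rightarrow> (real \<Rightarrow> real \<Rightarrow> real) \<Rightarrow> bool" where
  "simple_in X T f \<longleftrightarrow>
     simple_function (lebesgue_on {0<..<T}) f \<and> (\<forall>t \<in> {0<..<T}. f t \<in> X)"

definition strongly_measurable_in ::
  "(real \<Rightarrow> real) set \<Rightarrow> ((real \<Rightarrow> real) \<Rightarrow> real) \<Rightarrow> real \<Rightarrow> (real \<Rightarrow> real \<Rightarrow> real) \<Rightarrow> bool" where
  "strongly_measurable_in X N T f \<longleftrightarrow>
     (AE t in lebesgue_on {0<..<T}. f t \<in> X) \<and>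
     (\<exists>g. (\<forall>n. simple_in X T (g n)) \<and>
        (AE t in lebesgue_on {0<..<T}. (\<lambda>n::nat. N (\<lambda>s. f t s - g n t s)) \<longlonglongrightarrow> 0))"

definition Bochner_Linf ::
  "(real \<Rightarrow> real) set \<Rightarrow> ((real \<Rightarrow> real) \<Rightarrow> real) \<Rightarrow> real \<Rightarrow> (real \<Rightarrow> real \<Rightarrow> real) set" where
  "Bochner_Linf X N T = {f. strongly_measurable_in X N T f \<and>
     (\<exists>C. AE t in lebesgue_on {0<..<T}. N (f t) \<le> C)}"

definition Bochner_L2 ::
  "(real \<Rightarrow> real) set \<Rightarrow> ((real \<Rightarrow> real) \<Rightarrow> real) \<Rightarrow> real \<Rightarrow> (real \<Rightarrow> real \<Rightarrow> real) set" where
  "Bochner_L2 X N T = {f. strongly_measurable_in X N T f \<and>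
     integrable (lebesgue_on {0<..<T}) (\<lambda>t. (N (f t))\<^sup>2)}"

definition has_Bochner_integral_in ::
  "(real \<Rightarrow> real) set \<Rightarrow> ((real \<Rightarrow> real) \<Rightarrow> real) \<Rightarrow> real \<Rightarrow>
     (real \<Rightarrow> real \<Rightarrow> real) \<Rightarrow> (real \<Rightarrow> real) \<Rightarrow> bool" where
  "has_Bochner_integral_in X N T f y \<longleftrightarrow>
     strongly_measurable_in X N T f \<and> y \<in> X \<and>
     (\<exists>g. (\<forall>n. simple_in X T (g n)) \<and>
        ((\<lambda>n::nat. \<integral>\<^sup>+t. ennreal (N (\<lambda>s. f t s - g n t s)) \<partial>lebesgue_on {0<..<T}) \<longlonglongrightarrow> 0) \<and>
        ((\<lambda>n. N (\<lambda>s. y s - (\<Sum>w \<in> g n ` {0<..<T}.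
            measure lebesgue {t \<in> {0<..<T}. g n t = w} * w s))) \<longlonglongrightarrow> 0))"

text \<open>\<open>\<integral> \<psi>'(t) u(t) dt = - \<integral> \<psi>(t) v(t) dt\<close> as elements of \<open>X\<close>, i.e. up to seminorm zero.\<close>

definition has_weak_time_deriv ::
  "(real \<Rightarrow> real) set \<Rightarrow> ((real \<Rightarrow> real) \<Rightarrow> real) \<Rightarrow> real \<Rightarrow>
     (real \<Rightarrow> real \<Rightarrow> real) \<Rightarrow> (real \<Rightarrow> real \<Rightarrow> real) \<Rightarrow> bool" where
  "has_weak_time_deriv X N T u v \<longleftrightarrow>
     (\<forall>\<psi>. test_function 0 T \<psi> \<longrightarrow>
        (\<exists>y z. has_Bochner_integral_in X N T (\<lambda>t s. deriv \<psi> t * u t s) y \<and>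
               has_Bochner_integral_in X N T (\<lambda>t s. \<psi> t * v t s) z \<and>
               N (\<lambda>s. y s + z s) = 0))"

definition weak_time_deriv ::
  "(real \<Rightarrow> real) set \<Rightarrow> ((real \<Rightarrow> real) \<Rightarrow> real) \<Rightarrow> real \<Rightarrow>
     (real \<Rightarrow> real \<Rightarrow> real) \<Rightarrow> real \<Rightarrow> real \<Rightarrow> real" where
  "weak_time_deriv X N T u = (SOME v. has_weak_time_deriv X N T u v)"

definition Bochner_H1 ::
  "(real \<Rightarrow> real) set \<Rightarrow> ((real \<Rightarrow> real) \<Rightarrow> real) \<Rightarrow> real \<Rightarrow> (real \<Rightarrow> real \<Rightarrow> real) set" where
  "Bochner_H1 X N T =
     {u \<in> Bochner_L2 X N T. \<exists>v \<in> Bochner_L2 X N T. has_weak_time_deriv X N T u v}"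

definition continuous_in ::
  "(real \<Rightarrow> real) set \<Rightarrow> ((real \<Rightarrow> real) \<Rightarrow> real) \<Rightarrow> real \<Rightarrow> (real \<Rightarrow> real \<Rightarrow> real) \<Rightarrow> bool" where
  "continuous_in X N T u \<longleftrightarrow>
     (\<forall>t \<in> {0..<T}. u t \<in> X \<and>
        ((\<lambda>\<tau>. N (\<lambda>s. u \<tau> s - u t s)) \<longlongrightarrow> 0) (at t within {0..<T}))"


section \<open>The evolution problem\<close>

definition phi :: "real \<Rightarrow> nat \<Rightarrow> real \<Rightarrow> real" where
  "phi L \<eta> s = 2 * pi * real \<eta> * s / L"

abbreviation Linf_W1p_per :: "real \<Rightarrow> real \<Rightarrow> real \<Rightarrow> (real \<Rightarrow> real \<Rightarrow> real) set" where
  "Linf_W1p_per p L T \<equiv> Bochner_Linf (W1p_per p L) (W1p_norm p 0 L) T"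

abbreviation H1_L2 :: "real \<Rightarrow> real \<Rightarrow> (real \<Rightarrow> real \<Rightarrow> real) set" where
  "H1_L2 L T \<equiv> Bochner_H1 (Lp_space 2 0 L) (Lp_norm 2 0 L) T"

abbreviation time_deriv_L2 ::
  "real \<Rightarrow> real \<Rightarrow> (real \<Rightarrow> real \<Rightarrow> real) \<Rightarrow> real \<Rightarrow> real \<Rightarrow> real" where
  "time_deriv_L2 L T u \<equiv> weak_time_deriv (Lp_space 2 0 L) (Lp_norm 2 0 L) T u"

text \<open>An element of \<open>H\<^sup>1(0,T;L\<^sup>2(I))\<close> has a unique representative that is continuous in time with
  values in \<open>L\<^sup>2(I)\<close>, and conditions at every (or a given) time refer to it. The clause
  \<open>continuous_in\<close> says that \<open>u\<close> is this representative; without it \<open>u\<close> could be altered on a null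
  set of times so as to satisfy the initial condition vacuously.

  The convention \<open>|0|\<^sup>p\<^sup>-\<^sup>2 0 = 0\<close> holds for \<open>\<bar>x\<bar> powr (p - 2) * x\<close> automatically.\<close>

definition weak_solution ::
  "real \<Rightarrow> real \<Rightarrow> nat \<Rightarrow> (real \<Rightarrow> real) \<Rightarrow> real \<Rightarrow> (real \<Rightarrow> real \<Rightarrow> real) \<Rightarrow> bool" where
  "weak_solution p L \<eta> u0 T u \<longleftrightarrow>
     u \<in> Linf_W1p_per p L T \<and> u \<in> H1_L2 L T \<and>
     continuous_in (Lp_space 2 0 L) (Lp_norm 2 0 L) T u \<and>
     (\<exists>\<mu>1 \<in> Lp_space 2 0 T. \<exists>\<mu>2 \<in> Lp_space 2 0 T. \<forall>\<phi> \<in> Linf_W1p_per p L T.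
        (LINT t|lebesgue_on {0<..<T}. LINT s|lebesgue_on {0<..<L}.
           (time_deriv_L2 L T u t s
              - \<mu>1 t * sin (u t s + phi L \<eta> s) + \<mu>2 t * cos (u t s + phi L \<eta> s)) * \<phi> t s
           + \<bar>weak_deriv 0 L (\<lambda>x. u t x + phi L \<eta> x) s\<bar> powr (p - 2)
               * weak_deriv 0 L (\<lambda>x. u t x + phi L \<eta> x) s * weak_deriv 0 L (\<phi> t) s) = 0) \<and>
     (\<forall>t \<in> {0..<T}.
        (LINT s|lebesgue_on {0<..<L}. cos (u t s + phi L \<eta> s)) = 0 \<and>
        (LINT s|lebesgue_on {0<..<L}. sin (u t s + phi L \<eta> s)) = 0) \<and>
     u 0 \<in> W1p_per p L \<and> u 0 = u0"

end

theory Submission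
  imports Defs
begin

text \<open>The equation is discretised implicitly in time. Given \<open>u\<^sub>k\<close>, the next iterate minimises
  \<open>\<integral> \<bar>\<partial>\<^sub>s (v + \<phi>)\<bar>\<^sup>p / p + \<integral> (v - u\<^sub>k)\<^sup>2 / 2\<tau>\<close> among the \<open>v\<close> such that \<open>v - u\<^sub>k\<close> is orthogonal to
  \<open>sin (u\<^sub>k + \<phi>)\<close> and \<open>cos (u\<^sub>k + \<phi>)\<close>. This linearised constraint produces the two multipliers, and the
  closing conditions drift by \<open>O(\<tau>)\<close> only. The multipliers are bounded as long as the Gram determinant
  of \<open>sin (u\<^sub>k + \<phi>)\<close> and \<open>cos (u\<^sub>k + \<phi>)\<close> stays away from zero, hence for a short time.

  No compactness is needed. By monotonicity of the flux, and since the multiplier terms are Lipschitz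
  in \<open>L\<^sup>2\<close>, the schemes with steps \<open>\<tau>\<close> and \<open>\<tau>/2\<close> differ by \<open>O(\<tau>\<^sup>1\<^sup>/\<^sup>2)\<close> in \<open>L\<^sup>2\<close>, uniformly in time; the
  part of the dissipation quadratic in \<open>\<bar>x\<bar>\<^sup>p\<^sup>/\<^sup>2\<^sup>-\<^sup>1 x\<close> yields convergence in \<open>W\<^sup>1\<^sup>,\<^sup>p\<close> for almost
  every time. The difference quotients in time and the multipliers are merely bounded in \<open>L\<^sup>2\<close>, but
  convex combinations of their tails converge strongly, and since everything else in the
  discrete equation converges pointwise in time, this suffices to pass to the limit.\<close>

section \<open>The scalar flux of the p-Laplacian\<close>

text \<open>The multipliers are the obstacle. They are bounded, but nothing is known about the
  difference of those of two schemes, so a comparison cannot rest on their convergence. It rests on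
  geometry instead: their forces are normal to the constraint set. Tested with the difference of two
  approximate solutions, \<open>sn\<close> and \<open>cs\<close> produce the first-order terms in
  the Taylor expansion of the closing integrals; these integrals are O(\<tau>), so beyond that only
  a remainder quadratic in the difference survives. A bound on the multipliers absorbs it over a
  short time. The initial Gram determinant is positive because a closed curve cannot lie on a line.

  The exponent is handled by \<open>phalf\<close>, which turns the degenerate and the singular flux
  alike into Hilbert space quantities: minimising sequences, the comparison and the slopes of the
  limit are all measured in \<open>L\<^sup>2\<close> after this substitution. Halving the step makes
  the squared errors geometric, hence the errors summable, so the whole sequence converges at every
  time and the limit can be defined pointwise before anything is known about its regularity.\<close>

definition pflux :: "real \<Rightarrow> real \<Rightarrow> real" where
  "pflux p x = \<bar>x\<bar> powr (p - 2) * x"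

text \<open>The nonlinear substitution familiar from the regularity theory of the p-Laplacian: its
  square is \<open>\<bar>x\<bar> powr p\<close>, and monotonicity of the flux is coercive in it for
  every \<open>p > 1\<close>.\<close>

definition phalf :: "real \<Rightarrow> real \<Rightarrow> real" where
  "phalf p x = \<bar>x\<bar> powr (p / 2 - 1) * x"

text \<open>Includes \<open>y = 0\<close>, since \<open>0 powr q\<close> is 0 for every exponent;
  the later computations therefore rarely split off the origin.\<close>

lemma powr_mult_self: "y \<ge> 0 \<Longrightarrow> y powr q * y = y powr (q + 1)" for y q :: real
  by (simp add: powr_add)

lemma phalf_0 [simp]: "phalf p 0 = 0"
  by (simp add: phalf_def)

lemma pflux_0 [simp]: "pflux p 0 = 0"
  by (simp add: pflux_def)

lemma phalf_sq: "(phalf p x)\<^sup>2 = \<bar>x\<bar> powr p"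
proof (cases "x = 0")
  case False
  have "(\<bar>x\<bar> powr (p / 2 - 1))\<^sup>2 = \<bar>x\<bar> powr (p - 2)"
    using False by (simp add: power2_eq_square flip: powr_add)
  moreover have "x\<^sup>2 = \<bar>x\<bar> powr 2"
    using False by (simp add: powr_numeral)
  ultimately have "(phalf p x)\<^sup>2 = \<bar>x\<bar> powr (p - 2) * \<bar>x\<bar> powr 2"
    by (simp only: phalf_def power_mult_distrib)
  also have "\<dots> = \<bar>x\<bar> powr (p - 2 + 2)"
    by (rule powr_add [symmetric])
  also have "p - 2 + 2 = p" by simp
  finally show ?thesis .
qed simp

lemma abs_pflux: "\<bar>pflux p x\<bar> = \<bar>x\<bar> powr (p - 1)"
  using powr_mult_self [of "\<bar>x\<bar>" "p - 2"] by (simp add: pflux_def abs_mult)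

text \<open>Replacing both factors by the larger of the two absolute values stands in for Young's
  inequality with conjugate exponents.\<close>

lemma pflux_mult_le:
  assumes "p \<ge> 1"
  shows "\<bar>pflux p x * y\<bar> \<le> \<bar>x\<bar> powr p + \<bar>y\<bar> powr p"
proof -
  define m where "m = max \<bar>x\<bar> \<bar>y\<bar>"
  have "\<bar>pflux p x * y\<bar> = \<bar>x\<bar> powr (p - 1) * \<bar>y\<bar>"
    by (simp add: abs_mult abs_pflux)
  also have "\<dots> \<le> m powr (p - 1) * m"
    unfolding m_def using assms by (intro mult_mono powr_mono2) auto
  also have "\<dots> = m powr p"
    using powr_mult_self [of m "p - 1"] by (simp add: m_def)
  also have "\<dots> \<le> \<bar>x\<bar> powr p + \<bar>y\<bar> powr p"
    by (auto simp: m_def max_def)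
  finally show ?thesis .
qed

lemma pflux_scale: "y > 0 \<Longrightarrow> pflux p (y * x) = y powr (p - 1) * pflux p x"
  using powr_mult_self [of y "p - 2"] by (simp add: pflux_def abs_mult powr_mult)

lemma phalf_scale: "y > 0 \<Longrightarrow> phalf p (y * x) = y powr (p / 2) * phalf p x"
  using powr_mult_self [of y "p / 2 - 1"] by (simp add: phalf_def abs_mult powr_mult)

lemma pflux_minus [simp]: "pflux p (- x) = - pflux p x"
  by (simp add: pflux_def)

lemma phalf_minus [simp]: "phalf p (- x) = - phalf p x"
  by (simp add: phalf_def)

text \<open>With \<open>s = r powr (p / 2)\<close> the bound is \<open>s\<^sup>2 - p s powr (2 / p) + p - 1 \<ge> c (s - 1)\<^sup>2\<close>;
  weighted AM-GM bounds \<open>s powr (2 / p)\<close> by a combination of \<open>1, s\<close> if \<open>p \<ge> 2\<close>, of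
  \<open>s, s\<^sup>2\<close> if \<open>p < 2\<close>.\<close>

lemma bregman_one_pos:
  fixes p r :: real
  assumes "p > 1" "r \<ge> 0"
  shows "r powr p - 1 - p * (r - 1) \<ge> min 1 (p - 1) * (r powr (p / 2) - 1)\<^sup>2"
proof -
  consider "r = 0" | "r > 0" using assms by linarith
  then show ?thesis
  proof cases
    case 1
    then show ?thesis using assms by simp
  next
    case r: 2
  define s where "s = r powr (p / 2)"
  have s0: "s > 0" using r by (simp add: s_def)
  have s2: "s\<^sup>2 = r powr p"
    by (simp add: s_def power2_eq_square flip: powr_add)
  show ?thesis
  proof (cases "p \<ge> 2")
    case True
    have "s powr (2 / p) * 1 powr (1 - 2 / p) \<le> 2 / p * s + (1 - 2 / p) * 1"
      using True s0 by (intro Youngs_inequality_0) auto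
    moreover have "s powr (2 / p) = r"
      using assms by (simp add: s_def powr_powr)
    ultimately have "r \<le> 2 / p * s + (1 - 2 / p)" by simp
    then have "p * r \<le> p * (2 / p * s + (1 - 2 / p))"
      using assms by (intro mult_left_mono) auto
    also have "\<dots> = 2 * s + p - 2"
      using assms by (simp add: field_simps)
    finally have "s\<^sup>2 - 1 - p * (r - 1) \<ge> (s - 1)\<^sup>2"
      by (simp add: power2_eq_square algebra_simps)
    with True show ?thesis by (simp add: s2 flip: s_def)
  next
    case False
    have "(s\<^sup>2) powr (2 / p - 1) * s powr (2 - 2 / p) \<le> (2 / p - 1) * s\<^sup>2 + (2 - 2 / p) * s"
      using False assms s0 by (intro Youngs_inequality_0) (auto simp: field_simps)
    moreover have "(s\<^sup>2) powr (2 / p - 1) * s powr (2 - 2 / p) = r"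
    proof -
      have "(s\<^sup>2) powr (2 / p - 1) * s powr (2 - 2 / p) =
          r powr (p * (2 / p - 1)) * r powr (p / 2 * (2 - 2 / p))"
        by (simp add: s2 powr_powr) (simp add: s_def powr_powr)
      also have "\<dots> = r powr (p * (2 / p - 1) + p / 2 * (2 - 2 / p))"
        by (rule powr_add [symmetric])
      also have "p * (2 / p - 1) + p / 2 * (2 - 2 / p) = 1"
        using assms by (simp add: field_simps)
      finally show ?thesis using assms by simp
    qed
    ultimately have "r \<le> (2 / p - 1) * s\<^sup>2 + (2 - 2 / p) * s" by simp
    then have "p * r \<le> p * ((2 / p - 1) * s\<^sup>2 + (2 - 2 / p) * s)"
      using assms by (intro mult_left_mono) auto
    also have "\<dots> = (2 - p) * s\<^sup>2 + (2 * p - 2) * s"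
      using assms by (simp add: field_simps)
    finally have "s\<^sup>2 - 1 - p * (r - 1) \<ge> (p - 1) * (s - 1)\<^sup>2"
      by (simp add: power2_eq_square algebra_simps)
    with False show ?thesis by (simp add: s2 flip: s_def)
  qed
  qed
qed

text \<open>For \<open>r < 0\<close> the linear term has the favourable sign and leaves
  \<open>\<bar>r\<bar> powr p + p - 1\<close>, while the square is at most
  \<open>2 * (\<bar>r\<bar> powr p + 1)\<close>. This case costs the factor 1/2.\<close>

lemma bregman_one:
  fixes p r :: real
  assumes "p > 1"
  shows "\<bar>r\<bar> powr p - 1 - p * (r - 1) \<ge> min 1 (p - 1) / 2 * (phalf p r - 1)\<^sup>2"
proof (cases "r \<ge> 0")
  case True
  have "phalf p r = r powr (p / 2)"
    using True powr_mult_self [of r "p / 2 - 1"] by (simp add: phalf_def)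
  moreover have "min 1 (p - 1) / 2 * (r powr (p / 2) - 1)\<^sup>2 \<le> min 1 (p - 1) * (r powr (p / 2) - 1)\<^sup>2"
    using assms by (intro mult_right_mono) auto
  ultimately show ?thesis
    using bregman_one_pos [OF assms True] True by simp
next
  case False
  define c where "c = min 1 (p - 1)"
  have c: "0 \<le> c" "c \<le> 1" "c \<le> p - 1" using assms by (auto simp: c_def)
  have "(phalf p r - 1)\<^sup>2 \<le> 2 * ((phalf p r)\<^sup>2 + 1)"
    using sum_squares_bound [of "phalf p r" "-1"] by (simp add: power2_eq_square algebra_simps)
  then have "c / 2 * (phalf p r - 1)\<^sup>2 \<le> c / 2 * (2 * (\<bar>r\<bar> powr p + 1))"
    using c by (intro mult_left_mono) (auto simp: phalf_sq)
  also have "\<dots> = c * \<bar>r\<bar> powr p + c" by (simp add: algebra_simps)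
  also have "\<dots> \<le> 1 * \<bar>r\<bar> powr p + (p - 1)"
    using c by (intro add_mono mult_right_mono) auto
  also have "\<dots> \<le> \<bar>r\<bar> powr p - 1 - p * (r - 1)"
    using False assms by (simp add: algebra_simps mult_le_0_iff)
  finally show ?thesis by (simp add: c_def)
qed

text \<open>Both sides are homogeneous of degree p, so division by \<open>y powr p\<close> reduces
  the case \<open>y > 0\<close> to \<open>bregman_one\<close> with \<open>r = x / y\<close>; oddness
  of \<open>pflux\<close> and \<open>phalf\<close> covers \<open>y < 0\<close>.\<close>

lemma bregman:
  fixes p x y :: real
  assumes "p > 1"
  shows "\<bar>x\<bar> powr p - \<bar>y\<bar> powr p - p * pflux p y * (x - y)
    \<ge> min 1 (p - 1) / 2 * (phalf p x - phalf p y)\<^sup>2"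
proof -
  have pos: "\<bar>x\<bar> powr p - \<bar>y\<bar> powr p - p * pflux p y * (x - y)
      \<ge> min 1 (p - 1) / 2 * (phalf p x - phalf p y)\<^sup>2" if "y > 0" for x y
  proof -
    define r where "r = x / y"
    have x: "x = y * r" using that by (simp add: r_def)
    have 1: "\<bar>x\<bar> powr p = y powr p * \<bar>r\<bar> powr p"
      using that by (simp add: x abs_mult powr_mult)
    have "y powr p = y powr (p - 1) * y" using that powr_mult_self [of y "p - 1"] by simp
    then have 2: "p * pflux p y * (x - y) = y powr p * (p * (r - 1))"
      using that pflux_scale [of y p 1] by (simp add: x pflux_def algebra_simps)
    have 3: "phalf p x - phalf p y = y powr (p / 2) * (phalf p r - 1)"
      using that phalf_scale [of y p 1] phalf_scale [of y p r]
      by (simp add: x phalf_def algebra_simps)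
    have 4: "(y powr (p / 2))\<^sup>2 = y powr p" by (simp add: power2_eq_square flip: powr_add)
    have "y powr p * (min 1 (p - 1) / 2 * (phalf p r - 1)\<^sup>2) \<le>
        y powr p * (\<bar>r\<bar> powr p - 1 - p * (r - 1))"
      by (intro mult_left_mono bregman_one assms) auto
    then show ?thesis
      unfolding 1 2 3 power_mult_distrib 4 using that by (simp add: algebra_simps)
  qed
  consider "y > 0" | "y = 0" | "- y > 0" by linarith
  then show ?thesis
  proof cases
    case 1
    then show ?thesis by (rule pos)
  next
    case 2
    have "min 1 (p - 1) / 2 * \<bar>x\<bar> powr p \<le> 1 * \<bar>x\<bar> powr p"
      by (intro mult_right_mono) auto
    with 2 show ?thesis by (simp add: phalf_sq)
  next
    case 3
    have "phalf p (- x) - phalf p (- y) = - (phalf p x - phalf p y)" by simp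
    then have "(phalf p (- x) - phalf p (- y))\<^sup>2 = (phalf p x - phalf p y)\<^sup>2"
      by (metis power2_minus)
    with pos [OF 3, of "- x"] show ?thesis by (simp add: algebra_simps)
  qed
qed

text \<open>The sum of two Bregman inequalities with the roles of x and y exchanged.\<close>

lemma pflux_monotone:
  fixes p x y :: real
  assumes "p > 1"
  shows "p * ((pflux p x - pflux p y) * (x - y)) \<ge> min 1 (p - 1) * (phalf p x - phalf p y)\<^sup>2"
  using bregman [OF assms, of x y] bregman [OF assms, of y x]
  by (simp add: power2_commute [of "phalf p y"] algebra_simps)

lemma powr_convex_ineq:
  fixes p x y :: real
  assumes "p > 1"
  shows "\<bar>x\<bar> powr p - \<bar>y\<bar> powr p \<ge> p * pflux p y * (x - y)"
proof -
  have "0 \<le> min 1 (p - 1) / 2 * (phalf p x - phalf p y)\<^sup>2"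
    using assms by simp
  with bregman [OF assms, of x y] show ?thesis by linarith
qed

text \<open>Two Bregman inequalities based at the midpoint, whose linear terms cancel. This
  quantitative convexity is what makes minimising sequences Cauchy.\<close>

lemma powr_midpoint_gap:
  fixes p x y :: real
  assumes "p > 1"
  shows "\<bar>x\<bar> powr p + \<bar>y\<bar> powr p - 2 * \<bar>(x + y) / 2\<bar> powr p
    \<ge> min 1 (p - 1) / 4 * (phalf p x - phalf p y)\<^sup>2"
proof -
  define c where "c = min 1 (p - 1) / 2"
  have c: "c \<ge> 0" using assms by (simp add: c_def)
  define m where "m = (x + y) / 2"
  have m: "(x - m) + (y - m) = 0" by (simp add: m_def field_simps)
  have "(phalf p x - phalf p y)\<^sup>2 \<le> 2 * ((phalf p x - phalf p m)\<^sup>2 + (phalf p y - phalf p m)\<^sup>2)"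
    using sum_squares_bound [of "phalf p x - phalf p m" "- (phalf p y - phalf p m)"]
    by (simp add: power2_eq_square algebra_simps)
  then have "c / 2 * (phalf p x - phalf p y)\<^sup>2
      \<le> c / 2 * (2 * ((phalf p x - phalf p m)\<^sup>2 + (phalf p y - phalf p m)\<^sup>2))"
    using c by (intro mult_left_mono) auto
  also have "\<dots> = c * (phalf p x - phalf p m)\<^sup>2 + c * (phalf p y - phalf p m)\<^sup>2"
    by (simp add: algebra_simps)
  also have "\<dots> \<le> (\<bar>x\<bar> powr p - \<bar>m\<bar> powr p - p * pflux p m * (x - m)) +
      (\<bar>y\<bar> powr p - \<bar>m\<bar> powr p - p * pflux p m * (y - m))"
    unfolding c_def by (intro add_mono bregman assms)
  also have "\<dots> = \<bar>x\<bar> powr p + \<bar>y\<bar> powr p - 2 * \<bar>m\<bar> powr p - p * pflux p m * ((x - m) + (y - m))"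
    by (simp add: algebra_simps)
  finally show ?thesis using m by (simp add: c_def m_def)
qed

lemma powr_abs_add_le:
  fixes p x y :: real
  assumes "p \<ge> 1"
  shows "\<bar>x + y\<bar> powr p \<le> 2 powr p * (\<bar>x\<bar> powr p + \<bar>y\<bar> powr p)"
proof -
  have "\<bar>x + y\<bar> powr p \<le> (2 * max \<bar>x\<bar> \<bar>y\<bar>) powr p"
    using assms by (intro powr_mono2) auto
  also have "\<dots> = 2 powr p * (max \<bar>x\<bar> \<bar>y\<bar>) powr p" by (simp add: powr_mult)
  also have "\<dots> \<le> 2 powr p * (\<bar>x\<bar> powr p + \<bar>y\<bar> powr p)"
    by (intro mult_left_mono) (auto simp: max_def)
  finally show ?thesis .
qed

definition phalf_inv :: "real \<Rightarrow> real \<Rightarrow> real" where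
  "phalf_inv p y = \<bar>y\<bar> powr (2 / p - 1) * y"

lemma phalf_inv_phalf:
  assumes "p > 0"
  shows "phalf_inv p (phalf p x) = x"
proof (cases "x = 0")
  case False
  have "\<bar>phalf p x\<bar> = \<bar>x\<bar> powr (p / 2)"
    using powr_mult_self [of "\<bar>x\<bar>" "p / 2 - 1"] by (simp add: phalf_def abs_mult)
  then have "phalf_inv p (phalf p x) =
      \<bar>x\<bar> powr (p / 2 * (2 / p - 1)) * (\<bar>x\<bar> powr (p / 2 - 1)) * x"
    by (simp add: phalf_inv_def powr_powr phalf_def)
  also have "\<dots> = \<bar>x\<bar> powr (p / 2 * (2 / p - 1) + (p / 2 - 1)) * x"
    by (simp add: powr_add)
  also have "p / 2 * (2 / p - 1) + (p / 2 - 1) = 0"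
    using assms by (simp add: field_simps)
  finally show ?thesis using False by simp
qed (simp add: phalf_inv_def)

text \<open>The inverse belongs to the same family, with \<open>4 / p\<close> in place of p, so that
  one computation settles both compositions.\<close>

lemma phalf_phalf_inv:
  assumes "p > 0"
  shows "phalf p (phalf_inv p y) = y"
proof -
  have "phalf_inv p y = phalf (4 / p) y" by (simp add: phalf_inv_def phalf_def)
  moreover have "phalf p x = phalf_inv (4 / p) x" for x
    by (simp add: phalf_inv_def phalf_def)
  ultimately show ?thesis
    using phalf_inv_phalf [of "4 / p" y] assms by simp
qed

text \<open>\<open>\<bar>x\<bar> powr q\<close> is discontinuous at \<open>0\<close> for \<open>q < 0\<close>, but multiplication by \<open>x\<close> repairs this
  if \<open>q > -1\<close>.\<close>

lemma continuous_abs_powr_mult: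
  fixes q :: real
  assumes "q > -1"
  shows "continuous_on UNIV (\<lambda>x::real. \<bar>x\<bar> powr q * x)"
proof -
  have eq: "\<bar>x\<bar> powr q * x = sgn x * \<bar>x\<bar> powr (q + 1)" for x :: real
  proof (cases "x = 0")
    case False
    then have "\<bar>x\<bar> powr (q + 1) = \<bar>x\<bar> powr q * \<bar>x\<bar>" by (simp add: powr_add)
    then show ?thesis using mult_sgn_abs [of x] by (simp add: mult.left_commute)
  qed simp
  have cont: "isCont (\<lambda>x::real. \<bar>x\<bar> powr q * x) x" for x
  proof (cases "x = 0")
    case True
    have "((\<lambda>x::real. \<bar>x\<bar> powr (q + 1)) \<longlongrightarrow> \<bar>0\<bar> powr (q + 1)) (at 0)"
      using assms by (intro tendsto_powr' tendsto_intros) auto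
    then have "((\<lambda>x::real. \<bar>x\<bar> powr (q + 1)) \<longlongrightarrow> 0) (at 0)" by simp
    moreover have "\<forall>\<^sub>F x in at 0. norm (\<bar>x\<bar> powr q * x) \<le> \<bar>x\<bar> powr (q + 1)"
      unfolding eq by (auto simp: abs_mult abs_sgn_eq)
    ultimately have "((\<lambda>x::real. \<bar>x\<bar> powr q * x) \<longlongrightarrow> 0) (at 0)"
      by (rule Lim_null_comparison [rotated])
    with True show ?thesis by (simp add: isCont_def)
  next
    case False
    then show ?thesis by (intro continuous_intros) auto
  qed
  then show ?thesis by (simp add: continuous_on_eq_continuous_at)
qed

lemma continuous_pflux: "p > 1 \<Longrightarrow> continuous_on UNIV (pflux p)"
  using continuous_abs_powr_mult [of "p - 2"] by (simp add: pflux_def [abs_def])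

lemma continuous_phalf_inv: "p > 0 \<Longrightarrow> continuous_on UNIV (phalf_inv p)"
  using continuous_abs_powr_mult [of "2 / p - 1"] by (simp add: phalf_inv_def [abs_def])

lemma pflux_measurable [measurable]: "pflux p \<in> borel_measurable borel"
  unfolding pflux_def by measurable

lemma phalf_measurable [measurable]: "phalf p \<in> borel_measurable borel"
  unfolding phalf_def by measurable

lemma phalf_inv_measurable [measurable]: "phalf_inv p \<in> borel_measurable borel"
  unfolding phalf_inv_def by measurable

section \<open>Square integrable functions\<close>

text \<open>Stated over an arbitrary measure because the theory serves the space interval and the
  time interval alike.\<close>

definition sq_int :: "'a measure \<Rightarrow> ('a \<Rightarrow> real) \<Rightarrow> bool" where
  "sq_int M f \<longleftrightarrow> f \<in> borel_measurable M \<and> integrable M (\<lambda>x. (f x)\<^sup>2)"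

definition L2_norm_on :: "'a measure \<Rightarrow> ('a \<Rightarrow> real) \<Rightarrow> real" where
  "L2_norm_on M f = sqrt (LINT x|M. (f x)\<^sup>2)"

lemma sq_int_measurable: "sq_int M f \<Longrightarrow> f \<in> borel_measurable M"
  by (simp add: sq_int_def)

lemma sq_int_integrable: "sq_int M f \<Longrightarrow> integrable M (\<lambda>x. (f x)\<^sup>2)"
  by (simp add: sq_int_def)

lemma L2_norm_on_nonneg [simp]: "L2_norm_on M f \<ge> 0"
  by (simp add: L2_norm_on_def)

lemma L2_norm_on_power2: "(L2_norm_on M f)\<^sup>2 = (LINT x|M. (f x)\<^sup>2)"
  by (simp add: L2_norm_on_def)

lemma L2_norm_on_minus: "L2_norm_on M (\<lambda>x. - f x) = L2_norm_on M f"
  by (simp add: L2_norm_on_def)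

lemma L2_norm_on_commute: "L2_norm_on M (\<lambda>x. f x - g x) = L2_norm_on M (\<lambda>x. g x - f x)"
  by (simp add: L2_norm_on_def power2_commute)

lemma sq_int_mult_integrable:
  assumes "sq_int M f" "sq_int M g"
  shows "integrable M (\<lambda>x. f x * g x)"
proof (rule Bochner_Integration.integrable_bound)
  show "integrable M (\<lambda>x. (f x)\<^sup>2 + (g x)\<^sup>2)"
    using assms by (auto simp: sq_int_def)
  show "(\<lambda>x. f x * g x) \<in> borel_measurable M"
    using assms by (auto simp: sq_int_def)
  have "\<bar>a * b\<bar> \<le> a\<^sup>2 + b\<^sup>2" for a b :: real
    using sum_squares_bound [of "\<bar>a\<bar>" "\<bar>b\<bar>"] abs_ge_zero [of "a * b"]
    unfolding abs_mult power2_abs by linarith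
  then show "AE x in M. norm (f x * g x) \<le> norm ((f x)\<^sup>2 + (g x)\<^sup>2)"
    by (simp add: abs_of_nonneg)
qed

lemma sq_int_bound:
  assumes "sq_int M g" "f \<in> borel_measurable M" "AE x in M. \<bar>f x\<bar> \<le> \<bar>g x\<bar>"
  shows "sq_int M f"
  unfolding sq_int_def
proof (intro conjI assms(2))
  show "integrable M (\<lambda>x. (f x)\<^sup>2)"
  proof (rule Bochner_Integration.integrable_bound [OF sq_int_integrable [OF assms(1)]])
    show "AE x in M. norm ((f x)\<^sup>2) \<le> norm ((g x)\<^sup>2)"
      using assms(3) by eventually_elim (simp add: abs_le_square_iff)
  qed (use assms(2) in measurable)
qed

lemma sq_int_zero [simp]: "sq_int M (\<lambda>x. 0)"
  by (simp add: sq_int_def)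

lemma sq_int_add [intro]:
  assumes "sq_int M f" "sq_int M g"
  shows "sq_int M (\<lambda>x. f x + g x)"
proof -
  have "integrable M (\<lambda>x. (f x)\<^sup>2 + (g x)\<^sup>2 + 2 * (f x * g x))"
    using assms sq_int_mult_integrable [OF assms]
    by (intro Bochner_Integration.integrable_add integrable_mult_right) (auto simp: sq_int_def)
  then show ?thesis
    using assms by (auto simp: sq_int_def power2_eq_square algebra_simps)
qed

lemma sq_int_cmult [intro]: "sq_int M f \<Longrightarrow> sq_int M (\<lambda>x. c * f x)"
  by (auto simp: sq_int_def power_mult_distrib)

lemma sq_int_minus [intro]: "sq_int M f \<Longrightarrow> sq_int M (\<lambda>x. - f x)"
  using sq_int_cmult [of M f "-1"] by simp

lemma sq_int_diff [intro]: "sq_int M f \<Longrightarrow> sq_int M g \<Longrightarrow> sq_int M (\<lambda>x. f x - g x)"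
  using sq_int_add [of M f "\<lambda>x. - g x"] by auto

lemma sq_int_abs [intro]: "sq_int M f \<Longrightarrow> sq_int M (\<lambda>x. \<bar>f x\<bar>)"
  by (auto simp: sq_int_def)

lemma sq_int_sum [intro]:
  "(\<And>i. i \<in> I \<Longrightarrow> sq_int M (f i)) \<Longrightarrow> sq_int M (\<lambda>x. \<Sum>i\<in>I. f i x)"
  by (induction I rule: infinite_finite_induct) auto

lemma (in finite_measure) sq_int_const [intro]: "sq_int M (\<lambda>x. c)"
  by (simp add: sq_int_def)

lemma (in finite_measure) sq_int_bounded:
  assumes "f \<in> borel_measurable M" "AE x in M. \<bar>f x\<bar> \<le> B"
  shows "sq_int M f"
  by (rule sq_int_bound [OF sq_int_const [of "\<bar>B\<bar>"] assms(1)]) (use assms(2) in force)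

lemma (in finite_measure) sq_int_imp_integrable: "sq_int M f \<Longrightarrow> integrable M f"
  using sq_int_mult_integrable [of M f "\<lambda>x. 1"] by auto

lemma L2_Cauchy_Schwarz:
  assumes f: "sq_int M f" and g: "sq_int M g"
  shows "\<bar>LINT x|M. f x * g x\<bar> \<le> L2_norm_on M f * L2_norm_on M g"
proof -
  define A where "A = (LINT x|M. (f x)\<^sup>2)"
  define B where "B = (LINT x|M. f x * g x)"
  define C where "C = (LINT x|M. (g x)\<^sup>2)"
  have fg: "integrable M (\<lambda>x. f x * g x)" by (rule sq_int_mult_integrable [OF f g])
  have quad: "0 \<le> A + 2 * t * B + t\<^sup>2 * C" for t
  proof -
    have "0 \<le> (LINT x|M. (f x + t * g x)\<^sup>2)" by simp
    also have "\<dots> = (LINT x|M. (f x)\<^sup>2 + 2 * t * (f x * g x) + t\<^sup>2 * (g x)\<^sup>2)"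
      by (intro Bochner_Integration.integral_cong) (auto simp: power2_eq_square algebra_simps)
    also have "\<dots> = A + 2 * t * B + t\<^sup>2 * C"
      using f g fg by (simp add: A_def B_def C_def sq_int_def)
    finally show ?thesis .
  qed
  have "A \<ge> 0" "C \<ge> 0" by (auto simp: A_def C_def)
  have "B\<^sup>2 \<le> A * C"
  proof (cases "C = 0")
    case True
    then have "AE x in M. (g x)\<^sup>2 = 0"
      using g unfolding C_def by (subst (asm) integral_nonneg_eq_0_iff_AE) (auto simp: sq_int_def)
    then have "AE x in M. f x * g x = 0" by eventually_elim simp
    then have "B = 0" unfolding B_def by (rule integral_eq_zero_AE)
    with \<open>A \<ge> 0\<close> \<open>C \<ge> 0\<close> show ?thesis by simp
  next
    case False
    then have "C > 0" using \<open>C \<ge> 0\<close> by simp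
    then show ?thesis using quad [of "- B / C"]
      by (simp add: power2_eq_square field_simps)
  qed
  then have "\<bar>B\<bar> \<le> sqrt (A * C)"
    using real_le_rsqrt [of "\<bar>B\<bar>" "A * C"] by simp
  then show ?thesis
    by (simp add: A_def B_def C_def L2_norm_on_def real_sqrt_mult)
qed

lemma L2_norm_on_triangle:
  assumes f: "sq_int M f" and g: "sq_int M g"
  shows "L2_norm_on M (\<lambda>x. f x + g x) \<le> L2_norm_on M f + L2_norm_on M g"
proof (rule power2_le_imp_le)
  have "(LINT x|M. (f x + g x)\<^sup>2) = (LINT x|M. (f x)\<^sup>2 + 2 * (f x * g x) + (g x)\<^sup>2)"
    by (intro Bochner_Integration.integral_cong) (auto simp: power2_eq_square algebra_simps)
  also have "\<dots> = (LINT x|M. (f x)\<^sup>2) + 2 * (LINT x|M. f x * g x) + (LINT x|M. (g x)\<^sup>2)"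
    using f g sq_int_mult_integrable [OF f g] by (simp add: sq_int_def)
  also have "\<dots> \<le> (L2_norm_on M f + L2_norm_on M g)\<^sup>2"
    using L2_Cauchy_Schwarz [OF f g] by (simp add: power2_sum L2_norm_on_power2)
  finally show "(L2_norm_on M (\<lambda>x. f x + g x))\<^sup>2 \<le> (L2_norm_on M f + L2_norm_on M g)\<^sup>2"
    by (simp add: L2_norm_on_power2)
qed simp

lemma L2_norm_on_cmult: "L2_norm_on M (\<lambda>x. c * f x) = \<bar>c\<bar> * L2_norm_on M f"
  by (simp add: L2_norm_on_def power_mult_distrib real_sqrt_mult)

lemma L2_norm_on_abs [simp]: "L2_norm_on M (\<lambda>x. \<bar>f x\<bar>) = L2_norm_on M f"
  by (simp add: L2_norm_on_def)

lemma L2_norm_on_zero [simp]: "L2_norm_on M (\<lambda>x. 0) = 0"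
  by (simp add: L2_norm_on_def)

lemma L2_norm_on_triangle_diff:
  assumes "sq_int M f" "sq_int M g"
  shows "L2_norm_on M (\<lambda>x. f x - g x) \<le> L2_norm_on M f + L2_norm_on M g"
  using L2_norm_on_triangle [OF assms(1) sq_int_minus [OF assms(2)]]
  by (simp add: L2_norm_on_minus)

lemma L2_norm_on_triangle3:
  assumes "sq_int M f" "sq_int M g" "sq_int M h"
  shows "L2_norm_on M (\<lambda>x. f x - h x) \<le> L2_norm_on M (\<lambda>x. f x - g x) + L2_norm_on M (\<lambda>x. g x - h x)"
  using L2_norm_on_triangle [of M "\<lambda>x. f x - g x" "\<lambda>x. g x - h x"] assms by auto

lemma L2_norm_on_reverse_triangle:
  assumes "sq_int M f" "sq_int M g"
  shows "\<bar>L2_norm_on M f - L2_norm_on M g\<bar> \<le> L2_norm_on M (\<lambda>x. f x - g x)"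
proof -
  have "L2_norm_on M f \<le> L2_norm_on M (\<lambda>x. f x - g x) + L2_norm_on M g"
    using L2_norm_on_triangle [of M "\<lambda>x. f x - g x" g] assms by auto
  moreover have "L2_norm_on M g \<le> L2_norm_on M (\<lambda>x. g x - f x) + L2_norm_on M f"
    using L2_norm_on_triangle [of M "\<lambda>x. g x - f x" f] assms by auto
  ultimately show ?thesis by (simp add: L2_norm_on_commute [of M g f])
qed

lemma L2_norm_on_tendsto:
  assumes f: "\<And>n. sq_int M (f n)" and g: "sq_int M g" and lim: "(\<lambda>n. L2_norm_on M (\<lambda>x. f n x - g x)) \<longlonglongrightarrow> 0"
  shows "(\<lambda>n. L2_norm_on M (f n)) \<longlonglongrightarrow> L2_norm_on M g"
proof -
  have le: "norm (L2_norm_on M (f n) - L2_norm_on M g) \<le> L2_norm_on M (\<lambda>x. f n x - g x)" for n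
    using L2_norm_on_reverse_triangle [OF f g] by simp
  have "(\<lambda>n. L2_norm_on M (f n) - L2_norm_on M g) \<longlonglongrightarrow> 0"
    by (rule Lim_null_comparison [OF always_eventually lim]) (rule allI, rule le)
  then show ?thesis by (simp add: LIM_zero_iff)
qed

lemma L2_norm_on_sum:
  assumes "\<And>i. i \<in> I \<Longrightarrow> sq_int M (f i)"
  shows "L2_norm_on M (\<lambda>x. \<Sum>i\<in>I. f i x) \<le> (\<Sum>i\<in>I. L2_norm_on M (f i))"
  using assms
proof (induction I rule: infinite_finite_induct)
  case (insert i I)
  have "L2_norm_on M (\<lambda>x. f i x + (\<Sum>i\<in>I. f i x)) \<le> L2_norm_on M (f i) + L2_norm_on M (\<lambda>x. \<Sum>i\<in>I. f i x)"
    using insert by (intro L2_norm_on_triangle sq_int_sum) auto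
  with insert show ?case by force
qed auto

lemma (in finite_measure) L1_le_L2:
  assumes "sq_int M f"
  shows "(LINT x|M. \<bar>f x\<bar>) \<le> sqrt (measure M (space M)) * L2_norm_on M f"
  using L2_Cauchy_Schwarz [OF sq_int_const [of 1] sq_int_abs [OF assms]]
  by (simp add: L2_norm_on_def)

lemma L2_norm_on_eq_0:
  assumes "sq_int M f" "L2_norm_on M f = 0"
  shows "AE x in M. f x = 0"
proof -
  have "AE x in M. (f x)\<^sup>2 = 0"
    using assms by (subst integral_nonneg_eq_0_iff_AE [symmetric]) (auto simp: sq_int_def L2_norm_on_def)
  then show ?thesis by eventually_elim simp
qed

text \<open>Besides completeness it yields two facts used throughout: one majorant H of the whole
  sequence, for dominated convergence, and the limit in the explicit form of a pointwise
  \<open>lim\<close>, so that limits depending on a time parameter are given by a definition instead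
  of by a choice for each time.\<close>

theorem Riesz_Fischer:
  fixes f :: "nat \<Rightarrow> 'a \<Rightarrow> real"
  assumes f: "\<And>n. sq_int M (f n)"
    and sm: "summable (\<lambda>n. L2_norm_on M (\<lambda>x. f (Suc n) x - f n x))"
  defines "F \<equiv> \<lambda>x. lim (\<lambda>n. f n x)"
  obtains H where "sq_int M H" "AE x in M. \<forall>n. \<bar>f n x\<bar> \<le> H x"
    "AE x in M. (\<lambda>n. f n x) \<longlonglongrightarrow> F x" "sq_int M F"
    "(\<lambda>n. L2_norm_on M (\<lambda>x. f n x - F x)) \<longlonglongrightarrow> 0"
proof -
  define d where "d n x = \<bar>f (Suc n) x - f n x\<bar>" for n x
  define P where "P m x = \<bar>f 0 x\<bar> + (\<Sum>n<m. d n x)" for m x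
  define K where "K = L2_norm_on M (f 0) + (\<Sum>n. L2_norm_on M (\<lambda>x. f (Suc n) x - f n x))"
  have f_meas [measurable]: "f n \<in> borel_measurable M" for n using f by (rule sq_int_measurable)
  have d_meas [measurable]: "d n \<in> borel_measurable M" for n unfolding d_def by measurable
  have P_meas [measurable]: "P n \<in> borel_measurable M" for n unfolding P_def by measurable
  have d_sq: "sq_int M (d n)" for n unfolding d_def by (intro sq_int_abs sq_int_diff f)
  have d_nm: "L2_norm_on M (d n) = L2_norm_on M (\<lambda>x. f (Suc n) x - f n x)" for n
    unfolding d_def by simp
  have P_sq: "sq_int M (P m)" for m
    unfolding P_def by (intro sq_int_add sq_int_abs f sq_int_sum d_sq)
  have P_nm: "L2_norm_on M (P m) \<le> K" for m
  proof -
    have "L2_norm_on M (P m) \<le> L2_norm_on M (\<lambda>x. \<bar>f 0 x\<bar>) + L2_norm_on M (\<lambda>x. \<Sum>n<m. d n x)"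
      unfolding P_def by (intro L2_norm_on_triangle sq_int_abs f sq_int_sum d_sq)
    also have "\<dots> \<le> L2_norm_on M (f 0) + (\<Sum>n<m. L2_norm_on M (d n))"
      using d_sq by (auto intro!: L2_norm_on_sum)
    also have "(\<Sum>n<m. L2_norm_on M (d n)) \<le> (\<Sum>n. L2_norm_on M (\<lambda>x. f (Suc n) x - f n x))"
      unfolding d_nm by (rule sum_le_suminf [OF sm]) auto
    finally show ?thesis by (simp add: K_def)
  qed
  have P_nn: "(\<integral>\<^sup>+x. ennreal ((P m x)\<^sup>2) \<partial>M) \<le> ennreal (K\<^sup>2)" for m
  proof -
    have "(\<integral>\<^sup>+x. ennreal ((P m x)\<^sup>2) \<partial>M) = ennreal (LINT x|M. (P m x)\<^sup>2)"
      using P_sq by (intro nn_integral_eq_integral) (auto simp: sq_int_def)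
    also have "\<dots> = ennreal ((L2_norm_on M (P m))\<^sup>2)" by (simp add: L2_norm_on_power2)
    also have "\<dots> \<le> ennreal (K\<^sup>2)" using P_nm by (intro ennreal_leI power_mono) auto
    finally show ?thesis .
  qed
  have d_nonneg: "d n x \<ge> 0" for n x by (simp add: d_def)
  have P_nonneg: "P m x \<ge> 0" for m x by (auto simp: P_def intro!: add_nonneg_nonneg sum_nonneg d_nonneg)
  have P_incseq: "incseq (\<lambda>m. P m x)" for x
    by (rule incseq_SucI) (simp add: P_def d_nonneg)
  \<comment> \<open>Taken in \<open>ennreal\<close>, where the supremum exists at every point;
    monotone convergence then shows that it is finite almost everywhere, which is the summability of
    the increments.\<close>
  define S where "S x = (SUP m. ennreal ((P m x)\<^sup>2))" for x
  have S_meas [measurable]: "S \<in> borel_measurable M" unfolding S_def by measurable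
  have "(\<integral>\<^sup>+x. S x \<partial>M) = (SUP m. \<integral>\<^sup>+x. ennreal ((P m x)\<^sup>2) \<partial>M)"
    unfolding S_def
  proof (rule nn_integral_monotone_convergence_SUP)
    show "incseq (\<lambda>m x. ennreal ((P m x)\<^sup>2))"
      using P_incseq P_nonneg by (auto simp: incseq_def le_fun_def intro!: ennreal_leI power_mono)
  qed measurable
  also have "\<dots> \<le> ennreal (K\<^sup>2)" using P_nn by (intro SUP_least)
  finally have S_int: "(\<integral>\<^sup>+x. S x \<partial>M) \<le> ennreal (K\<^sup>2)" .
  then have S_fin: "AE x in M. S x \<noteq> \<infinity>"
    by (intro nn_integral_noteq_infinite) (auto simp: top_unique)
  have sum_d: "summable (\<lambda>n. d n x)" if fin: "S x \<noteq> \<infinity>" for x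
  proof -
    obtain r where r: "r \<ge> 0" "S x = ennreal r" using fin by (cases "S x") auto
    have "(P m x)\<^sup>2 \<le> r" for m
    proof -
      have "ennreal ((P m x)\<^sup>2) \<le> ennreal r"
        using SUP_upper [of m UNIV "\<lambda>m. ennreal ((P m x)\<^sup>2)"] r by (simp add: S_def)
      then show ?thesis using r by simp
    qed
    then have "P m x \<le> sqrt r" for m using real_le_rsqrt by blast
    then have "(\<Sum>n<m. d n x) \<le> sqrt r" for m
      using abs_ge_zero [of "f 0 x"] unfolding P_def by (smt (verit))
    then show ?thesis by (intro summableI_nonneg_bounded d_nonneg)
  qed
  have AE_sum: "AE x in M. summable (\<lambda>n. d n x)"
    using S_fin by (rule eventually_mono) (rule sum_d)
  define H where "H x = \<bar>f 0 x\<bar> + (\<Sum>n. d n x)" for x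
  have H_meas [measurable]: "H \<in> borel_measurable M" unfolding H_def by measurable
  have P_le_H: "P m x \<le> H x" if "summable (\<lambda>n. d n x)" for m x
    using sum_le_suminf [OF that, of "{..<m}"] d_nonneg by (auto simp: P_def H_def)
  have f_le_P: "\<bar>f n x\<bar> \<le> P n x" for n x
  proof (induction n)
    case 0 show ?case by (simp add: P_def)
  next
    case (Suc n)
    have "\<bar>f (Suc n) x\<bar> \<le> \<bar>f n x\<bar> + d n x" unfolding d_def by linarith
    with Suc show ?case by (simp add: P_def)
  qed
  have P_H: "(\<lambda>m. P m x) \<longlonglongrightarrow> H x" if "summable (\<lambda>n. d n x)" for x
    unfolding P_def H_def by (intro tendsto_intros summable_LIMSEQ that)
  have "AE x in M. ennreal ((H x)\<^sup>2) \<le> S x"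
    using AE_sum
  proof eventually_elim
    case (elim x)
    have "(\<lambda>m. ennreal ((P m x)\<^sup>2)) \<longlonglongrightarrow> ennreal ((H x)\<^sup>2)"
      by (intro tendsto_intros P_H elim)
    then show ?case
      by (rule LIMSEQ_le_const2) (auto simp: S_def intro!: SUP_upper)
  qed
  then have "(\<integral>\<^sup>+x. ennreal ((H x)\<^sup>2) \<partial>M) \<le> ennreal (K\<^sup>2)"
    by (rule order_trans [OF nn_integral_mono_AE S_int])
  then have "integrable M (\<lambda>x. (H x)\<^sup>2)"
    by (intro integrableI_bounded) (auto simp: le_less_trans)
  then have H_sq: "sq_int M H" by (simp add: sq_int_def)
  have bd: "AE x in M. \<forall>n. \<bar>f n x\<bar> \<le> H x"
    using AE_sum by (rule eventually_mono) (auto intro: order_trans [OF f_le_P P_le_H])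
  have conv: "AE x in M. (\<lambda>n. f n x) \<longlonglongrightarrow> F x"
    using AE_sum
  proof eventually_elim
    case (elim x)
    have "summable (\<lambda>n. f (Suc n) x - f n x)"
      using elim by (auto intro: summable_rabs_cancel simp: d_def)
    then have "convergent (\<lambda>m. \<Sum>n<m. f (Suc n) x - f n x)"
      by (simp add: summable_iff_convergent)
    then have "convergent (\<lambda>m. f m x - f 0 x)" by (simp only: sum_lessThan_telescope [of "\<lambda>n. f n x"])
    then have "convergent (\<lambda>m. (f m x - f 0 x) + f 0 x)" by (intro convergent_add convergent_const)
    then show ?case unfolding F_def by (simp add: convergent_LIMSEQ_iff)
  qed
  have F_meas [measurable]: "F \<in> borel_measurable M" unfolding F_def by measurable
  have F_le: "AE x in M. \<bar>F x\<bar> \<le> H x"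
    using bd conv
  proof eventually_elim
    case (elim x)
    from tendsto_rabs [OF elim(2)] show ?case
      by (rule LIMSEQ_le_const2) (use elim(1) in auto)
  qed
  have F_sq: "sq_int M F"
    by (rule sq_int_bound [OF H_sq F_meas]) (use F_le in force)
  have "(\<lambda>n. LINT x|M. (f n x - F x)\<^sup>2) \<longlonglongrightarrow> (LINT x|M. 0)"
  proof (rule integral_dominated_convergence [where w="\<lambda>x. (2 * H x)\<^sup>2"])
    show "integrable M (\<lambda>x. (2 * H x)\<^sup>2)" by (rule sq_int_integrable [OF sq_int_cmult [OF H_sq]])
    show "AE x in M. (\<lambda>n. (f n x - F x)\<^sup>2) \<longlonglongrightarrow> 0"
      using conv
    proof eventually_elim
      case (elim x)
      have "(\<lambda>n. (f n x - F x)\<^sup>2) \<longlonglongrightarrow> (F x - F x)\<^sup>2" by (intro tendsto_intros elim)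
      then show ?case by simp
    qed
    show "AE x in M. norm ((f n x - F x)\<^sup>2) \<le> (2 * H x)\<^sup>2" for n
      using bd F_le
    proof eventually_elim
      case (elim x)
      have "\<bar>f n x - F x\<bar> \<le> \<bar>2 * H x\<bar>" using elim spec [OF elim(1), of n] by linarith
      then show ?case by (simp only: real_norm_def abs_power2 abs_le_square_iff)
    qed
  qed (measurable)
  then have "(\<lambda>n. sqrt (LINT x|M. (f n x - F x)\<^sup>2)) \<longlonglongrightarrow> sqrt 0"
    by (intro tendsto_real_sqrt) simp
  then have "(\<lambda>n. L2_norm_on M (\<lambda>x. f n x - F x)) \<longlonglongrightarrow> 0" by (simp add: L2_norm_on_def)
  then show ?thesis by (rule that [OF H_sq bd conv F_sq])
qed

text \<open>Summability of the square roots follows from that of the integrals because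
  \<open>2 sqrt y \<le> r ^ n + y / r ^ n\<close>.\<close>

lemma (in finite_measure) AE_summable_sqrt:
  fixes g :: "nat \<Rightarrow> 'a \<Rightarrow> real"
  assumes g: "\<And>n. integrable M (g n)" and nonneg: "\<And>n x. g n x \<ge> 0"
    and bound: "\<And>n. (LINT x|M. g n x) \<le> K * (r\<^sup>2) ^ n" and r: "0 < r" "r < 1"
  shows "AE x in M. summable (\<lambda>n. sqrt (g n x))"
proof -
  define h where "h n x = r ^ n + g n x / r ^ n" for n x
  have h_int: "integrable M (h n)" for n unfolding h_def using g by simp
  have h_nonneg: "h n x \<ge> 0" for n x using nonneg r by (simp add: h_def)
  have h_le: "(LINT x|M. h n x) \<le> (measure M (space M) + K) * r ^ n" for n
  proof -
    have "(LINT x|M. h n x) = r ^ n * measure M (space M) + (LINT x|M. g n x) / r ^ n"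
      unfolding h_def using g by simp
    also have "(LINT x|M. g n x) / r ^ n \<le> K * (r\<^sup>2) ^ n / r ^ n"
      using bound r by (intro divide_right_mono) auto
    also have "\<dots> = K * r ^ n" using r by (simp add: power2_eq_square power_mult_distrib)
    finally show ?thesis by (simp add: algebra_simps)
  qed
  have "AE x in M. summable (\<lambda>n. h n x)"
  proof -
    have K: "measure M (space M) + K \<ge> 0"
    proof -
      have "0 \<le> (LINT x|M. h 0 x)" by (rule Bochner_Integration.integral_nonneg) (rule h_nonneg)
      also have "\<dots> \<le> (measure M (space M) + K) * r ^ 0" by (rule h_le)
      finally show ?thesis by simp
    qed
    have [measurable]: "h n \<in> borel_measurable M" for n using h_int by auto
    have "(\<integral>\<^sup>+x. (\<Sum>n. ennreal (h n x)) \<partial>M) = (\<Sum>n. \<integral>\<^sup>+x. ennreal (h n x) \<partial>M)"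
      by (rule nn_integral_suminf) measurable
    also have "\<dots> = (\<Sum>n. ennreal (LINT x|M. h n x))"
      using h_int h_nonneg by (simp add: nn_integral_eq_integral)
    also have "\<dots> \<le> (\<Sum>n. ennreal ((measure M (space M) + K) * r ^ n))"
      by (intro suminf_le ennreal_leI h_le) auto
    also have "\<dots> < \<infinity>"
    proof -
      have "summable (\<lambda>n. (measure M (space M) + K) * r ^ n)"
        using r by (intro summable_mult summable_geometric) auto
      then have "(\<Sum>n. ennreal ((measure M (space M) + K) * r ^ n)) \<noteq> top"
        using K r by (subst suminf_ennreal2) auto
      then show ?thesis by (simp add: less_top)
    qed
    finally have "AE x in M. (\<Sum>n. ennreal (h n x)) \<noteq> \<infinity>"
      by (intro nn_integral_noteq_infinite) auto
    then show ?thesis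
      by (rule eventually_mono) (rule summable_suminf_not_top, use h_nonneg in auto)
  qed
  then show ?thesis
  proof eventually_elim
    case (elim x)
    have "sqrt (g n x) \<le> h n x" for n
    proof -
      have "2 * (sqrt (r ^ n) * sqrt (g n x / r ^ n)) \<le> (sqrt (r ^ n))\<^sup>2 + (sqrt (g n x / r ^ n))\<^sup>2"
        using sum_squares_bound [of "sqrt (r ^ n)" "sqrt (g n x / r ^ n)"] by simp
      also have "\<dots> = h n x" using r nonneg by (simp add: h_def)
      also have "sqrt (r ^ n) * sqrt (g n x / r ^ n) = sqrt (g n x)"
        using r by (simp flip: real_sqrt_mult)
      finally show ?thesis using nonneg [of n x] by (smt (verit) real_sqrt_ge_zero)
    qed
    then show ?case
      by (intro summable_comparison_test' [OF elim, of 0]) (simp add: nonneg)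
  qed
qed

section \<open>Convergence in Lebesgue spaces\<close>

definition p_int :: "real \<Rightarrow> 'a measure \<Rightarrow> ('a \<Rightarrow> real) \<Rightarrow> bool" where
  "p_int p M f \<longleftrightarrow> f \<in> borel_measurable M \<and> integrable M (\<lambda>x. \<bar>f x\<bar> powr p)"

lemma p_int_measurable: "p_int p M f \<Longrightarrow> f \<in> borel_measurable M"
  by (simp add: p_int_def)

lemma p_int_bound:
  fixes g :: "'a \<Rightarrow> real"
  assumes "integrable M g" "f \<in> borel_measurable M" "AE x in M. norm (\<bar>f x\<bar> powr p) \<le> norm (g x)"
  shows "p_int p M f"
  unfolding p_int_def
proof
  show "integrable M (\<lambda>x. \<bar>f x\<bar> powr p)"
    by (rule Bochner_Integration.integrable_bound [OF assms(1)]) (use assms(2,3) in auto)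
qed (rule assms(2))

lemma p_int_add:
  assumes "p \<ge> 1" "p_int p M f" "p_int p M g"
  shows "p_int p M (\<lambda>x. f x + g x)"
proof (rule p_int_bound)
  show "integrable M (\<lambda>x. 2 powr p * (\<bar>f x\<bar> powr p + \<bar>g x\<bar> powr p))"
    using assms by (auto simp: p_int_def)
  show "AE x in M. norm (\<bar>f x + g x\<bar> powr p) \<le> norm (2 powr p * (\<bar>f x\<bar> powr p + \<bar>g x\<bar> powr p))"
    using powr_abs_add_le [OF assms(1)] by simp
qed (use assms in \<open>auto simp: p_int_def\<close>)

lemma p_int_cmult: "p_int p M f \<Longrightarrow> p_int p M (\<lambda>x. c * f x)"
  by (auto simp: p_int_def abs_mult powr_mult)

lemma p_int_diff:
  assumes "p \<ge> 1" "p_int p M f" "p_int p M g"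
  shows "p_int p M (\<lambda>x. f x - g x)"
  using p_int_add [OF assms(1,2) p_int_cmult [OF assms(3), of "-1"]] by simp

lemma p_int_mult_bounded:
  assumes "p \<ge> 0" "p_int p M f" "g \<in> borel_measurable M" "\<And>x. \<bar>g x\<bar> \<le> 1"
  shows "p_int p M (\<lambda>x. g x * f x)"
proof (rule p_int_bound)
  show "integrable M (\<lambda>x. \<bar>f x\<bar> powr p)" using assms by (simp add: p_int_def)
  have "\<bar>g x * f x\<bar> powr p \<le> \<bar>f x\<bar> powr p" for x
    using assms mult_right_mono [of "\<bar>g x\<bar>" 1 "\<bar>f x\<bar>"] by (intro powr_mono2) (auto simp: abs_mult)
  then show "AE x in M. norm (\<bar>g x * f x\<bar> powr p) \<le> norm (\<bar>f x\<bar> powr p)" by simp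
qed (use assms in \<open>auto simp: p_int_def\<close>)

lemma (in finite_measure) p_int_const [simp]: "p_int p M (\<lambda>x. c)"
  by (simp add: p_int_def)

lemma abs_le_1_plus_powr: "p \<ge> 1 \<Longrightarrow> \<bar>x\<bar> \<le> 1 + \<bar>x\<bar> powr p" for x p :: real
proof (cases "\<bar>x\<bar> \<ge> 1")
  case True
  assume "p \<ge> 1"
  with True powr_mono [of 1 p "\<bar>x\<bar>"] show ?thesis by simp
next
  case False
  with powr_ge_zero [of "\<bar>x\<bar>" p] show ?thesis by linarith
qed

lemma (in finite_measure) p_int_imp_integrable:
  assumes "p \<ge> 1" "p_int p M f"
  shows "integrable M f"
proof (rule Bochner_Integration.integrable_bound)
  show "integrable M (\<lambda>x. 1 + \<bar>f x\<bar> powr p)" using assms by (auto simp: p_int_def)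
  show "AE x in M. norm (f x) \<le> norm (1 + \<bar>f x\<bar> powr p)"
    using abs_le_1_plus_powr [OF assms(1)] by simp
qed (use assms in \<open>simp add: p_int_def\<close>)

lemma (in finite_measure) p_int_bounded:
  assumes "f \<in> borel_measurable M" "\<And>x. x \<in> space M \<Longrightarrow> \<bar>f x\<bar> \<le> B" "p \<ge> 0"
  shows "p_int p M f"
proof (rule p_int_bound)
  show "integrable M (\<lambda>x. B powr p)" by simp
  show "AE x in M. norm (\<bar>f x\<bar> powr p) \<le> norm (B powr p)"
    using assms by (intro AE_I2) (auto intro!: powr_mono2)
qed (use assms in auto)

lemma pflux_mult_integrable:
  assumes "p > 1" "p_int p M f" "p_int p M g"
  shows "integrable M (\<lambda>x. pflux p (f x) * g x)"
proof (rule Bochner_Integration.integrable_bound)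
  show "integrable M (\<lambda>x. \<bar>f x\<bar> powr p + \<bar>g x\<bar> powr p)" using assms by (auto simp: p_int_def)
  show "AE x in M. norm (pflux p (f x) * g x) \<le> norm (\<bar>f x\<bar> powr p + \<bar>g x\<bar> powr p)"
    using pflux_mult_le [of p] assms by simp
qed (use assms in \<open>auto simp: p_int_def\<close>)

lemma pflux_mult_integral_le:
  assumes "p > 1" "p_int p M f" "p_int p M g"
  shows "\<bar>LINT x|M. pflux p (f x) * g x\<bar> \<le> (LINT x|M. \<bar>f x\<bar> powr p) + (LINT x|M. \<bar>g x\<bar> powr p)"
proof -
  have "\<bar>LINT x|M. pflux p (f x) * g x\<bar> \<le> (LINT x|M. \<bar>pflux p (f x) * g x\<bar>)"
    by (rule integral_abs_bound)
  also have "\<dots> \<le> (LINT x|M. \<bar>f x\<bar> powr p + \<bar>g x\<bar> powr p)"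
    using assms pflux_mult_le [of p]
    by (intro integral_mono integrable_abs pflux_mult_integrable) (auto simp: p_int_def)
  also have "\<dots> = (LINT x|M. \<bar>f x\<bar> powr p) + (LINT x|M. \<bar>g x\<bar> powr p)"
    using assms by (simp add: p_int_def)
  finally show ?thesis .
qed

lemma sq_int_phalf: "p_int p M f \<Longrightarrow> sq_int M (\<lambda>x. phalf p (f x))"
  by (auto simp: p_int_def sq_int_def phalf_sq)

lemma p_int_of_phalf:
  assumes "f \<in> borel_measurable M" "sq_int M (\<lambda>x. phalf p (f x))"
  shows "p_int p M f"
  using assms by (auto simp: p_int_def sq_int_def phalf_sq)

text \<open>Convergence in \<open>L\<^sup>p\<close> is obtained by mapping \<open>L\<^sup>p\<close> homeomorphically onto \<open>L\<^sup>2\<close> by \<open>phalf\<close>;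
  this avoids the completeness of \<open>L\<^sup>p\<close> and the case distinction between \<open>p \<ge> 2\<close> and \<open>p < 2\<close>.\<close>

theorem phalf_complete:
  fixes G :: "nat \<Rightarrow> 'a \<Rightarrow> real"
  assumes p: "p > 1" and G: "\<And>n. p_int p M (G n)"
    and sm: "summable (\<lambda>n. L2_norm_on M (\<lambda>x. phalf p (G (Suc n) x) - phalf p (G n x)))"
  obtains F where "p_int p M F"
    "(\<lambda>n. LINT x|M. \<bar>G n x\<bar> powr p) \<longlonglongrightarrow> (LINT x|M. \<bar>F x\<bar> powr p)"
    "(\<lambda>n. LINT x|M. \<bar>G n x - F x\<bar> powr p) \<longlonglongrightarrow> 0"
    "\<And>h. p_int p M h \<Longrightarrow> (\<lambda>n. LINT x|M. pflux p (G n x) * h x) \<longlonglongrightarrow> (LINT x|M. pflux p (F x) * h x)"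
proof -
  define B where "B x = lim (\<lambda>n. phalf p (G n x))" for x
  obtain H where H: "sq_int M H" "AE x in M. \<forall>n. \<bar>phalf p (G n x)\<bar> \<le> H x"
    "AE x in M. (\<lambda>n. phalf p (G n x)) \<longlonglongrightarrow> B x" "sq_int M B"
    unfolding B_def by (rule Riesz_Fischer [OF sq_int_phalf [OF G] sm])
  define F where "F x = phalf_inv p (B x)" for x
  have [measurable]: "G n \<in> borel_measurable M" for n using G by (rule p_int_measurable)
  have [measurable]: "B \<in> borel_measurable M" using H(4) by (rule sq_int_measurable)
  have [measurable]: "F \<in> borel_measurable M" unfolding F_def by measurable
  have BF: "B x = phalf p (F x)" for x using p by (simp add: F_def phalf_phalf_inv)
  have F: "p_int p M F"
    by (rule p_int_of_phalf) (use H(4) in \<open>simp_all add: BF [symmetric]\<close>)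
  have conv: "AE x in M. (\<lambda>n. G n x) \<longlonglongrightarrow> F x"
    using H(3)
  proof eventually_elim
    case (elim x)
    have "isCont (phalf_inv p) (B x)"
      using continuous_phalf_inv [of p] p by (simp add: continuous_on_eq_continuous_at)
    from isCont_tendsto_compose [OF this elim] show ?case
      using p by (simp add: phalf_inv_phalf F_def)
  qed
  \<comment> \<open>The Riesz-Fischer majorant bounds all \<open>G n\<close> at once and serves each
    of the three dominated convergences below.\<close>
  have dom: "AE x in M. \<bar>G n x\<bar> powr p \<le> (H x)\<^sup>2" for n
    using H(2)
  proof eventually_elim
    case (elim x)
    then have "(phalf p (G n x))\<^sup>2 \<le> (H x)\<^sup>2"
      by (metis abs_ge_zero power2_abs power_mono)
    then show ?case by (simp add: phalf_sq)
  qed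
  have H2: "integrable M (\<lambda>x. (H x)\<^sup>2)" using H(1) by (rule sq_int_integrable)
  have Fp: "integrable M (\<lambda>x. \<bar>F x\<bar> powr p)" using F by (simp add: p_int_def)
  have powr_cont: "(\<lambda>n. \<bar>a n\<bar> powr p) \<longlonglongrightarrow> \<bar>l\<bar> powr p" if "a \<longlonglongrightarrow> l" for a :: "nat \<Rightarrow> real" and l
    using p that by (intro tendsto_powr' tendsto_intros) auto
  have 1: "(\<lambda>n. LINT x|M. \<bar>G n x\<bar> powr p) \<longlonglongrightarrow> (LINT x|M. \<bar>F x\<bar> powr p)"
  proof (rule integral_dominated_convergence [OF _ _ H2])
    show "AE x in M. (\<lambda>n. \<bar>G n x\<bar> powr p) \<longlonglongrightarrow> \<bar>F x\<bar> powr p"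
      using conv by eventually_elim (rule powr_cont)
  qed (use dom in \<open>simp_all\<close>)
  have "(\<lambda>n. LINT x|M. \<bar>G n x - F x\<bar> powr p) \<longlonglongrightarrow> (LINT x|M. 0)"
  proof (rule integral_dominated_convergence)
    show "integrable M (\<lambda>x. 2 powr p * ((H x)\<^sup>2 + \<bar>F x\<bar> powr p))" using H2 Fp by simp
    show "AE x in M. (\<lambda>n. \<bar>G n x - F x\<bar> powr p) \<longlonglongrightarrow> 0"
      using conv
    proof eventually_elim
      case (elim x)
      have "(\<lambda>n. G n x - F x) \<longlonglongrightarrow> F x - F x" by (intro tendsto_intros elim)
      from powr_cont [OF this] show ?case by simp
    qed
    show "AE x in M. norm (\<bar>G n x - F x\<bar> powr p) \<le> 2 powr p * ((H x)\<^sup>2 + \<bar>F x\<bar> powr p)" for n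
      using dom [of n]
    proof eventually_elim
      case (elim x)
      have "\<bar>G n x - F x\<bar> powr p \<le> 2 powr p * (\<bar>G n x\<bar> powr p + \<bar>F x\<bar> powr p)"
        using powr_abs_add_le [of p "G n x" "- F x"] p by simp
      also have "\<dots> \<le> 2 powr p * ((H x)\<^sup>2 + \<bar>F x\<bar> powr p)"
        using elim by (intro mult_left_mono add_mono) auto
      finally show ?case by simp
    qed
  qed simp_all
  then have 2: "(\<lambda>n. LINT x|M. \<bar>G n x - F x\<bar> powr p) \<longlonglongrightarrow> 0" by simp
  have 3: "(\<lambda>n. LINT x|M. pflux p (G n x) * h x) \<longlonglongrightarrow> (LINT x|M. pflux p (F x) * h x)"
    if h: "p_int p M h" for h
  proof (rule integral_dominated_convergence)
    have [measurable]: "h \<in> borel_measurable M" using h by (rule p_int_measurable)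
    show "(\<lambda>x. pflux p (F x) * h x) \<in> borel_measurable M" by measurable
    show "(\<lambda>x. pflux p (G n x) * h x) \<in> borel_measurable M" for n by measurable
    show "integrable M (\<lambda>x. (H x)\<^sup>2 + \<bar>h x\<bar> powr p)" using H2 h by (simp add: p_int_def)
    show "AE x in M. (\<lambda>n. pflux p (G n x) * h x) \<longlonglongrightarrow> pflux p (F x) * h x"
      using conv
    proof eventually_elim
      case (elim x)
      have "isCont (pflux p) (F x)"
        using continuous_pflux [of p] p by (simp add: continuous_on_eq_continuous_at)
      from isCont_tendsto_compose [OF this elim] show ?case by (intro tendsto_intros)
    qed
    show "AE x in M. norm (pflux p (G n x) * h x) \<le> (H x)\<^sup>2 + \<bar>h x\<bar> powr p" for n
      using dom [of n]
    proof eventually_elim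
      case (elim x)
      with pflux_mult_le [of p "G n x" "h x"] p show ?case by simp
    qed
  qed
  show ?thesis by (rule that [OF F 1 2 3])
qed

text \<open>By the elementary inequality \<open>y \<le> \<epsilon> + y\<^sup>p / \<epsilon>\<^sup>p\<^sup>-\<^sup>1\<close>.\<close>

lemma (in finite_measure) Lp_conv_imp_L1_conv:
  fixes f :: "nat \<Rightarrow> 'a \<Rightarrow> real"
  assumes p: "p > 1" and f: "\<And>n. p_int p M (f n)"
    and conv: "(\<lambda>n. LINT x|M. \<bar>f n x\<bar> powr p) \<longlonglongrightarrow> 0"
  shows "(\<lambda>n. LINT x|M. \<bar>f n x\<bar>) \<longlonglongrightarrow> 0"
proof (rule LIMSEQ_I)
  fix r :: real assume r: "r > 0"
  define m where "m = measure M (space M) + 1"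
  have m: "m > 0" by (simp add: m_def add_nonneg_pos)
  define e where "e = r / (2 * m)"
  have e: "e > 0" using r m by (simp add: e_def)
  define c where "c = e powr (1 - p)"
  have c: "c > 0" using e by (simp add: c_def)
  have pt: "\<bar>y\<bar> \<le> e + c * \<bar>y\<bar> powr p" for y
  proof (cases "\<bar>y\<bar> \<le> e")
    case True
    moreover have "c * \<bar>y\<bar> powr p \<ge> 0" using c by simp
    ultimately show ?thesis by linarith
  next
    case False
    then have y: "\<bar>y\<bar> > 0" using e by linarith
    have "\<bar>y\<bar> = \<bar>y\<bar> powr (1 - p) * \<bar>y\<bar> powr p" using y by (simp flip: powr_add)
    also have "\<dots> \<le> c * \<bar>y\<bar> powr p"
      unfolding c_def using False e p by (intro mult_right_mono powr_mono2') auto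
    finally show ?thesis using e by linarith
  qed
  from LIMSEQ_D [OF conv, of "r / (2 * c)"] r c obtain N where
    N: "\<And>n. n \<ge> N \<Longrightarrow> \<bar>LINT x|M. \<bar>f n x\<bar> powr p\<bar> < r / (2 * c)" by auto
  show "\<exists>no. \<forall>n\<ge>no. norm ((LINT x|M. \<bar>f n x\<bar>) - 0) < r"
  proof (intro exI allI impI)
    fix n assume "n \<ge> N"
    have fp: "integrable M (\<lambda>x. \<bar>f n x\<bar> powr p)" using f [of n] by (simp add: p_int_def)
    have fi: "integrable M (\<lambda>x. \<bar>f n x\<bar>)" using p_int_imp_integrable [of p "f n"] f p by auto
    have "(LINT x|M. \<bar>f n x\<bar>) \<le> (LINT x|M. e + c * \<bar>f n x\<bar> powr p)"
      using pt fp fi by (intro integral_mono) auto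
    also have "\<dots> = e * measure M (space M) + c * (LINT x|M. \<bar>f n x\<bar> powr p)"
      using fp by simp
    also have "\<dots> < e * m + c * (r / (2 * c))"
    proof (rule add_le_less_mono)
      show "e * measure M (space M) \<le> e * m" using e by (simp add: m_def)
      show "c * (LINT x|M. \<bar>f n x\<bar> powr p) < c * (r / (2 * c))"
        using N [OF \<open>n \<ge> N\<close>] c by (intro mult_strict_left_mono) auto
    qed
    also have "\<dots> = r" using m c by (simp add: e_def)
    finally show "norm ((LINT x|M. \<bar>f n x\<bar>) - 0) < r"
      using Bochner_Integration.integral_nonneg [of M "\<lambda>x. \<bar>f n x\<bar>"] by simp
  qed
qed

section \<open>Smooth cutoffs and the fundamental lemma\<close>

definition smooth_fun :: "(real \<Rightarrow> real) \<Rightarrow> bool" where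
  "smooth_fun f \<longleftrightarrow> (\<forall>n x. ((deriv ^^ n) f) differentiable (at x))"

lemma test_function_iff:
  "test_function a b \<psi> \<longleftrightarrow>
    smooth_fun \<psi> \<and> (\<exists>K. compact K \<and> K \<subseteq> {a<..<b} \<and> (\<forall>x. x \<notin> K \<longrightarrow> \<psi> x = 0))"
  unfolding test_function_def smooth_fun_def ..

lemma smooth_fun_differentiable: "smooth_fun f \<Longrightarrow> f differentiable (at x)"
  unfolding smooth_fun_def by (drule spec [of _ 0]) simp

lemma smooth_fun_deriv: "smooth_fun f \<Longrightarrow> smooth_fun (deriv f)"
proof -
  assume f: "smooth_fun f"
  have "(deriv ^^ n) (deriv f) = (deriv ^^ Suc n) f" for n by (simp add: funpow_swap1)
  with f show ?thesis unfolding smooth_fun_def by (metis)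
qed

lemma smooth_fun_DERIV: "smooth_fun f \<Longrightarrow> (f has_real_derivative deriv f x) (at x)"
  using smooth_fun_differentiable [of f x] by (simp add: DERIV_deriv_iff_real_differentiable)

lemma smooth_fun_continuous_on: "smooth_fun f \<Longrightarrow> continuous_on A f"
  by (rule DERIV_continuous_on) (rule has_field_derivative_at_within [OF smooth_fun_DERIV])

lemma smooth_fun_of_deriv:
  assumes "\<And>x. (f has_real_derivative g x) (at x)" "smooth_fun g"
  shows "smooth_fun f"
  unfolding smooth_fun_def
proof (intro allI)
  fix n x
  have g: "deriv f = g" using assms(1) by (auto intro: DERIV_imp_deriv)
  show "((deriv ^^ n) f) differentiable (at x)"
  proof (cases n)
    case 0
    then show ?thesis using assms(1) by (auto simp: real_differentiable_def)
  next
    case (Suc m)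
    then have "(deriv ^^ n) f = (deriv ^^ m) g" by (simp add: funpow_swap1 g)
    then show ?thesis using assms(2) by (simp add: smooth_fun_def)
  qed
qed

lemma smooth_fun_diff:
  assumes f: "smooth_fun f" and g: "smooth_fun g"
  shows "smooth_fun (\<lambda>x. f x - g x)"
proof -
  have eq: "(deriv ^^ n) (\<lambda>x. f x - g x) = (\<lambda>x. (deriv ^^ n) f x - (deriv ^^ n) g x)" for n
  proof (induction n)
    case (Suc n)
    have "deriv (\<lambda>x. (deriv ^^ n) f x - (deriv ^^ n) g x) x = deriv ((deriv ^^ n) f) x - deriv ((deriv ^^ n) g) x" for x
      using f g by (intro DERIV_imp_deriv derivative_intros)
        (simp_all add: smooth_fun_def DERIV_deriv_iff_real_differentiable)
    then show ?case by (simp add: Suc)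
  qed simp
  show ?thesis unfolding smooth_fun_def eq using f g by (auto simp: smooth_fun_def)
qed

lemma smooth_fun_affine:
  assumes f: "smooth_fun f"
  shows "smooth_fun (\<lambda>x. f (r * (x - c)))"
proof -
  have D: "((\<lambda>x. r ^ n * (deriv ^^ n) f (r * (x - c))) has_real_derivative
      r ^ Suc n * (deriv ^^ Suc n) f (r * (x - c))) (at x)" for n x
  proof -
    have "((deriv ^^ n) f has_real_derivative (deriv ^^ Suc n) f (r * (x - c))) (at (r * (x - c)))"
      using f by (simp add: smooth_fun_def DERIV_deriv_iff_real_differentiable)
    moreover have "((\<lambda>x. r * (x - c)) has_real_derivative r) (at x)"
      by (auto intro!: derivative_eq_intros)
    ultimately have "((\<lambda>x. (deriv ^^ n) f (r * (x - c))) has_real_derivative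
      (deriv ^^ Suc n) f (r * (x - c)) * r) (at x)"
      by (rule DERIV_chain2)
    from DERIV_cmult [OF this, of "r ^ n"] show ?thesis by (simp add: algebra_simps)
  qed
  have eq: "(deriv ^^ n) (\<lambda>x. f (r * (x - c))) = (\<lambda>x. r ^ n * (deriv ^^ n) f (r * (x - c)))" for n
  proof (induction n)
    case (Suc n)
    have "deriv (\<lambda>x. r ^ n * (deriv ^^ n) f (r * (x - c))) x = r ^ Suc n * (deriv ^^ Suc n) f (r * (x - c))" for x
      by (rule DERIV_imp_deriv [OF D])
    with Suc show ?case by auto
  qed simp
  show ?thesis unfolding smooth_fun_def eq using D by (auto simp: real_differentiable_def)
qed

section \<open>A smooth step function built from exp(-1/x)\<close>

definition expinv :: "nat \<Rightarrow> real \<Rightarrow> real" where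
  "expinv k x = (if x > 0 then exp (- inverse x) * inverse x ^ k else 0)"

lemma expinv_tendsto_0: "(expinv k \<longlongrightarrow> 0) (at 0)"
proof (rule filterlim_split_at)
  show "(expinv k \<longlongrightarrow> 0) (at_left 0)"
    by (rule tendsto_eventually) (auto simp: expinv_def eventually_at_filter)
  have "((\<lambda>x::real. inverse x ^ k / exp (inverse x)) \<longlongrightarrow> 0) (at_right 0)"
    by (rule filterlim_compose [OF tendsto_power_div_exp_0 filterlim_inverse_at_top_right])
  then show "(expinv k \<longlongrightarrow> 0) (at_right 0)"
    by (rule Lim_transform_eventually)
      (auto simp: expinv_def eventually_at_filter exp_minus field_simps)
qed

text \<open>The powers of \<open>inverse x\<close> are part of \<open>expinv\<close> in order that
  differentiation stays within the linear span of the family.\<close>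

lemma expinv_DERIV:
  "(expinv k has_real_derivative expinv (k + 2) x - real k * expinv (k + 1) x) (at x)"
proof -
  consider "x > 0" | "x < 0" | "x = 0" by linarith
  then show ?thesis
  proof cases
    case 1
    have "((\<lambda>x. exp (- inverse x) * inverse x ^ k) has_real_derivative
        expinv (k + 2) x - real k * expinv (k + 1) x) (at x)"
    proof -
      have i: "(inverse has_real_derivative - (inverse x)\<^sup>2) (at x)"
        using 1 DERIV_inverse [of x] by (simp add: power2_eq_square)
      have "((\<lambda>x. exp (- inverse x)) has_real_derivative exp (- inverse x) * (inverse x)\<^sup>2) (at x)"
        using DERIV_chain2 [OF DERIV_exp DERIV_minus [OF i]] by simp
      from DERIV_mult [OF this DERIV_power [OF i, of k]]
      have "((\<lambda>x. exp (- inverse x) * inverse x ^ k) has_real_derivative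
          exp (- inverse x) * (inverse x)\<^sup>2 * inverse x ^ k +
          real k * (- (inverse x)\<^sup>2 * inverse x ^ (k - Suc 0)) * exp (- inverse x)) (at x)"
        by simp
      moreover have "exp (- inverse x) * (inverse x)\<^sup>2 * inverse x ^ k +
          real k * (- (inverse x)\<^sup>2 * inverse x ^ (k - Suc 0)) * exp (- inverse x) =
          expinv (k + 2) x - real k * expinv (k + 1) x"
        using 1 by (cases k) (simp_all add: expinv_def power2_eq_square)
      ultimately show ?thesis by simp
    qed
    then show ?thesis
      by (rule has_field_derivative_transform_within_open [of _ _ _ "{0<..}"])
        (use 1 in \<open>auto simp: expinv_def\<close>)
  next
    case 2
    have "((\<lambda>x. 0) has_real_derivative 0) (at x)" by simp
    then have "(expinv k has_real_derivative 0) (at x)"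
      by (rule has_field_derivative_transform_within_open [of _ _ _ "{..<0}"])
        (use 2 in \<open>auto simp: expinv_def\<close>)
    with 2 show ?thesis by (simp add: expinv_def)
  next
    case 3
    \<comment> \<open>At the origin the difference quotient of one member is the next member of the
      family, whose limit is already known.\<close>
    have "(\<lambda>h. (expinv k (0 + h) - expinv k 0) / h) = expinv (Suc k)"
      by (auto simp: expinv_def field_simps)
    then have "(expinv k has_real_derivative 0) (at 0)"
      using expinv_tendsto_0 [of "Suc k"] by (simp add: DERIV_def)
    with 3 show ?thesis by (simp add: expinv_def)
  qed
qed

text \<open>A class that contains a derivative of each of its members: smoothness follows from a
  single differentiation rule, and no formula for the n-th derivative is required.\<close>

inductive bump_span :: "(real \<Rightarrow> real) \<Rightarrow> bool" where
  gen: "bump_span (\<lambda>x. c * (expinv n x * expinv m (1 - x)))"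
| add: "bump_span f \<Longrightarrow> bump_span g \<Longrightarrow> bump_span (\<lambda>x. f x + g x)"

lemma bump_span_DERIV:
  "bump_span f \<Longrightarrow> \<exists>g. bump_span g \<and> (\<forall>x. (f has_real_derivative g x) (at x))"
proof (induction rule: bump_span.induct)
  case (gen c n m)
  define g where "g x =
    (c * (expinv (n + 2) x * expinv m (1 - x)) + (- c * n) * (expinv (n + 1) x * expinv m (1 - x))) +
    ((- c) * (expinv n x * expinv (m + 2) (1 - x)) + (c * m) * (expinv n x * expinv (m + 1) (1 - x)))" for x
  have "bump_span g" unfolding g_def by (intro bump_span.intros)
  moreover have "((\<lambda>x. c * (expinv n x * expinv m (1 - x))) has_real_derivative g x) (at x)" for x
  proof -
    have "((\<lambda>x. 1 - x) has_real_derivative - 1) (at x)" by (auto intro!: derivative_eq_intros)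
    from DERIV_chain2 [OF expinv_DERIV this, of m]
    have "((\<lambda>x. expinv m (1 - x)) has_real_derivative
        - (expinv (m + 2) (1 - x) - real m * expinv (m + 1) (1 - x))) (at x)" by simp
    from DERIV_cmult [OF DERIV_mult [OF expinv_DERIV this, of n], of c]
    show ?thesis by (simp add: g_def algebra_simps)
  qed
  ultimately show ?case by blast
next
  case (add f1 f2)
  then obtain g1 g2 where "bump_span g1" "bump_span g2"
    "\<And>x. (f1 has_real_derivative g1 x) (at x)" "\<And>x. (f2 has_real_derivative g2 x) (at x)" by blast
  then show ?case
    by (intro exI [of _ "\<lambda>x. g1 x + g2 x"]) (auto intro: bump_span.add DERIV_add)
qed

lemma bump_span_smooth:
  assumes "bump_span f"
  shows "smooth_fun f"
proof -
  have "bump_span ((deriv ^^ n) f)" for n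
  proof (induction n)
    case (Suc n)
    then obtain g where g: "bump_span g" "\<And>x. ((deriv ^^ n) f has_real_derivative g x) (at x)"
      using bump_span_DERIV by blast
    then have "deriv ((deriv ^^ n) f) = g" by (auto intro: DERIV_imp_deriv)
    with g show ?case by simp
  qed (use assms in simp)
  then show ?thesis
    unfolding smooth_fun_def real_differentiable_def using bump_span_DERIV by fast
qed

lemma smooth_step_exists:
  obtains S S' :: "real \<Rightarrow> real" where "smooth_fun S" "\<And>x. (S has_real_derivative S' x) (at x)"
    "\<And>x. S' x \<ge> 0" "continuous_on UNIV S'"
    "\<And>x. x \<le> 0 \<Longrightarrow> S x = 0" "\<And>x. x \<ge> 1 \<Longrightarrow> S x = 1"
proof -
  define \<beta> where "\<beta> x = expinv 0 x * expinv 0 (1 - x)" for x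
  have "bump_span (\<lambda>x. 1 * (expinv 0 x * expinv 0 (1 - x)))" by (rule bump_span.gen)
  then have sm: "smooth_fun \<beta>" unfolding \<beta>_def [abs_def] using bump_span_smooth by simp
  then have cont: "continuous_on A \<beta>" for A by (rule smooth_fun_continuous_on)
  have nonneg: "\<beta> x \<ge> 0" for x by (simp add: \<beta>_def expinv_def)
  have zero: "\<beta> x = 0" if "x \<le> 0 \<or> x \<ge> 1" for x using that by (auto simp: \<beta>_def expinv_def)
  define Z where "Z = integral {0..1} \<beta>"
  have "Z \<noteq> 0"
  proof
    assume "Z = 0"
    then have "\<forall>x\<in>{0..1}. \<beta> x = 0"
      using integral_eq_0_iff [of 0 1 \<beta>] cont nonneg by (simp add: Z_def)
    then have "\<beta> (1/2) = 0" by simp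
    then show False by (simp add: \<beta>_def expinv_def)
  qed
  moreover have "Z \<ge> 0" unfolding Z_def by (intro integral_nonneg integrable_continuous_real cont nonneg)
  ultimately have Z: "Z > 0" by simp
  \<comment> \<open>Integration starts at -1 rather than at 0 so that 0 is interior to the interval
    on which the primitive is differentiated.\<close>
  define S where "S x = integral {-1..x} \<beta> / Z" for x
  have int: "\<beta> integrable_on {a..b}" for a b by (intro integrable_continuous_real cont)
  have S0: "S x = 0" if "x \<le> 0" for x
  proof -
    have "integral {-1..x} \<beta> = 0"
      using that by (auto intro!: integral_unique has_integral_is_0 zero)
    then show ?thesis by (simp add: S_def)
  qed
  have S1: "S x = 1" if "x \<ge> 1" for x
  proof -
    have "integral {-1..x} \<beta> = integral {-1..0} \<beta> + integral {0..1} \<beta> + integral {1..x} \<beta>"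
      using that by (simp add: Henstock_Kurzweil_Integration.integral_combine int)
    moreover have "integral {-1..0} \<beta> = 0" "integral {1..x} \<beta> = 0"
      by (auto intro!: integral_unique has_integral_is_0 zero)
    ultimately show ?thesis using Z by (simp add: S_def Z_def)
  qed
  have D: "(S has_real_derivative \<beta> x / Z) (at x)" for x
  proof (cases "x < 0")
    case True
    have "((\<lambda>x. 0) has_real_derivative 0) (at x)" by simp
    then have "(S has_real_derivative 0) (at x)"
      by (rule has_field_derivative_transform_within_open [of _ _ _ "{..<0}"])
        (use True S0 in auto)
    with True zero show ?thesis by simp
  next
    case False
    have "((\<lambda>u. integral {-1..u} \<beta>) has_real_derivative \<beta> x) (at x within {-1..x+1})"
      using False by (intro integral_has_real_derivative cont) auto
    then have "((\<lambda>u. integral {-1..u} \<beta>) has_real_derivative \<beta> x) (at x)"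
      using False at_within_interior [of x "{-1..x+1}"] by simp
    from DERIV_cdivide [OF this, of Z] show ?thesis by (simp add: S_def [abs_def])
  qed
  have "bump_span (\<lambda>x. (1 / Z) * (expinv 0 x * expinv 0 (1 - x)))" by (rule bump_span.gen)
  then have "smooth_fun (\<lambda>x. \<beta> x / Z)" using bump_span_smooth by (simp add: \<beta>_def)
  with D have "smooth_fun S" by (rule smooth_fun_of_deriv)
  moreover have "continuous_on UNIV (\<lambda>x. \<beta> x / Z)" using Z by (intro continuous_intros cont) auto
  ultimately show ?thesis
    using D S0 S1 nonneg Z by (intro that [of S "\<lambda>x. \<beta> x / Z"]) auto
qed

text \<open>Function and derivative are chosen together, since the properties used later relate the
  two.\<close>

definition smooth_step_pair :: "(real \<Rightarrow> real) \<times> (real \<Rightarrow> real)" where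
  "smooth_step_pair = (SOME (S, S'). smooth_fun S \<and> (\<forall>x. (S has_real_derivative S' x) (at x)) \<and>
    (\<forall>x. S' x \<ge> 0) \<and> continuous_on UNIV S' \<and> (\<forall>x\<le>0. S x = 0) \<and> (\<forall>x\<ge>1. S x = 1))"

definition smooth_step :: "real \<Rightarrow> real" where "smooth_step = fst smooth_step_pair"

definition smooth_step' :: "real \<Rightarrow> real" where "smooth_step' = snd smooth_step_pair"

lemma smooth_step_props:
  shows smooth_fun_smooth_step: "smooth_fun smooth_step"
    and smooth_step_DERIV: "\<And>x. (smooth_step has_real_derivative smooth_step' x) (at x)"
    and smooth_step'_nonneg: "\<And>x. smooth_step' x \<ge> 0"
    and smooth_step'_cont: "continuous_on UNIV smooth_step'"
    and smooth_step_0: "\<And>x. x \<le> 0 \<Longrightarrow> smooth_step x = 0"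
    and smooth_step_1: "\<And>x. x \<ge> 1 \<Longrightarrow> smooth_step x = 1"
proof -
  obtain S S' :: "real \<Rightarrow> real" where SS: "smooth_fun S \<and> (\<forall>x. (S has_real_derivative S' x) (at x)) \<and>
    (\<forall>x. S' x \<ge> 0) \<and> continuous_on UNIV S' \<and> (\<forall>x\<le>0. S x = 0) \<and> (\<forall>x\<ge>1. S x = 1)"
    by (rule smooth_step_exists) (rule that, auto)
  have "case smooth_step_pair of (S, S') \<Rightarrow> smooth_fun S \<and> (\<forall>x. (S has_real_derivative S' x) (at x)) \<and>
    (\<forall>x. S' x \<ge> 0) \<and> continuous_on UNIV S' \<and> (\<forall>x\<le>0. S x = 0) \<and> (\<forall>x\<ge>1. S x = 1)"
    unfolding smooth_step_pair_def by (rule someI [of _ "(S, S')"]) (use SS in simp)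
  then show "smooth_fun smooth_step" "\<And>x. (smooth_step has_real_derivative smooth_step' x) (at x)"
    "\<And>x. smooth_step' x \<ge> 0" "continuous_on UNIV smooth_step'"
    "\<And>x. x \<le> 0 \<Longrightarrow> smooth_step x = 0" "\<And>x. x \<ge> 1 \<Longrightarrow> smooth_step x = 1"
    unfolding smooth_step_def smooth_step'_def case_prod_beta by auto
qed

lemma smooth_step_mono: "x \<le> y \<Longrightarrow> smooth_step x \<le> smooth_step y"
  by (rule DERIV_nonneg_imp_nondecreasing [of x y smooth_step])
    (blast intro: smooth_step_DERIV smooth_step'_nonneg)+

lemma smooth_step_bounds: "0 \<le> smooth_step x" "smooth_step x \<le> 1"
proof -
  show "0 \<le> smooth_step x"
    using smooth_step_mono [of "min x 0" x] smooth_step_0 [of "min x 0"] by simp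
  show "smooth_step x \<le> 1"
    using smooth_step_mono [of x "max x 1"] smooth_step_1 [of "max x 1"] by simp
qed

lemma smooth_step'_eq_0:
  assumes "x < 0 \<or> x > 1"
  shows "smooth_step' x = 0"
proof -
  have c: "((\<lambda>_. c) has_real_derivative 0) (at x)" for c :: real by simp
  have "(smooth_step has_real_derivative 0) (at x)"
  proof (cases "x < 0")
    case True
    show ?thesis using c [of 0]
      by (rule has_field_derivative_transform_within_open [of _ _ _ "{..<0}"]) (use True in \<open>auto simp: smooth_step_0\<close>)
  next
    case False
    show ?thesis using c [of 1]
      by (rule has_field_derivative_transform_within_open [of _ _ _ "{1<..}"]) (use False assms in \<open>auto simp: smooth_step_1\<close>)
  qed
  with smooth_step_DERIV show ?thesis by (rule DERIV_unique)
qed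

text \<open>For \<open>c \<le> d\<close> it rises on an interval of length \<open>1 / r\<close> to
  the right of c and falls on one to the right of d. Both ramps lie on the same side, so the limit
  for large r is the indicator of \<open>{c<..d}\<close>, and the derivative is a difference of two
  approximate Dirac kernels.\<close>

definition smooth_cutoff :: "real \<Rightarrow> real \<Rightarrow> real \<Rightarrow> real \<Rightarrow> real" where
  "smooth_cutoff r c d x = smooth_step (r * (x - c)) - smooth_step (r * (x - d))"

lemma smooth_cutoff_DERIV:
  "(smooth_cutoff r c d has_real_derivative
     r * smooth_step' (r * (x - c)) - r * smooth_step' (r * (x - d))) (at x)"
proof -
  have "((\<lambda>x. smooth_step (r * (x - c))) has_real_derivative smooth_step' (r * (x - c)) * r) (at x)" for c
    by (rule DERIV_chain2 [OF smooth_step_DERIV]) (auto intro!: derivative_eq_intros)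
  from DERIV_diff [OF this [of c] this [of d]] show ?thesis
    by (simp add: smooth_cutoff_def [abs_def] mult.commute)
qed

lemma smooth_cutoff_eq_0:
  assumes "r > 0" "c \<le> d" "x \<le> c \<or> d + 1 / r \<le> x"
  shows "smooth_cutoff r c d x = 0"
proof (cases "x \<le> c")
  case True
  then have "r * (x - c) \<le> 0" "r * (x - d) \<le> 0"
    using assms by (auto intro!: mult_nonneg_nonpos)
  then show ?thesis by (simp add: smooth_cutoff_def smooth_step_0)
next
  case False
  then have "r * (x - d) \<ge> 1" using assms by (simp add: field_simps)
  moreover have "r * (x - d) \<le> r * (x - c)" using assms by simp
  ultimately have "r * (x - d) \<ge> 1" "r * (x - c) \<ge> 1" by auto
  then show ?thesis by (simp add: smooth_cutoff_def smooth_step_1)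
qed

lemma smooth_cutoff_eq_1:
  assumes "r > 0" "c + 1 / r \<le> x" "x \<le> d"
  shows "smooth_cutoff r c d x = 1"
proof -
  have "r * (x - c) \<ge> 1" using assms by (simp add: field_simps)
  moreover have "r * (x - d) \<le> 0" using assms by (auto intro!: mult_nonneg_nonpos)
  ultimately show ?thesis by (simp add: smooth_cutoff_def smooth_step_0 smooth_step_1)
qed

lemma smooth_cutoff_abs_le: "\<bar>smooth_cutoff r c d x\<bar> \<le> 1"
  using smooth_step_bounds [of "r * (x - c)"] smooth_step_bounds [of "r * (x - d)"]
  by (simp add: smooth_cutoff_def abs_le_iff)

lemma smooth_cutoff_test_function:
  assumes "r > 0" "c \<le> d" "a < c" "d + 1 / r < b"
  shows "test_function a b (smooth_cutoff r c d)"
  unfolding test_function_iff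
proof
  show "smooth_fun (smooth_cutoff r c d)"
    unfolding smooth_cutoff_def [abs_def]
    by (intro smooth_fun_diff smooth_fun_affine smooth_fun_smooth_step)
  show "\<exists>K. compact K \<and> K \<subseteq> {a<..<b} \<and> (\<forall>x. x \<notin> K \<longrightarrow> smooth_cutoff r c d x = 0)"
    using assms smooth_cutoff_eq_0 [of r c d] by (intro exI [of _ "{c..d + 1 / r}"]) auto
qed

lemma smooth_cutoff_tendsto:
  assumes "c \<le> d"
  shows "(\<lambda>n. smooth_cutoff (real (Suc n)) c d x) \<longlonglongrightarrow> indicator {c<..d} x"
proof -
  consider "x \<le> c" | "c < x" "x \<le> d" | "x > d" by linarith
  then show ?thesis
  proof cases
    case 1
    then have "smooth_cutoff (real (Suc n)) c d x = 0" for n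
      using assms by (intro smooth_cutoff_eq_0) auto
    with 1 show ?thesis by (simp del: of_nat_Suc)
  next
    case 2
    obtain N where N: "1 / real (Suc N) < x - c" using 2 nat_approx_posE [of "x - c"] by auto
    have "smooth_cutoff (real (Suc n)) c d x = 1" if "n \<ge> N" for n
    proof (rule smooth_cutoff_eq_1)
      have "1 / real (Suc n) \<le> 1 / real (Suc N)" using that by (simp add: frac_le)
      then show "c + 1 / real (Suc n) \<le> x" using N by linarith
    qed (use 2 in auto)
    then have "\<forall>\<^sub>F n in sequentially. smooth_cutoff (real (Suc n)) c d x = 1"
      by (auto simp: eventually_sequentially)
    then show ?thesis using 2 by (simp add: tendsto_eventually)
  next
    case 3
    obtain N where N: "1 / real (Suc N) < x - d" using 3 nat_approx_posE [of "x - d"] by auto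
    have "smooth_cutoff (real (Suc n)) c d x = 0" if "n \<ge> N" for n
    proof (rule smooth_cutoff_eq_0)
      have "1 / real (Suc n) \<le> 1 / real (Suc N)" using that by (simp add: frac_le)
      then show "x \<le> c \<or> d + 1 / real (Suc n) \<le> x" using N by linarith
    qed (use assms in auto)
    then have "\<forall>\<^sub>F n in sequentially. smooth_cutoff (real (Suc n)) c d x = 0"
      by (auto simp: eventually_sequentially)
    then show ?thesis using 3 by (simp add: tendsto_eventually)
  qed
qed

section \<open>The fundamental lemma of the calculus of variations\<close>

lemma sigma_finite_lebesgue: "sigma_finite_measure (lebesgue :: real measure)"
proof
  have "x \<in> (\<Union>n::nat. {- real n..real n})" for x :: real
  proof -
    obtain n :: nat where "\<bar>x\<bar> \<le> real n" using real_arch_simple by blast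
    then have "x \<in> {- real n..real n}" by auto
    then show ?thesis by blast
  qed
  then have "(\<Union>n::nat. {- real n..real n}) = UNIV" by blast
  then show "\<exists>A::real set set. countable A \<and> A \<subseteq> sets lebesgue \<and> \<Union> A = space lebesgue \<and>
      (\<forall>a\<in>A. emeasure lebesgue a \<noteq> \<infinity>)"
    by (intro exI [of _ "range (\<lambda>n::nat. {- real n..real n})"]) auto
qed

text \<open>The sets over which h integrates to zero form a Dynkin system, and the open rays are an
  intersection-stable generator of the Borel sets. A Lebesgue set differs from a Borel set by a null
  set.\<close>

lemma AE_zero_if_Ioi_integrals_zero:
  fixes h :: "real \<Rightarrow> real"
  assumes h: "integrable lebesgue h" and zero: "(LINT y|lebesgue. h y) = 0"
    and Ioi: "\<And>x. (LINT y|lebesgue. indicator {x<..} y * h y) = 0"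
  shows "AE y in lebesgue. h y = 0"
proof (rule sigma_finite_measure.density_zero [OF _ h])
  show "sigma_finite_measure (lebesgue :: real measure)"
    by (rule sigma_finite_lebesgue)
  have int: "integrable lebesgue (\<lambda>y. indicator A y * h y)" if "A \<in> sets lebesgue" for A
    using integrable_mult_indicator [OF that h] by simp
  have borel: "(LINT y|lebesgue. indicator A y * h y) = 0" if "A \<in> sets borel" for A
  proof -
    have "Int_stable (range (\<lambda>a::real. {a<..}))"
    proof -
      have "{a<..} \<inter> {b<..} = {max a b<..}" for a b :: real by auto
      then show ?thesis by (auto simp: Int_stable_def)
    qed
    moreover have "range (\<lambda>a::real. {a<..}) \<subseteq> Pow UNIV" by simp
    moreover have "A \<in> sigma_sets UNIV (range (\<lambda>a::real. {a<..}))"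
      using that by (simp add: borel_Ioi)
    ultimately show ?thesis
    proof (induction rule: sigma_sets_induct_disjoint)
      case (basic A)
      then show ?case using Ioi by auto
    next
      case (compl A)
      then have A: "A \<in> sets borel" by (simp add: borel_Ioi)
      have "(LINT y|lebesgue. indicator (UNIV - A) y * h y) =
          (LINT y|lebesgue. h y - indicator A y * h y)"
        by (intro Bochner_Integration.integral_cong) (auto simp: indicator_def)
      also have "\<dots> = (LINT y|lebesgue. h y) - (LINT y|lebesgue. indicator A y * h y)"
        using A h by (intro Bochner_Integration.integral_diff int) auto
      finally show ?case using zero compl by simp
    next
      case (union A)
      then have "range A \<subseteq> sets borel" by (simp add: borel_Ioi)
      then have "A i \<in> sets borel" for i by blast
      then have A: "A i \<in> sets lebesgue" for i by auto
      have "(LINT y:(\<Union>i. A i)|lebesgue. h y) = (\<Sum>i. (LINT y:(A i)|lebesgue. h y))"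
        using union A int [of "\<Union>i. A i"]
        by (intro lebesgue_integral_countable_add) (auto simp: set_integrable_def disjoint_family_on_def)
      then show ?case using union by (simp add: set_lebesgue_integral_def)
    qed auto
  qed
  show "set_lebesgue_integral lebesgue A h = 0" if A: "A \<in> sets lebesgue" for A
  proof -
    obtain B N N' where B: "B \<in> sets lborel" "A = B \<union> N" "N \<subseteq> N'" "N' \<in> null_sets lborel"
      using A by (auto elim: sets_completionE)
    have "AE y in lebesgue. y \<notin> N'" using B by (intro AE_not_in) (auto simp: null_sets_completionI)
    then have "(LINT y|lebesgue. indicator A y * h y) = (LINT y|lebesgue. indicator B y * h y)"
    proof (intro integral_cong_AE, goal_cases)
      case 3
      then show ?case by eventually_elim (use B in \<open>auto simp: indicator_def\<close>)
    qed (use int A B in \<open>auto intro: borel_measurable_integrable\<close>)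
    also have "\<dots> = 0" using borel B by simp
    finally show ?thesis by (simp add: set_lebesgue_integral_def)
  qed
qed

text \<open>All information on h comes through its products with test functions. A cutoff that
  equals 1 on a slightly larger interval supplies local measurability and an integrable majorant;
  steeper cutoffs then approach the indicator.\<close>

lemma test_zero_imp_interval_zero:
  fixes h :: "real \<Rightarrow> real"
  assumes int: "\<And>\<psi>. test_function a b \<psi> \<Longrightarrow> integrable (lebesgue_on {a<..<b}) (\<lambda>x. h x * \<psi> x)"
    and zero: "\<And>\<psi>. test_function a b \<psi> \<Longrightarrow> (LINT x|lebesgue_on {a<..<b}. h x * \<psi> x) = 0"
    and cd: "a < c" "c \<le> d" "d < b"
  shows "integrable (lebesgue_on {a<..<b}) (\<lambda>x. h x * indicator {c<..d} x)"
    and "(LINT x|lebesgue_on {a<..<b}. h x * indicator {c<..d} x) = 0"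
proof -
  define M where "M = lebesgue_on {a<..<b}"
  have Ioc: "{c<..d} \<inter> space M \<in> sets M" for c d
    unfolding M_def by (auto simp: sets_restrict_space)
  have ind [measurable]: "indicator {c<..d} \<in> borel_measurable M" for c d :: real
    unfolding M_def by (intro measurable_restrict_space1 borel_measurable_indicator) auto
  obtain k where k: "1 / real (Suc k) < min (c - a) (b - d) / 2"
    using cd nat_approx_posE [of "min (c - a) (b - d) / 2"] by auto
  define e where "e = 1 / real (Suc k)"
  have e: "e > 0" "e < (c - a) / 2" "e < (b - d) / 2" using k by (auto simp: e_def)
  \<comment> \<open>Ramps of width e: up from \<open>c - e\<close> to c, down from
    \<open>d + e\<close> to \<open>d + 2 * e\<close>, which is still below b.\<close>
  define \<psi>0 where "\<psi>0 = smooth_cutoff (real (Suc k)) (c - e) (d + e)"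
  have t0: "test_function a b \<psi>0"
  proof -
    have "d + e + e < b" using e(3) by (simp add: field_simps)
    then have "d + e + 1 / real (Suc k) < b" by (simp only: e_def)
    then show ?thesis
      unfolding \<psi>0_def using e cd by (intro smooth_cutoff_test_function) auto
  qed
  have one: "\<psi>0 x = 1" if "c < x" "x \<le> d + e" for x
  proof -
    have "c - e + 1 / real (Suc k) \<le> x" using that by (simp only: e_def)
    then show ?thesis unfolding \<psi>0_def using that by (intro smooth_cutoff_eq_1) auto
  qed
  have i0: "integrable M (\<lambda>x. h x * \<psi>0 x)" unfolding M_def by (rule int [OF t0])
  have loc: "integrable M (\<lambda>x. h x * indicator {c<..d'} x)" if "d' \<le> d + e" for d'
  proof (rule Bochner_Integration.integrable_bound [OF i0])
    have "(\<lambda>x. h x * \<psi>0 x * indicator {c<..d'} x) \<in> borel_measurable M"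
      using i0 by (intro borel_measurable_times borel_measurable_integrable ind)
    moreover have "(\<lambda>x. h x * \<psi>0 x * indicator {c<..d'} x) = (\<lambda>x. h x * indicator {c<..d'} x)"
      using one that by (auto simp: indicator_def)
    ultimately show "(\<lambda>x. h x * indicator {c<..d'} x) \<in> borel_measurable M" by simp
    show "AE x in M. norm (h x * indicator {c<..d'} x) \<le> norm (h x * \<psi>0 x)"
      using one that by (auto simp: indicator_def)
  qed
  show "integrable (lebesgue_on {a<..<b}) (\<lambda>x. h x * indicator {c<..d} x)"
    using loc [of d] e by (simp add: M_def)
  \<comment> \<open>The index shift by k keeps the falling ramp inside \<open>{d..d + e}\<close>,
    where the majorant built from \<open>\<psi>0\<close> is available.\<close>
  define \<psi> where "\<psi> n = smooth_cutoff (real (Suc (n + k))) c d" for n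
  have small: "1 / real (Suc (n + k)) \<le> e" for n by (simp add: e_def frac_le)
  have t: "test_function a b (\<psi> n)" for n
    unfolding \<psi>_def using small [of n] e cd by (intro smooth_cutoff_test_function) auto
  have lim: "(\<lambda>n. LINT x|M. h x * \<psi> n x) \<longlonglongrightarrow> (LINT x|M. h x * indicator {c<..d} x)"
  proof (rule integral_dominated_convergence)
    show "integrable M (\<lambda>x. \<bar>h x * indicator {c<..d + e} x\<bar>)" using loc [of "d + e"] by auto
    show "AE x in M. (\<lambda>n. h x * \<psi> n x) \<longlonglongrightarrow> h x * indicator {c<..d} x"
    proof (intro AE_I2 tendsto_intros)
      show "(\<lambda>n. \<psi> n x) \<longlonglongrightarrow> indicator {c<..d} x" for x
        using LIMSEQ_ignore_initial_segment [OF smooth_cutoff_tendsto [of c d x], of k] cd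
        by (simp add: \<psi>_def)
    qed
    show "AE x in M. norm (h x * \<psi> n x) \<le> \<bar>h x * indicator {c<..d + e} x\<bar>" for n
    proof (intro AE_I2)
      fix x
      show "norm (h x * \<psi> n x) \<le> \<bar>h x * indicator {c<..d + e} x\<bar>"
      proof (cases "c < x \<and> x \<le> d + e")
        case True
        then show ?thesis
          using smooth_cutoff_abs_le [of "real (Suc (n + k))" c d x]
          by (auto simp: \<psi>_def abs_mult intro!: mult_left_le)
      next
        case False
        then have "\<psi> n x = 0"
          unfolding \<psi>_def using small [of n] cd by (intro smooth_cutoff_eq_0) auto
        then show ?thesis by simp
      qed
    qed
    show "(\<lambda>x. h x * \<psi> n x) \<in> borel_measurable M" for n
      unfolding M_def by (intro borel_measurable_integrable int t)
  qed (use loc [of d] e in auto)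
  have "(\<lambda>n. LINT x|M. h x * \<psi> n x) = (\<lambda>n. 0)" unfolding M_def using zero t by auto
  with lim show "(LINT x|lebesgue_on {a<..<b}. h x * indicator {c<..d} x) = 0"
    by (simp add: M_def LIMSEQ_const_iff)
qed

text \<open>On a compact subinterval h is integrable and its integrals over subintervals vanish, so
  the criterion with rays applies there; countably many such subintervals exhaust the open
  interval.\<close>

theorem AE_zero_if_test_zero:
  fixes h :: "real \<Rightarrow> real"
  assumes int: "\<And>\<psi>. test_function a b \<psi> \<Longrightarrow> integrable (lebesgue_on {a<..<b}) (\<lambda>x. h x * \<psi> x)"
    and zero: "\<And>\<psi>. test_function a b \<psi> \<Longrightarrow> (LINT x|lebesgue_on {a<..<b}. h x * \<psi> x) = 0"
  shows "AE x in lebesgue_on {a<..<b}. h x = 0"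
proof -
  have T: "integrable (lebesgue_on {a<..<b}) (\<lambda>x. h x * indicator {c<..d} x)"
    "(LINT x|lebesgue_on {a<..<b}. h x * indicator {c<..d} x) = 0"
    if "a < c" "c \<le> d" "d < b" for c d
    by (rule test_zero_imp_interval_zero [OF _ _ that]; (rule int zero; assumption))+
  have loc: "AE x in lebesgue. x \<in> {c<..d} \<longrightarrow> h x = 0" if cd: "a < c" "c \<le> d" "d < b" for c d
  proof -
    define g where "g x = indicator {c<..d} x * h x" for x
    have eq: "(\<lambda>x. indicator {a<..<b} x *\<^sub>R (h x * indicator {c'<..d} x)) = (\<lambda>x. indicator {c'<..} x * g x)"
      if "c \<le> c'" for c'
      using that cd by (auto simp: g_def indicator_def fun_eq_iff)
    have eq': "(\<lambda>x. indicator {a<..<b} x *\<^sub>R (h x * indicator {c<..d} x)) = g"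
      using cd by (auto simp: g_def indicator_def fun_eq_iff)
    have "integrable lebesgue (\<lambda>x. indicator {a<..<b} x *\<^sub>R (h x * indicator {c<..d} x))"
      using T(1) [OF cd]
      by (subst integrable_restrict_space [symmetric]) auto
    then have g: "integrable lebesgue g" by (simp only: eq')
    have 0: "(LINT y|lebesgue. g y) = 0"
      using T(2) [OF cd]
      by (subst (asm) integral_restrict_space) (auto simp: eq' [unfolded real_scaleR_def])
    have "(LINT y|lebesgue. indicator {x<..} y * g y) = 0" for x
    proof -
      consider "x < c" | "c \<le> x" "x \<le> d" | "d < x" by linarith
      then show ?thesis
      proof cases
        case 1
        then have "(\<lambda>y. indicator {x<..} y * g y) = g" by (auto simp: g_def indicator_def fun_eq_iff)
        with 0 show ?thesis by simp
      next
        case 2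
        then show ?thesis
          using T(2) [of x d] cd
          by (subst (asm) integral_restrict_space) (auto simp: eq [unfolded real_scaleR_def])
      next
        case 3
        then have "(\<lambda>y. indicator {x<..} y * g y) = (\<lambda>y. 0)" by (auto simp: g_def indicator_def fun_eq_iff)
        then show ?thesis by simp
      qed
    qed
    from AE_zero_if_Ioi_integrals_zero [OF g 0 this] show ?thesis
      by eventually_elim (auto simp: g_def)
  qed
  have "AE x in lebesgue. \<forall>n. x \<in> {a + 1 / real (Suc n)<..b - 1 / real (Suc n)} \<longrightarrow> h x = 0"
  proof (subst AE_all_countable, intro allI)
    fix n
    show "AE x in lebesgue. x \<in> {a + 1 / real (Suc n)<..b - 1 / real (Suc n)} \<longrightarrow> h x = 0"
    proof (cases "a + 1 / real (Suc n) \<le> b - 1 / real (Suc n)")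
      case True
      then show ?thesis by (intro loc) auto
    qed auto
  qed
  then have "AE x in lebesgue. x \<in> {a<..<b} \<longrightarrow> h x = 0"
  proof eventually_elim
    case (elim x)
    show ?case
    proof
      assume x: "x \<in> {a<..<b}"
      obtain n where "1 / real (Suc n) < min (x - a) (b - x)"
        using x nat_approx_posE [of "min (x - a) (b - x)"] by auto
      then show "h x = 0" using spec [OF elim, of n] by auto
    qed
  qed
  then show ?thesis by (subst AE_restrict_space_iff) auto
qed

section \<open>Weak derivatives and primitives\<close>

lemma finite_measure_lebesgue_on_Ioo: "finite_measure (lebesgue_on {a<..<b :: real})"
  by (rule finite_measure_lebesgue_on) simp

locale interval =
  fixes L :: real
  assumes L_pos: "L > 0"
begin

abbreviation M :: "real measure" where "M \<equiv> lebesgue_on {0<..<L}"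

sublocale finite_measure M by (rule finite_measure_lebesgue_on_Ioo)

lemma measure_M [simp]: "measure M (space M) = L"
  using L_pos by (simp add: measure_restrict_space)

lemma integral_const_M: "(LINT x|M. c) = c * L" for c :: real
  using measure_M by simp

lemma borel_sets_M: "A \<in> sets borel \<Longrightarrow> A \<inter> {0<..<L} \<in> sets M"
  by (auto simp: sets_restrict_space)

lemma indicator_measurable_M:
  "A \<in> sets borel \<Longrightarrow> indicator A \<in> borel_measurable M"
  by (intro measurable_restrict_space1 borel_measurable_indicator) auto

lemma continuous_measurable_M:
  "continuous_on {0..L} f \<Longrightarrow> (f :: real \<Rightarrow> real) \<in> borel_measurable M"
  by (rule continuous_imp_measurable_on_sets_lebesgue) (auto intro: continuous_on_subset)

lemma continuous_bounded_M:
  fixes f :: "real \<Rightarrow> real"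
  assumes "continuous_on {0..L} f"
  obtains B where "B \<ge> 0" "\<And>x. x \<in> {0..L} \<Longrightarrow> \<bar>f x\<bar> \<le> B"
proof -
  have "bounded (f ` {0..L})"
    by (intro compact_imp_bounded compact_continuous_image assms) auto
  then obtain B where "\<forall>y\<in>f ` {0..L}. norm y \<le> B" by (auto simp: bounded_iff)
  then show ?thesis by (intro that [of "max B 0"]) (auto simp: max.coboundedI1)
qed

lemma continuous_sq_int_M: "continuous_on {0..L} f \<Longrightarrow> sq_int M f"
proof -
  assume f: "continuous_on {0..L} f"
  obtain B where B: "\<And>x. x \<in> {0..L} \<Longrightarrow> \<bar>f x\<bar> \<le> B" using continuous_bounded_M [OF f] by metis
  show ?thesis
    by (rule sq_int_bounded [of f B]) (use B f in \<open>auto intro!: AE_I2 continuous_measurable_M\<close>)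
qed

lemma continuous_integrable_M: "continuous_on {0..L} f \<Longrightarrow> integrable M (f :: real \<Rightarrow> real)"
  by (rule sq_int_imp_integrable [OF continuous_sq_int_M])

lemma AE_M_iff: "(AE x in M. P x) \<longleftrightarrow> (AE x in lebesgue. x \<in> {0<..<L} \<longrightarrow> P x)"
  by (subst AE_restrict_space_iff) auto

lemma AE_neq_M: "AE x in M. x \<noteq> c"
proof -
  have "AE x in lebesgue. x \<notin> {c}" by (rule AE_not_in) (simp add: null_sets_completionI)
  then show ?thesis unfolding AE_M_iff by eventually_elim auto
qed

lemma integral_M_eq:
  "(LINT x|M. f x) = (LINT x|lebesgue. indicator {0<..<L} x * f x)" for f :: "real \<Rightarrow> real"
  by (subst integral_restrict_space) auto

lemma integrable_M_iff:
  "integrable M f \<longleftrightarrow> integrable lebesgue (\<lambda>x. indicator {0<..<L} x * f x)" for f :: "real \<Rightarrow> real"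
  by (subst integrable_restrict_space) auto

lemma integral_M_continuous:
  fixes f :: "real \<Rightarrow> real"
  assumes f: "continuous_on {a..b} f" and ab: "0 \<le> a" "b \<le> L"
  shows "(LINT x|M. indicator {a..b} x * f x) = integral {a..b} f"
proof -
  have int: "set_integrable lebesgue {a..b} f"
    by (rule absolutely_integrable_continuous_real [OF f])
  have neq: "AE x in lebesgue. x \<notin> {0, L}" by (rule AE_not_in) (simp add: null_sets_completionI)
  have m1: "(\<lambda>x. indicator {a..b} x * f x) \<in> borel_measurable lebesgue"
    using int by (auto simp: set_integrable_def)
  have "(LINT x|M. indicator {a..b} x * f x) = (LINT x|lebesgue. indicator {0<..<L} x * (indicator {a..b} x * f x))"
    by (rule integral_M_eq)
  also have "\<dots> = (LINT x|lebesgue. indicator {a..b} x * f x)"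
  proof (rule integral_cong_AE)
    show "AE x in lebesgue. indicator {0<..<L} x * (indicator {a..b} x * f x) = indicator {a..b} x * f x"
      using neq by eventually_elim (use ab in \<open>auto simp: indicator_def\<close>)
    show "(\<lambda>x. indicator {0<..<L} x * (indicator {a..b} x * f x)) \<in> borel_measurable lebesgue"
      by (intro borel_measurable_times m1 borel_measurable_indicator) auto
  qed (rule m1)
  also have "\<dots> = integral {a..b} f"
    using set_lebesgue_integral_eq_integral(2) [OF int] by (simp add: set_lebesgue_integral_def)
  finally show ?thesis .
qed

lemma integral_M_FTC:
  fixes f :: "real \<Rightarrow> real"
  assumes f: "\<And>x. (f has_real_derivative f' x) (at x)" and f': "continuous_on UNIV f'"
    and ab: "0 \<le> a" "a \<le> b" "b \<le> L"
  shows "(LINT x|M. indicator {a..b} x * f' x) = f b - f a"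
proof -
  have "(f' has_integral f b - f a) {a..b}"
    using ab f by (intro fundamental_theorem_of_calculus)
      (auto simp: has_real_derivative_iff_has_vector_derivative [symmetric] intro: has_field_derivative_at_within)
  moreover have "(LINT x|M. indicator {a..b} x * f' x) = integral {a..b} f'"
    using ab by (intro integral_M_continuous continuous_on_subset [OF f']) auto
  ultimately show ?thesis by (simp add: integral_unique)
qed

text \<open>Absolute continuity on the closed interval with derivative g, expressed as an integral
  identity. The indicator keeps every integral over the one measure M, and the form survives limits
  in which only g converges in the mean.\<close>

definition prim_on :: "(real \<Rightarrow> real) \<Rightarrow> (real \<Rightarrow> real) \<Rightarrow> bool" where
  "prim_on u g \<longleftrightarrow> integrable M g \<and> (\<forall>x\<in>{0..L}. u x = u 0 + (LINT s|M. indicator {..x} s * g s))"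

lemma prim_onD: "prim_on u g \<Longrightarrow> x \<in> {0..L} \<Longrightarrow> u x = u 0 + (LINT s|M. indicator {..x} s * g s)"
  unfolding prim_on_def by blast

lemma prim_on_integrable: "prim_on u g \<Longrightarrow> integrable M g"
  unfolding prim_on_def by blast

lemma integrable_indicator_mult:
  fixes g :: "real \<Rightarrow> real"
  assumes "integrable M g" "A \<in> sets borel"
  shows "integrable M (\<lambda>s. indicator A s * g s)"
proof (rule Bochner_Integration.integrable_bound [OF assms(1)])
  show "(\<lambda>s. indicator A s * g s) \<in> borel_measurable M"
    by (rule borel_measurable_times
        [OF indicator_measurable_M [OF assms(2)] borel_measurable_integrable [OF assms(1)]])
  show "AE s in M. norm (indicator A s * g s) \<le> norm (g s)"
    by (intro AE_I2) (simp add: indicator_def)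
qed

lemma prim_on_diff_eq:
  assumes "prim_on u g" "0 \<le> x" "x \<le> y" "y \<le> L"
  shows "u y - u x = (LINT s|M. indicator {x<..y} s * g s)"
proof -
  have g: "integrable M g" using assms(1) by (rule prim_on_integrable)
  have "u y - u x = (LINT s|M. indicator {..y} s * g s) - (LINT s|M. indicator {..x} s * g s)"
    using prim_onD [OF assms(1), of x] prim_onD [OF assms(1), of y] assms(2-4) by auto
  also have "\<dots> = (LINT s|M. indicator {..y} s * g s - indicator {..x} s * g s)"
    using g by (intro Bochner_Integration.integral_diff [symmetric] integrable_indicator_mult) auto
  also have "\<dots> = (LINT s|M. indicator {x<..y} s * g s)"
    using assms by (intro Bochner_Integration.integral_cong) (auto simp: indicator_def)
  finally show ?thesis .
qed

lemma prim_on_diff_le: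
  assumes "prim_on u g" "x \<in> {0..L}" "y \<in> {0..L}"
  shows "\<bar>u y - u x\<bar> \<le> (LINT s|M. \<bar>g s\<bar>)"
proof -
  have g: "integrable M g" using assms(1) by (rule prim_on_integrable)
  have *: "\<bar>u y - u x\<bar> \<le> (LINT s|M. \<bar>g s\<bar>)" if "0 \<le> x" "x \<le> y" "y \<le> L" for x y
  proof -
    have "\<bar>u y - u x\<bar> \<le> (LINT s|M. \<bar>indicator {x<..y} s * g s\<bar>)"
      unfolding prim_on_diff_eq [OF assms(1) that] by (rule integral_abs_bound)
    also have "\<dots> \<le> (LINT s|M. \<bar>g s\<bar>)"
      using g by (intro integral_mono integrable_abs integrable_indicator_mult) (auto simp: indicator_def)
    finally show ?thesis .
  qed
  show ?thesis using *[of x y] *[of y x] assms by (cases "x \<le> y") auto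
qed

lemma continuous_on_primitive:
  assumes g: "integrable M g"
  shows "continuous_on {0..L} (\<lambda>x. LINT s|M. indicator {..x} s * (g s :: real))"
  unfolding continuous_on_sequentially comp_def
proof (intro allI ballI impI)
  fix X :: "nat \<Rightarrow> real" and x
  assume X: "x \<in> {0..L}" "(\<forall>n. X n \<in> {0..L}) \<and> X \<longlonglongrightarrow> x"
  show "(\<lambda>n. LINT s|M. indicator {..X n} s * g s) \<longlonglongrightarrow> (LINT s|M. indicator {..x} s * g s)"
  proof (rule integral_dominated_convergence)
    show "integrable M (\<lambda>s. \<bar>g s\<bar>)" using g by auto
    show "AE s in M. (\<lambda>n. indicator {..X n} s * g s) \<longlonglongrightarrow> indicator {..x} s * g s"
      using AE_neq_M [of x]
    proof eventually_elim
      case (elim s)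
      have "\<forall>\<^sub>F n in sequentially. indicator {..X n} s * g s = indicator {..x} s * g s"
      proof (cases "s < x")
        case True
        then have "\<forall>\<^sub>F n in sequentially. s < X n" using X by (intro order_tendstoD) auto
        then show ?thesis by eventually_elim (use True in \<open>auto simp: indicator_def\<close>)
      next
        case False
        then have "x < s" using elim by simp
        then have "\<forall>\<^sub>F n in sequentially. X n < s" using X by (intro order_tendstoD) auto
        then show ?thesis by eventually_elim (use \<open>x < s\<close> in \<open>auto simp: indicator_def\<close>)
      qed
      then show ?case by (rule tendsto_eventually)
    qed
    show "(\<lambda>s. indicator {..x} s * g s) \<in> borel_measurable M" for x
      by (intro borel_measurable_integrable integrable_indicator_mult g) auto
    then show "(\<lambda>s. indicator {..X n} s * g s) \<in> borel_measurable M" for n .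
  qed (auto simp: indicator_def)
qed

lemma prim_on_continuous:
  assumes "prim_on u g"
  shows "continuous_on {0..L} u"
proof -
  have "continuous_on {0..L} (\<lambda>x. u 0 + (LINT s|M. indicator {..x} s * g s))"
    by (intro continuous_intros continuous_on_primitive prim_on_integrable [OF assms])
  then show ?thesis
    by (rule continuous_on_eq) (rule prim_onD [OF assms, symmetric])
qed

lemma locally_integrable_of_integrable:
  assumes "integrable M f"
  shows "locally_integrable 0 L f"
  unfolding locally_integrable_def
proof (intro allI impI)
  fix K assume K: "compact K \<and> K \<subseteq> {0<..<L}"
  then have "integrable M (\<lambda>x. indicator K x * f x)"
    using assms by (intro integrable_indicator_mult) (auto intro: borel_compact)
  then have "integrable lebesgue (\<lambda>x. indicator {0<..<L} x * (indicator K x * f x))"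
    by (simp add: integrable_M_iff)
  moreover have "(\<lambda>x. indicator {0<..<L} x * (indicator K x * f x)) = (\<lambda>x. indicator K x *\<^sub>R f x)"
    using K by (auto simp: indicator_def fun_eq_iff)
  ultimately have "integrable lebesgue (\<lambda>x. indicator K x *\<^sub>R f x)" by simp
  moreover have "K \<in> sets borel" using K by (auto intro: borel_compact)
  then have "K \<in> sets lebesgue" by auto
  ultimately show "integrable (lebesgue_on K) f"
    by (subst integrable_restrict_space) auto
qed

lemma test_function_0:
  assumes "test_function a b \<psi>" "x \<le> a \<or> b \<le> x"
  shows "\<psi> x = 0"
  using assms by (auto simp: test_function_iff)

lemma test_function_deriv_cont:
  assumes "test_function a b \<psi>"
  shows "(\<psi> has_real_derivative deriv \<psi> x) (at x)" "continuous_on A (deriv \<psi>)" "continuous_on A \<psi>"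
  using assms by (auto simp: test_function_iff smooth_fun_DERIV
      intro: smooth_fun_continuous_on smooth_fun_deriv)

text \<open>Integration by parts through Fubini on the triangle \<open>s \<le> x\<close>. The test
  function vanishes at both ends: this removes the contribution of \<open>u 0\<close> and leaves
  \<open>- \<psi> s\<close> as the inner integral.\<close>

theorem prim_on_has_weak_deriv:
  assumes u: "prim_on u g"
  shows "has_weak_deriv 0 L u g"
  unfolding has_weak_deriv_def
proof (intro conjI allI impI)
  have g: "integrable M g" using u by (rule prim_on_integrable)
  show "locally_integrable 0 L g" by (rule locally_integrable_of_integrable [OF g])
  show "locally_integrable 0 L u"
    by (intro locally_integrable_of_integrable continuous_integrable_M prim_on_continuous [OF u])
  fix \<psi> assume \<psi>: "test_function 0 L \<psi>"
  note d\<psi> = test_function_deriv_cont [OF \<psi>]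
  have FTC: "(LINT x|M. indicator {s..L} x * deriv \<psi> x) = - \<psi> s" if "0 \<le> s" "s \<le> L" for s
    using integral_M_FTC [OF d\<psi>(1,2) that order_refl] test_function_0 [OF \<psi>, of L] by simp
  have d_int: "integrable M (deriv \<psi>)" by (rule continuous_integrable_M [OF d\<psi>(2)])
  have "(LINT x|M. deriv \<psi> x) = (LINT x|M. indicator {0..L} x * deriv \<psi> x)"
    by (intro Bochner_Integration.integral_cong) (auto simp: indicator_def)
  then have 0: "(LINT x|M. deriv \<psi> x) = 0"
    using FTC [of 0] test_function_0 [OF \<psi>, of 0] L_pos by simp
  interpret P: pair_sigma_finite M M
    by (intro pair_sigma_finite.intro sigma_finite_measure_axioms)
  obtain B where B: "B \<ge> 0" "\<And>x. x \<in> {0..L} \<Longrightarrow> \<bar>deriv \<psi> x\<bar> \<le> B"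
    using continuous_bounded_M [OF d\<psi>(2)] by metis
  define k where "k x s = indicator {..x} s * g s * deriv \<psi> x" for x s
  have g_meas [measurable]: "g \<in> borel_measurable M" using g by simp
  have d_meas [measurable]: "deriv \<psi> \<in> borel_measurable M" using d_int by simp
  have id_meas [measurable]: "(\<lambda>x. x) \<in> borel_measurable M"
    by (rule continuous_measurable_M) auto
  have k_eq: "k x s = (if s \<le> x then g s * deriv \<psi> x else 0)" for x s
    by (simp add: k_def indicator_def)
  have k_meas [measurable]: "(\<lambda>(x, s). k x s) \<in> borel_measurable (M \<Otimes>\<^sub>M M)"
    unfolding k_eq by measurable
  have k_bd: "\<bar>k x s\<bar> \<le> B * \<bar>g s\<bar>" if "x \<in> space M" for x s
  proof -
    have "\<bar>deriv \<psi> x\<bar> * \<bar>g s\<bar> \<le> B * \<bar>g s\<bar>"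
      using B that by (intro mult_right_mono) auto
    then show ?thesis using B(1) by (auto simp: k_eq abs_mult mult.commute)
  qed
  have k_s: "integrable M (k x)" if "x \<in> space M" for x
  proof (rule Bochner_Integration.integrable_bound)
    show "integrable M (\<lambda>s. B * \<bar>g s\<bar>)" using g by auto
    show "AE s in M. norm (k x s) \<le> norm (B * \<bar>g s\<bar>)"
      using k_bd [OF that] B by simp
    show "k x \<in> borel_measurable M" unfolding k_eq by measurable
  qed
  have "integrable (M \<Otimes>\<^sub>M M) (\<lambda>(x, s). k x s)"
  proof (rule P.Fubini_integrable)
    show "integrable M (\<lambda>x. LINT s|M. norm ((\<lambda>(x, s). k x s) (x, s)))"
    proof (rule Bochner_Integration.integrable_bound)
      show "integrable M (\<lambda>x. LINT s|M. B * \<bar>g s\<bar>)" by simp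
      show "AE x in M. norm (LINT s|M. norm ((\<lambda>(x, s). k x s) (x, s))) \<le> norm (LINT s|M. B * \<bar>g s\<bar>)"
      proof (rule AE_I2)
        fix x assume x: "x \<in> space M"
        have "(LINT s|M. \<bar>k x s\<bar>) \<le> (LINT s|M. B * \<bar>g s\<bar>)"
          using k_s [OF x] g k_bd [OF x] by (intro integral_mono) auto
        moreover have "0 \<le> (LINT s|M. \<bar>k x s\<bar>)" by simp
        ultimately show "norm (LINT s|M. norm ((\<lambda>(x, s). k x s) (x, s))) \<le> norm (LINT s|M. B * \<bar>g s\<bar>)"
          by simp
      qed
    qed measurable
    show "AE x in M. integrable M (\<lambda>s. (\<lambda>(x, s). k x s) (x, s))"
      using k_s by (intro AE_I2) simp
  qed measurable
  from P.Fubini_integral [OF this]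
  have Fub: "(LINT s|M. LINT x|M. k x s) = (LINT x|M. LINT s|M. k x s)" by simp
  have "(LINT x|M. u x * deriv \<psi> x) = (LINT x|M. u 0 * deriv \<psi> x + (LINT s|M. k x s))"
  proof (rule Bochner_Integration.integral_cong [OF refl])
    fix x assume "x \<in> space M"
    then have "u x = u 0 + (LINT s|M. indicator {..x} s * g s)" by (intro prim_onD [OF u]) simp
    then show "u x * deriv \<psi> x = u 0 * deriv \<psi> x + (LINT s|M. k x s)"
      by (simp add: k_def distrib_right)
  qed
  also have "\<dots> = u 0 * (LINT x|M. deriv \<psi> x) + (LINT x|M. LINT s|M. k x s)"
  proof (subst Bochner_Integration.integral_add)
    have "continuous_on {0..L} (\<lambda>x. LINT s|M. indicator {..x} s * g s)"
      by (rule continuous_on_primitive [OF g])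
    then have "integrable M (\<lambda>x. (LINT s|M. indicator {..x} s * g s) * deriv \<psi> x)"
      by (intro continuous_integrable_M continuous_intros d\<psi>)
    then show "integrable M (\<lambda>x. LINT s|M. k x s)" by (simp add: k_def)
  qed (use d_int in auto)
  also have "\<dots> = (LINT s|M. LINT x|M. k x s)" using Fub 0 by simp
  also have "\<dots> = (LINT s|M. - (g s * \<psi> s))"
  proof (rule Bochner_Integration.integral_cong [OF refl])
    fix s assume s: "s \<in> space M"
    have "(LINT x|M. k x s) = (LINT x|M. g s * (indicator {s..L} x * deriv \<psi> x))"
      by (intro Bochner_Integration.integral_cong) (auto simp: k_eq indicator_def)
    also have "\<dots> = g s * (LINT x|M. indicator {s..L} x * deriv \<psi> x)" by simp
    also have "\<dots> = - (g s * \<psi> s)" using FTC [of s] s by simp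
    finally show "(LINT x|M. k x s) = - (g s * \<psi> s)" .
  qed
  also have "\<dots> = - (LINT s|M. g s * \<psi> s)" by simp
  finally show "(LINT x|M. u x * deriv \<psi> x) = - (LINT s|M. g s * \<psi> s)" .
qed

text \<open>The kernels form a Dirac sequence: nonnegative, of mass 1 once their support fits into
  the interval, and supported in \<open>{c..c + 1 / real (Suc n)}\<close>.\<close>

lemma smooth_kernel_tendsto:
  assumes f: "continuous_on {0..L} f" and c: "0 < c" "c < L"
  shows "(\<lambda>n. LINT x|M. f x * (real (Suc n) * smooth_step' (real (Suc n) * (x - c)))) \<longlonglongrightarrow> f c"
proof -
  define \<kappa> where "\<kappa> n x = real (Suc n) * smooth_step' (real (Suc n) * (x - c))" for n x
  have \<kappa>_nonneg: "\<kappa> n x \<ge> 0" for n x by (simp add: \<kappa>_def smooth_step'_nonneg)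
  have \<kappa>_cont: "continuous_on A (\<kappa> n)" for n A
    unfolding \<kappa>_def by (intro continuous_intros continuous_on_compose2 [OF smooth_step'_cont]) auto
  have \<kappa>_DERIV: "((\<lambda>x. smooth_step (real (Suc n) * (x - c))) has_real_derivative \<kappa> n x) (at x)" for n x
  proof -
    have "((\<lambda>x. smooth_step (real (Suc n) * (x - c))) has_real_derivative
        smooth_step' (real (Suc n) * (x - c)) * real (Suc n)) (at x)"
      by (rule DERIV_chain2 [OF smooth_step_DERIV]) (auto intro!: derivative_eq_intros)
    then show ?thesis by (simp add: \<kappa>_def mult.commute)
  qed
  have \<kappa>_int: "integrable M (\<kappa> n)" for n by (rule continuous_integrable_M [OF \<kappa>_cont])
  have \<kappa>_1: "(LINT x|M. \<kappa> n x) = 1" if n: "1 / real (Suc n) < L - c" for n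
  proof -
    have "(LINT x|M. \<kappa> n x) = (LINT x|M. indicator {0..L} x * \<kappa> n x)"
      by (intro Bochner_Integration.integral_cong) (auto simp: indicator_def)
    also have "\<dots> = smooth_step (real (Suc n) * (L - c)) - smooth_step (real (Suc n) * (0 - c))"
      using L_pos by (intro integral_M_FTC [OF \<kappa>_DERIV \<kappa>_cont]) auto
    also have "smooth_step (real (Suc n) * (0 - c)) = 0"
      using c by (intro smooth_step_0 mult_nonneg_nonpos) auto
    also have "smooth_step (real (Suc n) * (L - c)) = 1"
    proof (rule smooth_step_1)
      have "real (Suc n) * (1 / real (Suc n)) \<le> real (Suc n) * (L - c)"
        using n by (intro mult_left_mono) auto
      then show "1 \<le> real (Suc n) * (L - c)" by simp
    qed
    finally show ?thesis by simp
  qed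
  have \<kappa>_supp: "x \<in> {c..c + 1 / real (Suc n)}" if "\<kappa> n x \<noteq> 0" for n x
  proof -
    have "\<not> (real (Suc n) * (x - c) < 0 \<or> real (Suc n) * (x - c) > 1)"
      using that smooth_step'_eq_0 [of "real (Suc n) * (x - c)"] by (auto simp: \<kappa>_def)
    then have "0 \<le> real (Suc n) * (x - c)" "real (Suc n) * (x - c) \<le> 1" by linarith+
    then have "0 \<le> x - c" "x - c \<le> 1 / real (Suc n)"
      by (simp_all only: zero_le_mult_iff pos_le_divide_eq of_nat_0_less_iff zero_less_Suc mult.commute) auto
    then show ?thesis by auto
  qed
  have "(\<lambda>n. LINT x|M. f x * \<kappa> n x) \<longlonglongrightarrow> f c"
  proof (rule LIMSEQ_I)
    fix e :: real assume e: "e > 0"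
    obtain d where d: "d > 0" "\<And>x. x \<in> {0..L} \<Longrightarrow> \<bar>x - c\<bar> < d \<Longrightarrow> \<bar>f x - f c\<bar> < e / 2"
      using f c e unfolding continuous_on_iff dist_real_def
      by (metis atLeastAtMost_iff half_gt_zero less_eq_real_def)
    obtain N where N: "1 / real (Suc N) < min d (L - c)"
      using d c nat_approx_posE [of "min d (L - c)"] by auto
    show "\<exists>no. \<forall>n\<ge>no. norm ((LINT x|M. f x * \<kappa> n x) - f c) < e"
    proof (intro exI allI impI)
      fix n assume "n \<ge> N"
      then have "1 / real (Suc n) \<le> 1 / real (Suc N)" by (simp add: frac_le)
      then have n: "1 / real (Suc n) < d" "1 / real (Suc n) < L - c" using N by linarith+
      have int: "integrable M (\<lambda>x. f x * \<kappa> n x)" "integrable M (\<lambda>x. f c * \<kappa> n x)"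
        by (intro continuous_integrable_M continuous_intros f \<kappa>_cont)+
      have "(LINT x|M. f x * \<kappa> n x) - f c = (LINT x|M. f x * \<kappa> n x) - (LINT x|M. f c * \<kappa> n x)"
        using \<kappa>_1 [OF n(2)] by simp
      also have "\<dots> = (LINT x|M. f x * \<kappa> n x - f c * \<kappa> n x)"
        using int by (rule Bochner_Integration.integral_diff [symmetric])
      finally have "\<bar>(LINT x|M. f x * \<kappa> n x) - f c\<bar> \<le> (LINT x|M. \<bar>f x * \<kappa> n x - f c * \<kappa> n x\<bar>)"
        by (simp add: integral_abs_bound)
      also have "\<dots> \<le> (LINT x|M. e / 2 * \<kappa> n x)"
      proof (rule integral_mono)
        show "integrable M (\<lambda>x. \<bar>f x * \<kappa> n x - f c * \<kappa> n x\<bar>)" using int by auto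
        show "integrable M (\<lambda>x. e / 2 * \<kappa> n x)" using \<kappa>_int by auto
        fix x assume x: "x \<in> space M"
        show "\<bar>f x * \<kappa> n x - f c * \<kappa> n x\<bar> \<le> e / 2 * \<kappa> n x"
        proof (cases "\<kappa> n x = 0")
          case False
          have "\<bar>x - c\<bar> < d" using \<kappa>_supp [OF False] n by auto
          moreover have "x \<in> {0..L}" using x by simp
          ultimately have "\<bar>f x - f c\<bar> \<le> e / 2" using d(2) [of x] by simp
          then have "\<bar>f x - f c\<bar> * \<kappa> n x \<le> e / 2 * \<kappa> n x" using \<kappa>_nonneg by (intro mult_right_mono) auto
          then show ?thesis using \<kappa>_nonneg [of n x] by (simp add: abs_mult flip: left_diff_distrib)
        qed simp
      qed
      also have "\<dots> = e / 2" using \<kappa>_1 [OF n(2)] by simp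
      finally show "norm ((LINT x|M. f x * \<kappa> n x) - f c) < e" using e by simp
    qed
  qed
  then show ?thesis by (simp add: \<kappa>_def)
qed

text \<open>Testing with \<open>smooth_cutoff\<close> at c and d lets the left side tend to
  \<open>f c - f d\<close>, since its derivative is a difference of Dirac kernels, and the right
  side to minus the integral of g over \<open>{c<..d}\<close>. Continuity of f gives these point
  values their meaning and carries the identity to the end points.\<close>

theorem weak_deriv_imp_prim_on:
  assumes f: "continuous_on {0..L} f" and w: "has_weak_deriv 0 L f g" and g: "integrable M g"
  shows "prim_on f g"
proof -
  have inner: "f d - f c = (LINT s|M. indicator {c<..d} s * g s)" if cd: "0 < c" "c \<le> d" "d < L" for c d
  proof -
    define \<psi> where "\<psi> n = smooth_cutoff (real (Suc n)) c d" for n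
    define \<kappa> where "\<kappa> c n x = real (Suc n) * smooth_step' (real (Suc n) * (x - c))" for c n x
    have deriv: "deriv (\<psi> n) x = \<kappa> c n x - \<kappa> d n x" for n x
      unfolding \<psi>_def \<kappa>_def by (rule DERIV_imp_deriv [OF smooth_cutoff_DERIV])
    have \<kappa>_int: "integrable M (\<lambda>x. f x * \<kappa> c n x)" for c n
      unfolding \<kappa>_def
      by (intro continuous_integrable_M continuous_intros f continuous_on_compose2 [OF smooth_step'_cont]) auto
    have lhs: "(\<lambda>n. LINT x|M. f x * deriv (\<psi> n) x) \<longlonglongrightarrow> f c - f d"
    proof -
      have "(LINT x|M. f x * deriv (\<psi> n) x) = (LINT x|M. f x * \<kappa> c n x) - (LINT x|M. f x * \<kappa> d n x)" for n
        using \<kappa>_int by (simp add: deriv right_diff_distrib)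
      moreover have "(\<lambda>n. (LINT x|M. f x * \<kappa> c n x) - (LINT x|M. f x * \<kappa> d n x)) \<longlonglongrightarrow> f c - f d"
        unfolding \<kappa>_def using cd by (intro tendsto_diff smooth_kernel_tendsto f) auto
      ultimately show ?thesis by simp
    qed
    obtain k where k: "1 / real (Suc k) < L - d" using cd nat_approx_posE [of "L - d"] by auto
    have test: "test_function 0 L (\<psi> n)" if "n \<ge> k" for n
    proof -
      have "1 / real (Suc n) \<le> 1 / real (Suc k)" using that by (simp add: frac_le)
      then have "d + 1 / real (Suc n) < L" using k by linarith
      then show ?thesis unfolding \<psi>_def using cd by (intro smooth_cutoff_test_function) auto
    qed
    have rhs: "(\<lambda>n. LINT x|M. g x * \<psi> n x) \<longlonglongrightarrow> (LINT x|M. g x * indicator {c<..d} x)"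
    proof (rule integral_dominated_convergence)
      show "integrable M (\<lambda>x. \<bar>g x\<bar>)" using g by auto
      show "AE x in M. (\<lambda>n. g x * \<psi> n x) \<longlonglongrightarrow> g x * indicator {c<..d} x"
        unfolding \<psi>_def using cd by (intro AE_I2 tendsto_intros smooth_cutoff_tendsto) auto
      show "AE x in M. norm (g x * \<psi> n x) \<le> \<bar>g x\<bar>" for n
        using smooth_cutoff_abs_le by (intro AE_I2) (auto simp: \<psi>_def abs_mult intro!: mult_left_le)
      have "continuous_on UNIV (\<psi> n)" for n
        unfolding \<psi>_def by (rule DERIV_continuous_on) (rule has_field_derivative_at_within [OF smooth_cutoff_DERIV])
      then show "(\<lambda>x. g x * \<psi> n x) \<in> borel_measurable M" for n
        using g by (intro borel_measurable_times continuous_measurable_M borel_measurable_integrable)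
          (auto intro: continuous_on_subset)
      show "(\<lambda>x. g x * indicator {c<..d} x) \<in> borel_measurable M"
        using g by (intro borel_measurable_times indicator_measurable_M borel_measurable_integrable) auto
    qed
    have "\<forall>\<^sub>F n in sequentially. (LINT x|M. f x * deriv (\<psi> n) x) = - (LINT x|M. g x * \<psi> n x)"
      using w test unfolding has_weak_deriv_def eventually_sequentially by blast
    then have "(\<lambda>n. - (LINT x|M. g x * \<psi> n x)) \<longlonglongrightarrow> f c - f d"
      using lhs by (rule Lim_transform_eventually [rotated])
    from LIMSEQ_unique [OF this tendsto_minus [OF rhs]] show ?thesis
      by (simp add: mult.commute)
  qed
  define F where "F x = f x - (LINT s|M. indicator {..x} s * g s)" for x
  have F_cont: "continuous_on {0..L} F"
    unfolding F_def by (intro continuous_intros f continuous_on_primitive g)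
  have F_eq: "F c = F d" if cd: "0 < c" "c \<le> d" "d < L" for c d
  proof -
    have "(LINT s|M. indicator {..d} s * g s) - (LINT s|M. indicator {..c} s * g s) =
        (LINT s|M. indicator {..d} s * g s - indicator {..c} s * g s)"
      using g by (intro Bochner_Integration.integral_diff [symmetric] integrable_indicator_mult) auto
    also have "\<dots> = (LINT s|M. indicator {c<..d} s * g s)"
      using cd by (intro Bochner_Integration.integral_cong) (auto simp: indicator_def)
    finally show ?thesis using inner [OF cd] by (simp add: F_def)
  qed
  have cl: "closure {0<..<L} = {0..L}" using L_pos by simp
  have F_const: "F x = F (L / 2)" if "x \<in> {0..L}" for x
  proof (rule continuous_constant_on_closure [of "{0<..<L}" F])
    show "F y = F (L / 2)" if "y \<in> {0<..<L}" for y
      using F_eq [of y "L / 2"] F_eq [of "L / 2" y] that L_pos by (cases "y \<le> L / 2") auto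
  qed (use F_cont cl that in auto)
  have "(LINT s|M. indicator {..0} s * g s) = (LINT s|M. 0)"
    by (intro Bochner_Integration.integral_cong) (auto simp: indicator_def)
  then have "F 0 = f 0" by (simp add: F_def)
  then have "f x = f 0 + (LINT s|M. indicator {..x} s * g s)" if "x \<in> {0..L}" for x
    using F_const [OF that] F_const [of 0] L_pos by (simp add: F_def)
  with g show ?thesis unfolding prim_on_def by blast
qed

end

section \<open>Uniqueness of the weak derivative\<close>

lemma has_weak_deriv_unique:
  assumes g: "has_weak_deriv a b f g" and h: "has_weak_deriv a b f h"
  shows "AE x in lebesgue_on {a<..<b}. g x = h x"
proof -
  have int: "integrable (lebesgue_on {a<..<b}) (\<lambda>x. k x * \<psi> x)"
    if k: "locally_integrable a b k" and \<psi>: "test_function a b \<psi>" for k \<psi>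
  proof -
    obtain K where K: "compact K" "K \<subseteq> {a<..<b}" "\<And>x. x \<notin> K \<Longrightarrow> \<psi> x = 0"
      using \<psi> by (auto simp: test_function_iff)
    have K_sets: "K \<in> sets lebesgue"
    proof -
      have "K \<in> sets borel" using K by (intro borel_compact)
      then show ?thesis by auto
    qed
    have "integrable (lebesgue_on K) k" using k K by (auto simp: locally_integrable_def)
    then have kK: "integrable lebesgue (\<lambda>x. indicator K x * k x)"
      using K_sets by (subst (asm) integrable_restrict_space) auto
    have \<psi>_cont: "continuous_on UNIV \<psi>"
      using \<psi> by (auto simp: test_function_iff intro: smooth_fun_continuous_on)
    have "bounded (\<psi> ` K)"
      using K \<psi>_cont by (intro compact_imp_bounded compact_continuous_image) (auto intro: continuous_on_subset)
    then obtain B where "\<forall>y\<in>\<psi> ` K. norm y \<le> B" unfolding bounded_iff by blast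
    then have B: "\<bar>\<psi> x\<bar> \<le> B" if "x \<in> K" for x using that by simp
    have "integrable lebesgue (\<lambda>x. indicator K x * k x * \<psi> x)"
    proof (rule Bochner_Integration.integrable_bound)
      show "integrable lebesgue (\<lambda>x. B * (indicator K x * k x))" using kK by auto
      have "\<psi> \<in> borel_measurable lebesgue"
        using \<psi>_cont continuous_imp_measurable_on_sets_lebesgue [of UNIV \<psi>] by (simp add: lebesgue_on_UNIV_eq)
      then show "(\<lambda>x. indicator K x * k x * \<psi> x) \<in> borel_measurable lebesgue"
        using kK by (intro borel_measurable_times [OF borel_measurable_integrable]) auto
      show "AE x in lebesgue. norm (indicator K x * k x * \<psi> x) \<le> norm (B * (indicator K x * k x))"
      proof (rule AE_I2)
        fix x
        show "norm (indicator K x * k x * \<psi> x) \<le> norm (B * (indicator K x * k x))"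
        proof (cases "x \<in> K")
          case True
          then have "\<bar>\<psi> x\<bar> * \<bar>k x\<bar> \<le> \<bar>B\<bar> * \<bar>k x\<bar>" using B [OF True] by (intro mult_right_mono) auto
          with True show ?thesis by (simp add: abs_mult mult.commute)
        qed simp
      qed
    qed
    moreover have "(\<lambda>x. indicator K x * k x * \<psi> x) = (\<lambda>x. indicator {a<..<b} x * (k x * \<psi> x))"
      using K by (auto simp: indicator_def fun_eq_iff)
    ultimately show ?thesis by (subst integrable_restrict_space) auto
  qed
  have "AE x in lebesgue_on {a<..<b}. g x - h x = 0"
  proof (rule AE_zero_if_test_zero)
    fix \<psi> assume \<psi>: "test_function a b \<psi>"
    have 1: "integrable (lebesgue_on {a<..<b}) (\<lambda>x. g x * \<psi> x)" "integrable (lebesgue_on {a<..<b}) (\<lambda>x. h x * \<psi> x)"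
      using g h by (intro int \<psi>; simp add: has_weak_deriv_def)+
    then show "integrable (lebesgue_on {a<..<b}) (\<lambda>x. (g x - h x) * \<psi> x)"
      by (simp add: left_diff_distrib)
    have "(LINT x|lebesgue_on {a<..<b}. g x * \<psi> x) = (LINT x|lebesgue_on {a<..<b}. h x * \<psi> x)"
    proof -
      have "(LINT x|lebesgue_on {a<..<b}. f x * deriv \<psi> x) = - (LINT x|lebesgue_on {a<..<b}. g x * \<psi> x)"
        "(LINT x|lebesgue_on {a<..<b}. f x * deriv \<psi> x) = - (LINT x|lebesgue_on {a<..<b}. h x * \<psi> x)"
        using g h \<psi> unfolding has_weak_deriv_def by blast+
      then show ?thesis by linarith
    qed
    with 1 show "(LINT x|lebesgue_on {a<..<b}. (g x - h x) * \<psi> x) = 0"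
      by (simp add: left_diff_distrib)
  qed
  then show ?thesis by eventually_elim simp
qed

text \<open>The bridge from the unspecified choice inside \<open>weak_deriv\<close> to a derivative
  that is known explicitly.\<close>

lemma weak_deriv_AE_eq:
  assumes "has_weak_deriv a b f g"
  shows "AE x in lebesgue_on {a<..<b}. weak_deriv a b f x = g x"
  unfolding weak_deriv_def by (rule has_weak_deriv_unique [OF someI [of "has_weak_deriv a b f", OF assms] assms])

section \<open>First-order Taylor estimates for sine and cosine\<close>

lemma taylor1_le:
  fixes F F' :: "real \<Rightarrow> real"
  assumes F: "\<And>x. (F has_real_derivative F' x) (at x)" and lip: "\<And>x y. \<bar>F' x - F' y\<bar> \<le> \<bar>x - y\<bar>"
  shows "\<bar>F y - F x - F' x * (y - x)\<bar> \<le> (y - x)\<^sup>2"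
proof -
  have *: "\<exists>z. F y - F x = F' z * (y - x) \<and> \<bar>z - x\<bar> \<le> \<bar>y - x\<bar>"
  proof (cases x y rule: linorder_cases)
    case less
    with MVT2 [of x y F F'] F obtain z where "x < z" "z < y" "F y - F x = (y - x) * F' z" by blast
    then show ?thesis by (intro exI [of _ z]) (auto simp: algebra_simps)
  next
    case greater
    with MVT2 [of y x F F'] F obtain z where "y < z" "z < x" "F x - F y = (x - y) * F' z" by blast
    then show ?thesis by (intro exI [of _ z]) (auto simp: algebra_simps)
  qed auto
  then obtain z where z: "F y - F x = F' z * (y - x)" "\<bar>z - x\<bar> \<le> \<bar>y - x\<bar>" by blast
  then have "\<bar>F y - F x - F' x * (y - x)\<bar> = \<bar>F' z - F' x\<bar> * \<bar>y - x\<bar>"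
    by (simp add: abs_mult flip: left_diff_distrib)
  also have "\<dots> \<le> \<bar>y - x\<bar> * \<bar>y - x\<bar>"
    using lip [of z x] z by (intro mult_right_mono) auto
  finally show ?thesis by (simp add: power2_eq_square flip: abs_mult)
qed

lemma lipschitz_of_deriv_le_1:
  fixes F F' :: "real \<Rightarrow> real"
  assumes F: "\<And>x. (F has_real_derivative F' x) (at x)" and F': "\<And>x. \<bar>F' x\<bar> \<le> 1"
  shows "\<bar>F y - F x\<bar> \<le> \<bar>y - x\<bar>"
proof -
  have *: "\<bar>F y - F x\<bar> \<le> \<bar>y - x\<bar>" if xy: "x < y" for x y
  proof -
    obtain z where "F y - F x = (y - x) * F' z" using MVT2 [OF xy, of F F'] F by blast
    then show ?thesis using F' [of z] by (simp add: abs_mult mult_left_le)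
  qed
  show ?thesis using *[of x y] *[of y x] by (cases x y rule: linorder_cases) auto
qed

lemma sin_lipschitz: "\<bar>sin y - sin x\<bar> \<le> \<bar>y - x\<bar>" for x y :: real
  by (rule lipschitz_of_deriv_le_1 [where F'=cos]) (auto intro: DERIV_sin)

lemma cos_lipschitz: "\<bar>cos y - cos x\<bar> \<le> \<bar>y - x\<bar>" for x y :: real
  by (rule lipschitz_of_deriv_le_1 [where F'="\<lambda>x. - sin x"]) (auto intro: DERIV_cos)

lemma sin_taylor1: "\<bar>sin y - sin x - cos x * (y - x)\<bar> \<le> (y - x)\<^sup>2" for x y :: real
  by (rule taylor1_le) (auto intro: DERIV_sin cos_lipschitz)

lemma cos_taylor1: "\<bar>cos y - cos x + sin x * (y - x)\<bar> \<le> (y - x)\<^sup>2" for x y :: real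
  using taylor1_le [of cos "\<lambda>x. - sin x" y x] sin_lipschitz
  by (auto intro: DERIV_cos simp: abs_minus_commute)

text \<open>The increments of \<open>D\<close> over a fine partition add up to a small multiple of the bounded total
  increment of \<open>G\<close>.\<close>

lemma constant_if_increments_small:
  fixes D G :: "real \<Rightarrow> real"
  assumes x: "x \<ge> 0"
    and small: "\<And>e. e > 0 \<Longrightarrow> \<exists>d>0. \<forall>y z. 0 \<le> y \<and> y \<le> z \<and> z \<le> x \<and> z - y < d \<longrightarrow>
      \<bar>D z - D y\<bar> \<le> e * (G z - G y)"
  shows "D x = D 0"
proof -
  have "\<bar>D x - D 0\<bar> \<le> e * (G x - G 0)" if e: "e > 0" for e
  proof -
    obtain d where d: "d > 0" "\<And>y z. 0 \<le> y \<Longrightarrow> y \<le> z \<Longrightarrow> z \<le> x \<Longrightarrow> z - y < d \<Longrightarrow>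
      \<bar>D z - D y\<bar> \<le> e * (G z - G y)" using small [OF e] by blast
    obtain n :: nat where n: "x / d < real n" using reals_Archimedean2 by blast
    have n0: "real n > 0" using n x d by (meson divide_nonneg_pos le_less_trans)
    define p where "p i = real i * x / real n" for i
    have p: "0 \<le> p i" "p i \<le> p (Suc i)" "p (Suc i) - p i = x / real n" for i
      using x n0 by (auto simp: p_def field_simps)
    have pn: "p (Suc i) \<le> x" if "i < n" for i
      using that x n0 by (simp add: p_def pos_divide_le_eq mult.commute mult_left_mono)
    have xn: "x / real n < d" using n n0 d by (simp add: field_simps)
    have "D x - D 0 = D (p n) - D (p 0)" using n0 by (simp add: p_def)
    also have "\<dots> = (\<Sum>i<n. D (p (Suc i)) - D (p i))" by (rule sum_lessThan_telescope [symmetric])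
    finally have "\<bar>D x - D 0\<bar> \<le> (\<Sum>i<n. \<bar>D (p (Suc i)) - D (p i)\<bar>)" by (simp add: sum_abs)
    also have "\<dots> \<le> (\<Sum>i<n. e * (G (p (Suc i)) - G (p i)))"
      using p pn xn by (intro sum_mono d) auto
    also have "\<dots> = e * (\<Sum>i<n. G (p (Suc i)) - G (p i))" by (simp add: sum_distrib_left)
    also have "(\<Sum>i<n. G (p (Suc i)) - G (p i)) = G (p n) - G (p 0)" by (rule sum_lessThan_telescope)
    also have "\<dots> = G x - G 0" using n0 by (simp add: p_def)
    finally show ?thesis .
  qed
  \<comment> \<open>Adding 1 to the increment of G allows division by it whatever its sign or size,
    so that e can tend to 0 at once.\<close>
  then have "\<bar>D x - D 0\<bar> / (\<bar>G x - G 0\<bar> + 1) \<le> e" if "e > 0" for e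
  proof -
    have "\<bar>D x - D 0\<bar> \<le> e * (G x - G 0)" using that by fact
    also have "\<dots> \<le> e * (\<bar>G x - G 0\<bar> + 1)" using that by (intro mult_left_mono) auto
    finally show ?thesis by (simp add: pos_divide_le_eq add_nonneg_pos)
  qed
  then have "\<bar>D x - D 0\<bar> / (\<bar>G x - G 0\<bar> + 1) \<le> 0" by (rule field_le_epsilon) simp
  moreover have "\<bar>G x - G 0\<bar> + 1 > 0" by simp
  ultimately have "\<bar>D x - D 0\<bar> \<le> 0 * (\<bar>G x - G 0\<bar> + 1)" by (simp only: pos_divide_le_eq)
  then show ?thesis by simp
qed

section \<open>The chain rule for absolutely continuous functions\<close>

context interval
begin

lemma prim_on_weak_deriv:
  assumes "prim_on u g"
  shows "AE x in M. weak_deriv 0 L u x = g x"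
  by (rule weak_deriv_AE_eq [OF prim_on_has_weak_deriv [OF assms]])

lemma prim_on_linear:
  assumes u: "prim_on u g" and v: "prim_on v h"
  shows "prim_on (\<lambda>x. a * u x + b * v x) (\<lambda>x. a * g x + b * h x)"
  unfolding prim_on_def
proof (intro conjI ballI)
  have g: "integrable M g" and h: "integrable M h" using u v by (auto intro: prim_on_integrable)
  show "integrable M (\<lambda>x. a * g x + b * h x)" using g h by auto
  fix x assume x: "x \<in> {0..L}"
  have "(LINT s|M. indicator {..x} s * (a * g s + b * h s)) =
      (LINT s|M. a * (indicator {..x} s * g s) + b * (indicator {..x} s * h s))"
    by (intro Bochner_Integration.integral_cong) (auto simp: algebra_simps)
  also have "\<dots> = a * (LINT s|M. indicator {..x} s * g s) + b * (LINT s|M. indicator {..x} s * h s)"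
    using integrable_indicator_mult [OF g, of "{..x}"] integrable_indicator_mult [OF h, of "{..x}"] by simp
  finally show "a * u x + b * v x = a * u 0 + b * v 0 + (LINT s|M. indicator {..x} s * (a * g s + b * h s))"
    using prim_onD [OF u x] prim_onD [OF v x] by (simp add: algebra_simps)
qed

lemma prim_on_C1:
  assumes f: "\<And>x. (f has_real_derivative f' x) (at x)" and f': "continuous_on UNIV f'"
  shows "prim_on f f'"
  unfolding prim_on_def
proof (intro conjI ballI)
  show "integrable M f'" by (rule continuous_integrable_M) (rule continuous_on_subset [OF f'], simp)
  fix x assume x: "x \<in> {0..L}"
  have "(LINT s|M. indicator {..x} s * f' s) = (LINT s|M. indicator {0..x} s * f' s)"
    by (intro Bochner_Integration.integral_cong) (auto simp: indicator_def)
  also have "\<dots> = f x - f 0" using x by (intro integral_M_FTC f f') auto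
  finally show "f x = f 0 + (LINT s|M. indicator {..x} s * f' s)" by simp
qed

text \<open>The defect D between \<open>F (u y)\<close> and the candidate primitive is shown to be
  constant. Over a short interval both the Taylor remainder of F and the oscillation of
  \<open>F'\<close> along u are at most e times the integral of
  \<open>\<bar>g\<bar>\<close>.\<close>

theorem prim_on_chain:
  assumes u: "prim_on u g" and F: "\<And>x. (F has_real_derivative F' x) (at x)"
    and lip: "\<And>x y. \<bar>F' x - F' y\<bar> \<le> \<bar>x - y\<bar>" and F'1: "\<And>x. \<bar>F' x\<bar> \<le> 1"
  shows "prim_on (\<lambda>x. F (u x)) (\<lambda>x. F' (u x) * g x)"
  unfolding prim_on_def
proof (intro conjI ballI)
  have g: "integrable M g" using u by (rule prim_on_integrable)
  have u_cont: "continuous_on {0..L} u" using u by (rule prim_on_continuous)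
  have F'_cont: "continuous_on UNIV F'"
  proof (rule continuous_onI)
    fix x e :: real assume "e > 0"
    then show "\<exists>d>0. \<forall>x'\<in>UNIV. dist x' x < d \<longrightarrow> dist (F' x') (F' x) \<le> e"
      by (intro exI [of _ e]) (auto simp: dist_real_def intro: order_trans [OF lip])
  qed
  have F'u: "(\<lambda>x. F' (u x)) \<in> borel_measurable M"
    by (intro continuous_measurable_M continuous_on_compose2 [OF F'_cont u_cont]) auto
  show F'g: "integrable M (\<lambda>x. F' (u x) * g x)"
  proof (rule Bochner_Integration.integrable_bound [OF g])
    show "(\<lambda>x. F' (u x) * g x) \<in> borel_measurable M"
      using F'u borel_measurable_integrable [OF g] by (rule borel_measurable_times)
    show "AE x in M. norm (F' (u x) * g x) \<le> norm (g x)"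
      using F'1 by (auto simp: abs_mult intro!: mult_left_le_one_le)
  qed
  fix x assume x: "x \<in> {0..L}"
  define D where "D y = F (u y) - (LINT s|M. indicator {..y} s * (F' (u s) * g s))" for y
  \<comment> \<open>The factor 2 pays for the two error sources, Taylor remainder and oscillation of
    \<open>F'\<close>.\<close>
  define G where "G y = 2 * (LINT s|M. indicator {..y} s * \<bar>g s\<bar>)" for y
  have abs_g: "integrable M (\<lambda>s. \<bar>g s\<bar>)" using g by auto
  have incr: "(LINT s|M. indicator {..z} s * h s) - (LINT s|M. indicator {..y} s * h s) =
      (LINT s|M. indicator {y<..z} s * h s)" if h: "integrable M h" and yz: "y \<le> z" for h :: "real \<Rightarrow> real" and y z
  proof -
    have "(LINT s|M. indicator {..z} s * h s) - (LINT s|M. indicator {..y} s * h s) =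
        (LINT s|M. indicator {..z} s * h s - indicator {..y} s * h s)"
      using h by (intro Bochner_Integration.integral_diff [symmetric] integrable_indicator_mult) auto
    also have "\<dots> = (LINT s|M. indicator {y<..z} s * h s)"
      using yz by (intro Bochner_Integration.integral_cong) (auto simp: indicator_def)
    finally show ?thesis .
  qed
  have "D x = D 0"
  proof (rule constant_if_increments_small [where G=G])
    show "0 \<le> x" using x by simp
    fix e :: real assume e: "e > 0"
    have "uniformly_continuous_on {0..L} u"
      using u_cont by (intro compact_uniformly_continuous) auto
    then obtain d where d: "d > 0" "\<And>y z. y \<in> {0..L} \<Longrightarrow> z \<in> {0..L} \<Longrightarrow> \<bar>z - y\<bar> < d \<Longrightarrow> \<bar>u z - u y\<bar> < e"
      using e unfolding uniformly_continuous_on_def dist_real_def by metis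
    have "\<bar>D z - D y\<bar> \<le> e * (G z - G y)" if yz: "0 \<le> y" "y \<le> z" "z \<le> x" "z - y < d" for y z
    proof -
      have zL: "z \<le> L" using yz x by simp
      define I where "I = (LINT s|M. indicator {y<..z} s * \<bar>g s\<bar>)"
      have I_int: "integrable M (\<lambda>s. indicator {y<..z} s * \<bar>g s\<bar>)"
        using abs_g by (rule integrable_indicator_mult) simp
      have uzy: "u z - u y = (LINT s|M. indicator {y<..z} s * g s)"
        using yz zL by (intro prim_on_diff_eq [OF u]) auto
      have uzy_le: "\<bar>u z - u y\<bar> \<le> I"
      proof -
        have "\<bar>u z - u y\<bar> \<le> (LINT s|M. \<bar>indicator {y<..z} s * g s\<bar>)"
          unfolding uzy by (rule integral_abs_bound)
        then show ?thesis by (simp add: I_def abs_mult)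
      qed
      have uzy_e: "\<bar>u z - u y\<bar> < e" using yz zL by (intro d) auto
      have 1: "integrable M (\<lambda>s. indicator {y<..z} s * g s)" by (intro integrable_indicator_mult g) simp
      have 2: "integrable M (\<lambda>s. indicator {y<..z} s * (F' (u s) * g s))" by (intro integrable_indicator_mult F'g) simp
      have "D z - D y = F (u z) - F (u y) - (LINT s|M. indicator {y<..z} s * (F' (u s) * g s))"
        using incr [OF F'g yz(2)] by (simp add: D_def)
      also have "\<dots> = (F (u z) - F (u y) - F' (u y) * (u z - u y)) -
          (LINT s|M. indicator {y<..z} s * (F' (u s) * g s) - F' (u y) * (indicator {y<..z} s * g s))"
        using 1 2 by (simp add: uzy)
      finally have "\<bar>D z - D y\<bar> \<le> \<bar>F (u z) - F (u y) - F' (u y) * (u z - u y)\<bar> +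
          \<bar>LINT s|M. indicator {y<..z} s * (F' (u s) * g s) - F' (u y) * (indicator {y<..z} s * g s)\<bar>"
        by linarith
      also have "\<dots> \<le> e * I + e * I"
      proof (rule add_mono)
        have "\<bar>F (u z) - F (u y) - F' (u y) * (u z - u y)\<bar> \<le> (u z - u y)\<^sup>2"
          by (rule taylor1_le [OF F lip])
        also have "\<dots> = \<bar>u z - u y\<bar> * \<bar>u z - u y\<bar>" by (simp add: power2_eq_square flip: abs_mult)
        also have "\<dots> \<le> e * I" using uzy_le uzy_e by (intro mult_mono) auto
        finally show "\<bar>F (u z) - F (u y) - F' (u y) * (u z - u y)\<bar> \<le> e * I" .
        have "\<bar>LINT s|M. indicator {y<..z} s * (F' (u s) * g s) - F' (u y) * (indicator {y<..z} s * g s)\<bar>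
          \<le> (LINT s|M. \<bar>indicator {y<..z} s * (F' (u s) * g s) - F' (u y) * (indicator {y<..z} s * g s)\<bar>)"
          by (rule integral_abs_bound)
        also have "\<dots> \<le> (LINT s|M. e * (indicator {y<..z} s * \<bar>g s\<bar>))"
        proof (rule integral_mono)
          fix s assume s: "s \<in> space M"
          show "\<bar>indicator {y<..z} s * (F' (u s) * g s) - F' (u y) * (indicator {y<..z} s * g s)\<bar> \<le>
              e * (indicator {y<..z} s * \<bar>g s\<bar>)"
          proof (cases "y < s \<and> s \<le> z")
            case True
            have "\<bar>F' (u s) - F' (u y)\<bar> \<le> \<bar>u s - u y\<bar>" by (rule lip)
            also have "\<dots> < e" using True yz zL by (intro d) auto
            finally have "\<bar>F' (u s) - F' (u y)\<bar> * \<bar>g s\<bar> \<le> e * \<bar>g s\<bar>" by (intro mult_right_mono) auto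
            with True show ?thesis by (simp flip: abs_mult left_diff_distrib)
          qed (auto simp: indicator_def)
        qed (use 1 2 I_int in auto)
        also have "\<dots> = e * I" by (simp add: I_def)
        finally show "\<bar>LINT s|M. indicator {y<..z} s * (F' (u s) * g s) - F' (u y) * (indicator {y<..z} s * g s)\<bar> \<le> e * I" .
      qed
      also have "e * I + e * I = e * (G z - G y)"
        using incr [OF abs_g yz(2)] by (simp add: G_def I_def flip: right_diff_distrib)
      finally show ?thesis .
    qed
    with d(1) show "\<exists>d>0. \<forall>y z. 0 \<le> y \<and> y \<le> z \<and> z \<le> x \<and> z - y < d \<longrightarrow> \<bar>D z - D y\<bar> \<le> e * (G z - G y)"
      by blast
  qed
  moreover have "(LINT s|M. indicator {..0} s * (F' (u s) * g s)) = (LINT s|M. 0)"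
    by (intro Bochner_Integration.integral_cong) (auto simp: indicator_def)
  ultimately show "F (u x) = F (u 0) + (LINT s|M. indicator {..x} s * (F' (u s) * g s))"
    by (simp add: D_def)
qed

end

section \<open>Periodic Sobolev functions\<close>

lemma Lp_space_iff: "f \<in> Lp_space p a b \<longleftrightarrow> p_int p (lebesgue_on {a<..<b}) f"
  by (simp add: Lp_space_def p_int_def)

lemma Lp_space_2_iff: "f \<in> Lp_space 2 a b \<longleftrightarrow> sq_int (lebesgue_on {a<..<b}) f"
  by (simp add: Lp_space_def sq_int_def)

lemma Lp_norm_2_eq: "Lp_norm 2 a b f = L2_norm_on (lebesgue_on {a<..<b}) f"
  by (simp add: Lp_norm_def L2_norm_on_def powr_half_sqrt)

locale periodic_interval = interval +
  fixes p :: real and \<eta> :: nat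
  assumes p_gt_1: "p > 1"
begin

definition phi_deriv :: real where "phi_deriv = 2 * pi * real \<eta> / L"

abbreviation ph :: "real \<Rightarrow> real" where "ph \<equiv> phi L \<eta>"

lemma phi_DERIV: "(ph has_real_derivative phi_deriv) (at x)"
  unfolding phi_def [abs_def] phi_deriv_def using L_pos by (auto intro!: derivative_eq_intros)

lemma phi_shift: "ph (s + of_int k * L) = ph s + 2 * pi * of_int (int \<eta> * k)"
  using L_pos by (simp add: phi_def field_simps)

lemma phi_prim_on: "prim_on ph (\<lambda>_. phi_deriv)"
  by (rule prim_on_C1 [OF phi_DERIV]) simp

lemma phi_cont: "continuous_on A ph"
  unfolding phi_def [abs_def] by (intro continuous_intros) (use L_pos in auto)

text \<open>The derivative is carried along explicitly. With \<open>weak_deriv\<close>, a choice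
  modulo null sets, every algebraic rule would hold only almost everywhere.\<close>

definition W_rep :: "(real \<Rightarrow> real) \<Rightarrow> (real \<Rightarrow> real) \<Rightarrow> bool" where
  "W_rep u g \<longleftrightarrow> prim_on u g \<and> p_int p M g \<and> u \<in> C_per L"

lemma W_rep_prim_on: "W_rep u g \<Longrightarrow> prim_on u g"
  by (simp only: W_rep_def)

lemma W_rep_p_int: "W_rep u g \<Longrightarrow> p_int p M g"
  by (simp only: W_rep_def)

lemma W_rep_C_per: "W_rep u g \<Longrightarrow> u \<in> C_per L"
  by (simp only: W_rep_def)

lemma C_per_cont: "u \<in> C_per L \<Longrightarrow> continuous_on A u"
  by (auto simp: C_per_def intro: continuous_on_subset)

lemma W_rep_cont: "W_rep u g \<Longrightarrow> continuous_on A u"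
  by (rule C_per_cont [OF W_rep_C_per])

lemma reduce_mod_L:
  obtains y k where "y \<in> {0..L}" "x = y + of_int k * L"
proof
  let ?k = "\<lfloor>x / L\<rfloor>"
  show "x = (x - of_int ?k * L) + of_int ?k * L" by simp
  have "of_int ?k \<le> x / L" "x / L \<le> of_int ?k + 1" by linarith+
  then have "of_int ?k * L \<le> x" "x \<le> (of_int ?k + 1) * L"
    by (simp_all only: pos_le_divide_eq [OF L_pos] pos_divide_le_eq [OF L_pos])
  then show "x - of_int ?k * L \<in> {0..L}" by (simp add: algebra_simps)
qed

lemma C_per_shift: "u \<in> C_per L \<Longrightarrow> y \<in> {0..L} \<Longrightarrow> u (y + of_int k * L) = u y"
  unfolding C_per_def by blast

lemma W_rep_sq_int: "W_rep u g \<Longrightarrow> sq_int M u"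
  by (rule continuous_sq_int_M [OF W_rep_cont])

lemma W_rep_linear:
  assumes "W_rep u g" "W_rep v h"
  shows "W_rep (\<lambda>x. a * u x + b * v x) (\<lambda>x. a * g x + b * h x)"
  unfolding W_rep_def
proof (intro conjI)
  show "prim_on (\<lambda>x. a * u x + b * v x) (\<lambda>x. a * g x + b * h x)"
    by (intro prim_on_linear W_rep_prim_on assms)
  show "p_int p M (\<lambda>x. a * g x + b * h x)"
    using p_gt_1 by (intro p_int_add p_int_cmult W_rep_p_int [OF assms(1)] W_rep_p_int [OF assms(2)]) simp
  show "(\<lambda>x. a * u x + b * v x) \<in> C_per L"
    unfolding C_per_def
  proof (intro CollectI conjI ballI allI)
    show "continuous_on UNIV (\<lambda>x. a * u x + b * v x)"
      by (intro continuous_intros W_rep_cont [OF assms(1)] W_rep_cont [OF assms(2)])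
    fix s :: real and k :: int assume "s \<in> {0..L}"
    then show "a * u (s + of_int k * L) + b * v (s + of_int k * L) = a * u s + b * v s"
      by (simp only: C_per_shift [OF W_rep_C_per [OF assms(1)]] C_per_shift [OF W_rep_C_per [OF assms(2)]])
  qed
qed

lemma W_rep_diff:
  assumes "W_rep u g" "W_rep v h"
  shows "W_rep (\<lambda>x. u x - v x) (\<lambda>x. g x - h x)"
  using W_rep_linear [OF assms, of 1 "-1"] by simp

lemma prim_on_theta:
  assumes "W_rep u g"
  shows "prim_on (\<lambda>x. u x + ph x) (\<lambda>x. g x + phi_deriv)"
  using prim_on_linear [OF W_rep_prim_on [OF assms] phi_prim_on, of 1 1] by simp

lemma p_int_theta:
  assumes "W_rep u g"
  shows "p_int p M (\<lambda>x. g x + phi_deriv)"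
  using p_gt_1 by (intro p_int_add W_rep_p_int [OF assms] p_int_const) simp

lemma theta_cont: "W_rep u g \<Longrightarrow> continuous_on A (\<lambda>x. u x + ph x)"
  by (intro continuous_intros W_rep_cont phi_cont)

text \<open>A shift by a period moves \<open>ph\<close> by an integer multiple of 2 pi because
  \<eta> is a natural number, so F of the angle is periodic although the angle itself need not be.
  This is what makes \<open>sn\<close> and \<open>cs\<close> legitimate test functions.\<close>

lemma W_rep_trig:
  assumes u: "W_rep u g" and F: "\<And>x. (F has_real_derivative F' x) (at x)"
    and lip: "\<And>x y. \<bar>F' x - F' y\<bar> \<le> \<bar>x - y\<bar>" and F'1: "\<And>x. \<bar>F' x\<bar> \<le> 1"
    and per: "\<And>x k. F (x + 2 * pi * of_int k) = F x"
  shows "W_rep (\<lambda>x. F (u x + ph x)) (\<lambda>x. F' (u x + ph x) * (g x + phi_deriv))"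
  unfolding W_rep_def
proof (intro conjI)
  show "prim_on (\<lambda>x. F (u x + ph x)) (\<lambda>x. F' (u x + ph x) * (g x + phi_deriv))"
    by (rule prim_on_chain [OF prim_on_theta [OF u] F lip F'1])
  have F_cont: "continuous_on A F" for A
    by (rule DERIV_continuous_on) (rule has_field_derivative_at_within [OF F])
  have F'_cont: "continuous_on UNIV F'"
  proof (rule continuous_onI)
    fix x e :: real assume "e > 0"
    then show "\<exists>d>0. \<forall>x'\<in>UNIV. dist x' x < d \<longrightarrow> dist (F' x') (F' x) \<le> e"
      by (intro exI [of _ e]) (auto simp: dist_real_def intro: order_trans [OF lip])
  qed
  have "(\<lambda>x. F' (u x + ph x)) \<in> borel_measurable M"
    by (intro continuous_measurable_M continuous_on_compose2 [OF F'_cont theta_cont [OF u]]) auto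
  then show "p_int p M (\<lambda>x. F' (u x + ph x) * (g x + phi_deriv))"
    using p_gt_1 F'1 by (intro p_int_mult_bounded p_int_theta [OF u]) auto
  show "(\<lambda>x. F (u x + ph x)) \<in> C_per L"
    unfolding C_per_def
  proof (intro CollectI conjI ballI allI)
    show "continuous_on UNIV (\<lambda>x. F (u x + ph x))"
      by (intro continuous_on_compose2 [OF F_cont theta_cont [OF u]]) auto
    fix s :: real and k :: int assume s: "s \<in> {0..L}"
    have "u (s + of_int k * L) + ph (s + of_int k * L) = (u s + ph s) + 2 * pi * of_int (int \<eta> * k)"
      using C_per_shift [OF W_rep_C_per [OF u] s] by (simp add: phi_shift)
    then show "F (u (s + of_int k * L) + ph (s + of_int k * L)) = F (u s + ph s)"
      using per [of "u s + ph s" "int \<eta> * k"] by simp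
  qed
qed

lemma W_rep_sin:
  assumes "W_rep u g"
  shows "W_rep (\<lambda>x. sin (u x + ph x)) (\<lambda>x. cos (u x + ph x) * (g x + phi_deriv))"
proof (rule W_rep_trig [OF assms])
  show "sin (x + 2 * pi * of_int k) = sin x" for x k
    using sin_int_2pin [of k] cos_int_2pin [of k] by (simp add: sin_add)
qed (use cos_lipschitz in auto)

lemma W_rep_cos:
  assumes "W_rep u g"
  shows "W_rep (\<lambda>x. cos (u x + ph x)) (\<lambda>x. - sin (u x + ph x) * (g x + phi_deriv))"
proof (rule W_rep_trig [OF assms])
  show "cos (x + 2 * pi * of_int k) = cos x" for x k
    using sin_int_2pin [of k] cos_int_2pin [of k] by (simp add: cos_add)
  show "\<bar>- sin x - - sin y\<bar> \<le> \<bar>x - y\<bar>" for x y :: real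
    using sin_lipschitz [of y x] by linarith
  show "(cos has_real_derivative - sin x) (at x)" for x :: real by (rule DERIV_cos)
qed simp

lemma W_rep_in_W1p_per:
  assumes "W_rep u g"
  shows "u \<in> W1p_per p L"
proof -
  have c: "continuous_on {0..L} u" by (rule W_rep_cont [OF assms])
  obtain B where B: "\<And>x. x \<in> {0..L} \<Longrightarrow> \<bar>u x\<bar> \<le> B" using continuous_bounded_M [OF c] by metis
  have "p_int p M u"
    by (rule p_int_bounded [of u B]) (use B p_gt_1 in \<open>auto intro: continuous_measurable_M [OF c]\<close>)
  then have "u \<in> Lp_space p 0 L" "g \<in> Lp_space p 0 L"
    using W_rep_p_int [OF assms] by (simp_all only: Lp_space_iff)
  then show ?thesis
    using W_rep_C_per [OF assms] prim_on_has_weak_deriv [OF W_rep_prim_on [OF assms]]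
    unfolding W1p_per_def W1p_def by blast
qed

lemma W1p_per_imp_W_rep:
  assumes "u \<in> W1p_per p L"
  obtains g where "W_rep u g"
proof -
  obtain g where "g \<in> Lp_space p 0 L" and w: "has_weak_deriv 0 L u g" and u: "u \<in> C_per L"
    using assms unfolding W1p_per_def W1p_def by blast
  then have g: "p_int p M g" by (simp only: Lp_space_iff)
  have "prim_on u g"
    by (rule weak_deriv_imp_prim_on [OF C_per_cont [OF u] w p_int_imp_integrable [OF _ g]])
      (use p_gt_1 in simp)
  with g u show ?thesis by (intro that [of g]) (simp only: W_rep_def)
qed

text \<open>On \<open>{0..L}\<close> the values of d differ by at most the integral of
  \<open>\<bar>h\<bar>\<close>; averaging this over the interval and applying Cauchy-Schwarz to the
  mean of \<open>\<bar>d\<bar>\<close> gives the bound, and periodicity extends it to the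
  line.\<close>

lemma sup_le_L2_plus_L1:
  assumes W: "W_rep d h"
  shows "\<bar>d x\<bar> \<le> L2_norm_on M d / sqrt L + (LINT s|M. \<bar>h s\<bar>)"
proof -
  obtain y k where y: "y \<in> {0..L}" "x = y + of_int k * L" by (rule reduce_mod_L)
  have dx: "d x = d y" unfolding y(2) by (rule C_per_shift [OF W_rep_C_per [OF W] y(1)])
  define \<rho> where "\<rho> = (LINT s|M. \<bar>h s\<bar>)"
  have d_int: "integrable M (\<lambda>s. \<bar>d s\<bar>)"
    by (intro integrable_abs continuous_integrable_M W_rep_cont [OF W])
  have "\<bar>d y\<bar> * L = (LINT s|M. \<bar>d y\<bar>)" by (simp only: integral_const_M)
  also have "\<dots> \<le> (LINT s|M. \<bar>d s\<bar> + \<rho>)"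
  proof (rule integral_mono)
    fix s assume "s \<in> space M"
    then have "s \<in> {0..L}" by simp
    from prim_on_diff_le [OF W_rep_prim_on [OF W] this y(1)]
    show "\<bar>d y\<bar> \<le> \<bar>d s\<bar> + \<rho>" unfolding \<rho>_def by linarith
  qed (use d_int in auto)
  also have "\<dots> = (LINT s|M. \<bar>d s\<bar>) + \<rho> * L"
    using d_int by (simp add: integral_const_M del: lebesgue_integral_const)
  also have "(LINT s|M. \<bar>d s\<bar>) \<le> sqrt L * L2_norm_on M d"
    using L1_le_L2 [OF W_rep_sq_int [OF W]] unfolding measure_M .
  finally have "\<bar>d y\<bar> * L \<le> sqrt L * L2_norm_on M d + \<rho> * L" by simp
  also have "\<dots> = (L2_norm_on M d / sqrt L + \<rho>) * L"
    using L_pos by (simp add: field_simps flip: real_sqrt_mult)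
  finally show ?thesis using L_pos dx by (simp add: \<rho>_def)
qed

text \<open>Convergence of the values in \<open>L\<^sup>2\<close> and of the slopes in the mean
  makes the sequence uniformly Cauchy. The limit u is thus the continuous periodic representative of
  w, at every point and not just almost everywhere.\<close>

lemma W_rep_limit:
  assumes W: "\<And>n. W_rep (v n) (g n)" and g: "p_int p M g'"
    and gconv: "(\<lambda>n. LINT s|M. \<bar>g n s - g' s\<bar>) \<longlonglongrightarrow> 0"
    and w: "sq_int M w" and vconv: "(\<lambda>n. L2_norm_on M (\<lambda>s. v n s - w s)) \<longlonglongrightarrow> 0"
  obtains u where "W_rep u g'" "uniform_limit UNIV v u sequentially"
proof -
  have gi: "integrable M (g n)" for n by (rule prim_on_integrable [OF W_rep_prim_on [OF W]])
  have gi': "integrable M g'" by (rule p_int_imp_integrable [OF _ g]) (use p_gt_1 in simp)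
  define a where "a n = L2_norm_on M (\<lambda>s. v n s - w s) / sqrt L + (LINT s|M. \<bar>g n s - g' s\<bar>)" for n
  have a0: "a \<longlonglongrightarrow> 0"
  proof -
    have "a \<longlonglongrightarrow> 0 / sqrt L + 0"
      unfolding a_def using L_pos by (intro tendsto_intros vconv gconv) auto
    then show ?thesis by simp
  qed
  have diff: "\<bar>v n x - v m x\<bar> \<le> a n + a m" for n m x
  proof -
    have "\<bar>v n x - v m x\<bar> \<le> L2_norm_on M (\<lambda>s. v n s - v m s) / sqrt L + (LINT s|M. \<bar>g n s - g m s\<bar>)"
      by (rule sup_le_L2_plus_L1 [OF W_rep_diff [OF W W]])
    moreover have "L2_norm_on M (\<lambda>s. v n s - v m s) / sqrt L \<le>
        (L2_norm_on M (\<lambda>s. v n s - w s) + L2_norm_on M (\<lambda>s. v m s - w s)) / sqrt L"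
      using L2_norm_on_triangle3 [OF W_rep_sq_int [OF W] w W_rep_sq_int [OF W], of n m] L_pos
      by (intro divide_right_mono) (auto simp: L2_norm_on_commute [of M w])
    moreover have "(LINT s|M. \<bar>g n s - g m s\<bar>) \<le> (LINT s|M. \<bar>g n s - g' s\<bar> + \<bar>g m s - g' s\<bar>)"
      using gi gi' by (intro integral_mono) auto
    moreover have "(LINT s|M. \<bar>g n s - g' s\<bar> + \<bar>g m s - g' s\<bar>) =
        (LINT s|M. \<bar>g n s - g' s\<bar>) + (LINT s|M. \<bar>g m s - g' s\<bar>)"
      using gi gi' by (intro Bochner_Integration.integral_add) auto
    ultimately show ?thesis unfolding a_def add_divide_distrib by linarith
  qed
  have "uniformly_Cauchy_on UNIV v"
    unfolding uniformly_Cauchy_on_def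
  proof (intro allI impI)
    fix e :: real assume "e > 0"
    then have "\<forall>\<^sub>F n in sequentially. a n < e / 2" by (intro order_tendstoD(2) [OF a0]) auto
    then obtain N where N: "\<And>n. n \<ge> N \<Longrightarrow> a n < e / 2" by (auto simp: eventually_sequentially)
    show "\<exists>N. \<forall>x\<in>UNIV. \<forall>m\<ge>N. \<forall>n\<ge>N. dist (v m x) (v n x) < e"
    proof (intro exI ballI allI impI)
      fix x m n assume "m \<ge> N" "n \<ge> N"
      then show "dist (v m x) (v n x) < e"
        using N [of m] N [of n] diff [of m x n] unfolding dist_real_def by linarith
    qed
  qed
  then have "uniformly_convergent_on UNIV v" by (simp only: uniformly_convergent_eq_Cauchy)
  then obtain u where u: "uniform_limit UNIV v u sequentially" by (auto simp: uniformly_convergent_on_def)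
  have pt: "(\<lambda>n. v n x) \<longlonglongrightarrow> u x" for x using tendsto_uniform_limitI [OF u] by simp
  have "W_rep u g'"
    unfolding W_rep_def
  proof (intro conjI g)
    have "u \<in> C_per L"
      unfolding C_per_def
    proof (intro CollectI conjI ballI allI)
      show "continuous_on UNIV u"
        by (rule uniform_limit_theorem [OF _ u]) (use W_rep_cont [OF W] in auto)
      fix s :: real and k :: int assume "s \<in> {0..L}"
      then have "v n (s + of_int k * L) = v n s" for n by (intro C_per_shift [OF W_rep_C_per [OF W]])
      with pt [of "s + of_int k * L"] have "(\<lambda>n. v n s) \<longlonglongrightarrow> u (s + of_int k * L)" by simp
      with pt [of s] show "u (s + of_int k * L) = u s" by (rule LIMSEQ_unique [rotated])
    qed
    then show "u \<in> C_per L" .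
    show "prim_on u g'"
      unfolding prim_on_def
    proof (intro conjI ballI gi')
      fix x assume x: "x \<in> {0..L}"
      have i1: "integrable M (\<lambda>s. indicator {..x} s * g n s)" for n by (intro integrable_indicator_mult gi) simp
      have i2: "integrable M (\<lambda>s. indicator {..x} s * g' s)" by (intro integrable_indicator_mult gi') simp
      have "(\<lambda>n. (LINT s|M. indicator {..x} s * g n s) - (LINT s|M. indicator {..x} s * g' s)) \<longlonglongrightarrow> 0"
      proof (rule Lim_null_comparison [OF _ gconv], rule always_eventually, rule allI)
        fix n
        have "(LINT s|M. indicator {..x} s * g n s) - (LINT s|M. indicator {..x} s * g' s) =
            (LINT s|M. indicator {..x} s * g n s - indicator {..x} s * g' s)"
          using i1 i2 by (intro Bochner_Integration.integral_diff [symmetric])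
        also have "norm \<dots> \<le> (LINT s|M. \<bar>indicator {..x} s * g n s - indicator {..x} s * g' s\<bar>)"
          unfolding real_norm_def by (rule integral_abs_bound)
        also have "\<dots> \<le> (LINT s|M. \<bar>g n s - g' s\<bar>)"
          using i1 i2 gi gi' by (intro integral_mono) (auto simp: indicator_def)
        finally show "norm ((LINT s|M. indicator {..x} s * g n s) - (LINT s|M. indicator {..x} s * g' s)) \<le>
          (LINT s|M. \<bar>g n s - g' s\<bar>)" .
      qed
      then have "(\<lambda>n. LINT s|M. indicator {..x} s * g n s) \<longlonglongrightarrow> (LINT s|M. indicator {..x} s * g' s)"
        by (rule LIM_zero_cancel)
      then have "(\<lambda>n. v n 0 + (LINT s|M. indicator {..x} s * g n s)) \<longlonglongrightarrow> u 0 + (LINT s|M. indicator {..x} s * g' s)"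
        by (intro tendsto_add pt)
      moreover have "v n 0 + (LINT s|M. indicator {..x} s * g n s) = v n x" for n
        by (rule prim_onD [OF W_rep_prim_on [OF W] x, symmetric])
      ultimately have "(\<lambda>n. v n x) \<longlonglongrightarrow> u 0 + (LINT s|M. indicator {..x} s * g' s)" by simp
      with pt [of x] show "u x = u 0 + (LINT s|M. indicator {..x} s * g' s)" by (rule LIMSEQ_unique)
    qed
  qed
  from that [OF this u] show ?thesis .
qed

end

section \<open>The constrained implicit time step\<close>

lemma summable_if_squares_geometric:
  fixes a :: "nat \<Rightarrow> real"
  assumes a: "\<And>n. a n \<ge> 0" "\<And>n. (a n)\<^sup>2 \<le> K * q ^ n" and q: "0 < q" "q < 1"
  shows "summable a"
proof -
  have le: "a n \<le> sqrt K * sqrt q ^ n" for n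
  proof -
    have "a n \<le> sqrt (K * q ^ n)" using a by (intro real_le_rsqrt) auto
    then show ?thesis by (simp add: real_sqrt_mult real_sqrt_power)
  qed
  have "summable (\<lambda>n. sqrt K * sqrt q ^ n)"
    using q by (intro summable_mult summable_geometric) auto
  then show ?thesis
    by (rule summable_comparison_test' [where N=0]) (simp add: a le)
qed

context periodic_interval
begin

abbreviation sn :: "(real \<Rightarrow> real) \<Rightarrow> real \<Rightarrow> real" where "sn w x \<equiv> sin (w x + ph x)"

abbreviation cs :: "(real \<Rightarrow> real) \<Rightarrow> real \<Rightarrow> real" where "cs w x \<equiv> cos (w x + ph x)"

abbreviation ip :: "(real \<Rightarrow> real) \<Rightarrow> (real \<Rightarrow> real) \<Rightarrow> real" where
  "ip f g \<equiv> (LINT x|M. f x * g x)"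

abbreviation nrm :: "(real \<Rightarrow> real) \<Rightarrow> real" where "nrm \<equiv> L2_norm_on M"

definition energy :: "(real \<Rightarrow> real) \<Rightarrow> real" where
  "energy g = (LINT x|M. \<bar>g x + phi_deriv\<bar> powr p)"

definition step_functional :: "real \<Rightarrow> (real \<Rightarrow> real) \<Rightarrow> (real \<Rightarrow> real) \<Rightarrow> (real \<Rightarrow> real) \<Rightarrow> real" where
  "step_functional \<tau> w v g = energy g / p + (nrm (\<lambda>x. v x - w x))\<^sup>2 / (2 * \<tau>)"

text \<open>An affine condition on v, so midpoints of admissible functions are admissible; it holds
  for \<open>v = w\<close>, and this competitor yields the dissipation of energy along the
  scheme.\<close>

definition admissible :: "(real \<Rightarrow> real) \<Rightarrow> (real \<Rightarrow> real) \<Rightarrow> (real \<Rightarrow> real) \<Rightarrow> bool" where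
  "admissible w v g \<longleftrightarrow> W_rep v g \<and> ip (\<lambda>x. v x - w x) (sn w) = 0 \<and> ip (\<lambda>x. v x - w x) (cs w) = 0"

lemma energy_nonneg: "energy g \<ge> 0"
  by (simp add: energy_def)

lemma energy_integrable: "W_rep u g \<Longrightarrow> integrable M (\<lambda>x. \<bar>g x + phi_deriv\<bar> powr p)"
  using p_int_theta by (auto simp: p_int_def)

lemma step_functional_nonneg: "\<tau> > 0 \<Longrightarrow> step_functional \<tau> w v g \<ge> 0"
  using energy_nonneg [of g] p_gt_1 by (simp add: step_functional_def)

lemma sn_sq_int: "W_rep w h \<Longrightarrow> sq_int M (sn w)"
  using W_rep_sq_int [OF W_rep_sin] by blast

lemma cs_sq_int: "W_rep w h \<Longrightarrow> sq_int M (cs w)"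
  using W_rep_sq_int [OF W_rep_cos] by blast

lemma ip_linear:
  assumes "sq_int M f1" "sq_int M f2" "sq_int M h"
  shows "ip (\<lambda>x. a * f1 x + b * f2 x) h = a * ip f1 h + b * ip f2 h"
proof -
  have "ip (\<lambda>x. a * f1 x + b * f2 x) h = (LINT x|M. a * (f1 x * h x) + b * (f2 x * h x))"
    by (intro Bochner_Integration.integral_cong) (auto simp: algebra_simps)
  also have "\<dots> = a * ip f1 h + b * ip f2 h"
    using sq_int_mult_integrable [OF assms(1,3)] sq_int_mult_integrable [OF assms(2,3)] by simp
  finally show ?thesis .
qed

lemma admissible_combination:
  assumes w: "W_rep w h" and 1: "admissible w v1 g1" and \<phi>: "W_rep \<phi> \<phi>'"
    and 0: "ip \<phi> (sn w) = 0" "ip \<phi> (cs w) = 0"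
  shows "admissible w (\<lambda>x. v1 x + e * \<phi> x) (\<lambda>x. g1 x + e * \<phi>' x)"
proof -
  have W1: "W_rep v1 g1" using 1 by (simp only: admissible_def)
  have d: "sq_int M (\<lambda>x. v1 x - w x)" by (intro sq_int_diff W_rep_sq_int [OF W1] W_rep_sq_int [OF w])
  have eq: "v1 x + e * \<phi> x - w x = 1 * (v1 x - w x) + e * \<phi> x" for x by simp
  have "W_rep (\<lambda>x. v1 x + e * \<phi> x) (\<lambda>x. g1 x + e * \<phi>' x)"
    using W_rep_linear [OF W1 \<phi>, of 1 e] by simp
  then show ?thesis
    unfolding admissible_def eq ip_linear [OF d W_rep_sq_int [OF \<phi>] sn_sq_int [OF w]]
      ip_linear [OF d W_rep_sq_int [OF \<phi>] cs_sq_int [OF w]]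
    using 1 0 by (simp add: admissible_def)
qed

section \<open>Existence of a minimiser by uniform convexity\<close>

lemma step_functional_midpoint:
  assumes w: "W_rep w h" and 1: "W_rep v1 g1" and 2: "W_rep v2 g2" and \<tau>: "\<tau> > 0"
  shows "step_functional \<tau> w v1 g1 + step_functional \<tau> w v2 g2 -
      2 * step_functional \<tau> w (\<lambda>x. (v1 x + v2 x) / 2) (\<lambda>x. (g1 x + g2 x) / 2) \<ge>
    min 1 (p - 1) / (4 * p) * (nrm (\<lambda>x. phalf p (g1 x + phi_deriv) - phalf p (g2 x + phi_deriv)))\<^sup>2 +
    (nrm (\<lambda>x. v1 x - v2 x))\<^sup>2 / (4 * \<tau>)"
proof -
  have mid: "W_rep (\<lambda>x. (v1 x + v2 x) / 2) (\<lambda>x. (g1 x + g2 x) / 2)"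
    using W_rep_linear [OF 1 2, of "1/2" "1/2"] by (simp add: add_divide_distrib)
  note e1 = energy_integrable [OF 1] and e2 = energy_integrable [OF 2] and em = energy_integrable [OF mid]
  have b: "sq_int M (\<lambda>x. phalf p (g1 x + phi_deriv) - phalf p (g2 x + phi_deriv))"
    by (intro sq_int_diff sq_int_phalf p_int_theta [OF 1] p_int_theta [OF 2])
  have "min 1 (p - 1) / 4 * (nrm (\<lambda>x. phalf p (g1 x + phi_deriv) - phalf p (g2 x + phi_deriv)))\<^sup>2 =
      (LINT x|M. min 1 (p - 1) / 4 * (phalf p (g1 x + phi_deriv) - phalf p (g2 x + phi_deriv))\<^sup>2)"
    by (simp add: L2_norm_on_power2)
  also have "\<dots> \<le> (LINT x|M. \<bar>g1 x + phi_deriv\<bar> powr p + \<bar>g2 x + phi_deriv\<bar> powr p -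
      2 * \<bar>(g1 x + g2 x) / 2 + phi_deriv\<bar> powr p)"
  proof (rule integral_mono)
    show "integrable M (\<lambda>x. min 1 (p - 1) / 4 * (phalf p (g1 x + phi_deriv) - phalf p (g2 x + phi_deriv))\<^sup>2)"
      by (rule integrable_mult_right) (rule sq_int_integrable [OF b])
    show "integrable M (\<lambda>x. \<bar>g1 x + phi_deriv\<bar> powr p + \<bar>g2 x + phi_deriv\<bar> powr p -
      2 * \<bar>(g1 x + g2 x) / 2 + phi_deriv\<bar> powr p)"
      by (intro Bochner_Integration.integrable_add Bochner_Integration.integrable_diff integrable_mult_right e1 e2 em)
    fix x
    have eq: "(g1 x + phi_deriv + (g2 x + phi_deriv)) / 2 = (g1 x + g2 x) / 2 + phi_deriv" by simp
    show "min 1 (p - 1) / 4 * (phalf p (g1 x + phi_deriv) - phalf p (g2 x + phi_deriv))\<^sup>2 \<le>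
      \<bar>g1 x + phi_deriv\<bar> powr p + \<bar>g2 x + phi_deriv\<bar> powr p - 2 * \<bar>(g1 x + g2 x) / 2 + phi_deriv\<bar> powr p"
      using powr_midpoint_gap [OF p_gt_1, of "g1 x + phi_deriv" "g2 x + phi_deriv"] unfolding eq .
  qed
  also have "\<dots> = energy g1 + energy g2 - 2 * energy (\<lambda>x. (g1 x + g2 x) / 2)"
    using e1 e2 em by (simp add: energy_def)
  finally have "min 1 (p - 1) / 4 * (nrm (\<lambda>x. phalf p (g1 x + phi_deriv) - phalf p (g2 x + phi_deriv)))\<^sup>2 / p \<le>
      (energy g1 + energy g2 - 2 * energy (\<lambda>x. (g1 x + g2 x) / 2)) / p"
    using p_gt_1 by (intro divide_right_mono) auto
  moreover have "(nrm (\<lambda>x. v1 x - w x))\<^sup>2 + (nrm (\<lambda>x. v2 x - w x))\<^sup>2 - 2 * (nrm (\<lambda>x. (v1 x + v2 x) / 2 - w x))\<^sup>2 =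
      (nrm (\<lambda>x. v1 x - v2 x))\<^sup>2 / 2"
  proof -
    have i1: "integrable M (\<lambda>x. (v1 x - w x)\<^sup>2)" "integrable M (\<lambda>x. (v2 x - w x)\<^sup>2)"
        "integrable M (\<lambda>x. ((v1 x + v2 x) / 2 - w x)\<^sup>2)"
      by (intro sq_int_integrable sq_int_diff W_rep_sq_int [OF 1] W_rep_sq_int [OF 2] W_rep_sq_int [OF w]
          W_rep_sq_int [OF mid])+
    have "(nrm (\<lambda>x. v1 x - w x))\<^sup>2 + (nrm (\<lambda>x. v2 x - w x))\<^sup>2 - 2 * (nrm (\<lambda>x. (v1 x + v2 x) / 2 - w x))\<^sup>2 =
        (LINT x|M. (v1 x - w x)\<^sup>2 + (v2 x - w x)\<^sup>2 - 2 * ((v1 x + v2 x) / 2 - w x)\<^sup>2)"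
      unfolding L2_norm_on_power2 using i1 by simp
    also have "\<dots> = (LINT x|M. (v1 x - v2 x)\<^sup>2 / 2)"
      by (intro Bochner_Integration.integral_cong) (auto simp: power2_eq_square field_simps)
    finally show ?thesis by (simp add: L2_norm_on_power2)
  qed
  then have "((nrm (\<lambda>x. v1 x - w x))\<^sup>2 + (nrm (\<lambda>x. v2 x - w x))\<^sup>2 - 2 * (nrm (\<lambda>x. (v1 x + v2 x) / 2 - w x))\<^sup>2) / (2 * \<tau>) =
      (nrm (\<lambda>x. v1 x - v2 x))\<^sup>2 / 2 / (2 * \<tau>)"
    by (simp only:)
  moreover have "(nrm (\<lambda>x. v1 x - v2 x))\<^sup>2 / 2 / (2 * \<tau>) = (nrm (\<lambda>x. v1 x - v2 x))\<^sup>2 / (4 * \<tau>)" by simp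
  ultimately show ?thesis
    unfolding step_functional_def by (simp add: add_divide_distrib diff_divide_distrib)
qed

text \<open>The direct method with strong instead of weak convergence: the midpoint of two almost
  minimisers is admissible and cannot lie below the infimum, so the convexity gap bounds their
  distance, in \<open>L\<^sup>2\<close> for the functions and, through \<open>phalf\<close>, for the
  slopes.\<close>

theorem step_minimizer_exists:
  assumes w: "W_rep w h" and \<tau>: "\<tau> > 0"
  obtains v g where "admissible w v g"
    "\<And>v' g'. admissible w v' g' \<Longrightarrow> step_functional \<tau> w v g \<le> step_functional \<tau> w v' g'"
proof -
  define J where "J = step_functional \<tau> w"
  define JS where "JS = {J v g |v g. admissible w v g}"
  define m where "m = Inf JS"
  have "admissible w w h" using w by (simp add: admissible_def)
  then have ne: "JS \<noteq> {}" by (auto simp: JS_def)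
  have bdd: "bdd_below JS"
    using step_functional_nonneg [OF \<tau>] by (intro bdd_belowI [of _ 0]) (auto simp: JS_def J_def)
  have m_le: "m \<le> J v g" if "admissible w v g" for v g
    unfolding m_def using that by (intro cInf_lower bdd) (auto simp: JS_def)
  \<comment> \<open>An excess of \<open>(1/4) ^ n\<close> controls squared distances; the distances
    themselves are then O(2^-n) and summable.\<close>
  have "\<exists>vg. admissible w (fst vg) (snd vg) \<and> J (fst vg) (snd vg) < m + (1/4) ^ n" for n :: nat
  proof -
    have "\<exists>j\<in>JS. j < m + (1/4) ^ n"
      using ne bdd unfolding m_def by (subst cInf_less_iff [symmetric]) auto
    then show ?thesis by (auto simp: JS_def)
  qed
  then obtain vg where vg: "\<And>n. admissible w (fst (vg n)) (snd (vg n))"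
    "\<And>n. J (fst (vg n)) (snd (vg n)) < m + (1/4) ^ n" by metis
  define v where "v n = fst (vg n)" for n
  define g where "g n = snd (vg n)" for n
  have adm: "admissible w (v n) (g n)" for n using vg by (simp add: v_def g_def)
  have W: "W_rep (v n) (g n)" for n using adm by (simp add: admissible_def)
  have J_less: "J (v n) (g n) < m + (1/4) ^ n" for n using vg by (simp add: v_def g_def)
  define c where "c = min 1 (p - 1) / (4 * p)"
  have c: "c > 0" using p_gt_1 by (simp add: c_def)
  define b where "b n x = phalf p (g n x + phi_deriv)" for n x
  have gap: "c * (nrm (\<lambda>x. b (Suc n) x - b n x))\<^sup>2 + (nrm (\<lambda>x. v (Suc n) x - v n x))\<^sup>2 / (4 * \<tau>) \<le> 2 * (1/4) ^ n" for n
  proof -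
    have mid: "admissible w (\<lambda>x. (v (Suc n) x + v n x) / 2) (\<lambda>x. (g (Suc n) x + g n x) / 2)"
    proof -
      have d: "sq_int M (\<lambda>x. v n x - w x)" for n by (intro sq_int_diff W_rep_sq_int [OF W] W_rep_sq_int [OF w])
      have "(\<lambda>x. v n x + 1/2 * (v (Suc n) x - v n x)) = (\<lambda>x. (v (Suc n) x + v n x) / 2)"
        "(\<lambda>x. g n x + 1/2 * (g (Suc n) x - g n x)) = (\<lambda>x. (g (Suc n) x + g n x) / 2)"
        by (auto simp: field_simps)
      moreover have eq: "v (Suc n) x - v n x = 1 * (v (Suc n) x - w x) + (-1) * (v n x - w x)" for x by simp
      have "ip (\<lambda>x. v (Suc n) x - v n x) (sn w) = 0" "ip (\<lambda>x. v (Suc n) x - v n x) (cs w) = 0"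
        unfolding eq ip_linear [OF d d sn_sq_int [OF w]] ip_linear [OF d d cs_sq_int [OF w]]
        using adm [of n] adm [of "Suc n"] by (simp_all add: admissible_def)
      from admissible_combination [OF w adm [of n] W_rep_diff [OF W W] this, of "1/2"]
      have "admissible w (\<lambda>x. v n x + 1/2 * (v (Suc n) x - v n x)) (\<lambda>x. g n x + 1/2 * (g (Suc n) x - g n x))" .
      ultimately show ?thesis by simp
    qed
    have "(1/4::real) ^ Suc n \<le> (1/4) ^ n" by simp
    then show ?thesis
      using step_functional_midpoint [OF w W W \<tau>, of "Suc n" n] m_le [OF mid] J_less [of n] J_less [of "Suc n"]
      unfolding J_def b_def c_def by linarith
  qed
  have b_bound: "(nrm (\<lambda>x. b (Suc n) x - b n x))\<^sup>2 \<le> 2 / c * (1/4) ^ n" for n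
  proof -
    have "c * (nrm (\<lambda>x. b (Suc n) x - b n x))\<^sup>2 \<le> 2 * (1/4) ^ n"
    proof -
      have "0 \<le> (nrm (\<lambda>x. v (Suc n) x - v n x))\<^sup>2 / (4 * \<tau>)" using \<tau> by simp
      then show ?thesis using gap [of n] by linarith
    qed
    then show ?thesis using c by (simp add: field_simps)
  qed
  have v_bound: "(nrm (\<lambda>x. v (Suc n) x - v n x))\<^sup>2 \<le> 8 * \<tau> * (1/4) ^ n" for n
  proof -
    have "0 \<le> c * (nrm (\<lambda>x. b (Suc n) x - b n x))\<^sup>2" using c by simp
    then have "(nrm (\<lambda>x. v (Suc n) x - v n x))\<^sup>2 / (4 * \<tau>) \<le> 2 * (1/4) ^ n"
      using gap [of n] by linarith
    then show ?thesis using \<tau> by (simp add: field_simps)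
  qed
  have sm_b: "summable (\<lambda>n. nrm (\<lambda>x. b (Suc n) x - b n x))"
    by (rule summable_if_squares_geometric [OF _ b_bound]) auto
  have sm_v: "summable (\<lambda>n. nrm (\<lambda>x. v (Suc n) x - v n x))"
    by (rule summable_if_squares_geometric [OF _ v_bound]) auto
  obtain G where G: "p_int p M G"
    "(\<lambda>n. LINT x|M. \<bar>g n x + phi_deriv\<bar> powr p) \<longlonglongrightarrow> (LINT x|M. \<bar>G x\<bar> powr p)"
    "(\<lambda>n. LINT x|M. \<bar>g n x + phi_deriv - G x\<bar> powr p) \<longlonglongrightarrow> 0"
    by (rule phalf_complete [OF p_gt_1 p_int_theta [OF W] sm_b [unfolded b_def]])
  define g' where "g' x = G x - phi_deriv" for x
  have g'_p: "p_int p M g'"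
    unfolding g'_def using p_gt_1 by (intro p_int_diff G p_int_const) auto
  have "(\<lambda>n. LINT x|M. \<bar>g n x + phi_deriv - G x\<bar>) \<longlonglongrightarrow> 0"
    using p_gt_1 by (intro Lp_conv_imp_L1_conv [OF p_gt_1 _ G(3)] p_int_diff p_int_theta [OF W] G(1)) auto
  then have g_L1: "(\<lambda>n. LINT x|M. \<bar>g n x - g' x\<bar>) \<longlonglongrightarrow> 0"
    by (simp add: g'_def algebra_simps)
  obtain w2 where w2: "sq_int M w2" "(\<lambda>n. nrm (\<lambda>x. v n x - w2 x)) \<longlonglongrightarrow> 0"
    by (rule Riesz_Fischer [OF W_rep_sq_int [OF W] sm_v])
  obtain u where u: "W_rep u g'" "uniform_limit UNIV v u sequentially"
    by (rule W_rep_limit [OF W g'_p g_L1 w2])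
  \<comment> \<open>One dominated convergence for the two constraints and for the squared distance
    to w. By uniform convergence \<open>v n\<close> is eventually within 1 of u, hence the argument
    \<open>B + 1\<close> of the bound K.\<close>
  have lim: "(\<lambda>n. LINT x|M. f (v n x) x) \<longlonglongrightarrow> (LINT x|M. f (u x) x)"
    if f: "\<And>y x. isCont (\<lambda>y. f y x) y" and meas: "\<And>n. (\<lambda>x. f (v n x) x) \<in> borel_measurable M"
      "(\<lambda>x. f (u x) x) \<in> borel_measurable M"
      and bd: "\<And>B y x. B \<ge> 0 \<Longrightarrow> \<bar>y\<bar> \<le> B \<Longrightarrow> x \<in> {0..L} \<Longrightarrow> \<bar>f y x\<bar> \<le> K B" for f :: "real \<Rightarrow> real \<Rightarrow> real" and K
  proof -
    obtain B where B: "B \<ge> 0" "\<And>x. x \<in> {0..L} \<Longrightarrow> \<bar>u x\<bar> \<le> B"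
      using continuous_bounded_M [OF W_rep_cont [OF u(1)]] by metis
    have "\<forall>\<^sub>F n in sequentially. \<forall>x\<in>UNIV. dist (v n x) (u x) < 1"
      using u(2) unfolding uniform_limit_iff by simp
    then obtain N where N: "\<And>n x. n \<ge> N \<Longrightarrow> \<bar>v n x - u x\<bar> < 1"
      by (auto simp: eventually_sequentially dist_real_def)
    have "(\<lambda>n. LINT x|M. f (v (n + N) x) x) \<longlonglongrightarrow> (LINT x|M. f (u x) x)"
    proof (rule integral_dominated_convergence)
      show "integrable M (\<lambda>x. K (B + 1))" by simp
      show "AE x in M. (\<lambda>n. f (v (n + N) x) x) \<longlonglongrightarrow> f (u x) x"
      proof (intro AE_I2 isCont_tendsto_compose [OF f] LIMSEQ_ignore_initial_segment)
        show "(\<lambda>n. v n x) \<longlonglongrightarrow> u x" for x using tendsto_uniform_limitI [OF u(2)] by simp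
      qed
      show "AE x in M. norm (f (v (n + N) x) x) \<le> K (B + 1)" for n
      proof (rule AE_I2)
        fix x assume "x \<in> space M"
        then have x: "x \<in> {0..L}" by simp
        have "\<bar>v (n + N) x\<bar> \<le> B + 1" using N [of "n + N" x] B(2) [OF x] by simp
        then show "norm (f (v (n + N) x) x) \<le> K (B + 1)"
          using bd [of "B + 1"] B(1) x by simp
      qed
    qed (use meas in auto)
    then show ?thesis by (rule LIMSEQ_offset)
  qed
  obtain Bw where Bw: "Bw \<ge> 0" "\<And>x. x \<in> {0..L} \<Longrightarrow> \<bar>w x\<bar> \<le> Bw"
    using continuous_bounded_M [OF W_rep_cont [OF w]] by metis
  have ip_lim: "ip (\<lambda>x. u x - w x) k = 0" if k: "continuous_on {0..L} k" "\<And>x. \<bar>k x\<bar> \<le> 1"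
    and k0: "\<And>n. ip (\<lambda>x. v n x - w x) k = 0" for k
  proof -
    have "(\<lambda>n. ip (\<lambda>x. v n x - w x) k) \<longlonglongrightarrow> ip (\<lambda>x. u x - w x) k"
    proof (rule lim [where K="\<lambda>B. (B + Bw) * 1"])
      show "(\<lambda>x. (v n x - w x) * k x) \<in> borel_measurable M" for n
        by (intro continuous_measurable_M continuous_intros W_rep_cont [OF W] W_rep_cont [OF w] k)
      show "(\<lambda>x. (u x - w x) * k x) \<in> borel_measurable M"
        by (intro continuous_measurable_M continuous_intros W_rep_cont [OF u(1)] W_rep_cont [OF w] k)
      fix B y x :: real assume B: "B \<ge> 0" "\<bar>y\<bar> \<le> B" "x \<in> {0..L}"
      have "\<bar>y - w x\<bar> \<le> B + Bw" using B Bw(2) [of x] by simp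
      then show "\<bar>(y - w x) * k x\<bar> \<le> (B + Bw) * 1"
        unfolding abs_mult using k(2) B Bw(1) by (intro mult_mono) auto
    qed (intro continuous_intros)
    then show ?thesis unfolding k0 by (simp add: LIMSEQ_const_iff)
  qed
  have adm_u: "admissible w u g'"
    unfolding admissible_def
    using ip_lim [of "sn w"] ip_lim [of "cs w"] u(1) adm W_rep_cont [OF W_rep_sin [OF w]] W_rep_cont [OF W_rep_cos [OF w]]
    by (simp add: admissible_def)
  have n1: "(\<lambda>n. (nrm (\<lambda>x. v n x - w x))\<^sup>2) \<longlonglongrightarrow> (nrm (\<lambda>x. u x - w x))\<^sup>2"
    unfolding L2_norm_on_power2
  proof (rule lim [where K="\<lambda>B. (B + Bw)\<^sup>2"])
    show "(\<lambda>x. (v n x - w x)\<^sup>2) \<in> borel_measurable M" for n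
      by (intro continuous_measurable_M continuous_intros W_rep_cont [OF W] W_rep_cont [OF w])
    show "(\<lambda>x. (u x - w x)\<^sup>2) \<in> borel_measurable M"
      by (intro continuous_measurable_M continuous_intros W_rep_cont [OF u(1)] W_rep_cont [OF w])
    fix B y x :: real assume B: "B \<ge> 0" "\<bar>y\<bar> \<le> B" "x \<in> {0..L}"
    have "\<bar>y - w x\<bar> \<le> \<bar>B + Bw\<bar>" using B Bw(2) [of x] by simp
    then show "\<bar>(y - w x)\<^sup>2\<bar> \<le> (B + Bw)\<^sup>2" by (simp only: abs_power2 abs_le_square_iff)
  qed (intro continuous_intros)
  have n2: "(\<lambda>n. energy (g n)) \<longlonglongrightarrow> energy g'"
    using G(2) by (simp add: energy_def g'_def)
  have "(\<lambda>n. J (v n) (g n)) \<longlonglongrightarrow> J u g'"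
    unfolding J_def step_functional_def using \<tau> p_gt_1
    by (intro tendsto_add tendsto_divide tendsto_const n1 n2) auto
  moreover have "(\<lambda>n. m + (1/4) ^ n) \<longlonglongrightarrow> m + 0"
    by (intro tendsto_intros LIMSEQ_power_zero) auto
  ultimately have "J u g' \<le> m + 0"
    by (rule LIMSEQ_le) (use J_less less_imp_le in blast)
  then have "J u g' \<le> J v' g''" if "admissible w v' g''" for v' g'' using m_le [OF that] by simp
  then show ?thesis using adm_u by (intro that [of u g']) (simp_all only: J_def)
qed

section \<open>The Euler-Lagrange equation with multipliers\<close>

definition EL :: "real \<Rightarrow> (real \<Rightarrow> real) \<Rightarrow> (real \<Rightarrow> real) \<Rightarrow> (real \<Rightarrow> real) \<Rightarrow>
    (real \<Rightarrow> real) \<Rightarrow> (real \<Rightarrow> real) \<Rightarrow> real" where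
  "EL \<tau> w v g \<phi> \<phi>' = (LINT x|M. pflux p (g x + phi_deriv) * \<phi>' x) + ip (\<lambda>x. v x - w x) \<phi> / \<tau>"

lemma EL_linear:
  assumes w: "W_rep w h" and v: "W_rep v g" and 1: "W_rep \<phi>1 \<phi>1'" and 2: "W_rep \<phi>2 \<phi>2'"
  shows "EL \<tau> w v g (\<lambda>x. a * \<phi>1 x + b * \<phi>2 x) (\<lambda>x. a * \<phi>1' x + b * \<phi>2' x) =
    a * EL \<tau> w v g \<phi>1 \<phi>1' + b * EL \<tau> w v g \<phi>2 \<phi>2'"
proof -
  have i: "integrable M (\<lambda>x. pflux p (g x + phi_deriv) * \<phi>1' x)" "integrable M (\<lambda>x. pflux p (g x + phi_deriv) * \<phi>2' x)"
    by (intro pflux_mult_integrable p_gt_1 p_int_theta [OF v] W_rep_p_int [OF 1] W_rep_p_int [OF 2])+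
  have "(LINT x|M. pflux p (g x + phi_deriv) * (a * \<phi>1' x + b * \<phi>2' x)) =
      (LINT x|M. a * (pflux p (g x + phi_deriv) * \<phi>1' x) + b * (pflux p (g x + phi_deriv) * \<phi>2' x))"
    by (intro Bochner_Integration.integral_cong) (auto simp: algebra_simps)
  also have "\<dots> = a * (LINT x|M. pflux p (g x + phi_deriv) * \<phi>1' x) + b * (LINT x|M. pflux p (g x + phi_deriv) * \<phi>2' x)"
    using i by simp
  finally have A: "(LINT x|M. pflux p (g x + phi_deriv) * (a * \<phi>1' x + b * \<phi>2' x)) =
      a * (LINT x|M. pflux p (g x + phi_deriv) * \<phi>1' x) + b * (LINT x|M. pflux p (g x + phi_deriv) * \<phi>2' x)" .
  have d: "sq_int M (\<lambda>x. v x - w x)" by (intro sq_int_diff W_rep_sq_int [OF v] W_rep_sq_int [OF w])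
  have B: "ip (\<lambda>x. v x - w x) (\<lambda>x. a * \<phi>1 x + b * \<phi>2 x) = a * ip (\<lambda>x. v x - w x) \<phi>1 + b * ip (\<lambda>x. v x - w x) \<phi>2"
    using ip_linear [OF W_rep_sq_int [OF 1] W_rep_sq_int [OF 2] d, of a b] by (simp only: mult.commute [of "v _ - w _"])
  show ?thesis unfolding EL_def A B by (simp add: algebra_simps add_divide_distrib)
qed

text \<open>Convexity replaces differentiation of the energy: its increment is bounded above by the
  flux at the perturbed slope. After division by e, dominated convergence moves the flux back to the
  minimiser.\<close>

lemma minimizer_EL_nonneg:
  assumes w: "W_rep w h" and \<tau>: "\<tau> > 0" and v: "admissible w v g"
    and min: "\<And>v' g'. admissible w v' g' \<Longrightarrow> step_functional \<tau> w v g \<le> step_functional \<tau> w v' g'"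
    and \<phi>: "W_rep \<phi> \<phi>'" and 0: "ip \<phi> (sn w) = 0" "ip \<phi> (cs w) = 0"
  shows "EL \<tau> w v g \<phi> \<phi>' \<ge> 0"
proof -
  have V: "W_rep v g" using v by (simp only: admissible_def)
  define G where "G x = g x + phi_deriv" for x
  have G_p: "p_int p M G" unfolding G_def by (rule p_int_theta [OF V])
  have \<phi>_p: "p_int p M \<phi>'" by (rule W_rep_p_int [OF \<phi>])
  have Ge_p: "p_int p M (\<lambda>x. G x + e * \<phi>' x)" for e
    using p_gt_1 by (intro p_int_add p_int_cmult G_p \<phi>_p) simp
  have d: "sq_int M (\<lambda>x. v x - w x)" by (intro sq_int_diff W_rep_sq_int [OF V] W_rep_sq_int [OF w])
  define B where "B = ip (\<lambda>x. v x - w x) \<phi>"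
  define C where "C = (nrm \<phi>)\<^sup>2"
  have pos: "(LINT x|M. pflux p (G x + e * \<phi>' x) * \<phi>' x) + B / \<tau> + e * C / (2 * \<tau>) \<ge> 0" if e: "e > 0" for e
  proof -
    have "step_functional \<tau> w v g \<le> step_functional \<tau> w (\<lambda>x. v x + e * \<phi> x) (\<lambda>x. g x + e * \<phi>' x)"
      by (rule min [OF admissible_combination [OF w v \<phi> 0]])
    moreover have "energy (\<lambda>x. g x + e * \<phi>' x) - energy g \<le> p * e * (LINT x|M. pflux p (G x + e * \<phi>' x) * \<phi>' x)"
    proof -
      have i1: "integrable M (\<lambda>x. \<bar>G x + e * \<phi>' x\<bar> powr p)" "integrable M (\<lambda>x. \<bar>G x\<bar> powr p)"
        using Ge_p [of e] G_p by (simp_all add: p_int_def)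
      have i2: "integrable M (\<lambda>x. pflux p (G x + e * \<phi>' x) * \<phi>' x)"
        by (intro pflux_mult_integrable p_gt_1 Ge_p \<phi>_p)
      have "energy (\<lambda>x. g x + e * \<phi>' x) - energy g = (LINT x|M. \<bar>G x + e * \<phi>' x\<bar> powr p - \<bar>G x\<bar> powr p)"
        using i1 by (simp add: energy_def G_def algebra_simps)
      also have "\<dots> \<le> (LINT x|M. p * e * (pflux p (G x + e * \<phi>' x) * \<phi>' x))"
      proof (rule integral_mono)
        fix x
        show "\<bar>G x + e * \<phi>' x\<bar> powr p - \<bar>G x\<bar> powr p \<le> p * e * (pflux p (G x + e * \<phi>' x) * \<phi>' x)"
          using powr_convex_ineq [OF p_gt_1, where x="G x" and y="G x + e * \<phi>' x"] by (simp add: algebra_simps)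
      qed (use i1 i2 in auto)
      finally show ?thesis by simp
    qed
    moreover have "(nrm (\<lambda>x. v x + e * \<phi> x - w x))\<^sup>2 = (nrm (\<lambda>x. v x - w x))\<^sup>2 + 2 * e * B + e\<^sup>2 * C"
    proof -
      have "(LINT x|M. (v x + e * \<phi> x - w x)\<^sup>2) =
          (LINT x|M. (v x - w x)\<^sup>2 + 2 * e * ((v x - w x) * \<phi> x) + e\<^sup>2 * (\<phi> x)\<^sup>2)"
        by (intro Bochner_Integration.integral_cong) (auto simp: power2_eq_square algebra_simps)
      also have "\<dots> = (LINT x|M. (v x - w x)\<^sup>2) + 2 * e * B + e\<^sup>2 * (LINT x|M. (\<phi> x)\<^sup>2)"
        using sq_int_integrable [OF d] sq_int_integrable [OF W_rep_sq_int [OF \<phi>]]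
          sq_int_mult_integrable [OF d W_rep_sq_int [OF \<phi>]] by (simp add: B_def)
      finally show ?thesis by (simp add: L2_norm_on_power2 C_def)
    qed
    moreover have "(energy (\<lambda>x. g x + e * \<phi>' x) - energy g) / p \<le> e * (LINT x|M. pflux p (G x + e * \<phi>' x) * \<phi>' x)"
      if "energy (\<lambda>x. g x + e * \<phi>' x) - energy g \<le> p * e * (LINT x|M. pflux p (G x + e * \<phi>' x) * \<phi>' x)"
      using that p_gt_1 by (simp add: field_simps)
    ultimately have "0 \<le> e * (LINT x|M. pflux p (G x + e * \<phi>' x) * \<phi>' x) + (2 * e * B + e\<^sup>2 * C) / (2 * \<tau>)"
      unfolding step_functional_def by (simp add: add_divide_distrib diff_divide_distrib)
    also have "\<dots> = e * ((LINT x|M. pflux p (G x + e * \<phi>' x) * \<phi>' x) + B / \<tau> + e * C / (2 * \<tau>))"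
      using \<tau> by (simp add: field_simps power2_eq_square)
    finally show ?thesis using e by (simp add: zero_le_mult_iff)
  qed
  define e where "e n = 1 / real (Suc n)" for n
  have e_pos: "e n > 0" "e n \<le> 1" for n by (auto simp: e_def)
  have e_0: "e \<longlonglongrightarrow> 0" unfolding e_def by (rule LIMSEQ_Suc [OF lim_1_over_n])
  have [measurable]: "G \<in> borel_measurable M" "\<phi>' \<in> borel_measurable M"
    using G_p \<phi>_p by (auto intro: p_int_measurable)
  have "(\<lambda>n. LINT x|M. pflux p (G x + e n * \<phi>' x) * \<phi>' x) \<longlonglongrightarrow> (LINT x|M. pflux p (G x) * \<phi>' x)"
  proof (rule integral_dominated_convergence)
    show "integrable M (\<lambda>x. 2 powr p * (\<bar>G x\<bar> powr p + \<bar>\<phi>' x\<bar> powr p) + \<bar>\<phi>' x\<bar> powr p)"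
      using G_p \<phi>_p by (auto simp: p_int_def)
    show "AE x in M. (\<lambda>n. pflux p (G x + e n * \<phi>' x) * \<phi>' x) \<longlonglongrightarrow> pflux p (G x) * \<phi>' x"
    proof (rule AE_I2)
      fix x
      have "(\<lambda>n. G x + e n * \<phi>' x) \<longlonglongrightarrow> G x + 0 * \<phi>' x" by (intro tendsto_intros e_0)
      then have "(\<lambda>n. G x + e n * \<phi>' x) \<longlonglongrightarrow> G x" by simp
      moreover have "isCont (pflux p) (G x)"
        using continuous_pflux [OF p_gt_1] by (simp add: continuous_on_eq_continuous_at)
      ultimately have "(\<lambda>n. pflux p (G x + e n * \<phi>' x)) \<longlonglongrightarrow> pflux p (G x)"
        by (rule isCont_tendsto_compose [rotated])
      then show "(\<lambda>n. pflux p (G x + e n * \<phi>' x) * \<phi>' x) \<longlonglongrightarrow> pflux p (G x) * \<phi>' x"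
        by (rule tendsto_mult_right)
    qed
    show "AE x in M. norm (pflux p (G x + e n * \<phi>' x) * \<phi>' x) \<le>
      2 powr p * (\<bar>G x\<bar> powr p + \<bar>\<phi>' x\<bar> powr p) + \<bar>\<phi>' x\<bar> powr p" for n
    proof (rule AE_I2)
      fix x
      have "\<bar>pflux p (G x + e n * \<phi>' x) * \<phi>' x\<bar> \<le> \<bar>G x + e n * \<phi>' x\<bar> powr p + \<bar>\<phi>' x\<bar> powr p"
        using p_gt_1 by (intro pflux_mult_le) simp
      also have "\<bar>G x + e n * \<phi>' x\<bar> powr p \<le> 2 powr p * (\<bar>G x\<bar> powr p + \<bar>e n * \<phi>' x\<bar> powr p)"
        using p_gt_1 by (intro powr_abs_add_le) simp
      also have "\<bar>e n * \<phi>' x\<bar> powr p \<le> \<bar>\<phi>' x\<bar> powr p"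
        using e_pos [of n] p_gt_1 by (intro powr_mono2) (auto simp: abs_mult intro!: mult_left_le_one_le)
      finally show "norm (pflux p (G x + e n * \<phi>' x) * \<phi>' x) \<le>
          2 powr p * (\<bar>G x\<bar> powr p + \<bar>\<phi>' x\<bar> powr p) + \<bar>\<phi>' x\<bar> powr p" by simp
    qed
  qed measurable
  then have "(\<lambda>n. (LINT x|M. pflux p (G x + e n * \<phi>' x) * \<phi>' x) + B / \<tau> + e n * C / (2 * \<tau>)) \<longlonglongrightarrow>
      (LINT x|M. pflux p (G x) * \<phi>' x) + B / \<tau> + 0 * C / (2 * \<tau>)"
    using \<tau> by (intro tendsto_add tendsto_divide tendsto_mult tendsto_const e_0) auto
  then have "0 \<le> (LINT x|M. pflux p (G x) * \<phi>' x) + B / \<tau> + 0 * C / (2 * \<tau>)"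
    by (rule LIMSEQ_le_const) (use pos e_pos in blast)
  then show ?thesis by (simp add: EL_def B_def G_def)
qed

lemma minimizer_EL:
  assumes w: "W_rep w h" and \<tau>: "\<tau> > 0" and v: "admissible w v g"
    and min: "\<And>v' g'. admissible w v' g' \<Longrightarrow> step_functional \<tau> w v g \<le> step_functional \<tau> w v' g'"
    and \<phi>: "W_rep \<phi> \<phi>'" and 0: "ip \<phi> (sn w) = 0" "ip \<phi> (cs w) = 0"
  shows "EL \<tau> w v g \<phi> \<phi>' = 0"
proof (rule antisym)
  show "0 \<le> EL \<tau> w v g \<phi> \<phi>'" by (rule minimizer_EL_nonneg [OF w \<tau> v min \<phi> 0])
  have V: "W_rep v g" using v by (simp only: admissible_def)
  have "0 \<le> EL \<tau> w v g (\<lambda>x. (-1) * \<phi> x + 0 * \<phi> x) (\<lambda>x. (-1) * \<phi>' x + 0 * \<phi>' x)"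
  proof (rule minimizer_EL_nonneg [OF w \<tau> v min W_rep_linear [OF \<phi> \<phi>]])
    show "ip (\<lambda>x. (-1) * \<phi> x + 0 * \<phi> x) (sn w) = 0" "ip (\<lambda>x. (-1) * \<phi> x + 0 * \<phi> x) (cs w) = 0"
      using 0 by simp_all
  qed
  also have "\<dots> = (-1) * EL \<tau> w v g \<phi> \<phi>' + 0 * EL \<tau> w v g \<phi> \<phi>'" by (rule EL_linear [OF w V \<phi> \<phi>])
  finally show "EL \<tau> w v g \<phi> \<phi>' \<le> 0" by simp
qed

text \<open>This is \<open>det A_T(\<theta>)\<close> of the problem, for the angle
  \<open>w + ph\<close>.\<close>

definition gram_det :: "(real \<Rightarrow> real) \<Rightarrow> real" where
  "gram_det w = ip (sn w) (sn w) * ip (cs w) (cs w) - (ip (sn w) (cs w))\<^sup>2"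

lemma trig_ip_bound:
  assumes "W_rep w h" "\<And>x. \<bar>f x\<bar> \<le> 1" "\<And>x. \<bar>k x\<bar> \<le> 1" "sq_int M f" "sq_int M k"
  shows "\<bar>ip f k\<bar> \<le> L"
proof -
  have "\<bar>ip f k\<bar> \<le> (LINT x|M. \<bar>f x * k x\<bar>)" by (rule integral_abs_bound)
  also have "\<dots> \<le> (LINT x|M. 1)"
  proof (rule integral_mono)
    show "integrable M (\<lambda>x. \<bar>f x * k x\<bar>)" using sq_int_mult_integrable [OF assms(4,5)] by auto
    show "\<bar>f x * k x\<bar> \<le> 1" for x
      using mult_mono [OF assms(2) assms(3), of x x] by (simp add: abs_mult)
  qed simp
  also have "\<dots> = L" using integral_const_M [of 1] by simp
  finally show ?thesis .
qed

text \<open>Made for the flux term of \<open>EL\<close> on \<open>sn w\<close> and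
  \<open>cs w\<close>: the chain rule gives their derivatives as a trigonometric factor F times the
  slope \<open>h + phi_deriv\<close> of the previous iterate.\<close>

lemma trig_energy_bound:
  assumes w: "W_rep w h" and F: "F \<in> borel_measurable M" "\<And>x. \<bar>F x\<bar> \<le> 1" and v: "W_rep v g"
  shows "\<bar>LINT x|M. pflux p (g x + phi_deriv) * (F x * (h x + phi_deriv))\<bar> \<le> energy g + energy h"
proof -
  have Fp: "p_int p M (\<lambda>x. F x * (h x + phi_deriv))"
    using p_gt_1 by (intro p_int_mult_bounded p_int_theta [OF w] F) auto
  have "\<bar>LINT x|M. pflux p (g x + phi_deriv) * (F x * (h x + phi_deriv))\<bar> \<le>
      energy g + (LINT x|M. \<bar>F x * (h x + phi_deriv)\<bar> powr p)"
    using pflux_mult_integral_le [OF p_gt_1 p_int_theta [OF v] Fp] by (simp add: energy_def)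
  also have "(LINT x|M. \<bar>F x * (h x + phi_deriv)\<bar> powr p) \<le> energy h"
    unfolding energy_def
  proof (rule integral_mono)
    show "integrable M (\<lambda>x. \<bar>F x * (h x + phi_deriv)\<bar> powr p)" using Fp by (simp add: p_int_def)
    show "integrable M (\<lambda>x. \<bar>h x + phi_deriv\<bar> powr p)" by (rule energy_integrable [OF w])
    show "\<bar>F x * (h x + phi_deriv)\<bar> powr p \<le> \<bar>h x + phi_deriv\<bar> powr p" for x
      using p_gt_1 F(2) [of x] by (intro powr_mono2) (auto simp: abs_mult intro!: mult_left_le_one_le)
  qed
  finally show ?thesis by simp
qed

text \<open>The multipliers come from subtracting from \<open>\<phi>\<close> its projection onto the span of \<open>sn w\<close> and
  \<open>cs w\<close>. The time difference does not enter the bound: it is orthogonal to both functions.\<close>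

theorem minimizer_multipliers:
  assumes w: "W_rep w h" and \<tau>: "\<tau> > 0" and v: "admissible w v g"
    and min: "\<And>v' g'. admissible w v' g' \<Longrightarrow> step_functional \<tau> w v g \<le> step_functional \<tau> w v' g'"
    and det: "gram_det w \<ge> \<delta>" "\<delta> > 0"
  obtains l1 l2 where "\<bar>l1\<bar> \<le> 2 * L * (energy g + energy h) / \<delta>" "\<bar>l2\<bar> \<le> 2 * L * (energy g + energy h) / \<delta>"
    "\<And>\<phi> \<phi>'. W_rep \<phi> \<phi>' \<Longrightarrow> EL \<tau> w v g \<phi> \<phi>' = l1 * ip (sn w) \<phi> - l2 * ip (cs w) \<phi>"
proof -
  have V: "W_rep v g" using v by (simp only: admissible_def)
  define S' where "S' x = cos (w x + ph x) * (h x + phi_deriv)" for x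
  define C' where "C' x = - sin (w x + ph x) * (h x + phi_deriv)" for x
  have S: "W_rep (sn w) S'" unfolding S'_def by (rule W_rep_sin [OF w])
  have C: "W_rep (cs w) C'" unfolding C'_def by (rule W_rep_cos [OF w])
  note Ssq = sn_sq_int [OF w] and Csq = cs_sq_int [OF w]
  define ss where "ss = ip (sn w) (sn w)"
  define cc where "cc = ip (cs w) (cs w)"
  define sc where "sc = ip (sn w) (cs w)"
  define D where "D = gram_det w"
  have D_eq: "D = ss * cc - sc\<^sup>2" by (simp add: D_def gram_det_def ss_def cc_def sc_def)
  have D_pos: "D > 0" "D \<ge> \<delta>" using det by (auto simp: D_def)
  have bounds: "\<bar>ss\<bar> \<le> L" "\<bar>cc\<bar> \<le> L" "\<bar>sc\<bar> \<le> L"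
    unfolding ss_def cc_def sc_def by (intro trig_ip_bound [OF w] Ssq Csq; simp)+
  define RS where "RS = EL \<tau> w v g (sn w) S'"
  define RC where "RC = EL \<tau> w v g (cs w) C'"
  define A where "A = energy g + energy h"
  have A0: "A \<ge> 0" using energy_nonneg [of g] energy_nonneg [of h] by (simp add: A_def)
  have RS: "\<bar>RS\<bar> \<le> A"
  proof -
    have "RS = (LINT x|M. pflux p (g x + phi_deriv) * (cos (w x + ph x) * (h x + phi_deriv)))"
      using v by (simp add: RS_def EL_def S'_def admissible_def)
    also have "\<bar>\<dots>\<bar> \<le> A" unfolding A_def
      by (intro trig_energy_bound [OF w _ _ V] sq_int_measurable [OF Csq]) simp
    finally show ?thesis .
  qed
  have RC: "\<bar>RC\<bar> \<le> A"
  proof -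
    have "RC = (LINT x|M. pflux p (g x + phi_deriv) * (- sin (w x + ph x) * (h x + phi_deriv)))"
      using v by (simp add: RC_def EL_def C'_def admissible_def)
    also have "\<bar>\<dots>\<bar> \<le> A" unfolding A_def
      by (intro trig_energy_bound [OF w _ _ V] borel_measurable_uminus sq_int_measurable [OF Ssq]) simp
    finally show ?thesis .
  qed
  have quot: "\<bar>(x * R1 - y * R2) / D\<bar> \<le> 2 * L * A / \<delta>"
    if "\<bar>x\<bar> \<le> L" "\<bar>y\<bar> \<le> L" "\<bar>R1\<bar> \<le> A" "\<bar>R2\<bar> \<le> A" for x y R1 R2
  proof -
    have "\<bar>x * R1\<bar> \<le> L * A" "\<bar>y * R2\<bar> \<le> L * A"
      unfolding abs_mult using that L_pos by (auto intro!: mult_mono)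
    then have "\<bar>x * R1 - y * R2\<bar> \<le> 2 * L * A" by linarith
    then have "\<bar>x * R1 - y * R2\<bar> / D \<le> 2 * L * A / D" using D_pos by (intro divide_right_mono) auto
    also have "\<dots> \<le> 2 * L * A / \<delta>" using D_pos det L_pos A0 by (intro divide_left_mono mult_nonneg_nonneg) auto
    finally show ?thesis using D_pos by simp
  qed
  show ?thesis
  proof (rule that)
    show "\<bar>(cc * RS - sc * RC) / D\<bar> \<le> 2 * L * (energy g + energy h) / \<delta>"
      using quot [OF bounds(2,3) RS RC] by (simp only: A_def)
    show "\<bar>(sc * RS - ss * RC) / D\<bar> \<le> 2 * L * (energy g + energy h) / \<delta>"
      using quot [OF bounds(3,1) RS RC] by (simp only: A_def)
    fix \<phi> \<phi>' assume \<phi>: "W_rep \<phi> \<phi>'"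
    note \<phi>sq = W_rep_sq_int [OF \<phi>]
    define a where "a = ip (sn w) \<phi>"
    define b where "b = ip (cs w) \<phi>"
    \<comment> \<open>Coefficients of the projection of \<phi> onto the two trigonometric functions,
      by Cramer's rule; D is the determinant of the Gram matrix.\<close>
    define \<alpha> where "\<alpha> = (cc * a - sc * b) / D"
    define \<beta> where "\<beta> = (ss * b - sc * a) / D"
    note SC = W_rep_linear [OF S C, of \<alpha> \<beta>]
    have \<psi>: "W_rep (\<lambda>x. 1 * \<phi> x + (-1) * (\<alpha> * sn w x + \<beta> * cs w x)) (\<lambda>x. 1 * \<phi>' x + (-1) * (\<alpha> * S' x + \<beta> * C' x))"
      by (rule W_rep_linear [OF \<phi> SC])
    have solve: "\<alpha> * ss + \<beta> * sc = a" "\<alpha> * sc + \<beta> * cc = b"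
    proof -
      have "\<alpha> * ss + \<beta> * sc = a * D / D" unfolding \<alpha>_def \<beta>_def
        by (simp only: times_divide_eq_left flip: add_divide_distrib) (simp add: D_eq power2_eq_square algebra_simps)
      then show "\<alpha> * ss + \<beta> * sc = a" using D_pos by simp
      have "\<alpha> * sc + \<beta> * cc = b * D / D" unfolding \<alpha>_def \<beta>_def
        by (simp only: times_divide_eq_left flip: add_divide_distrib) (simp add: D_eq power2_eq_square algebra_simps)
      then show "\<alpha> * sc + \<beta> * cc = b" using D_pos by simp
    qed
    have sc': "ip (cs w) (sn w) = sc" by (simp add: sc_def mult.commute)
    have a': "ip \<phi> (sn w) = a" "ip \<phi> (cs w) = b" by (simp_all add: a_def b_def mult.commute)
    have z1: "ip (\<lambda>x. 1 * \<phi> x + (-1) * (\<alpha> * sn w x + \<beta> * cs w x)) (sn w) = 0"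
      unfolding ip_linear [OF \<phi>sq W_rep_sq_int [OF SC] Ssq] ip_linear [OF Ssq Csq Ssq] a' sc'
      using solve by (simp flip: ss_def)
    have z2: "ip (\<lambda>x. 1 * \<phi> x + (-1) * (\<alpha> * sn w x + \<beta> * cs w x)) (cs w) = 0"
      unfolding ip_linear [OF \<phi>sq W_rep_sq_int [OF SC] Csq] ip_linear [OF Ssq Csq Csq] a'
      using solve by (simp flip: cc_def sc_def)
    have "EL \<tau> w v g (\<lambda>x. 1 * \<phi> x + (-1) * (\<alpha> * sn w x + \<beta> * cs w x))
        (\<lambda>x. 1 * \<phi>' x + (-1) * (\<alpha> * S' x + \<beta> * C' x)) = 0"
      by (rule minimizer_EL [OF w \<tau> v min \<psi> z1 z2])
    then have "EL \<tau> w v g \<phi> \<phi>' = \<alpha> * RS + \<beta> * RC"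
      unfolding EL_linear [OF w V \<phi> SC] EL_linear [OF w V S C] by (simp add: RS_def RC_def)
    also have "\<dots> = (cc * RS - sc * RC) / D * a - (sc * RS - ss * RC) / D * b"
      unfolding \<alpha>_def \<beta>_def
      by (simp only: times_divide_eq_left flip: add_divide_distrib diff_divide_distrib) (simp add: algebra_simps)
    finally show "EL \<tau> w v g \<phi> \<phi>' = (cc * RS - sc * RC) / D * ip (sn w) \<phi> - (sc * RS - ss * RC) / D * ip (cs w) \<phi>"
      by (simp only: a_def b_def)
  qed
qed

text \<open>If the determinant vanished, the unit tangent (cos, sin) of the angle would be
  orthogonal to a fixed vector, hence constant up to sign, and by continuity constant. Its integral
  could then not be zero, so the curve would not close.\<close>

lemma gram_det_pos:
  assumes w: "W_rep w h" and s0: "(LINT x|M. sn w x) = 0" and c0: "(LINT x|M. cs w x) = 0"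
  shows "gram_det w > 0"
proof (rule ccontr)
  assume "\<not> gram_det w > 0"
  then have det: "gram_det w \<le> 0" by simp
  note Ssq = sn_sq_int [OF w] and Csq = cs_sq_int [OF w]
  define ss where "ss = ip (sn w) (sn w)"
  define cc where "cc = ip (cs w) (cs w)"
  define sc where "sc = ip (sn w) (cs w)"
  have D_eq: "gram_det w = ss * cc - sc\<^sup>2" by (simp add: gram_det_def ss_def cc_def sc_def)
  have nonneg: "ss \<ge> 0" "cc \<ge> 0" by (simp_all add: ss_def cc_def)
  have i: "integrable M (\<lambda>x. sn w x * sn w x)" "integrable M (\<lambda>x. cs w x * cs w x)" "integrable M (\<lambda>x. sn w x * cs w x)"
    by (intro sq_int_mult_integrable Ssq Csq)+
  have "ss + cc = (LINT x|M. sn w x * sn w x + cs w x * cs w x)" unfolding ss_def cc_def using i by simp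
  also have "\<dots> = (LINT x|M. 1)"
    by (intro Bochner_Integration.integral_cong) (simp_all flip: power2_eq_square)
  finally have sum: "ss + cc = L" using integral_const_M [of 1] by simp
  text \<open>Equality in Cauchy-Schwarz: \<open>sn w\<close> and \<open>cs w\<close> are proportional.\<close>
  have quad: "ip (\<lambda>x. a * sn w x + b * cs w x) (\<lambda>x. a * sn w x + b * cs w x) = a\<^sup>2 * ss + 2 * a * b * sc + b\<^sup>2 * cc" for a b
  proof -
    have "ip (\<lambda>x. a * sn w x + b * cs w x) (\<lambda>x. a * sn w x + b * cs w x) =
      (LINT x|M. a\<^sup>2 * (sn w x * sn w x) + 2 * a * b * (sn w x * cs w x) + b\<^sup>2 * (cs w x * cs w x))"
      by (intro Bochner_Integration.integral_cong) (auto simp: power2_eq_square algebra_simps)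
    also have "\<dots> = a\<^sup>2 * ss + 2 * a * b * sc + b\<^sup>2 * cc" using i by (simp add: ss_def sc_def cc_def)
    finally show ?thesis .
  qed
  \<comment> \<open>A vector on which the Gram form is not positive: \<open>(cc, - sc)\<close>,
    whose value is \<open>cc\<close> times the determinant, or \<open>(0, 1)\<close> when
    \<open>cc\<close> is zero.\<close>
  obtain a b where ab: "a\<^sup>2 + b\<^sup>2 \<noteq> 0" "a\<^sup>2 * ss + 2 * a * b * sc + b\<^sup>2 * cc \<le> 0"
  proof (cases "cc > 0")
    case True
    have "cc\<^sup>2 * ss + 2 * cc * (- sc) * sc + (- sc)\<^sup>2 * cc = cc * gram_det w"
      by (simp add: D_eq power2_eq_square algebra_simps)
    also have "\<dots> \<le> 0" using True det by (simp add: mult_nonneg_nonpos)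
    finally show ?thesis using True by (intro that [of cc "- sc"]) (auto simp: sum_power2_eq_zero_iff)
  next
    case False
    then show ?thesis using nonneg by (intro that [of 0 1]) auto
  qed
  define F where "F x = a * sn w x + b * cs w x" for x
  \<comment> \<open>The component of the tangent along the remaining direction:
    \<open>(F x)^2 + (H x)^2\<close> is constant, so the vanishing of F fixes H up to sign.\<close>
  define H where "H x = b * sn w x - a * cs w x" for x
  define r where "r = a\<^sup>2 + b\<^sup>2"
  have "r \<ge> 0" by (simp add: r_def)
  moreover have "r \<noteq> 0" unfolding r_def by (rule ab(1))
  ultimately have r: "r > 0" by simp
  have S_cont: "continuous_on A (sn w)" and C_cont: "continuous_on A (cs w)" for A
    by (intro W_rep_cont [OF W_rep_sin [OF w]] W_rep_cont [OF W_rep_cos [OF w]])+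
  have F_cont: "continuous_on A F" and H_cont: "continuous_on A H" for A
    unfolding F_def H_def by (intro continuous_intros S_cont C_cont)+
  have "(LINT x|M. (F x)\<^sup>2) \<le> 0" using ab(2) unfolding F_def power2_eq_square [of "_ + _"] quad .
  moreover have "(LINT x|M. (F x)\<^sup>2) \<ge> 0" by simp
  ultimately have "L2_norm_on M F = 0" unfolding L2_norm_on_def by simp
  then have F0: "AE x in M. F x = 0"
    by (rule L2_norm_on_eq_0 [rotated]) (intro continuous_sq_int_M F_cont)
  have FH: "(F x)\<^sup>2 + (H x)\<^sup>2 = r" for x
  proof -
    have "(a * s + b * c)\<^sup>2 + (b * s - a * c)\<^sup>2 = (a\<^sup>2 + b\<^sup>2) * (s\<^sup>2 + c\<^sup>2)" for s c :: real
      by (simp add: power2_eq_square algebra_simps)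
    then have "(F x)\<^sup>2 + (H x)\<^sup>2 = (a\<^sup>2 + b\<^sup>2) * ((sn w x)\<^sup>2 + (cs w x)\<^sup>2)"
      unfolding F_def H_def .
    then show ?thesis by (simp add: r_def)
  qed
  have H2: "(H x)\<^sup>2 = r" if x: "x \<in> {0<..<L}" for x
  proof -
    have F1: "integrable M (\<lambda>y. (F y)\<^sup>2)" by (intro continuous_integrable_M continuous_intros F_cont)
    have "(LINT y|M. (F y)\<^sup>2) = 0"
      by (rule integral_eq_zero_AE) (use F0 in \<open>eventually_elim, simp\<close>)
    moreover have "(LINT y|M. (F y)\<^sup>2) = integral {0..L} (\<lambda>y. (F y)\<^sup>2)"
    proof -
      have "(LINT y|M. (F y)\<^sup>2) = (LINT y|M. indicator {0..L} y * (F y)\<^sup>2)"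
        by (intro Bochner_Integration.integral_cong) (auto simp: indicator_def)
      also have "\<dots> = integral {0..L} (\<lambda>y. (F y)\<^sup>2)"
        by (intro integral_M_continuous continuous_intros F_cont) auto
      finally show ?thesis .
    qed
    ultimately have "\<forall>y\<in>{0..L}. (F y)\<^sup>2 = 0"
      using L_pos by (subst integral_eq_0_iff [symmetric]) (auto intro!: continuous_intros F_cont)
    then have "(F x)\<^sup>2 = 0" using x by auto
    then show ?thesis using FH [of x] by simp
  qed
  have "H x \<noteq> 0" if "x \<in> {0<..<L}" for x using H2 [OF that] r by auto
  moreover have "connected (H ` {0<..<L})" by (intro connected_continuous_image H_cont) auto
  ultimately have sign: "(\<forall>x\<in>{0<..<L}. H x > 0) \<or> (\<forall>x\<in>{0<..<L}. H x < 0)"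
  proof -
    assume nz: "\<And>x. x \<in> {0<..<L} \<Longrightarrow> H x \<noteq> 0" and conn: "connected (H ` {0<..<L})"
    show ?thesis
    proof (rule ccontr)
      assume "\<not> ?thesis"
      then obtain x y where xy: "x \<in> {0<..<L}" "y \<in> {0<..<L}" "H x \<le> 0" "H y \<ge> 0" by force
      then have "0 \<in> H ` {0<..<L}" using connectedD_interval [OF conn, of "H x" "H y" 0] by blast
      then show False using nz by force
    qed
  qed
  have HI: "(LINT x|M. H x) = 0"
  proof -
    have "integrable M (sn w)" "integrable M (cs w)" by (intro continuous_integrable_M S_cont C_cont)+
    then show ?thesis unfolding H_def using s0 c0 by simp
  qed
  have "H x = sqrt r" if "\<forall>x\<in>{0<..<L}. H x > 0" "x \<in> {0<..<L}" for x
    using H2 [OF that(2)] that by (metis less_imp_le real_sqrt_unique)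
  moreover have "H x = - sqrt r" if "\<forall>x\<in>{0<..<L}. H x < 0" "x \<in> {0<..<L}" for x
  proof -
    have "(- H x)\<^sup>2 = r" "- H x \<ge> 0" using H2 [OF that(2)] that by (auto intro: less_imp_le)
    then have "sqrt r = - H x" using real_sqrt_unique by blast
    then show ?thesis by simp
  qed
  ultimately have "\<exists>c. c \<noteq> 0 \<and> (\<forall>x\<in>space M. H x = c)"
    using sign r by (metis neg_equal_0_iff_equal real_sqrt_eq_zero_cancel_iff less_irrefl space_lebesgue_on)
  then obtain c where c: "c \<noteq> 0" "\<And>x. x \<in> space M \<Longrightarrow> H x = c" by blast
  have "(LINT x|M. H x) = (LINT x|M. c)" by (intro Bochner_Integration.integral_cong c(2)) auto
  then show False using HI c(1) L_pos integral_const_M [of c] by simp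
qed

end

section \<open>The time-discrete flow\<close>

context periodic_interval
begin

text \<open>Minimisation can be iterated forever, whereas the multipliers are controlled only while
  the Gram determinant is; hence iterates for every k but multipliers for \<open>k < N\<close>. The
  multiplier directions are taken at the old iterate, the flux at the new one.\<close>

definition scheme :: "real \<Rightarrow> real \<Rightarrow> nat \<Rightarrow> real \<Rightarrow> (nat \<Rightarrow> real \<Rightarrow> real) \<Rightarrow> (nat \<Rightarrow> real \<Rightarrow> real) \<Rightarrow>
    (nat \<Rightarrow> real) \<Rightarrow> (nat \<Rightarrow> real) \<Rightarrow> bool" where
  "scheme E \<Lambda> N \<tau> U G l1 l2 \<longleftrightarrow> \<tau> > 0 \<and> (\<forall>k. W_rep (U k) (G k)) \<and>
    (\<forall>k. ip (\<lambda>x. U (Suc k) x - U k x) (sn (U k)) = 0 \<and> ip (\<lambda>x. U (Suc k) x - U k x) (cs (U k)) = 0) \<and>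
    (\<forall>k. energy (G k) \<le> p * E) \<and>
    (\<forall>n. (\<Sum>k<n. (nrm (\<lambda>x. U (Suc k) x - U k x))\<^sup>2) \<le> 2 * \<tau> * E) \<and>
    (LINT x|M. sn (U 0) x) = 0 \<and> (LINT x|M. cs (U 0) x) = 0 \<and>
    (\<forall>k<N. \<bar>l1 k\<bar> \<le> \<Lambda> \<and> \<bar>l2 k\<bar> \<le> \<Lambda>) \<and>
    (\<forall>k<N. \<forall>\<phi> \<phi>'. W_rep \<phi> \<phi>' \<longrightarrow>
      EL \<tau> (U k) (U (Suc k)) (G (Suc k)) \<phi> \<phi>' = l1 k * ip (sn (U k)) \<phi> - l2 k * ip (cs (U k)) \<phi>)"

lemma schemeD:
  assumes "scheme E \<Lambda> N \<tau> U G l1 l2"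
  shows scheme_tau: "\<tau> > 0" and scheme_W: "\<And>k. W_rep (U k) (G k)"
    and scheme_orth: "\<And>k. ip (\<lambda>x. U (Suc k) x - U k x) (sn (U k)) = 0"
      "\<And>k. ip (\<lambda>x. U (Suc k) x - U k x) (cs (U k)) = 0"
    and scheme_energy: "\<And>k. energy (G k) \<le> p * E"
    and scheme_sum: "\<And>n. (\<Sum>k<n. (nrm (\<lambda>x. U (Suc k) x - U k x))\<^sup>2) \<le> 2 * \<tau> * E"
    and scheme_init: "(LINT x|M. sn (U 0) x) = 0" "(LINT x|M. cs (U 0) x) = 0"
    and scheme_l: "\<And>k. k < N \<Longrightarrow> \<bar>l1 k\<bar> \<le> \<Lambda>" "\<And>k. k < N \<Longrightarrow> \<bar>l2 k\<bar> \<le> \<Lambda>"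
    and scheme_EL: "\<And>k \<phi> \<phi>'. k < N \<Longrightarrow> W_rep \<phi> \<phi>' \<Longrightarrow>
      EL \<tau> (U k) (U (Suc k)) (G (Suc k)) \<phi> \<phi>' = l1 k * ip (sn (U k)) \<phi> - l2 k * ip (cs (U k)) \<phi>"
  using assms by (simp_all only: scheme_def)

lemma scheme_sq:
  assumes "scheme E \<Lambda> N \<tau> U G l1 l2"
  shows "sq_int M (U k)"
  by (rule W_rep_sq_int [OF scheme_W [OF assms]])

lemma scheme_E_nonneg:
  assumes "scheme E \<Lambda> N \<tau> U G l1 l2"
  shows "E \<ge> 0"
  using order_trans [OF energy_nonneg scheme_energy [OF assms]] p_gt_1 by (simp add: zero_le_mult_iff)

lemma scheme_step_le:
  assumes s: "scheme E \<Lambda> N \<tau> U G l1 l2"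
  shows "(nrm (\<lambda>x. U (Suc k) x - U k x))\<^sup>2 \<le> 2 * \<tau> * E"
proof -
  have "(nrm (\<lambda>x. U (Suc k) x - U k x))\<^sup>2 \<le> (\<Sum>j<Suc k. (nrm (\<lambda>x. U (Suc j) x - U j x))\<^sup>2)"
    by (simp add: sum_nonneg)
  also have "\<dots> \<le> 2 * \<tau> * E" by (rule scheme_sum [OF s])
  finally show ?thesis .
qed

text \<open>Cauchy-Schwarz over n increments whose squares have a total of at most
  \<open>2 * \<tau> * E\<close>: in terms of the elapsed time \<open>real n * \<tau>\<close> this is
  discrete Hoelder continuity of exponent 1/2.\<close>

lemma scheme_Hoelder:
  assumes s: "scheme E \<Lambda> N \<tau> U G l1 l2"
  shows "(nrm (\<lambda>x. U (j + n) x - U j x))\<^sup>2 \<le> real n * (2 * \<tau> * E)"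
proof -
  note sq = scheme_sq [OF s]
  define a where "a k = nrm (\<lambda>x. U (Suc k) x - U k x)" for k
  have "nrm (\<lambda>x. U (j + n) x - U j x) \<le> (\<Sum>i<n. a (j + i))"
  proof (induction n)
    case (Suc n)
    have "nrm (\<lambda>x. U (j + Suc n) x - U j x) \<le> a (j + n) + nrm (\<lambda>x. U (j + n) x - U j x)"
      using L2_norm_on_triangle3 [OF sq [of "Suc (j + n)"] sq [of "j + n"] sq [of j]] by (simp add: a_def)
    with Suc show ?case by simp
  qed simp
  then have "(nrm (\<lambda>x. U (j + n) x - U j x))\<^sup>2 \<le> (\<Sum>i<n. a (j + i))\<^sup>2" by (intro power_mono) auto
  also have "\<dots> \<le> (\<Sum>i<n. (a (j + i))\<^sup>2) * real (card {..<n})"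
    using Cauchy_Schwarz_ineq_sum [of "\<lambda>i. a (j + i)" "\<lambda>_. 1" "{..<n}"] by simp
  also have "(\<Sum>i<n. (a (j + i))\<^sup>2) \<le> (\<Sum>i<j + n. (a i)\<^sup>2)"
  proof -
    have "(\<Sum>i<n. (a (j + i))\<^sup>2) = (\<Sum>i\<in>(+) j ` {..<n}. (a i)\<^sup>2)" by (subst sum.reindex) auto
    also have "\<dots> \<le> (\<Sum>i<j + n. (a i)\<^sup>2)" by (intro sum_mono2) auto
    finally show ?thesis .
  qed
  also have "\<dots> \<le> 2 * \<tau> * E" unfolding a_def by (rule scheme_sum [OF s])
  finally show ?thesis by (simp add: mult.commute mult_right_mono)
qed

text \<open>Translates between the closing integrals and orthogonality to \<open>sn\<close> and
  \<open>cs\<close>, with an error quadratic in the \<open>L\<^sup>2\<close> distance.\<close>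

lemma sn_taylor_integral:
  assumes w: "W_rep w h" and v: "W_rep v g"
  shows "\<bar>(LINT x|M. sn v x) - (LINT x|M. sn w x) - ip (\<lambda>x. v x - w x) (cs w)\<bar> \<le> (nrm (\<lambda>x. v x - w x))\<^sup>2"
    and "\<bar>(LINT x|M. cs v x) - (LINT x|M. cs w x) + ip (\<lambda>x. v x - w x) (sn w)\<bar> \<le> (nrm (\<lambda>x. v x - w x))\<^sup>2"
proof -
  have d: "sq_int M (\<lambda>x. v x - w x)" by (intro sq_int_diff W_rep_sq_int [OF v] W_rep_sq_int [OF w])
  note i = sq_int_imp_integrable [OF sn_sq_int [OF v]] sq_int_imp_integrable [OF sn_sq_int [OF w]]
    sq_int_imp_integrable [OF cs_sq_int [OF v]] sq_int_imp_integrable [OF cs_sq_int [OF w]]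
    sq_int_mult_integrable [OF d cs_sq_int [OF w]] sq_int_mult_integrable [OF d sn_sq_int [OF w]]
    sq_int_integrable [OF d]
  have eq1: "(LINT x|M. sn v x) - (LINT x|M. sn w x) - ip (\<lambda>x. v x - w x) (cs w) =
      (LINT x|M. sn v x - sn w x - (v x - w x) * cs w x)"
    by (simp only: Bochner_Integration.integral_diff [OF Bochner_Integration.integrable_diff [OF i(1,2)] i(5)]
        Bochner_Integration.integral_diff [OF i(1,2)])
  have "\<bar>(LINT x|M. sn v x) - (LINT x|M. sn w x) - ip (\<lambda>x. v x - w x) (cs w)\<bar> \<le>
      (LINT x|M. \<bar>sn v x - sn w x - (v x - w x) * cs w x\<bar>)" unfolding eq1 by (rule integral_abs_bound)
  also have "\<dots> \<le> (LINT x|M. (v x - w x)\<^sup>2)"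
  proof (rule integral_mono)
    show "\<bar>sn v x - sn w x - (v x - w x) * cs w x\<bar> \<le> (v x - w x)\<^sup>2" for x
      using sin_taylor1 [of "v x + ph x" "w x + ph x"]
      unfolding add_diff_cancel_right mult.commute [of "v x - w x"] .
  next
    show "integrable M (\<lambda>x. \<bar>sn v x - sn w x - (v x - w x) * cs w x\<bar>)"
      by (rule integrable_abs [OF Bochner_Integration.integrable_diff [OF Bochner_Integration.integrable_diff [OF i(1,2)] i(5)]])
  qed (rule i(7))
  finally show "\<bar>(LINT x|M. sn v x) - (LINT x|M. sn w x) - ip (\<lambda>x. v x - w x) (cs w)\<bar> \<le> (nrm (\<lambda>x. v x - w x))\<^sup>2"
    by (simp only: L2_norm_on_power2)
  have eq2: "(LINT x|M. cs v x) - (LINT x|M. cs w x) + ip (\<lambda>x. v x - w x) (sn w) =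
      (LINT x|M. cs v x - cs w x + (v x - w x) * sn w x)"
    by (simp only: Bochner_Integration.integral_add [OF Bochner_Integration.integrable_diff [OF i(3,4)] i(6)]
        Bochner_Integration.integral_diff [OF i(3,4)])
  have "\<bar>(LINT x|M. cs v x) - (LINT x|M. cs w x) + ip (\<lambda>x. v x - w x) (sn w)\<bar> \<le>
      (LINT x|M. \<bar>cs v x - cs w x + (v x - w x) * sn w x\<bar>)" unfolding eq2 by (rule integral_abs_bound)
  also have "\<dots> \<le> (LINT x|M. (v x - w x)\<^sup>2)"
  proof (rule integral_mono)
    show "\<bar>cs v x - cs w x + (v x - w x) * sn w x\<bar> \<le> (v x - w x)\<^sup>2" for x
      using cos_taylor1 [of "v x + ph x" "w x + ph x"]
      unfolding add_diff_cancel_right mult.commute [of "v x - w x"] .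
  next
    show "integrable M (\<lambda>x. \<bar>cs v x - cs w x + (v x - w x) * sn w x\<bar>)"
      by (rule integrable_abs [OF Bochner_Integration.integrable_add [OF Bochner_Integration.integrable_diff [OF i(3,4)] i(6)]])
  qed (rule i(7))
  finally show "\<bar>(LINT x|M. cs v x) - (LINT x|M. cs w x) + ip (\<lambda>x. v x - w x) (sn w)\<bar> \<le> (nrm (\<lambda>x. v x - w x))\<^sup>2"
    by (simp only: L2_norm_on_power2)
qed

text \<open>The linearised constraint is exact up to the square of the increment, and the squares of the
  increments sum up to \<open>O(\<tau>)\<close>.\<close>

lemma scheme_drift:
  assumes s: "scheme E \<Lambda> N \<tau> U G l1 l2"
  shows "\<bar>LINT x|M. sn (U k) x\<bar> \<le> 2 * \<tau> * E" "\<bar>LINT x|M. cs (U k) x\<bar> \<le> 2 * \<tau> * E"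
proof -
  have "\<bar>LINT x|M. sn (U k) x\<bar> \<le> (\<Sum>j<k. (nrm (\<lambda>x. U (Suc j) x - U j x))\<^sup>2) \<and>
    \<bar>LINT x|M. cs (U k) x\<bar> \<le> (\<Sum>j<k. (nrm (\<lambda>x. U (Suc j) x - U j x))\<^sup>2)"
  proof (induction k)
    case 0
    then show ?case using scheme_init [OF s] by simp
  next
    case (Suc k)
    then show ?case
      using sn_taylor_integral [OF scheme_W [OF s] scheme_W [OF s], of "Suc k" k]
      unfolding scheme_orth [OF s] by simp linarith
  qed
  with scheme_sum [OF s, of k] show "\<bar>LINT x|M. sn (U k) x\<bar> \<le> 2 * \<tau> * E" "\<bar>LINT x|M. cs (U k) x\<bar> \<le> 2 * \<tau> * E"
    by linarith+
qed

text \<open>Linear interpolation at half steps, which puts a scheme of step \<tau> on the grid of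
  one of step \<tau>/2. Integer division yields the iterate itself for even i and the mean of its
  two neighbours for odd i.\<close>

definition half_grid :: "(nat \<Rightarrow> real \<Rightarrow> real) \<Rightarrow> nat \<Rightarrow> real \<Rightarrow> real" where
  "half_grid U i x = (U (i div 2) x + U ((i + 1) div 2) x) / 2"

lemma half_grid_even: "half_grid U (2 * m) x = U m x"
  by (simp add: half_grid_def)

lemma half_grid_odd: "half_grid U (Suc (2 * m)) x = (U m x + U (Suc m) x) / 2"
  by (simp add: half_grid_def)

lemma half_grid_cases:
  obtains (even) "\<And>x. half_grid U i x = U (i div 2) x"
      "\<And>x. half_grid U (Suc i) x = (U (i div 2) x + U (Suc (i div 2)) x) / 2"
    | (odd) "\<And>x. half_grid U i x = (U (i div 2) x + U (Suc (i div 2)) x) / 2"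
      "\<And>x. half_grid U (Suc i) x = U (Suc (i div 2)) x"
proof (cases "even i")
  case True
  then obtain m where m: "i = 2 * m" by (rule evenE)
  show ?thesis by (rule even) (simp_all add: m half_grid_even half_grid_odd)
next
  case False
  then obtain m where m: "i = 2 * m + 1" by (rule oddE)
  then have "Suc i = 2 * Suc m" by simp
  then have "half_grid U (Suc i) x = U (Suc m) x" for x by (simp only: half_grid_even)
  then show ?thesis by (intro odd) (simp_all add: m half_grid_odd)
qed

lemma half_grid_Suc:
  "half_grid U (Suc i) x - half_grid U i x = 1/2 * (U (Suc (i div 2)) x - U (i div 2) x)"
  by (rule half_grid_cases [of U i]) (simp_all add: field_simps)

lemma half_grid_dist:
  "\<exists>\<theta>. 0 \<le> \<theta> \<and> \<theta> \<le> 1 \<and> (\<forall>x. half_grid U i x - U (i div 2) x = \<theta> * (U (Suc (i div 2)) x - U (i div 2) x))"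
proof (rule half_grid_cases [of U i])
  assume "\<And>x. half_grid U i x = U (i div 2) x"
  then show ?thesis by (intro exI [of _ 0]) simp
next
  assume "\<And>x. half_grid U i x = (U (i div 2) x + U (Suc (i div 2)) x) / 2"
  then show ?thesis by (intro exI [of _ "1/2"]) (simp add: field_simps)
qed

lemma half_grid_Suc_dist:
  "\<exists>\<theta>. 0 \<le> \<theta> \<and> \<theta> \<le> 1 \<and> (\<forall>x. half_grid U (Suc i) x - U (i div 2) x = \<theta> * (U (Suc (i div 2)) x - U (i div 2) x))"
proof (rule half_grid_cases [of U i])
  assume "\<And>x. half_grid U (Suc i) x = (U (i div 2) x + U (Suc (i div 2)) x) / 2"
  then show ?thesis by (intro exI [of _ "1/2"]) (simp add: field_simps)
next
  assume "\<And>x. half_grid U (Suc i) x = U (Suc (i div 2)) x"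
  then show ?thesis by (intro exI [of _ 1]) simp
qed

lemma phalf_monotone_integral:
  assumes "p_int p M X" "p_int p M Y"
  shows "min 1 (p - 1) / p * (nrm (\<lambda>x. phalf p (X x) - phalf p (Y x)))\<^sup>2 \<le>
    (LINT x|M. (pflux p (X x) - pflux p (Y x)) * (X x - Y x))"
proof -
  have b: "sq_int M (\<lambda>x. phalf p (X x) - phalf p (Y x))" by (intro sq_int_diff sq_int_phalf assms)
  have d: "p_int p M (\<lambda>x. X x - Y x)" using p_gt_1 by (intro p_int_diff assms) simp
  have i: "integrable M (\<lambda>x. (pflux p (X x) - pflux p (Y x)) * (X x - Y x))"
    using pflux_mult_integrable [OF p_gt_1 assms(1) d] pflux_mult_integrable [OF p_gt_1 assms(2) d]
    by (simp add: left_diff_distrib)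
  have "min 1 (p - 1) / p * (nrm (\<lambda>x. phalf p (X x) - phalf p (Y x)))\<^sup>2 =
      (LINT x|M. min 1 (p - 1) / p * (phalf p (X x) - phalf p (Y x))\<^sup>2)" by (simp add: L2_norm_on_power2)
  also have "\<dots> \<le> (LINT x|M. (pflux p (X x) - pflux p (Y x)) * (X x - Y x))"
  proof (rule integral_mono)
    show "integrable M (\<lambda>x. min 1 (p - 1) / p * (phalf p (X x) - phalf p (Y x))\<^sup>2)"
      by (rule integrable_mult_right) (rule sq_int_integrable [OF b])
    show "min 1 (p - 1) / p * (phalf p (X x) - phalf p (Y x))\<^sup>2 \<le> (pflux p (X x) - pflux p (Y x)) * (X x - Y x)" for x
      using pflux_monotone [OF p_gt_1, of "X x" "Y x"] p_gt_1 by (simp add: field_simps)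
  qed (rule i)
  finally show ?thesis .
qed

text \<open>The difference is split at \<open>U k\<close>. Its first part is orthogonal to the
  multiplier directions by the linearised constraint; the second is the first-order Taylor term
  between the closing integrals of \<open>U k\<close> and \<open>V i\<close>, which are both of the
  order of the step.\<close>

lemma scheme_multiplier_term:
  assumes s: "scheme E \<Lambda> N \<tau> U G l1 l2" and r: "scheme E \<Lambda> N' \<sigma> V H m1 m2" and k: "k < N"
  shows "\<bar>l1 k * ip (sn (U k)) (\<lambda>x. U (Suc k) x - V i x)\<bar> \<le> \<Lambda> * (2 * \<tau> * E + 2 * \<sigma> * E + (nrm (\<lambda>x. V i x - U k x))\<^sup>2)"
    and "\<bar>l2 k * ip (cs (U k)) (\<lambda>x. U (Suc k) x - V i x)\<bar> \<le> \<Lambda> * (2 * \<tau> * E + 2 * \<sigma> * E + (nrm (\<lambda>x. V i x - U k x))\<^sup>2)"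
proof -
  note sqU = scheme_sq [OF s] and sqV = scheme_sq [OF r] and WU = scheme_W [OF s] and WV = scheme_W [OF r]
  have split: "ip f (\<lambda>x. U (Suc k) x - V i x) = ip (\<lambda>x. U (Suc k) x - U k x) f - ip (\<lambda>x. V i x - U k x) f"
    if f: "sq_int M f" for f
  proof -
    have "ip f (\<lambda>x. U (Suc k) x - V i x) = (LINT x|M. (U (Suc k) x - U k x) * f x - (V i x - U k x) * f x)"
      by (intro Bochner_Integration.integral_cong) (auto simp: algebra_simps)
    also have "\<dots> = ip (\<lambda>x. U (Suc k) x - U k x) f - ip (\<lambda>x. V i x - U k x) f"
      by (intro Bochner_Integration.integral_diff sq_int_mult_integrable sq_int_diff sqU sqV f)
    finally show ?thesis .
  qed
  have \<Lambda>: "\<Lambda> \<ge> 0" using scheme_l(1) [OF s k] by linarith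
  have nn: "0 \<le> 2 * \<tau> * E + 2 * \<sigma> * E + (nrm (\<lambda>x. V i x - U k x))\<^sup>2"
    using scheme_E_nonneg [OF s] scheme_tau [OF s] scheme_tau [OF r] by simp
  have "\<bar>ip (sn (U k)) (\<lambda>x. U (Suc k) x - V i x)\<bar> \<le> 2 * \<tau> * E + 2 * \<sigma> * E + (nrm (\<lambda>x. V i x - U k x))\<^sup>2"
    unfolding split [OF sn_sq_int [OF WU]] scheme_orth [OF s]
    using sn_taylor_integral(2) [OF WU WV, of i k] scheme_drift(2) [OF s, of k] scheme_drift(2) [OF r, of i]
    by linarith
  then show "\<bar>l1 k * ip (sn (U k)) (\<lambda>x. U (Suc k) x - V i x)\<bar> \<le> \<Lambda> * (2 * \<tau> * E + 2 * \<sigma> * E + (nrm (\<lambda>x. V i x - U k x))\<^sup>2)"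
    unfolding abs_mult using scheme_l(1) [OF s k] \<Lambda> by (intro mult_mono) auto
  have "\<bar>ip (cs (U k)) (\<lambda>x. U (Suc k) x - V i x)\<bar> \<le> 2 * \<tau> * E + 2 * \<sigma> * E + (nrm (\<lambda>x. V i x - U k x))\<^sup>2"
    unfolding split [OF cs_sq_int [OF WU]] scheme_orth [OF s]
    using sn_taylor_integral(1) [OF WU WV, of i k] scheme_drift(1) [OF s, of k] scheme_drift(1) [OF r, of i]
    by linarith
  then show "\<bar>l2 k * ip (cs (U k)) (\<lambda>x. U (Suc k) x - V i x)\<bar> \<le> \<Lambda> * (2 * \<tau> * E + 2 * \<sigma> * E + (nrm (\<lambda>x. V i x - U k x))\<^sup>2)"
    unfolding abs_mult using scheme_l(2) [OF s k] \<Lambda> by (intro mult_mono) auto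
qed

lemma nrm_power2_triangle:
  assumes "sq_int M f" "sq_int M g" "sq_int M h"
  shows "(nrm (\<lambda>x. f x - h x))\<^sup>2 \<le> 2 * (nrm (\<lambda>x. f x - g x))\<^sup>2 + 2 * (nrm (\<lambda>x. g x - h x))\<^sup>2"
proof -
  have "(nrm (\<lambda>x. f x - h x))\<^sup>2 \<le> (nrm (\<lambda>x. f x - g x) + nrm (\<lambda>x. g x - h x))\<^sup>2"
    by (intro power_mono L2_norm_on_triangle3 assms) auto
  also have "\<dots> \<le> 2 * (nrm (\<lambda>x. f x - g x))\<^sup>2 + 2 * (nrm (\<lambda>x. g x - h x))\<^sup>2"
    using sum_squares_bound [of "nrm (\<lambda>x. f x - g x)" "nrm (\<lambda>x. g x - h x)"] by (simp add: power2_sum)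
  finally show ?thesis .
qed

lemma nrm_scaled_le:
  assumes "\<And>x. f x = \<theta> * g x" "0 \<le> \<theta>" "\<theta> \<le> 1"
  shows "nrm f \<le> nrm g"
proof -
  have "f = (\<lambda>x. \<theta> * g x)" by (rule ext) (rule assms(1))
  then have "nrm f = \<bar>\<theta>\<bar> * nrm g" by (simp only: L2_norm_on_cmult)
  then show ?thesis using assms by (simp add: mult_left_le_one_le)
qed

text \<open>Both discrete equations are tested with \<open>U (Suc k) - V (Suc i)\<close>, the
  difference of the functions whose slopes enter the fluxes. Monotonicity of the flux produces the
  dissipation on the left. The true error at index \<open>Suc i\<close> differs from this test
  function by the interpolation error q, which is charged to the increments.\<close>

theorem scheme_comparison_step:
  assumes s: "scheme E \<Lambda> N \<tau> U G l1 l2" and r: "scheme E \<Lambda> (2 * N) (\<tau> / 2) V H m1 m2" and i: "i < 2 * N"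
  defines "e \<equiv> \<lambda>i x. half_grid U i x - V i x"
  defines "dU \<equiv> (nrm (\<lambda>x. U (Suc (i div 2)) x - U (i div 2) x))\<^sup>2"
  defines "dV \<equiv> (nrm (\<lambda>x. V (Suc i) x - V i x))\<^sup>2"
  assumes S: "(nrm (e i))\<^sup>2 \<le> S" "(nrm (e (Suc i)))\<^sup>2 \<le> S"
  shows "(nrm (e (Suc i)))\<^sup>2 - (nrm (e i))\<^sup>2 +
    \<tau> * (min 1 (p - 1) / p * (nrm (\<lambda>x. phalf p (G (Suc (i div 2)) x + phi_deriv) - phalf p (H (Suc i) x + phi_deriv)))\<^sup>2)
    \<le> 4 * \<tau> * \<Lambda> * (4 * \<tau> * E + 2 * S + 2 * dU) + 2 * dU + dV"
proof -
  define k where "k = i div 2"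
  have k: "k < N" using i by (auto simp: k_def)
  note sqU = scheme_sq [OF s] and sqV = scheme_sq [OF r] and WU = scheme_W [OF s] and WV = scheme_W [OF r]
  have \<tau>: "\<tau> > 0" by (rule scheme_tau [OF s])
  have \<Lambda>: "\<Lambda> \<ge> 0" using scheme_l(1) [OF s k] by linarith
  have \<tau>E: "\<tau> * E \<ge> 0" "2 * (\<tau> / 2) * E = \<tau> * E" "4 * \<tau> * E = 4 * (\<tau> * E)" "2 * \<tau> * E = 2 * (\<tau> * E)"
    using \<tau> scheme_E_nonneg [OF s] by simp_all
  have sq_hg: "sq_int M (half_grid U j)" for j
    using sq_int_add [OF sq_int_cmult [OF sqU, of "1/2" "j div 2"] sq_int_cmult [OF sqU, of "1/2" "(j + 1) div 2"]]
    by (simp add: half_grid_def [abs_def] add_divide_distrib)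
  have sq_e: "sq_int M (e j)" for j unfolding e_def by (intro sq_int_diff sq_hg sqV)
  define dk where "dk x = U (Suc k) x - U k x" for x
  define di where "di x = V (Suc i) x - V i x" for x
  have sq_dk: "sq_int M dk" and sq_di: "sq_int M di" unfolding dk_def di_def by (intro sq_int_diff sqU sqV)+
  have dU_eq: "dU = (nrm dk)\<^sup>2" and dV_eq: "dV = (nrm di)\<^sup>2" 
    unfolding dU_def dV_def dk_def [abs_def] di_def [abs_def] k_def by (rule refl)+
  define \<phi> where "\<phi> x = U (Suc k) x - V (Suc i) x" for x
  define \<phi>' where "\<phi>' x = G (Suc k) x - H (Suc i) x" for x
  have \<phi>: "W_rep \<phi> \<phi>'" unfolding \<phi>_def \<phi>'_def by (rule W_rep_diff [OF WU WV])
  note sq_\<phi> = W_rep_sq_int [OF \<phi>]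
  \<comment> \<open>Zero when \<open>Suc i\<close> is a point of the coarse grid, and minus half a
    coarse increment when it lies between two such points.\<close>
  define q where "q x = half_grid U (Suc i) x - U (Suc k) x" for x
  have sq_q: "sq_int M q" unfolding q_def by (intro sq_int_diff sq_hg sqU)
  have D: "half_grid U (Suc i) x - half_grid U i x = 1/2 * dk x" for x
    unfolding dk_def k_def by (rule half_grid_Suc)
  have eq_e: "e (Suc i) x - e i x = 1/2 * dk x - di x" for x
    using D [of x] by (simp add: e_def di_def)
  have e_split: "e (Suc i) x = \<phi> x + q x" for x by (simp add: e_def \<phi>_def q_def)
  have nq: "nrm q \<le> nrm dk"
  proof -
    obtain \<theta> where \<theta>: "0 \<le> \<theta>" "\<theta> \<le> 1" "\<And>x. half_grid U (Suc i) x - U k x = \<theta> * dk x"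
      using half_grid_Suc_dist [of U i] unfolding k_def dk_def by blast
    have "- q x = (1 - \<theta>) * dk x" for x using \<theta>(3) [of x] by (simp add: q_def dk_def algebra_simps)
    then have "nrm (\<lambda>x. - q x) \<le> nrm dk" by (rule nrm_scaled_le) (use \<theta> in auto)
    then show ?thesis by (simp add: L2_norm_on_minus)
  qed
  have "(nrm (e (Suc i)))\<^sup>2 - (nrm (e i))\<^sup>2 = (LINT x|M. (e (Suc i) x)\<^sup>2 - (e i x)\<^sup>2)"
    unfolding L2_norm_on_power2
    by (intro Bochner_Integration.integral_diff [symmetric] sq_int_integrable sq_e)
  also have "\<dots> \<le> (LINT x|M. 2 * ((1/2 * dk x - di x) * \<phi> x) + 2 * ((1/2 * dk x - di x) * q x))"
  proof (rule integral_mono)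
    show "integrable M (\<lambda>x. (e (Suc i) x)\<^sup>2 - (e i x)\<^sup>2)"
      by (intro Bochner_Integration.integrable_diff sq_int_integrable sq_e)
    show "integrable M (\<lambda>x. 2 * ((1/2 * dk x - di x) * \<phi> x) + 2 * ((1/2 * dk x - di x) * q x))"
      by (intro Bochner_Integration.integrable_add integrable_mult_right sq_int_mult_integrable sq_int_diff sq_int_cmult sq_dk sq_di sq_\<phi> sq_q)
    fix x
    have "(e (Suc i) x)\<^sup>2 - (e i x)\<^sup>2 = 2 * ((e (Suc i) x - e i x) * e (Suc i) x) - (e (Suc i) x - e i x)\<^sup>2"
      by (simp add: power2_eq_square algebra_simps)
    also have "\<dots> \<le> 2 * ((e (Suc i) x - e i x) * e (Suc i) x)" by simp
    also have "\<dots> = 2 * ((1/2 * dk x - di x) * \<phi> x) + 2 * ((1/2 * dk x - di x) * q x)"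
      unfolding eq_e unfolding e_split by (simp add: algebra_simps)
    finally show "(e (Suc i) x)\<^sup>2 - (e i x)\<^sup>2 \<le> 2 * ((1/2 * dk x - di x) * \<phi> x) + 2 * ((1/2 * dk x - di x) * q x)" .
  qed
  also have "\<dots> = 2 * ip (\<lambda>x. 1/2 * dk x - di x) \<phi> + 2 * ip (\<lambda>x. 1/2 * dk x - di x) q"
  proof -
    have "integrable M (\<lambda>x. (1/2 * dk x - di x) * \<phi> x)" "integrable M (\<lambda>x. (1/2 * dk x - di x) * q x)"
      by (intro sq_int_mult_integrable sq_int_diff sq_int_cmult sq_dk sq_di sq_\<phi> sq_q)+
    then show ?thesis by simp
  qed
  finally have main: "(nrm (e (Suc i)))\<^sup>2 - (nrm (e i))\<^sup>2 \<le> 2 * ip (\<lambda>x. 1/2 * dk x - di x) \<phi> + 2 * ip (\<lambda>x. 1/2 * dk x - di x) q" .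
  have q_term: "2 * ip (\<lambda>x. 1/2 * dk x - di x) q \<le> 2 * dU + dV"
  proof -
    have "\<bar>ip (\<lambda>x. 1/2 * dk x - di x) q\<bar> \<le> nrm (\<lambda>x. 1/2 * dk x - di x) * nrm q"
      by (intro L2_Cauchy_Schwarz sq_int_diff sq_int_cmult sq_dk sq_di sq_q)
    also have "nrm (\<lambda>x. 1/2 * dk x - di x) \<le> nrm (\<lambda>x. 1/2 * dk x) + nrm di"
      by (intro L2_norm_on_triangle_diff sq_int_cmult sq_dk sq_di)
    also have "nrm (\<lambda>x. 1/2 * dk x) = 1/2 * nrm dk" using L2_norm_on_cmult [of M "1/2" dk] by simp
    finally have "\<bar>ip (\<lambda>x. 1/2 * dk x - di x) q\<bar> \<le> (1/2 * nrm dk + nrm di) * nrm q" by (simp add: mult_right_mono)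
    also have "\<dots> \<le> (1/2 * nrm dk + nrm di) * nrm dk" using nq by (intro mult_left_mono) auto
    also have "\<dots> \<le> (nrm dk)\<^sup>2 + 1/2 * (nrm di)\<^sup>2"
      using sum_squares_bound [of "nrm di" "nrm dk"] by (simp add: power2_eq_square algebra_simps)
    finally show ?thesis by (simp add: dU_eq dV_eq)
  qed
  have \<phi>_term: "ip (\<lambda>x. 1/2 * dk x - di x) \<phi> = 1/2 * ip dk \<phi> - ip di \<phi>"
  proof -
    have "ip (\<lambda>x. 1/2 * dk x + (-1) * di x) \<phi> = 1/2 * ip dk \<phi> + (-1) * ip di \<phi>" by (rule ip_linear [OF sq_dk sq_di sq_\<phi>])
    then show ?thesis by simp
  qed
  define X where "X x = G (Suc k) x + phi_deriv" for x
  define Y where "Y x = H (Suc i) x + phi_deriv" for x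
  have XY: "p_int p M X" "p_int p M Y" unfolding X_def Y_def by (intro p_int_theta [OF WU] p_int_theta [OF WV])+
  define B where "B = min 1 (p - 1) / p * (nrm (\<lambda>x. phalf p (X x) - phalf p (Y x)))\<^sup>2"
  define a1 where "a1 = l1 k * ip (sn (U k)) \<phi>"
  define a2 where "a2 = l2 k * ip (cs (U k)) \<phi>"
  define b1 where "b1 = m1 i * ip (sn (V i)) \<phi>"
  define b2 where "b2 = m2 i * ip (cs (V i)) \<phi>"
  have ELU: "(LINT x|M. pflux p (X x) * \<phi>' x) + ip dk \<phi> / \<tau> = a1 - a2"
    using scheme_EL [OF s k \<phi>] by (simp add: EL_def X_def dk_def a1_def a2_def)
  have ELV: "(LINT x|M. pflux p (Y x) * \<phi>' x) + ip di \<phi> / (\<tau> / 2) = b1 - b2"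
    using scheme_EL [OF r i \<phi>] by (simp add: EL_def Y_def di_def b1_def b2_def)
  have mono: "B \<le> (LINT x|M. pflux p (X x) * \<phi>' x) - (LINT x|M. pflux p (Y x) * \<phi>' x)"
  proof -
    have "B \<le> (LINT x|M. (pflux p (X x) - pflux p (Y x)) * (X x - Y x))"
      unfolding B_def by (rule phalf_monotone_integral [OF XY])
    also have "\<dots> = (LINT x|M. pflux p (X x) * \<phi>' x - pflux p (Y x) * \<phi>' x)"
      by (intro Bochner_Integration.integral_cong) (auto simp: X_def Y_def \<phi>'_def algebra_simps)
    also have "\<dots> = (LINT x|M. pflux p (X x) * \<phi>' x) - (LINT x|M. pflux p (Y x) * \<phi>' x)"
      by (intro Bochner_Integration.integral_diff pflux_mult_integrable p_gt_1 XY W_rep_p_int [OF \<phi>])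
    finally show ?thesis .
  qed
  \<comment> \<open>Over half a coarse step each increment is \<open>\<tau> / 2\<close> times its
    difference quotient: this common factor permits the two equations to be subtracted.\<close>
  have "1/2 * ip dk \<phi> - ip di \<phi> = \<tau> / 2 * (ip dk \<phi> / \<tau> - ip di \<phi> / (\<tau> / 2))"
    using \<tau> by (simp add: field_simps)
  also have "\<dots> \<le> \<tau> / 2 * (\<bar>a1\<bar> + \<bar>a2\<bar> + \<bar>b1\<bar> + \<bar>b2\<bar> - B)"
    using ELU ELV mono \<tau> by (intro mult_left_mono) linarith+
  finally have key: "1/2 * ip dk \<phi> - ip di \<phi> \<le> \<tau> / 2 * (\<bar>a1\<bar> + \<bar>a2\<bar> + \<bar>b1\<bar> + \<bar>b2\<bar> - B)" .
  \<comment> \<open>Two distances are needed because the two equations are linearised at different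
    points: the coarse one at \<open>U k\<close> and compared with \<open>V (Suc i)\<close>, the
    fine one at \<open>V i\<close> and compared with \<open>U (Suc k)\<close>.\<close>
  have dist1: "(nrm (\<lambda>x. V (Suc i) x - U k x))\<^sup>2 \<le> 2 * S + 2 * dU"
  proof -
    have "nrm (\<lambda>x. half_grid U (Suc i) x - U k x) \<le> nrm dk"
      using half_grid_Suc_dist [of U i] nrm_scaled_le [of "\<lambda>x. half_grid U (Suc i) x - U k x" _ dk] unfolding k_def dk_def by blast
    then have "(nrm (\<lambda>x. half_grid U (Suc i) x - U k x))\<^sup>2 \<le> dU" unfolding dU_eq by (intro power_mono) auto
    moreover have "nrm (\<lambda>x. V (Suc i) x - half_grid U (Suc i) x) = nrm (e (Suc i))"
      unfolding e_def by (rule L2_norm_on_commute)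
    ultimately show ?thesis
      using nrm_power2_triangle [OF sqV [of "Suc i"] sq_hg [of "Suc i"] sqU [of k]] S(2) by simp
  qed
  have dist2: "(nrm (\<lambda>x. U (Suc k) x - V i x))\<^sup>2 \<le> 2 * S + 2 * dU"
  proof -
    obtain \<theta> where \<theta>: "0 \<le> \<theta>" "\<theta> \<le> 1" "\<And>x. half_grid U i x - U k x = \<theta> * dk x"
      using half_grid_dist [of U i] unfolding k_def dk_def by blast
    have "U (Suc k) x - half_grid U i x = (1 - \<theta>) * dk x" for x using \<theta>(3) [of x] by (simp add: dk_def algebra_simps)
    then have "nrm (\<lambda>x. U (Suc k) x - half_grid U i x) \<le> nrm dk" by (rule nrm_scaled_le) (use \<theta> in auto)
    then have "(nrm (\<lambda>x. U (Suc k) x - half_grid U i x))\<^sup>2 \<le> dU" unfolding dU_eq by (intro power_mono) auto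
    then show ?thesis
      using nrm_power2_triangle [OF sqU [of "Suc k"] sq_hg [of i] sqV [of i]] S(1) by (simp add: e_def)
  qed
  have A: "\<bar>a1\<bar> \<le> \<Lambda> * (4 * \<tau> * E + 2 * S + 2 * dU)" "\<bar>a2\<bar> \<le> \<Lambda> * (4 * \<tau> * E + 2 * S + 2 * dU)"
  proof -
    have "\<Lambda> * (2 * \<tau> * E + 2 * (\<tau> / 2) * E + (nrm (\<lambda>x. V (Suc i) x - U k x))\<^sup>2) \<le> \<Lambda> * (4 * \<tau> * E + 2 * S + 2 * dU)"
      using dist1 \<Lambda> \<tau>E by (intro mult_left_mono) linarith+
    then show "\<bar>a1\<bar> \<le> \<Lambda> * (4 * \<tau> * E + 2 * S + 2 * dU)" "\<bar>a2\<bar> \<le> \<Lambda> * (4 * \<tau> * E + 2 * S + 2 * dU)"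
      using scheme_multiplier_term [OF s r k, of "Suc i"] unfolding a1_def a2_def \<phi>_def by linarith+
  qed
  have Bb: "\<bar>b1\<bar> \<le> \<Lambda> * (4 * \<tau> * E + 2 * S + 2 * dU)" "\<bar>b2\<bar> \<le> \<Lambda> * (4 * \<tau> * E + 2 * S + 2 * dU)"
  proof -
    have neg: "ip f (\<lambda>x. V (Suc i) x - U (Suc k) x) = - ip f \<phi>" for f
    proof -
      have "ip f (\<lambda>x. V (Suc i) x - U (Suc k) x) = (LINT x|M. - (f x * \<phi> x))"
        by (intro Bochner_Integration.integral_cong) (auto simp: \<phi>_def algebra_simps)
      then show ?thesis by simp
    qed
    have "\<bar>b1\<bar> \<le> \<Lambda> * (2 * (\<tau> / 2) * E + 2 * \<tau> * E + (nrm (\<lambda>x. U (Suc k) x - V i x))\<^sup>2) \<and>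
        \<bar>b2\<bar> \<le> \<Lambda> * (2 * (\<tau> / 2) * E + 2 * \<tau> * E + (nrm (\<lambda>x. U (Suc k) x - V i x))\<^sup>2)"
      using scheme_multiplier_term [OF r s i, of "Suc k"] neg
      unfolding b1_def b2_def by simp
    moreover have "\<Lambda> * (2 * (\<tau> / 2) * E + 2 * \<tau> * E + (nrm (\<lambda>x. U (Suc k) x - V i x))\<^sup>2) \<le> \<Lambda> * (4 * \<tau> * E + 2 * S + 2 * dU)"
      using dist2 \<Lambda> \<tau>E by (intro mult_left_mono) linarith+
    ultimately show "\<bar>b1\<bar> \<le> \<Lambda> * (4 * \<tau> * E + 2 * S + 2 * dU)" "\<bar>b2\<bar> \<le> \<Lambda> * (4 * \<tau> * E + 2 * S + 2 * dU)"
      by linarith+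
  qed
  have "\<tau> / 2 * (\<bar>a1\<bar> + \<bar>a2\<bar> + \<bar>b1\<bar> + \<bar>b2\<bar> - B) \<le> \<tau> / 2 * (4 * (\<Lambda> * (4 * \<tau> * E + 2 * S + 2 * dU)) - B)"
    using A Bb \<tau> by (intro mult_left_mono) linarith+
  with key \<phi>_term have "2 * ip (\<lambda>x. 1/2 * dk x - di x) \<phi> \<le> \<tau> * (4 * (\<Lambda> * (4 * \<tau> * E + 2 * S + 2 * dU)) - B)" by simp
  then have "(nrm (e (Suc i)))\<^sup>2 - (nrm (e i))\<^sup>2 + \<tau> * B \<le> 4 * \<tau> * \<Lambda> * (4 * \<tau> * E + 2 * S + 2 * dU) + 2 * dU + dV"
    using main q_term by (simp add: algebra_simps)
  then show ?thesis by (simp add: B_def X_def Y_def k_def)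
qed

end

lemma sum_div_2: "(\<Sum>i<2 * N. f (i div 2)) = 2 * (\<Sum>k<N. f k)" for f :: "nat \<Rightarrow> real"
  by (induction N) simp_all

section \<open>Accumulated error of two consecutive schemes\<close>

context periodic_interval
begin

text \<open>In place of a discrete Gronwall inequality the largest squared error S is absorbed: the
  smallness condition bounds its total coefficient by 1/2. Everything else is O(\<tau>), because the
  squared increments of either scheme sum up to O(\<tau>).\<close>

theorem scheme_comparison:
  assumes s: "scheme E \<Lambda> N \<tau> U G l1 l2" and r: "scheme E \<Lambda> (2 * N) (\<tau> / 2) V H m1 m2" and UV: "V 0 = U 0"
    and small: "32 * \<Lambda> * (real N * \<tau>) \<le> 1"
  shows "\<And>i. i \<le> 2 * N \<Longrightarrow> (nrm (\<lambda>x. half_grid U i x - V i x))\<^sup>2 \<le> 24 * \<tau> * E"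
    and "(\<Sum>i<2 * N. \<tau> * (min 1 (p - 1) / p * (nrm (\<lambda>x. phalf p (G (Suc (i div 2)) x + phi_deriv) - phalf p (H (Suc i) x + phi_deriv)))\<^sup>2))
      \<le> 24 * \<tau> * E"
proof -
  define e where "e i = (nrm (\<lambda>x. half_grid U i x - V i x))\<^sup>2" for i
  define dU where "dU k = (nrm (\<lambda>x. U (Suc k) x - U k x))\<^sup>2" for k
  define dV where "dV i = (nrm (\<lambda>x. V (Suc i) x - V i x))\<^sup>2" for i
  define B where "B i = \<tau> * (min 1 (p - 1) / p * (nrm (\<lambda>x. phalf p (G (Suc (i div 2)) x + phi_deriv) - phalf p (H (Suc i) x + phi_deriv)))\<^sup>2)" for i
  define S where "S = Max (e ` {..2 * N})"
  have \<tau>: "\<tau> > 0" by (rule scheme_tau [OF s])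
  have E: "\<tau> * E \<ge> 0" using \<tau> scheme_E_nonneg [OF s] by simp
  have S: "e i \<le> S" if "i \<le> 2 * N" for i unfolding S_def using that by (intro Max_ge) auto
  have e0: "e 0 = 0" by (simp add: e_def half_grid_def UV)
  have S0: "S \<ge> 0" using S [of 0] e0 by simp
  have B0: "B i \<ge> 0" for i using \<tau> p_gt_1 by (simp add: B_def)
  have nn: "dU k \<ge> 0" "dV k \<ge> 0" for k by (simp_all add: dU_def dV_def)
  have step: "e (Suc i) - e i + B i \<le> 4 * \<tau> * \<Lambda> * (4 * \<tau> * E + 2 * S + 2 * dU (i div 2)) + 2 * dU (i div 2) + dV i"
    if i: "i < 2 * N" for i
    using scheme_comparison_step [OF s r i, of S] S [of i] S [of "Suc i"] i
    unfolding e_def B_def dU_def dV_def by simp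
  have total: "e n + (\<Sum>i<n. B i) \<le> S / 2 + 12 * (\<tau> * E)" if n: "n \<le> 2 * N" for n
  proof (cases "N = 0")
    case True
    then show ?thesis using n e0 S0 E by simp
  next
    case False
    have \<Lambda>: "\<Lambda> \<ge> 0" using scheme_l(1) [OF s, of 0] False by linarith
    define t where "t = \<tau> * \<Lambda>"
    have t: "t \<ge> 0" using \<tau> \<Lambda> by (simp add: t_def)
    have Nt: "32 * (real N * t) \<le> 1" using small by (simp add: t_def mult_ac)
    have "1 * t \<le> real N * t" using False t by (intro mult_right_mono) auto
    then have t32: "32 * t \<le> 1" using Nt by linarith
    define R where "R i = 4 * t * (4 * \<tau> * E + 2 * S + 2 * dU (i div 2)) + 2 * dU (i div 2) + dV i" for i
    have R0: "R i \<ge> 0" for i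
      unfolding R_def using t \<tau> scheme_E_nonneg [OF s] S0 nn by (intro add_nonneg_nonneg mult_nonneg_nonneg) auto
    have "e n + (\<Sum>i<n. B i) \<le> (\<Sum>i<n. R i)" using n
    proof (induction n)
      case (Suc n)
      then have "e n + (\<Sum>i<n. B i) \<le> (\<Sum>i<n. R i)" by simp
      moreover have "e (Suc n) - e n + B n \<le> R n" using step [of n] Suc.prems by (simp add: R_def t_def mult_ac)
      ultimately show ?case by simp
    qed (simp add: e0)
    also have "\<dots> \<le> (\<Sum>i<2 * N. R i)" using n R0 by (intro sum_mono2) auto
    also have "\<dots> = real (2 * N) * (4 * t * (4 * \<tau> * E + 2 * S)) + (8 * t + 2) * (\<Sum>i<2 * N. dU (i div 2)) + (\<Sum>i<2 * N. dV i)"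
      unfolding R_def by (simp add: sum.distrib sum_distrib_left algebra_simps)
    \<comment> \<open>The origin of 32: \<open>2 * N\<close> steps with the term
      \<open>4 * t * (4 * \<tau> * E + 2 * S)\<close> make \<open>32 * (real N * t)\<close> times
      \<open>\<tau> * E + S / 2\<close>.\<close>
    also have "\<dots> = (32 * (real N * t)) * (\<tau> * E + S / 2) + (8 * t + 2) * (2 * (\<Sum>k<N. dU k)) + (\<Sum>i<2 * N. dV i)"
      unfolding sum_div_2 by (simp add: algebra_simps)
    also have "\<dots> \<le> 1 * (\<tau> * E + S / 2) + (1/4 + 2) * (2 * (2 * \<tau> * E)) + 2 * (\<tau> / 2) * E"
    proof (intro add_mono mult_mono)
      show "(\<Sum>k<N. dU k) \<le> 2 * \<tau> * E" unfolding dU_def by (rule scheme_sum [OF s])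
      show "(\<Sum>i<2 * N. dV i) \<le> 2 * (\<tau> / 2) * E" unfolding dV_def by (rule scheme_sum [OF r])
      show "0 \<le> 2 * (\<Sum>k<N. dU k)" using nn by (simp add: sum_nonneg)
    next
      show "0 \<le> \<tau> * E + S / 2" using E S0 by simp
    qed (use Nt t32 t \<tau> scheme_E_nonneg [OF s] S0 sum_nonneg [of "{..<N}" dU] nn in auto)
    \<comment> \<open>The multiples of \<open>\<tau> * E\<close> add up to 11, rounded up to 12;
      moving \<open>S / 2\<close> to the left doubles this to 24.\<close>
    also have "\<dots> \<le> S / 2 + 12 * (\<tau> * E)" using E by (simp add: algebra_simps)
    finally show ?thesis .
  qed
  have "S \<in> e ` {..2 * N}" unfolding S_def by (intro Max_in) auto
  then obtain j where j: "j \<le> 2 * N" "S = e j" by auto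
  have "(\<Sum>i<j. B i) \<ge> 0" by (intro sum_nonneg B0)
  then have S_le: "S \<le> 24 * (\<tau> * E)" using total [OF j(1)] j(2) by linarith
  show "(nrm (\<lambda>x. half_grid U i x - V i x))\<^sup>2 \<le> 24 * \<tau> * E" if "i \<le> 2 * N" for i
    using S [OF that] S_le by (simp add: e_def)
  have "e (2 * N) \<ge> 0" by (simp add: e_def)
  then have "(\<Sum>i<2 * N. B i) \<le> 24 * \<tau> * E" using total [of "2 * N"] S_le by simp
  then show "(\<Sum>i<2 * N. \<tau> * (min 1 (p - 1) / p * (nrm (\<lambda>x. phalf p (G (Suc (i div 2)) x + phi_deriv) - phalf p (H (Suc i) x + phi_deriv)))\<^sup>2))
      \<le> 24 * \<tau> * E" by (simp only: B_def)
qed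

section \<open>Existence of the discrete flow on a short time interval\<close>

lemma nrm_L1: "sq_int M f \<Longrightarrow> (LINT x|M. \<bar>f x\<bar>) \<le> sqrt L * nrm f"
  using L1_le_L2 [of f] unfolding measure_M .

lemma trig_ip_lipschitz:
  assumes w: "W_rep w h" and u: "W_rep u g"
    and F: "\<And>x y. \<bar>F x - F y\<bar> \<le> \<bar>x - y\<bar>" "\<And>x. \<bar>F x\<bar> \<le> 1" "\<And>w h. W_rep w h \<Longrightarrow> sq_int M (\<lambda>x. F (w x + ph x))"
    and K: "\<And>x y. \<bar>K x - K y\<bar> \<le> \<bar>x - y\<bar>" "\<And>x. \<bar>K x\<bar> \<le> 1" "\<And>w h. W_rep w h \<Longrightarrow> sq_int M (\<lambda>x. K (w x + ph x))"
  shows "\<bar>ip (\<lambda>x. F (w x + ph x)) (\<lambda>x. K (w x + ph x)) - ip (\<lambda>x. F (u x + ph x)) (\<lambda>x. K (u x + ph x))\<bar> \<le>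
    2 * sqrt L * nrm (\<lambda>x. w x - u x)"
proof -
  have d: "sq_int M (\<lambda>x. w x - u x)" by (intro sq_int_diff W_rep_sq_int [OF w] W_rep_sq_int [OF u])
  note i1 = sq_int_mult_integrable [OF F(3) [OF w] K(3) [OF w]]
  note i2 = sq_int_mult_integrable [OF F(3) [OF u] K(3) [OF u]]
  have eq: "ip (\<lambda>x. F (w x + ph x)) (\<lambda>x. K (w x + ph x)) - ip (\<lambda>x. F (u x + ph x)) (\<lambda>x. K (u x + ph x)) =
      (LINT x|M. F (w x + ph x) * K (w x + ph x) - F (u x + ph x) * K (u x + ph x))"
    by (rule Bochner_Integration.integral_diff [OF i1 i2, symmetric])
  have "\<bar>ip (\<lambda>x. F (w x + ph x)) (\<lambda>x. K (w x + ph x)) - ip (\<lambda>x. F (u x + ph x)) (\<lambda>x. K (u x + ph x))\<bar> \<le>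
      (LINT x|M. \<bar>F (w x + ph x) * K (w x + ph x) - F (u x + ph x) * K (u x + ph x)\<bar>)"
    unfolding eq by (rule integral_abs_bound)
  also have "\<dots> \<le> (LINT x|M. 2 * \<bar>w x - u x\<bar>)"
  proof (rule integral_mono)
    show "integrable M (\<lambda>x. \<bar>F (w x + ph x) * K (w x + ph x) - F (u x + ph x) * K (u x + ph x)\<bar>)"
      by (rule integrable_abs [OF Bochner_Integration.integrable_diff [OF i1 i2]])
    show "integrable M (\<lambda>x. 2 * \<bar>w x - u x\<bar>)"
      by (intro integrable_mult_right integrable_abs sq_int_imp_integrable d)
    fix x
    have "F (w x + ph x) * K (w x + ph x) - F (u x + ph x) * K (u x + ph x) =
        (F (w x + ph x) - F (u x + ph x)) * K (w x + ph x) + F (u x + ph x) * (K (w x + ph x) - K (u x + ph x))"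
      by (simp add: algebra_simps)
    moreover have "\<bar>(F (w x + ph x) - F (u x + ph x)) * K (w x + ph x)\<bar> \<le> \<bar>w x - u x\<bar> * 1"
      unfolding abs_mult using F(1) [of "w x + ph x" "u x + ph x"] K(2) by (intro mult_mono) auto
    moreover have "\<bar>F (u x + ph x) * (K (w x + ph x) - K (u x + ph x))\<bar> \<le> 1 * \<bar>w x - u x\<bar>"
      unfolding abs_mult using K(1) [of "w x + ph x" "u x + ph x"] F(2) by (intro mult_mono) auto
    ultimately show "\<bar>F (w x + ph x) * K (w x + ph x) - F (u x + ph x) * K (u x + ph x)\<bar> \<le> 2 * \<bar>w x - u x\<bar>"
      by linarith
  qed
  also have "\<dots> = 2 * (LINT x|M. \<bar>w x - u x\<bar>)" by simp
  also have "\<dots> \<le> 2 * (sqrt L * nrm (\<lambda>x. w x - u x))" using nrm_L1 [OF d] by simp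
  finally show ?thesis by simp
qed

text \<open>Carries positivity from the initial datum to iterates that are close to it in
  \<open>L\<^sup>2\<close>.\<close>

lemma gram_det_lipschitz:
  assumes w: "W_rep w h" and u: "W_rep u g"
  shows "\<bar>gram_det w - gram_det u\<bar> \<le> 8 * L * sqrt L * nrm (\<lambda>x. w x - u x)"
proof -
  define c where "c = 2 * sqrt L * nrm (\<lambda>x. w x - u x)"
  have sl: "\<bar>sin x - sin y\<bar> \<le> \<bar>x - y\<bar>" "\<bar>cos x - cos y\<bar> \<le> \<bar>x - y\<bar>" for x y :: real
    by (rule sin_lipschitz cos_lipschitz)+
  have ss: "\<bar>ip (sn w) (sn w) - ip (sn u) (sn u)\<bar> \<le> c" unfolding c_def
    by (rule trig_ip_lipschitz [OF w u]) (rule sl abs_sin_le_one sn_sq_int, assumption?)+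
  have cc: "\<bar>ip (cs w) (cs w) - ip (cs u) (cs u)\<bar> \<le> c" unfolding c_def
    by (rule trig_ip_lipschitz [OF w u]) (rule sl abs_cos_le_one cs_sq_int, assumption?)+
  have sc: "\<bar>ip (sn w) (cs w) - ip (sn u) (cs u)\<bar> \<le> c" unfolding c_def
    by (rule trig_ip_lipschitz [OF w u]) (rule sl abs_sin_le_one abs_cos_le_one sn_sq_int cs_sq_int, assumption?)+
  have b: "\<bar>ip (sn v) (sn v)\<bar> \<le> L" "\<bar>ip (cs v) (cs v)\<bar> \<le> L" "\<bar>ip (sn v) (cs v)\<bar> \<le> L" if "W_rep v k" for v k
    by (rule trig_ip_bound [OF that]; (rule abs_sin_le_one abs_cos_le_one sn_sq_int [OF that] cs_sq_int [OF that]))+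
  have prod: "\<bar>x * y - x' * y'\<bar> \<le> 2 * L * c" if "\<bar>x - x'\<bar> \<le> c" "\<bar>y - y'\<bar> \<le> c" "\<bar>y\<bar> \<le> L" "\<bar>x'\<bar> \<le> L" for x y x' y' :: real
  proof -
    have "x * y - x' * y' = (x - x') * y + x' * (y - y')" by (simp add: algebra_simps)
    moreover have "\<bar>(x - x') * y\<bar> \<le> c * L" "\<bar>x' * (y - y')\<bar> \<le> L * c"
      unfolding abs_mult using that L_pos by (intro mult_mono; linarith)+
    ultimately have "\<bar>x * y - x' * y'\<bar> \<le> c * L + L * c" by linarith
    then show ?thesis by simp
  qed
  have "\<bar>gram_det w - gram_det u\<bar> \<le> 2 * L * c + 2 * L * c"
    using prod [OF ss cc b(2) [OF w] b(1) [OF u]] prod [OF sc sc b(3) [OF w] b(3) [OF u]]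
    unfolding gram_det_def power2_eq_square by linarith
  then show ?thesis by (simp add: c_def)
qed

text \<open>The three constants depend on the datum alone and are fixed before N and \<tau>, which
  makes the bounds uniform along refinements of the time grid.\<close>

theorem scheme_exists:
  assumes u0: "W_rep u0 g0" and init: "(LINT x|M. sn u0 x) = 0" "(LINT x|M. cs u0 x) = 0"
  obtains T0 \<Lambda> E where "T0 > 0" "\<Lambda> \<ge> 0" "E \<ge> 0"
    "\<And>N \<tau>. \<tau> > 0 \<Longrightarrow> real N * \<tau> \<le> T0 \<Longrightarrow> \<exists>U G l1 l2. scheme E \<Lambda> N \<tau> U G l1 l2 \<and> U 0 = u0"
proof -
  define E where "E = energy g0 / p"
  have E0: "E \<ge> 0" using energy_nonneg [of g0] p_gt_1 by (simp add: E_def)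
  define d0 where "d0 = gram_det u0"
  have d0: "d0 > 0" unfolding d0_def by (rule gram_det_pos [OF u0 init])
  define c where "c = 8 * L * sqrt L"
  have c: "c > 0" using L_pos by (simp add: c_def)
  \<comment> \<open>Up to time \<open>T0\<close> the discrete Hoelder estimate keeps the iterates
    within \<open>d0 / (2 * c)\<close> of \<open>u0\<close>, so the determinant loses at most half
    of \<open>d0\<close>. The added 1 avoids a zero denominator when E vanishes.\<close>
  define T0 where "T0 = (d0 / (2 * c))\<^sup>2 / (2 * E + 1)"
  have T0: "T0 > 0" using d0 c E0 by (simp add: T0_def)
  \<comment> \<open>The bound of \<open>minimizer_multipliers\<close> with \<open>d0 / 2\<close> for
    the determinant and \<open>p * E\<close> for each of the two energies.\<close>
  define \<Lambda> where "\<Lambda> = 2 * L * (2 * (p * E)) / (d0 / 2)"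
  have \<Lambda>: "\<Lambda> \<ge> 0" using L_pos d0 E0 p_gt_1 by (simp add: \<Lambda>_def)
  have ex: "\<exists>U G l1 l2. scheme E \<Lambda> N \<tau> U G l1 l2 \<and> U 0 = u0" if \<tau>: "\<tau> > 0" and N: "real N * \<tau> \<le> T0" for N \<tau>
  proof -
    define good where "good w vg \<longleftrightarrow> admissible w (fst vg) (snd vg) \<and>
        (\<forall>v' g'. admissible w v' g' \<longrightarrow> step_functional \<tau> w (fst vg) (snd vg) \<le> step_functional \<tau> w v' g')" for w vg
    have good_ex: "\<exists>vg. good w vg" if w: "W_rep w h" for w h
    proof (rule step_minimizer_exists [OF w \<tau>])
      fix v g
      assume "admissible w v g" "\<And>v' g'. admissible w v' g' \<Longrightarrow> step_functional \<tau> w v g \<le> step_functional \<tau> w v' g'"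
      then have "good w (v, g)" by (simp add: good_def)
      then show ?thesis ..
    qed
    define Z where "Z = rec_nat (u0, g0) (\<lambda>_ vg. SOME vg'. good (fst vg) vg')"
    define U where "U k = fst (Z k)" for k
    define G where "G k = snd (Z k)" for k
    have Z_Suc: "Z (Suc k) = (SOME vg'. good (U k) vg')" for k by (simp add: Z_def U_def)
    have U0: "U 0 = u0" "G 0 = g0" by (simp_all add: U_def G_def Z_def)
    have W: "W_rep (U k) (G k)" for k
    proof (induction k)
      case (Suc k)
      have "good (U k) (Z (Suc k))" unfolding Z_Suc by (rule someI_ex [OF good_ex [OF Suc]])
      then show ?case by (simp only: good_def admissible_def U_def G_def)
    qed (simp add: U0 u0)
    have good: "good (U k) (Z (Suc k))" for k unfolding Z_Suc by (rule someI_ex [OF good_ex [OF W]])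
    have adm: "admissible (U k) (U (Suc k)) (G (Suc k))" for k
      using good [of k] by (simp only: good_def U_def G_def)
    have min: "step_functional \<tau> (U k) (U (Suc k)) (G (Suc k)) \<le> step_functional \<tau> (U k) v' g'"
      if "admissible (U k) v' g'" for k v' g'
      using good [of k] that by (simp only: good_def U_def G_def)
    have dissip: "energy (G (Suc k)) / p + (nrm (\<lambda>x. U (Suc k) x - U k x))\<^sup>2 / (2 * \<tau>) \<le> energy (G k) / p" for k
      using min [of k "U k" "G k"] W [of k] by (simp add: step_functional_def admissible_def)
    have total: "energy (G n) / p + (\<Sum>k<n. (nrm (\<lambda>x. U (Suc k) x - U k x))\<^sup>2) / (2 * \<tau>) \<le> E" for n
    proof (induction n)
      case (Suc n)
      with dissip [of n] show ?case by (simp add: add_divide_distrib)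
    qed (simp add: U0 E_def)
    have en: "energy (G k) \<le> p * E" for k
    proof -
      have "0 \<le> (\<Sum>j<k. (nrm (\<lambda>x. U (Suc j) x - U j x))\<^sup>2) / (2 * \<tau>)" using \<tau> by (simp add: sum_nonneg)
      then have "energy (G k) / p \<le> E" using total [of k] by linarith
      then show ?thesis using p_gt_1 by (simp add: field_simps)
    qed
    have sum: "(\<Sum>k<n. (nrm (\<lambda>x. U (Suc k) x - U k x))\<^sup>2) \<le> 2 * \<tau> * E" for n
    proof -
      have "0 \<le> energy (G n) / p" using energy_nonneg p_gt_1 by simp
      then have "(\<Sum>k<n. (nrm (\<lambda>x. U (Suc k) x - U k x))\<^sup>2) / (2 * \<tau>) \<le> E" using total [of n] by linarith
      then show ?thesis using \<tau> by (simp add: field_simps)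
    qed
    \<comment> \<open>With \<open>N = 0\<close> no multipliers are claimed. This already gives
      access to the Hoelder estimate, which must precede the bound on the determinant and hence the
      multipliers.\<close>
    have pre: "scheme E \<Lambda> 0 \<tau> U G (\<lambda>_. 0) (\<lambda>_. 0)"
      unfolding scheme_def using \<tau> W adm en sum init U0 by (simp add: admissible_def)
    have det: "gram_det (U k) \<ge> d0 / 2" if k: "k < N" for k
    proof -
      have "(nrm (\<lambda>x. U k x - u0 x))\<^sup>2 \<le> real k * (2 * \<tau> * E)"
        using scheme_Hoelder [OF pre, of 0 k] by (simp add: U0)
      also have "\<dots> = (real k * \<tau>) * (2 * E)" by simp
      also have "\<dots> \<le> T0 * (2 * E + 1)"
      proof (intro mult_mono)
        have "real k * \<tau> \<le> real N * \<tau>" using k \<tau> by (intro mult_right_mono) auto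
        then show "real k * \<tau> \<le> T0" using N by simp
      qed (use E0 T0 in auto)
      also have "\<dots> = (d0 / (2 * c))\<^sup>2" using E0 by (simp add: T0_def)
      finally have "nrm (\<lambda>x. U k x - u0 x) \<le> d0 / (2 * c)"
        by (rule power2_le_imp_le) (use d0 c in simp)
      then have "c * nrm (\<lambda>x. U k x - u0 x) \<le> c * (d0 / (2 * c))" using c by (intro mult_left_mono) auto
      also have "\<dots> = d0 / 2" using c by simp
      finally have "\<bar>gram_det (U k) - d0\<bar> \<le> d0 / 2"
        using gram_det_lipschitz [OF W u0, of k] unfolding c_def d0_def by linarith
      then show ?thesis by linarith
    qed
    define mult where "mult k l \<longleftrightarrow> \<bar>fst l\<bar> \<le> \<Lambda> \<and> \<bar>snd l\<bar> \<le> \<Lambda> \<and> (\<forall>\<phi> \<phi>'. W_rep \<phi> \<phi>' \<longrightarrow>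
        EL \<tau> (U k) (U (Suc k)) (G (Suc k)) \<phi> \<phi>' = fst l * ip (sn (U k)) \<phi> - snd l * ip (cs (U k)) \<phi>)" for k l
    have mult_ex: "\<exists>l. mult k l" if k: "k < N" for k
    proof -
      obtain l1 l2 where l: "\<bar>l1\<bar> \<le> 2 * L * (energy (G (Suc k)) + energy (G k)) / (d0 / 2)"
        "\<bar>l2\<bar> \<le> 2 * L * (energy (G (Suc k)) + energy (G k)) / (d0 / 2)"
        "\<And>\<phi> \<phi>'. W_rep \<phi> \<phi>' \<Longrightarrow> EL \<tau> (U k) (U (Suc k)) (G (Suc k)) \<phi> \<phi>' = l1 * ip (sn (U k)) \<phi> - l2 * ip (cs (U k)) \<phi>"
        by (rule minimizer_multipliers [OF W \<tau> adm min det [OF k]]) (use d0 in auto)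
      have "2 * L * (energy (G (Suc k)) + energy (G k)) / (d0 / 2) \<le> \<Lambda>"
        unfolding \<Lambda>_def using en [of k] en [of "Suc k"] L_pos d0 by (intro divide_right_mono mult_left_mono) auto
      then have "\<bar>l1\<bar> \<le> \<Lambda>" "\<bar>l2\<bar> \<le> \<Lambda>" using l(1,2) by linarith+
      with l(3) have "mult k (l1, l2)" by (simp add: mult_def)
      then show ?thesis ..
    qed
    define l where "l k = (SOME l. mult k l)" for k
    have l: "mult k (l k)" if "k < N" for k unfolding l_def by (rule someI_ex [OF mult_ex [OF that]])
    have "scheme E \<Lambda> N \<tau> U G (\<lambda>k. fst (l k)) (\<lambda>k. snd (l k))"
      using pre l unfolding scheme_def mult_def by simp
    with U0(1) show ?thesis by (intro exI conjI)
  qed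
  show ?thesis by (rule that [OF T0 \<Lambda> E0 ex])
qed

end

section \<open>The limit of the discrete flows\<close>

text \<open>Dyadic steps let \<open>scheme_comparison\<close> relate each member to the next; since
  the number of steps times the step length is T for every n, the single condition
  \<open>small\<close> provides its smallness hypothesis throughout.\<close>

locale discrete_flow = periodic_interval +
  fixes T E \<Lambda> :: real and u0 :: "real \<Rightarrow> real"
    and U G :: "nat \<Rightarrow> nat \<Rightarrow> real \<Rightarrow> real" and l1 l2 :: "nat \<Rightarrow> nat \<Rightarrow> real"
  assumes T_pos: "T > 0" and \<Lambda>_nonneg: "\<Lambda> \<ge> 0" and E_nonneg: "E \<ge> 0" and small: "32 * \<Lambda> * T \<le> 1"
    and sch: "\<And>n. scheme E \<Lambda> (2 ^ n) (T / 2 ^ n) (U n) (G n) (l1 n) (l2 n)"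
    and U_0: "\<And>n. U n 0 = u0"
begin

sublocale time: interval T by unfold_locales (rule T_pos)

abbreviation MT :: "real measure" where "MT \<equiv> lebesgue_on {0<..<T}"

abbreviation tau :: "nat \<Rightarrow> real" where "tau n \<equiv> T / 2 ^ n"

section \<open>Dyadic time cells\<close>

definition ix :: "nat \<Rightarrow> real \<Rightarrow> nat" where "ix n t = nat \<lceil>t * 2 ^ n / T\<rceil>"

text \<open>The cells are open on the left and closed on the right; \<open>cell\<close> indexes the
  left end point and \<open>ix\<close> the right one, where the implicit scheme takes its value. At
  \<open>t = 0\<close> truncated subtraction returns 0, so identities between the two are claimed
  for \<open>t > 0\<close> only.\<close>

definition cell :: "nat \<Rightarrow> real \<Rightarrow> nat" where "cell n t = ix n t - 1"

lemma ix_0 [simp]: "ix n 0 = 0"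
  by (simp add: ix_def)

lemma ix_bounds:
  assumes "t \<ge> 0"
  shows "t * 2 ^ n / T \<le> real (ix n t)" "real (ix n t) < t * 2 ^ n / T + 1"
proof -
  have "0 \<le> t * 2 ^ n / T" using assms T_pos by simp
  then have "real (ix n t) = of_int \<lceil>t * 2 ^ n / T\<rceil>" unfolding ix_def by (simp add: le_ceiling_iff)
  then show "t * 2 ^ n / T \<le> real (ix n t)" "real (ix n t) < t * 2 ^ n / T + 1" by linarith+
qed

lemma ix_eq_Suc_cell:
  assumes "t > 0"
  shows "ix n t = Suc (cell n t)"
proof -
  have "0 < t * 2 ^ n / T" using assms T_pos by simp
  then have "real (ix n t) > 0" using ix_bounds(1) [of t n] assms by linarith
  then show ?thesis by (simp add: cell_def)
qed

lemma cell_bounds: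
  assumes "t > 0"
  shows "real (cell n t) < t * 2 ^ n / T" "t * 2 ^ n / T \<le> real (cell n t) + 1"
  using ix_bounds [of t n] ix_eq_Suc_cell [OF assms, of n] assms by simp_all

lemma cell_less:
  assumes "0 < t" "t \<le> T"
  shows "cell n t < 2 ^ n"
proof -
  have "t * 2 ^ n / T \<le> 2 ^ n" using assms T_pos by (simp add: field_simps)
  then have "real (cell n t) < 2 ^ n" by (rule less_le_trans [OF cell_bounds(1) [OF assms(1)]])
  then have "real (cell n t) < real (2 ^ n)" by (simp only: of_nat_power of_nat_numeral)
  then show ?thesis by (simp only: of_nat_less_iff)
qed

text \<open>The point of dyadic grids: the coarse index \<open>i div 2\<close> in the comparison of
  schemes belongs to the cell around the same time.\<close>

lemma cell_Suc_div_2: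
  assumes "t > 0"
  shows "cell (Suc n) t div 2 = cell n t"
proof -
  have eq: "t * 2 ^ Suc n / T = 2 * (t * 2 ^ n / T)" by simp
  define r where "r = t * 2 ^ n / T"
  have "real (cell n t) < r" "r \<le> real (cell n t) + 1"
    unfolding r_def by (rule cell_bounds [OF assms])+
  moreover have "real (cell (Suc n) t) < 2 * r" "2 * r \<le> real (cell (Suc n) t) + 1"
    unfolding r_def eq [symmetric] by (rule cell_bounds [OF assms])+
  ultimately have "real (cell (Suc n) t) < 2 * (real (cell n t) + 1)" "2 * real (cell n t) < real (cell (Suc n) t) + 1"
    by simp_all
  then have "cell (Suc n) t < 2 * (cell n t + 1)" "2 * cell n t < cell (Suc n) t + 1"
    by (simp_all flip: of_nat_less_iff [where 'a=real])
  then show ?thesis by presburger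
qed

lemma cell_eq_iff:
  assumes "t > 0"
  shows "cell n t = k \<longleftrightarrow> t \<in> {real k * tau n<..real (Suc k) * tau n}"
proof -
  have "t \<in> {real k * tau n<..real (Suc k) * tau n} \<longleftrightarrow> real k < t * 2 ^ n / T \<and> t * 2 ^ n / T \<le> real k + 1"
    using T_pos by (simp add: field_simps)
  also have "\<dots> \<longleftrightarrow> cell n t = k"
  proof
    assume *: "real k < t * 2 ^ n / T \<and> t * 2 ^ n / T \<le> real k + 1"
    then have "real k < real (cell n t) + 1" "real (cell n t) < real k + 1"
      using cell_bounds [OF assms, of n] by linarith+
    then show "cell n t = k" by linarith
  next
    assume "cell n t = k"
    then show "real k < t * 2 ^ n / T \<and> t * 2 ^ n / T \<le> real k + 1" using cell_bounds [OF assms, of n] by simp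
  qed
  finally show ?thesis ..
qed

lemma simple_cell: "simple_function MT (cell n)"
  unfolding simple_function_def
proof
  have "cell n ` space MT \<subseteq> {..<2 ^ n}" using cell_less by (auto simp: less_imp_le)
  then show "finite (cell n ` space MT)" by (rule finite_subset) simp
  show "\<forall>k\<in>cell n ` space MT. cell n -` {k} \<inter> space MT \<in> sets MT"
  proof
    fix k
    have "cell n -` {k} \<inter> space MT = {real k * tau n<..real (Suc k) * tau n} \<inter> {0<..<T}"
    proof (rule set_eqI)
      fix x
      show "x \<in> cell n -` {k} \<inter> space MT \<longleftrightarrow> x \<in> {real k * tau n<..real (Suc k) * tau n} \<inter> {0<..<T}"
      proof (cases "x \<in> {0<..<T}")
        case True
        then have "x > 0" by simp
        with True cell_eq_iff [OF \<open>x > 0\<close>, of n k] show ?thesis unfolding space_lebesgue_on by blast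
      next
        case False
        then show ?thesis unfolding space_lebesgue_on by blast
      qed
    qed
    then show "cell n -` {k} \<inter> space MT \<in> sets MT" using time.borel_sets_M by simp
  qed
qed

lemma simple_fun_cell: "simple_function MT (\<lambda>t. F (cell n t))"
  using simple_function_compose [OF simple_cell, of F n] by (simp add: comp_def)

lemma integrable_simple_MT: "simple_function MT f \<Longrightarrow> integrable MT (f :: real \<Rightarrow> real)"
proof -
  assume f: "simple_function MT f"
  then have "finite (f ` space MT)" by (rule simple_functionD)
  then obtain B where B: "\<And>y. y \<in> f ` space MT \<Longrightarrow> \<bar>y\<bar> \<le> B"
    by (metis Max_ge finite_imageI imageI)
  show "integrable MT f"
    by (rule time.integrable_const_bound [where B=B])
      (use B borel_measurable_simple_function [OF f] in \<open>auto intro!: AE_I2\<close>)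
qed

lemma integral_indicator_MT:
  assumes "0 \<le> a" "a \<le> b" "b \<le> T"
  shows "(LINT t|MT. indicator {a<..b} t) = b - a"
proof -
  have "(LINT t|MT. indicator {a<..b} t) = (LINT t|MT. indicator {a..b} t * (1::real))"
  proof (rule integral_cong_AE)
    show "AE t in MT. indicator {a<..b} t = indicator {a..b} t * (1::real)"
      using time.AE_neq_M [of a] by eventually_elim (auto simp: indicator_def)
    show "(\<lambda>t. indicator {a..b} t * (1::real)) \<in> borel_measurable MT"
      using time.indicator_measurable_M [of "{a..b}"] by simp
    show "indicator {a<..b} \<in> borel_measurable MT" by (rule time.indicator_measurable_M) simp
  qed
  also have "\<dots> = integral {a..b} (\<lambda>_. 1)" using assms by (intro time.integral_M_continuous) auto
  also have "\<dots> = b - a" using assms by simp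
  finally show ?thesis .
qed

lemma cell_expand:
  fixes F :: "nat \<Rightarrow> real"
  assumes "t \<in> space MT"
  shows "F (cell n t) = (\<Sum>k<2 ^ n. F k * indicator {real k * tau n<..real (Suc k) * tau n} t)"
proof -
  have t: "t > 0" "t \<le> T" using assms by auto
  have "(\<Sum>k<2 ^ n. F k * indicator {real k * tau n<..real (Suc k) * tau n} t) =
      (\<Sum>k<2 ^ n. F k * of_bool (cell n t = k))"
    by (simp only: indicator_def cell_eq_iff [OF t(1)])
  also have "\<dots> = (\<Sum>k<2 ^ n. if k = cell n t then F k else 0)"
    by (intro sum.cong refl) (simp add: eq_commute)
  also have "\<dots> = F (cell n t)" using cell_less [OF t, of n] by simp
  finally show ?thesis ..
qed

lemma integral_cell: "(LINT t|MT. F (cell n t)) = tau n * (\<Sum>k<2 ^ n. F k)" for F :: "nat \<Rightarrow> real"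
proof -
  have ind: "integrable MT (\<lambda>t. F k * indicator {real k * tau n<..real (Suc k) * tau n} t)" for k
    by (intro integrable_mult_right time.integrable_const_bound [where B=1] time.indicator_measurable_M) auto
  have le: "real (Suc k) * tau n \<le> T" if "k < 2 ^ n" for k
  proof -
    have "real (Suc k) \<le> real (2 ^ n)" using that by (simp only: of_nat_le_iff Suc_le_eq)
    then have "real (Suc k) * tau n \<le> real (2 ^ n) * tau n" using T_pos by (intro mult_right_mono) auto
    then show ?thesis by simp
  qed
  have "(LINT t|MT. F (cell n t)) = (LINT t|MT. (\<Sum>k<2 ^ n. F k * indicator {real k * tau n<..real (Suc k) * tau n} t))"
    by (rule Bochner_Integration.integral_cong [OF refl]) (rule cell_expand)
  also have "\<dots> = (\<Sum>k<2 ^ n. LINT t|MT. F k * indicator {real k * tau n<..real (Suc k) * tau n} t)"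
    by (rule Bochner_Integration.integral_sum) (rule ind)
  also have "\<dots> = (\<Sum>k<2 ^ n. F k * tau n)"
  proof (rule sum.cong [OF refl])
    fix k :: nat assume "k \<in> {..<2 ^ n}"
    then have "(LINT t|MT. indicator {real k * tau n<..real (Suc k) * tau n} t) = real (Suc k) * tau n - real k * tau n"
      using T_pos le by (intro integral_indicator_MT mult_right_mono) auto
    also have "\<dots> = tau n"
      by (simp only: of_nat_Suc distrib_right mult_1_left add_diff_cancel_right')
    finally show "(LINT t|MT. F k * indicator {real k * tau n<..real (Suc k) * tau n} t) = F k * tau n" by simp
  qed
  also have "\<dots> = tau n * (\<Sum>k<2 ^ n. F k)" by (simp add: sum_distrib_left mult.commute)
  finally show ?thesis .
qed

section \<open>Convergence of the step functions\<close>

lemmas W_U = scheme_W [OF sch] and sq_U = scheme_sq [OF sch]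

definition ub :: "nat \<Rightarrow> real \<Rightarrow> real \<Rightarrow> real" where "ub n t = U n (ix n t)"

definition gb :: "nat \<Rightarrow> real \<Rightarrow> real \<Rightarrow> real" where "gb n t = G n (ix n t)"

text \<open>At every time in \<open>{0..T}\<close> this is the limit in \<open>L\<^sup>2\<close>; at
  almost every time the convergence turns out to be uniform in space, so that \<open>u t\<close>
  itself is the continuous periodic representative.\<close>

definition u :: "real \<Rightarrow> real \<Rightarrow> real" where "u t s = lim (\<lambda>n. ub n t s)"

lemma ub_W: "W_rep (ub n t) (gb n t)"
  unfolding ub_def gb_def by (rule W_U)

lemma ub_sq: "sq_int M (ub n t)"
  by (rule W_rep_sq_int [OF ub_W])

lemma tau_tendsto: "(\<lambda>n. tau n) \<longlonglongrightarrow> 0"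
proof -
  have "(\<lambda>n. T * (1/2) ^ n) \<longlonglongrightarrow> T * 0" by (intro tendsto_intros LIMSEQ_power_zero) auto
  then show ?thesis by (simp add: power_divide)
qed

lemma tau_Suc: "tau (Suc n) = tau n / 2" by simp

lemma comparison:
  shows "\<And>i. i \<le> 2 * 2 ^ n \<Longrightarrow> (nrm (\<lambda>x. half_grid (U n) i x - U (Suc n) i x))\<^sup>2 \<le> 24 * tau n * E"
    and "(\<Sum>i<2 * 2 ^ n. tau n * (min 1 (p - 1) / p * (nrm (\<lambda>x. phalf p (G n (Suc (i div 2)) x + phi_deriv) - phalf p (G (Suc n) (Suc i) x + phi_deriv)))\<^sup>2))
      \<le> 24 * tau n * E"
proof -
  have r: "scheme E \<Lambda> (2 * 2 ^ n) (tau n / 2) (U (Suc n)) (G (Suc n)) (l1 (Suc n)) (l2 (Suc n))"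
    using sch [of "Suc n"] unfolding tau_Suc unfolding power_Suc .
  have "32 * \<Lambda> * (real (2 ^ n) * tau n) \<le> 1" using small by simp
  from scheme_comparison [OF sch r _ this]
  show "\<And>i. i \<le> 2 * 2 ^ n \<Longrightarrow> (nrm (\<lambda>x. half_grid (U n) i x - U (Suc n) i x))\<^sup>2 \<le> 24 * tau n * E"
    "(\<Sum>i<2 * 2 ^ n. tau n * (min 1 (p - 1) / p * (nrm (\<lambda>x. phalf p (G n (Suc (i div 2)) x + phi_deriv) - phalf p (G (Suc n) (Suc i) x + phi_deriv)))\<^sup>2))
      \<le> 24 * tau n * E"
    using U_0 by auto
qed

text \<open>The constant is \<open>2 * 24 + 2 * 2\<close>: the comparison error on the half grid,
  and the jump from the interpolation to the right end of the coarse cell.\<close>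

lemma ub_step:
  assumes "0 \<le> t" "t \<le> T"
  shows "(nrm (\<lambda>x. ub (Suc n) t x - ub n t x))\<^sup>2 \<le> 52 * T * E * (1/2) ^ n"
proof (cases "t = 0")
  case True
  then show ?thesis using T_pos E_nonneg by (simp add: ub_def U_0)
next
  case False
  then have t: "t > 0" using assms by simp
  define i where "i = cell (Suc n) t"
  define k where "k = cell n t"
  have k: "k = i div 2" using cell_Suc_div_2 [OF t, of n] by (simp add: i_def k_def)
  have i: "Suc i \<le> 2 * 2 ^ n" using cell_less [OF t assms(2), of "Suc n"] by (simp add: i_def)
  have sq_hg: "sq_int M (half_grid (U n) j)" for j
    using sq_int_add [OF sq_int_cmult [OF sq_U, of "1/2" n "j div 2"] sq_int_cmult [OF sq_U, of "1/2" n "(j + 1) div 2"]]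
    by (simp add: half_grid_def [abs_def] add_divide_distrib)
  obtain \<theta> where \<theta>: "0 \<le> \<theta>" "\<theta> \<le> 1" "\<And>x. half_grid (U n) (Suc i) x - U n k x = \<theta> * (U n (Suc k) x - U n k x)"
    using half_grid_Suc_dist [of "U n" i] unfolding k by blast
  have "half_grid (U n) (Suc i) x - U n (Suc k) x = (\<theta> - 1) * (U n (Suc k) x - U n k x)" for x
    using \<theta>(3) [of x] by (simp add: algebra_simps)
  then have "- (half_grid (U n) (Suc i) x - U n (Suc k) x) = (1 - \<theta>) * (U n (Suc k) x - U n k x)" for x
    by (simp add: algebra_simps)
  then have "nrm (\<lambda>x. - (half_grid (U n) (Suc i) x - U n (Suc k) x)) \<le> nrm (\<lambda>x. U n (Suc k) x - U n k x)"
    by (rule nrm_scaled_le) (use \<theta> in auto)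
  then have "nrm (\<lambda>x. half_grid (U n) (Suc i) x - U n (Suc k) x) \<le> nrm (\<lambda>x. U n (Suc k) x - U n k x)"
    by (simp only: L2_norm_on_minus)
  then have "(nrm (\<lambda>x. half_grid (U n) (Suc i) x - U n (Suc k) x))\<^sup>2 \<le> (nrm (\<lambda>x. U n (Suc k) x - U n k x))\<^sup>2"
    by (intro power_mono) auto
  also have "\<dots> \<le> 2 * tau n * E" by (rule scheme_step_le [OF sch])
  finally have 1: "(nrm (\<lambda>x. half_grid (U n) (Suc i) x - U n (Suc k) x))\<^sup>2 \<le> 2 * tau n * E" .
  have 2: "(nrm (\<lambda>x. U (Suc n) (Suc i) x - half_grid (U n) (Suc i) x))\<^sup>2 \<le> 24 * tau n * E"
    using comparison(1) [OF i] by (simp only: L2_norm_on_commute [of M "U (Suc n) (Suc i)"])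
  have ub: "ub (Suc n) t = U (Suc n) (Suc i)" "ub n t = U n (Suc k)"
    unfolding ub_def ix_eq_Suc_cell [OF t] i_def k_def by (rule refl)+
  define \<epsilon> where "\<epsilon> = tau n * E"
  have "(nrm (\<lambda>x. ub (Suc n) t x - ub n t x))\<^sup>2 \<le> 52 * \<epsilon>"
    using nrm_power2_triangle [OF sq_U [of "Suc n" "Suc i"] sq_hg [of "Suc i"] sq_U [of n "Suc k"]] 1 2
    unfolding ub mult.assoc \<epsilon>_def [symmetric] by linarith
  then show ?thesis by (simp add: \<epsilon>_def power_divide)
qed

lemma ub_converges:
  assumes "0 \<le> t" "t \<le> T"
  shows "sq_int M (u t)" "(\<lambda>n. nrm (\<lambda>x. ub n t x - u t x)) \<longlonglongrightarrow> 0"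
proof -
  have "summable (\<lambda>n. nrm (\<lambda>x. ub (Suc n) t x - ub n t x))"
    by (rule summable_if_squares_geometric [OF _ ub_step [OF assms]]) auto
  from Riesz_Fischer [OF ub_sq this, folded u_def]
  show "sq_int M (u t)" "(\<lambda>n. nrm (\<lambda>x. ub n t x - u t x)) \<longlonglongrightarrow> 0" by blast+
qed

lemma u_0: "u 0 = u0"
  by (rule ext) (simp add: u_def ub_def U_0)

text \<open>The drift vanishes with the step, and the closing integrals are Lipschitz in
  \<open>L\<^sup>2\<close>. Convergence in \<open>L\<^sup>2\<close> holds at each time, and
  therefore so do the constraints.\<close>

lemma u_constraint:
  assumes "0 \<le> t" "t \<le> T"
  shows "(LINT x|M. sin (u t x + ph x)) = 0" "(LINT x|M. cos (u t x + ph x)) = 0"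
proof -
  have u_meas [measurable]: "u t \<in> borel_measurable M" by (rule sq_int_measurable [OF ub_converges(1) [OF assms]])
  have ph_meas [measurable]: "ph \<in> borel_measurable M" by (rule continuous_measurable_M [OF phi_cont])
  have d: "sq_int M (\<lambda>x. ub n t x - u t x)" for n by (intro sq_int_diff ub_sq ub_converges assms)
  have *: "(LINT x|M. F (u t x + ph x)) = 0"
    if F: "\<And>x y. \<bar>F x - F y\<bar> \<le> \<bar>x - y\<bar>" "\<And>x. \<bar>F x\<bar> \<le> 1" "F \<in> borel_measurable borel"
      and drift: "\<And>n k. \<bar>LINT x|M. F (U n k x + ph x)\<bar> \<le> 2 * tau n * E" for F :: "real \<Rightarrow> real"
  proof -
    have [measurable]: "F \<in> borel_measurable borel" by (rule F(3))
    have [measurable]: "ub n t \<in> borel_measurable M" for n by (rule sq_int_measurable [OF ub_sq])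
    have i: "integrable M (\<lambda>x. F (u t x + ph x))" "integrable M (\<lambda>x. F (ub n t x + ph x))" for n
      by (rule integrable_const_bound [where B=1]; use F(2) in \<open>auto intro!: AE_I2\<close>)+
    have "\<bar>LINT x|M. F (u t x + ph x)\<bar> \<le> 2 * tau n * E + sqrt L * nrm (\<lambda>x. ub n t x - u t x)" for n
    proof -
      have "(LINT x|M. F (u t x + ph x)) = (LINT x|M. F (ub n t x + ph x)) - (LINT x|M. F (ub n t x + ph x) - F (u t x + ph x))"
        using i by simp
      moreover have "\<bar>LINT x|M. F (ub n t x + ph x)\<bar> \<le> 2 * tau n * E" unfolding ub_def by (rule drift)
      moreover have "\<bar>LINT x|M. F (ub n t x + ph x) - F (u t x + ph x)\<bar> \<le> sqrt L * nrm (\<lambda>x. ub n t x - u t x)"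
      proof -
        have "\<bar>LINT x|M. F (ub n t x + ph x) - F (u t x + ph x)\<bar> \<le> (LINT x|M. \<bar>F (ub n t x + ph x) - F (u t x + ph x)\<bar>)"
          by (rule integral_abs_bound)
        also have "\<dots> \<le> (LINT x|M. \<bar>ub n t x - u t x\<bar>)"
        proof (rule integral_mono)
          show "\<bar>F (ub n t x + ph x) - F (u t x + ph x)\<bar> \<le> \<bar>ub n t x - u t x\<bar>" for x
            using F(1) [of "ub n t x + ph x" "u t x + ph x"] by simp
        qed (use i sq_int_imp_integrable [OF d [of n]] in auto)
        also have "\<dots> \<le> sqrt L * nrm (\<lambda>x. ub n t x - u t x)" by (rule nrm_L1 [OF d])
        finally show ?thesis .
      qed
      ultimately show ?thesis by linarith
    qed
    moreover have "(\<lambda>n. 2 * tau n * E + sqrt L * nrm (\<lambda>x. ub n t x - u t x)) \<longlonglongrightarrow> 2 * 0 * E + sqrt L * 0"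
      by (intro tendsto_intros ub_converges assms tau_tendsto)
    ultimately have "\<bar>LINT x|M. F (u t x + ph x)\<bar> \<le> 2 * 0 * E + sqrt L * 0"
      by (intro LIMSEQ_le_const) auto
    then show ?thesis by simp
  qed
  show "(LINT x|M. sin (u t x + ph x)) = 0"
    by (rule *) (rule sin_lipschitz abs_sin_le_one scheme_drift [OF sch]
        borel_measurable_continuous_onI [OF continuous_on_sin [OF continuous_on_id]])+
  show "(LINT x|M. cos (u t x + ph x)) = 0"
    by (rule *) (rule cos_lipschitz abs_cos_le_one scheme_drift [OF sch]
        borel_measurable_continuous_onI [OF continuous_on_cos [OF continuous_on_id]])+
qed

lemma u_Hoelder:
  assumes "0 \<le> t" "t \<le> t'" "t' \<le> T"
  shows "nrm (\<lambda>x. u t' x - u t x) \<le> sqrt (2 * E * (t' - t))"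
proof -
  have tT: "t \<le> T" "0 \<le> t'" using assms by auto
  have "nrm (\<lambda>x. u t' x - u t x) \<le> nrm (\<lambda>x. ub n t' x - u t' x) + sqrt (2 * E * (t' - t + tau n)) + nrm (\<lambda>x. ub n t x - u t x)" for n
  proof -
    have "real (ix n t) < real (ix n t') + 1"
      using ix_bounds(2) [of t n] ix_bounds(1) [OF tT(2), of n] assms T_pos
      by (smt (verit) divide_right_mono mult_right_mono zero_le_power)
    then have le: "ix n t \<le> ix n t'" by simp
    define m where "m = ix n t' - ix n t"
    have m: "ix n t' = ix n t + m" using le by (simp add: m_def)
    have "real m < (t' - t) * 2 ^ n / T + 1"
      using ix_bounds(1) [OF assms(1), of n] ix_bounds(2) [OF tT(2), of n] m by (simp add: diff_divide_distrib left_diff_distrib)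
    then have "real m * tau n \<le> ((t' - t) * 2 ^ n / T + 1) * tau n" using T_pos by (intro mult_right_mono) auto
    also have "\<dots> = t' - t + tau n" using T_pos by (simp add: field_simps)
    finally have mt: "real m * tau n \<le> t' - t + tau n" .
    have "(nrm (\<lambda>x. ub n t' x - ub n t x))\<^sup>2 \<le> real m * (2 * tau n * E)"
      using scheme_Hoelder [OF sch, of n "ix n t" m] by (simp only: ub_def m)
    also have "\<dots> = 2 * E * (real m * tau n)" by simp
    also have "\<dots> \<le> 2 * E * (t' - t + tau n)" using mt E_nonneg by (intro mult_left_mono) auto
    finally have 1: "nrm (\<lambda>x. ub n t' x - ub n t x) \<le> sqrt (2 * E * (t' - t + tau n))" by (rule real_le_rsqrt)
    have "nrm (\<lambda>x. u t' x - u t x) \<le> nrm (\<lambda>x. u t' x - ub n t' x) + nrm (\<lambda>x. ub n t' x - u t x)"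
      by (intro L2_norm_on_triangle3 ub_sq ub_converges assms tT)
    moreover have "nrm (\<lambda>x. ub n t' x - u t x) \<le> nrm (\<lambda>x. ub n t' x - ub n t x) + nrm (\<lambda>x. ub n t x - u t x)"
      by (intro L2_norm_on_triangle3 ub_sq ub_converges assms tT)
    ultimately show ?thesis using 1 by (simp only: L2_norm_on_commute [of M "u t'" "ub n t'"])
  qed
  moreover have "(\<lambda>n. nrm (\<lambda>x. ub n t' x - u t' x) + sqrt (2 * E * (t' - t + tau n)) + nrm (\<lambda>x. ub n t x - u t x))
      \<longlonglongrightarrow> 0 + sqrt (2 * E * (t' - t + 0)) + 0"
    by (intro tendsto_intros ub_converges assms tT tau_tendsto)
  ultimately have "nrm (\<lambda>x. u t' x - u t x) \<le> 0 + sqrt (2 * E * (t' - t + 0)) + 0"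
    by (intro LIMSEQ_le_const) auto
  then show ?thesis by simp
qed

text \<open>What the passage to the limit requires at one good time, with g as the slope of
  \<open>u t\<close>; the last clause is the convergence of the nonlinear flux against arbitrary
  \<open>L\<^sup>p\<close> functions.\<close>

definition limit_at :: "real \<Rightarrow> (real \<Rightarrow> real) \<Rightarrow> bool" where
  "limit_at t g \<longleftrightarrow> W_rep (u t) g \<and>
    (\<lambda>n. LINT x|M. \<bar>gb n t x - g x\<bar> powr p) \<longlonglongrightarrow> 0 \<and> energy g \<le> p * E \<and>
    (\<forall>h. p_int p M h \<longrightarrow> (\<lambda>n. LINT x|M. pflux p (gb n t x + phi_deriv) * h x) \<longlonglongrightarrow>
      (LINT x|M. pflux p (g x + phi_deriv) * h x))"

text \<open>The dissipation in the comparison of consecutive schemes bounds the time integral of the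
  squared \<open>phalf\<close> differences by O(2^-n). Hence at almost every time their square roots
  are summable and \<open>phalf_complete\<close> applies.\<close>

lemma AE_limit_at: "AE t in MT. \<exists>g. limit_at t g"
proof -
  define B where "B n t x = phalf p (gb n t x + phi_deriv)" for n t x
  define y where "y n t = (nrm (\<lambda>x. B (Suc n) t x - B n t x))\<^sup>2" for n t
  define c where "c = min 1 (p - 1) / p"
  have c: "c > 0" using p_gt_1 by (simp add: c_def)
  define Y where "Y n i = (nrm (\<lambda>x. phalf p (G n (Suc (i div 2)) x + phi_deriv) - phalf p (G (Suc n) (Suc i) x + phi_deriv)))\<^sup>2" for n i
  have y_eq: "y n t = Y n (cell (Suc n) t)" if "t \<in> space MT" for n t
  proof -
    have t: "t > 0" using that by simp
    show ?thesis
      unfolding y_def Y_def B_def gb_def ix_eq_Suc_cell [OF t] cell_Suc_div_2 [OF t]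
      by (simp only: L2_norm_on_commute [of M "\<lambda>x. phalf p (G n (Suc (cell n t)) x + phi_deriv)"])
  qed
  have y_int: "integrable MT (y n)" for n
    using integrable_simple_MT [OF simple_fun_cell [of "Y n" "Suc n"]]
    by (subst Bochner_Integration.integrable_cong [OF refl y_eq])
  \<comment> \<open>The ratio 1/2 is written as a square to match the form \<open>r\<^sup>2\<close>
    expected by \<open>AE_summable_sqrt\<close>.\<close>
  have y_bound: "(LINT t|MT. y n t) \<le> 12 * T * E / c * ((sqrt (1/2))\<^sup>2) ^ n" for n
  proof -
    have "(LINT t|MT. y n t) = tau (Suc n) * (\<Sum>i<2 ^ Suc n. Y n i)"
      unfolding integral_cell [symmetric] by (rule Bochner_Integration.integral_cong [OF refl y_eq])
    also have "\<dots> = (\<Sum>i<2 * 2 ^ n. tau n * (c * Y n i)) / (2 * c)"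
    proof -
      have "(\<Sum>i<2 * 2 ^ n. tau n * (c * Y n i)) = tau n * (c * (\<Sum>i<2 * 2 ^ n. Y n i))"
        by (simp only: sum_distrib_left)
      then show ?thesis using c by simp
    qed
    also have "\<dots> \<le> 24 * tau n * E / (2 * c)"
      using comparison(2) [of n] c unfolding Y_def c_def by (intro divide_right_mono) auto
    also have "\<dots> = 12 * T * E / c * ((sqrt (1/2))\<^sup>2) ^ n" by (simp add: power_divide)
    finally show ?thesis .
  qed
  have "AE t in MT. summable (\<lambda>n. sqrt (y n t))"
    by (rule time.AE_summable_sqrt [OF y_int _ y_bound]) (auto simp: y_def)
  then show ?thesis
  proof (rule AE_mp, intro AE_I2 impI)
    fix t assume t: "t \<in> space MT" and "summable (\<lambda>n. sqrt (y n t))"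
    then have sm: "summable (\<lambda>n. nrm (\<lambda>x. phalf p (gb (Suc n) t x + phi_deriv) - phalf p (gb n t x + phi_deriv)))"
      by (simp add: y_def B_def)
    have t': "0 \<le> t" "t \<le> T" using t by auto
    show "\<exists>g. limit_at t g"
    proof (rule phalf_complete [OF p_gt_1 p_int_theta [OF ub_W] sm])
    fix F
    assume F: "p_int p M F" "(\<lambda>n. LINT x|M. \<bar>gb n t x + phi_deriv\<bar> powr p) \<longlonglongrightarrow> (LINT x|M. \<bar>F x\<bar> powr p)"
      "(\<lambda>n. LINT x|M. \<bar>gb n t x + phi_deriv - F x\<bar> powr p) \<longlonglongrightarrow> 0"
      "\<And>h. p_int p M h \<Longrightarrow> (\<lambda>n. LINT x|M. pflux p (gb n t x + phi_deriv) * h x) \<longlonglongrightarrow> (LINT x|M. pflux p (F x) * h x)"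
    define g where "g x = F x - phi_deriv" for x
    have g_p: "p_int p M g" unfolding g_def using p_gt_1 by (intro p_int_diff F p_int_const) auto
    have gp: "(\<lambda>n. LINT x|M. \<bar>gb n t x - g x\<bar> powr p) \<longlonglongrightarrow> 0"
      using F(3) by (simp add: g_def algebra_simps)
    have "(\<lambda>n. LINT x|M. \<bar>gb n t x - g x\<bar>) \<longlonglongrightarrow> 0"
      using p_gt_1 by (intro Lp_conv_imp_L1_conv [OF p_gt_1 _ gp] p_int_diff W_rep_p_int [OF ub_W] g_p) auto
    then obtain v where v: "W_rep v g" "uniform_limit UNIV (\<lambda>n. ub n t) v sequentially"
      by (rule W_rep_limit [OF ub_W g_p _ ub_converges [OF t']])
    \<comment> \<open>Uniform convergence identifies the pointwise limit at every s, so no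
      modification of \<open>u t\<close> on a null set is involved.\<close>
    have "u t = v"
    proof
      fix s
      have "(\<lambda>n. ub n t s) \<longlonglongrightarrow> v s" using tendsto_uniform_limitI [OF v(2)] by simp
      then show "u t s = v s" unfolding u_def by (rule limI)
    qed
    moreover have "energy g \<le> p * E"
    proof -
      have "(\<lambda>n. energy (gb n t)) \<longlonglongrightarrow> energy g" using F(2) by (simp add: energy_def g_def)
      then show ?thesis by (rule LIMSEQ_le_const2) (auto simp: gb_def intro: scheme_energy [OF sch])
    qed
    ultimately have "limit_at t g" unfolding limit_at_def using v gp F(4) by (simp add: g_def)
    then show "\<exists>g. limit_at t g" by (rule exI [where x=g])
    qed
  qed
qed

end

section \<open>Strongly convergent convex combinations\<close>

text \<open>The sets consist of weights rather than of combined vectors, because the same weights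
  have to be applied to several sequences at once.\<close>

definition tail_convex :: "nat \<Rightarrow> (nat \<Rightarrow> real) set" where
  "tail_convex n = {c. (\<forall>k. c k \<ge> 0) \<and> (\<forall>k<n. c k = 0) \<and> (\<exists>N. (\<forall>k\<ge>N. c k = 0) \<and> (\<Sum>k<N. c k) = 1)}"

definition fin_supp :: "(nat \<Rightarrow> real) \<Rightarrow> bool" where
  "fin_supp c \<longleftrightarrow> (\<exists>N. \<forall>k\<ge>N. c k = 0)"

lemma sum_supp_eq:
  fixes c f :: "nat \<Rightarrow> real"
  assumes "\<And>k. k \<ge> N \<Longrightarrow> c k = 0"
  shows "(\<Sum>k | c k \<noteq> 0. c k * f k) = (\<Sum>k<N. c k * f k)"
  using assms by (intro sum.mono_neutral_left) (auto simp: not_less [symmetric])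

lemma fin_supp_common:
  assumes "fin_supp c" "fin_supp d"
  obtains N where "\<And>k. k \<ge> N \<Longrightarrow> c k = 0" "\<And>k. k \<ge> N \<Longrightarrow> d k = 0"
proof -
  obtain N1 N2 where "\<And>k. k \<ge> N1 \<Longrightarrow> c k = 0" "\<And>k. k \<ge> N2 \<Longrightarrow> d k = 0"
    using assms unfolding fin_supp_def by metis
  then show ?thesis by (intro that [of "max N1 N2"]) auto
qed

lemma fin_supp_add: "fin_supp c \<Longrightarrow> fin_supp d \<Longrightarrow> fin_supp (\<lambda>k. c k + d k)"
proof -
  assume "fin_supp c" "fin_supp d"
  then obtain N1 N2 where "\<forall>k\<ge>N1. c k = 0" "\<forall>k\<ge>N2. d k = 0" unfolding fin_supp_def by blast
  then show ?thesis unfolding fin_supp_def by (intro exI [of _ "max N1 N2"]) simp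
qed

lemma tail_convex_fin_supp: "c \<in> tail_convex n \<Longrightarrow> fin_supp c"
  by (auto simp: tail_convex_def fin_supp_def)

lemma tail_convex_antimono: "n \<le> m \<Longrightarrow> tail_convex m \<subseteq> tail_convex n"
  by (auto simp: tail_convex_def)

lemma tail_convex_unit: "(\<lambda>k. of_bool (k = n)) \<in> tail_convex n"
  by (auto simp: tail_convex_def intro!: exI [of _ "Suc n"])

lemma tail_convex_midpoint:
  assumes "c \<in> tail_convex n" "d \<in> tail_convex n"
  shows "(\<lambda>k. 1/2 * (c k + d k)) \<in> tail_convex n"
proof -
  obtain N1 where N1: "\<forall>k\<ge>N1. c k = 0" "(\<Sum>k<N1. c k) = 1" using assms by (auto simp: tail_convex_def)
  obtain N2 where N2: "\<forall>k\<ge>N2. d k = 0" "(\<Sum>k<N2. d k) = 1" using assms by (auto simp: tail_convex_def)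
  define N where "N = max N1 N2"
  have "(\<Sum>k<N. c k) = (\<Sum>k<N1. c k)" using N1 by (intro sum.mono_neutral_right) (auto simp: N_def)
  moreover have "(\<Sum>k<N. d k) = (\<Sum>k<N2. d k)" using N2 by (intro sum.mono_neutral_right) (auto simp: N_def)
  ultimately have "(\<Sum>k<N. 1/2 * (c k + d k)) = 1"
    using N1 N2 by (simp add: sum.distrib flip: sum_distrib_left sum_divide_distrib)
  moreover have "\<forall>k\<ge>N. 1/2 * (c k + d k) = 0" using N1 N2 by (simp add: N_def)
  moreover have "\<forall>k. 1/2 * (c k + d k) \<ge> 0" "\<forall>k<n. 1/2 * (c k + d k) = 0"
    using assms by (auto simp: tail_convex_def)
  ultimately show ?thesis unfolding tail_convex_def by blast
qed

lemma tail_convex_tendsto_0: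
  assumes c: "\<And>n. c n \<in> tail_convex n" and z: "z \<longlonglongrightarrow> (0::real)"
  shows "(\<lambda>n. \<Sum>k | c n k \<noteq> 0. c n k * z k) \<longlonglongrightarrow> 0"
proof (rule LIMSEQ_I)
  fix e :: real assume e: "e > 0"
  then obtain N where N: "\<And>k. k \<ge> N \<Longrightarrow> \<bar>z k\<bar> < e / 2" using LIMSEQ_D [OF z, of "e / 2"] by auto
  show "\<exists>no. \<forall>n\<ge>no. norm ((\<Sum>k | c n k \<noteq> 0. c n k * z k) - 0) < e"
  proof (intro exI allI impI)
    fix n assume n: "n \<ge> N"
    obtain K where K: "\<And>k. k \<ge> K \<Longrightarrow> c n k = 0" "(\<Sum>k<K. c n k) = 1"
      using c [of n] by (auto simp: tail_convex_def)
    have "\<bar>\<Sum>k<K. c n k * z k\<bar> \<le> (\<Sum>k<K. \<bar>c n k * z k\<bar>)" by (rule sum_abs)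
    also have "\<dots> \<le> (\<Sum>k<K. c n k * (e / 2))"
    proof (rule sum_mono)
      fix k
      have ck: "c n k \<ge> 0" "k < n \<Longrightarrow> c n k = 0" using c [of n] by (auto simp: tail_convex_def)
      show "\<bar>c n k * z k\<bar> \<le> c n k * (e / 2)"
      proof (cases "k < n")
        case False
        then have "\<bar>z k\<bar> \<le> e / 2" using N [of k] n by simp
        then have "c n k * \<bar>z k\<bar> \<le> c n k * (e / 2)" using ck by (intro mult_left_mono) auto
        then show ?thesis using ck by (simp only: abs_mult abs_of_nonneg)
      qed (use ck in simp)
    qed
    also have "\<dots> = e / 2" using K(2) by (simp flip: sum_distrib_right sum_divide_distrib)
    finally have "\<bar>\<Sum>k | c n k \<noteq> 0. c n k * z k\<bar> \<le> e / 2"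
      using sum_supp_eq [of K "c n" z] K(1) by simp
    then show "norm ((\<Sum>k | c n k \<noteq> 0. c n k * z k) - 0) < e" using e by simp
  qed
qed

lemma tail_convex_sum_1: "c \<in> tail_convex n \<Longrightarrow> (\<Sum>k | c k \<noteq> 0. c k) = 1"
proof -
  assume "c \<in> tail_convex n"
  then obtain K where K: "\<And>k. k \<ge> K \<Longrightarrow> c k = 0" "(\<Sum>k<K. c k) = 1"
    by (auto simp: tail_convex_def)
  then show ?thesis using sum_supp_eq [of K c "\<lambda>_. 1"] by simp
qed

lemma tail_convex_tendsto:
  assumes c: "\<And>n. c n \<in> tail_convex n" and z: "z \<longlonglongrightarrow> (l::real)"
  shows "(\<lambda>n. \<Sum>k | c n k \<noteq> 0. c n k * z k) \<longlonglongrightarrow> l"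
proof -
  have "(\<lambda>n. \<Sum>k | c n k \<noteq> 0. c n k * (z k - l)) \<longlonglongrightarrow> 0"
    using z by (intro tail_convex_tendsto_0 c) (simp add: LIM_zero)
  moreover have "(\<Sum>k | c n k \<noteq> 0. c n k * (z k - l)) = (\<Sum>k | c n k \<noteq> 0. c n k * z k) - l" for n
    using tail_convex_sum_1 [OF c [of n]]
    by (simp add: right_diff_distrib sum_subtractf flip: sum_distrib_right)
  ultimately show ?thesis by (simp add: LIM_zero_iff)
qed

text \<open>A Hilbert space substitute for weak compactness: for a bounded sequence, elements of almost
  minimal norm in the convex hulls of the tails form a Cauchy sequence by the parallelogram identity.
  Only the quadratic form induced on coefficient sequences is needed.\<close>

theorem convex_combinations_Cauchy:
  fixes q :: "(nat \<Rightarrow> real) \<Rightarrow> real"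
  assumes nonneg: "\<And>c. fin_supp c \<Longrightarrow> q c \<ge> 0"
    and par: "\<And>c d. fin_supp c \<Longrightarrow> fin_supp d \<Longrightarrow> q (\<lambda>k. c k + d k) + q (\<lambda>k. c k - d k) = 2 * q c + 2 * q d"
    and hom: "\<And>c. fin_supp c \<Longrightarrow> q (\<lambda>k. 1/2 * c k) = q c / 4"
    and bdd: "\<And>n. q (\<lambda>k. of_bool (k = n)) \<le> B"
  obtains c where "\<And>n. c n \<in> tail_convex n" "\<And>n. q (\<lambda>k. c (Suc n) k - c n k) \<le> (1/4) ^ n"
proof -
  define m where "m n = Inf (q ` tail_convex n)" for n
  have ne: "q ` tail_convex n \<noteq> {}" for n using tail_convex_unit by blast
  have bb: "bdd_below (q ` tail_convex n)" for n
    by (intro bdd_belowI [of _ 0]) (auto intro: nonneg tail_convex_fin_supp)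
  have m_le: "m n \<le> q c" if "c \<in> tail_convex n" for n c
    unfolding m_def using that by (intro cInf_lower bb) auto
  have m_mono: "m n \<le> m k" if "n \<le> k" for n k
    unfolding m_def by (intro cInf_superset_mono ne bb image_mono tail_convex_antimono that)
  have m_B: "m n \<le> B" for n using m_le [OF tail_convex_unit] bdd order_trans by blast
  have "incseq m" using m_mono by (simp add: incseq_def)
  then obtain l where ml: "m \<longlonglongrightarrow> l" "\<forall>i. m i \<le> l" by (rule incseq_convergent [of m B]) (use m_B in auto)
  have m_Cauchy: "Cauchy m" by (rule LIMSEQ_imp_Cauchy [OF ml(1)])
  have "\<exists>d. d \<in> tail_convex n \<and> q d < m n + 1 / real (Suc n)" for n
  proof -
    have "\<exists>x\<in>q ` tail_convex n. x < m n + 1 / real (Suc n)"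
      unfolding m_def by (subst cInf_less_iff [OF ne bb, symmetric]) simp
    then show ?thesis by auto
  qed
  then obtain d where d: "\<And>n. d n \<in> tail_convex n" "\<And>n. q (d n) < m n + 1 / real (Suc n)" by metis
  have q_diff: "q (\<lambda>k. d j k - d l k) \<le> 2 * (m l - m j) + 2 * (1 / real (Suc j)) + 2 * (1 / real (Suc l))" if "j \<le> l" for j l
  proof -
    have dl: "d l \<in> tail_convex j" using d(1) tail_convex_antimono [OF that] by blast
    note fs = tail_convex_fin_supp [OF d(1)]
    \<comment> \<open>Both elements lie in the convex hull of the j-th tail and so does their
      midpoint; this lower bound turns the parallelogram law into an upper bound for the
      difference.\<close>
    have "m j \<le> q (\<lambda>k. 1/2 * (d j k + d l k))" by (intro m_le tail_convex_midpoint d dl)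
    also have "\<dots> = q (\<lambda>k. d j k + d l k) / 4" by (intro hom fin_supp_add fs)
    finally have "4 * m j \<le> q (\<lambda>k. d j k + d l k)" by simp
    then have "q (\<lambda>k. d j k - d l k) \<le> 2 * q (d j) + 2 * q (d l) - 4 * m j"
      using par [OF fs fs, of j l] by linarith
    moreover have "z \<le> 2 * (ml - mj) + 2 * x + 2 * y"
      if "z \<le> 2 * a + 2 * b - 4 * mj" "a < mj + x" "b < ml + y" for z a b x y mj ml :: real
      using that by simp
    ultimately show ?thesis using d(2) [of j] d(2) [of l] by blast
  qed
  have "\<exists>N. \<forall>j\<ge>N. \<forall>l\<ge>j. q (\<lambda>k. d j k - d l k) \<le> e" if e: "e > 0" for e
  proof -
    obtain N1 where N1: "\<And>j l. j \<ge> N1 \<Longrightarrow> l \<ge> N1 \<Longrightarrow> \<bar>m j - m l\<bar> < e / 8"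
      using m_Cauchy e unfolding Cauchy_def dist_real_def by (meson zero_less_divide_iff zero_less_numeral)
    obtain N2 where N2: "1 / real (Suc N2) < e / 8" using e nat_approx_posE [of "e / 8"] by auto
    have "q (\<lambda>k. d j k - d l k) \<le> e" if jl: "j \<ge> max N1 N2" "l \<ge> j" for j l
    proof -
      have "1 / real (Suc j) \<le> 1 / real (Suc N2)" "1 / real (Suc l) \<le> 1 / real (Suc N2)"
        using jl by (auto intro!: divide_left_mono)
      moreover have "\<bar>m l - m j\<bar> < e / 8" using jl by (intro N1) auto
      moreover have "z \<le> e" if "x \<le> a" "y \<le> a" "\<bar>b\<bar> < e / 8" "z \<le> 2 * b + 2 * x + 2 * y" "a < e / 8"
        for a b x y z :: real
        using that by linarith
      ultimately show ?thesis using q_diff [OF jl(2)] N2 by blast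
    qed
    then show ?thesis by blast
  qed
  then have "\<exists>N. \<forall>j\<ge>N. \<forall>l\<ge>j. q (\<lambda>k. d j k - d l k) \<le> (1/4) ^ n" for n :: nat by simp
  then obtain N where N: "\<And>n j l. j \<ge> N n \<Longrightarrow> l \<ge> j \<Longrightarrow> q (\<lambda>k. d j k - d l k) \<le> (1/4) ^ n" by metis
  \<comment> \<open>The partial sums dominate n and \<open>N n\<close> and are monotone, three
    properties needed together.\<close>
  define r where "r n = n + (\<Sum>i\<le>n. N i)" for n
  have r: "r n \<ge> n" "r n \<ge> N n" "r (Suc n) \<ge> r n" for n
  proof -
    have "N n \<le> (\<Sum>i\<le>n. N i)" by (intro member_le_sum) auto
    then show "r n \<ge> n" "r n \<ge> N n" "r (Suc n) \<ge> r n" by (auto simp: r_def)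
  qed
  have sym: "q (\<lambda>k. d (r (Suc n)) k - d (r n) k) = q (\<lambda>k. d (r n) k - d (r (Suc n)) k)" for n
  proof -
    note fs = tail_convex_fin_supp [OF d(1)]
    have "q (\<lambda>k. d (r n) k + d (r (Suc n)) k) + q (\<lambda>k. d (r n) k - d (r (Suc n)) k) =
        2 * q (d (r n)) + 2 * q (d (r (Suc n)))" by (rule par [OF fs fs])
    moreover have "q (\<lambda>k. d (r (Suc n)) k + d (r n) k) + q (\<lambda>k. d (r (Suc n)) k - d (r n) k) =
        2 * q (d (r (Suc n))) + 2 * q (d (r n))" by (rule par [OF fs fs])
    moreover have "(\<lambda>k. d (r (Suc n)) k + d (r n) k) = (\<lambda>k. d (r n) k + d (r (Suc n)) k)" by (simp add: add.commute)
    ultimately show ?thesis by simp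
  qed
  show ?thesis
  proof (rule that [of "\<lambda>n. d (r n)"])
    show "d (r n) \<in> tail_convex n" for n using d(1) tail_convex_antimono [OF r(1)] by blast
    show "q (\<lambda>k. d (r (Suc n)) k - d (r n) k) \<le> (1/4) ^ n" for n
      unfolding sym by (intro N r)
  qed
qed

section \<open>Averaged difference quotients and multipliers\<close>

context discrete_flow
begin

definition dq :: "nat \<Rightarrow> real \<Rightarrow> real \<Rightarrow> real" where
  "dq n t s = (U n (Suc (cell n t)) s - U n (cell n t) s) / tau n"

definition m1 :: "nat \<Rightarrow> real \<Rightarrow> real" where "m1 n t = l1 n (cell n t)"

definition m2 :: "nat \<Rightarrow> real \<Rightarrow> real" where "m2 n t = l2 n (cell n t)"

lemma dq_eq: "dq n t = (\<lambda>s. 1 / tau n * (U n (Suc (cell n t)) s - U n (cell n t) s))"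
  by (rule ext) (simp add: dq_def)

lemma sq_dq: "sq_int M (dq n t)"
  unfolding dq_eq by (intro sq_int_cmult sq_int_diff sq_U)

lemma simple_dq: "simple_function MT (dq n)"
  unfolding dq_eq by (rule simple_fun_cell)

lemma dq_energy: "(LINT t|MT. (nrm (dq n t))\<^sup>2) \<le> 2 * E"
proof -
  define F where "F k = (nrm (\<lambda>s. 1 / tau n * (U n (Suc k) s - U n k s)))\<^sup>2" for k
  have F: "F k = (1 / tau n)\<^sup>2 * (nrm (\<lambda>s. U n (Suc k) s - U n k s))\<^sup>2" for k
    by (simp only: F_def L2_norm_on_cmult power_mult_distrib power2_abs)
  have "(LINT t|MT. (nrm (dq n t))\<^sup>2) = tau n * (\<Sum>k<2 ^ n. F k)"
    unfolding dq_eq F_def [symmetric] by (rule integral_cell)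
  also have "\<dots> = tau n * (1 / tau n)\<^sup>2 * (\<Sum>k<2 ^ n. (nrm (\<lambda>s. U n (Suc k) s - U n k s))\<^sup>2)"
    by (simp only: F sum_distrib_left mult.assoc)
  also have "\<dots> \<le> tau n * (1 / tau n)\<^sup>2 * (2 * tau n * E)"
    using T_pos by (intro mult_left_mono scheme_sum [OF sch]) auto
  also have "\<dots> = 2 * E" using T_pos by (simp add: power2_eq_square)
  finally show ?thesis .
qed

definition wq :: "(nat \<Rightarrow> real) \<Rightarrow> real \<Rightarrow> real \<Rightarrow> real" where
  "wq c t s = (\<Sum>k | c k \<noteq> 0. c k * dq k t s)"

definition n1 :: "(nat \<Rightarrow> real) \<Rightarrow> real \<Rightarrow> real" where "n1 c t = (\<Sum>k | c k \<noteq> 0. c k * m1 k t)"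

definition n2 :: "(nat \<Rightarrow> real) \<Rightarrow> real \<Rightarrow> real" where "n2 c t = (\<Sum>k | c k \<noteq> 0. c k * m2 k t)"

lemma sq_wq: "sq_int M (wq c t)"
  unfolding wq_def [abs_def] by (intro sq_int_sum sq_int_cmult sq_dq)

lemma simple_wq: "simple_function MT (wq c)"
proof -
  have "simple_function MT (\<lambda>t s. \<Sum>k\<in>I. c k * dq k t s)" if "finite I" for I
    using that
  proof (induction I)
    case empty
    then show ?case by simp
  next
    case (insert i I)
    have "simple_function MT (\<lambda>t. (\<lambda>a b s. c i * a s + b s) (dq i t) (\<lambda>s. \<Sum>k\<in>I. c k * dq k t s))"
      by (rule simple_function_compose2 [OF simple_dq insert.IH])
    with insert show ?case by simp
  qed
  moreover have "wq c = (\<lambda>t s. \<Sum>k\<in>{k. c k \<noteq> 0}. c k * dq k t s)" by (intro ext) (simp add: wq_def)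
  ultimately show ?thesis
  proof (cases "finite {k. c k \<noteq> 0}")
    \<comment> \<open>A sum over an infinite index set is 0 by convention, so the statement holds
      for arbitrary coefficients.\<close>
    case False
    then have "wq c = (\<lambda>t s. 0)" by (intro ext) (simp add: wq_def)
    then show ?thesis by simp
  qed simp
qed

lemma simple_n: "simple_function MT (n1 c)" "simple_function MT (n2 c)"
  unfolding n1_def [abs_def] n2_def [abs_def] m1_def m2_def
  by (intro simple_function_sum simple_function_mult simple_function_const simple_fun_cell)+

text \<open>The squared norm of the combination in the product of
  \<open>L\<^sup>2(0,T;L\<^sup>2(I))\<close> with two copies of \<open>L\<^sup>2(0,T)\<close>. The
  three sequences share their weights because the limit equation is linear in the three
  jointly.\<close>

definition qf :: "(nat \<Rightarrow> real) \<Rightarrow> real" where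
  "qf c = (LINT t|MT. (nrm (wq c t))\<^sup>2 + (n1 c t)\<^sup>2 + (n2 c t)\<^sup>2)"

lemma qf_simple: "simple_function MT (\<lambda>t. (nrm (wq c t))\<^sup>2 + (n1 c t)\<^sup>2 + (n2 c t)\<^sup>2)"
  by (intro simple_function_add simple_function_compose1 [OF simple_wq] simple_function_compose1 [OF simple_n(1)] simple_function_compose1 [OF simple_n(2)])

lemma qf_integrable: "integrable MT (\<lambda>t. (nrm (wq c t))\<^sup>2 + (n1 c t)\<^sup>2 + (n2 c t)\<^sup>2)"
  by (rule integrable_simple_MT [OF qf_simple])

lemma combination_linear:
  fixes f :: "nat \<Rightarrow> real"
  assumes "fin_supp c" "fin_supp d"
  shows "(\<Sum>k | a * c k + b * d k \<noteq> 0. (a * c k + b * d k) * f k) =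
    a * (\<Sum>k | c k \<noteq> 0. c k * f k) + b * (\<Sum>k | d k \<noteq> 0. d k * f k)"
proof (rule fin_supp_common [OF assms])
  fix N assume N: "\<And>k. k \<ge> N \<Longrightarrow> c k = 0" "\<And>k. k \<ge> N \<Longrightarrow> d k = 0"
  have 1: "(\<Sum>k | a * c k + b * d k \<noteq> 0. (a * c k + b * d k) * f k) = (\<Sum>k<N. (a * c k + b * d k) * f k)"
    by (rule sum_supp_eq) (simp add: N)
  have 2: "(\<Sum>k | c k \<noteq> 0. c k * f k) = (\<Sum>k<N. c k * f k)"
    and 3: "(\<Sum>k | d k \<noteq> 0. d k * f k) = (\<Sum>k<N. d k * f k)"
    by (rule sum_supp_eq, simp add: N)+
  show ?thesis unfolding 1 2 3
    by (simp add: sum.distrib sum_distrib_left algebra_simps)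
qed

lemma wq_linear:
  assumes "fin_supp c" "fin_supp d"
  shows "wq (\<lambda>k. a * c k + b * d k) t s = a * wq c t s + b * wq d t s"
    "n1 (\<lambda>k. a * c k + b * d k) t = a * n1 c t + b * n1 d t"
    "n2 (\<lambda>k. a * c k + b * d k) t = a * n2 c t + b * n2 d t"
  unfolding wq_def n1_def n2_def by (rule combination_linear [OF assms])+

lemma nrm_parallelogram:
  assumes "sq_int M f" "sq_int M g"
  shows "(nrm (\<lambda>x. f x + g x))\<^sup>2 + (nrm (\<lambda>x. f x - g x))\<^sup>2 = 2 * (nrm f)\<^sup>2 + 2 * (nrm g)\<^sup>2"
proof -
  have "(LINT x|M. (f x + g x)\<^sup>2) + (LINT x|M. (f x - g x)\<^sup>2) = (LINT x|M. (f x + g x)\<^sup>2 + (f x - g x)\<^sup>2)"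
    by (intro Bochner_Integration.integral_add [symmetric] sq_int_integrable sq_int_add sq_int_diff assms)
  also have "\<dots> = (LINT x|M. 2 * (f x)\<^sup>2 + 2 * (g x)\<^sup>2)"
    by (intro Bochner_Integration.integral_cong) (auto simp: power2_eq_square algebra_simps)
  also have "\<dots> = 2 * (LINT x|M. (f x)\<^sup>2) + 2 * (LINT x|M. (g x)\<^sup>2)"
    using assms by (simp add: sq_int_def)
  finally show ?thesis by (simp only: L2_norm_on_power2)
qed

lemma qf_parallelogram:
  assumes "fin_supp c" "fin_supp d"
  shows "qf (\<lambda>k. c k + d k) + qf (\<lambda>k. c k - d k) = 2 * qf c + 2 * qf d"
proof -
  note l = wq_linear [OF assms, of 1 1] wq_linear [OF assms, of 1 "-1"]
  have eq: "wq (\<lambda>k. c k + d k) t = (\<lambda>s. wq c t s + wq d t s)" "wq (\<lambda>k. c k - d k) t = (\<lambda>s. wq c t s - wq d t s)"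
    "n1 (\<lambda>k. c k + d k) t = n1 c t + n1 d t" "n1 (\<lambda>k. c k - d k) t = n1 c t - n1 d t"
    "n2 (\<lambda>k. c k + d k) t = n2 c t + n2 d t" "n2 (\<lambda>k. c k - d k) t = n2 c t - n2 d t" for t
    using l by (auto simp: fun_eq_iff)
  have "qf (\<lambda>k. c k + d k) + qf (\<lambda>k. c k - d k) =
      (LINT t|MT. ((nrm (wq (\<lambda>k. c k + d k) t))\<^sup>2 + (n1 (\<lambda>k. c k + d k) t)\<^sup>2 + (n2 (\<lambda>k. c k + d k) t)\<^sup>2) +
        ((nrm (wq (\<lambda>k. c k - d k) t))\<^sup>2 + (n1 (\<lambda>k. c k - d k) t)\<^sup>2 + (n2 (\<lambda>k. c k - d k) t)\<^sup>2))"
    unfolding qf_def by (rule Bochner_Integration.integral_add [OF qf_integrable qf_integrable, symmetric])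
  also have "\<dots> = (LINT t|MT. 2 * ((nrm (wq c t))\<^sup>2 + (n1 c t)\<^sup>2 + (n2 c t)\<^sup>2) + 2 * ((nrm (wq d t))\<^sup>2 + (n1 d t)\<^sup>2 + (n2 d t)\<^sup>2))"
  proof (rule Bochner_Integration.integral_cong [OF refl])
    fix t
    have sqid: "(x + y)\<^sup>2 + (x - y)\<^sup>2 = 2 * x\<^sup>2 + 2 * y\<^sup>2" for x y :: real by (simp add: power2_eq_square algebra_simps)
    have alg: "(x1 + y1 + z1) + (x2 + y2 + z2) = 2 * (a1 + b1 + c1) + 2 * (a2 + b2 + c2)"
      if "x1 + x2 = 2 * a1 + 2 * a2" "y1 + y2 = 2 * b1 + 2 * b2" "z1 + z2 = 2 * c1 + 2 * c2"
      for x1 x2 y1 y2 z1 z2 a1 a2 b1 b2 c1 c2 :: real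
    proof -
      have "(x1 + y1 + z1) + (x2 + y2 + z2) = (x1 + x2) + (y1 + y2) + (z1 + z2)" by simp
      also have "\<dots> = 2 * (a1 + b1 + c1) + 2 * (a2 + b2 + c2)" unfolding that by simp
      finally show ?thesis .
    qed
    show "((nrm (wq (\<lambda>k. c k + d k) t))\<^sup>2 + (n1 (\<lambda>k. c k + d k) t)\<^sup>2 + (n2 (\<lambda>k. c k + d k) t)\<^sup>2) +
        ((nrm (wq (\<lambda>k. c k - d k) t))\<^sup>2 + (n1 (\<lambda>k. c k - d k) t)\<^sup>2 + (n2 (\<lambda>k. c k - d k) t)\<^sup>2) =
        2 * ((nrm (wq c t))\<^sup>2 + (n1 c t)\<^sup>2 + (n2 c t)\<^sup>2) + 2 * ((nrm (wq d t))\<^sup>2 + (n1 d t)\<^sup>2 + (n2 d t)\<^sup>2)"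
      unfolding eq
      by (rule alg [OF nrm_parallelogram [OF sq_wq [of c t] sq_wq [of d t]] sqid [of "n1 c t" "n1 d t"] sqid [of "n2 c t" "n2 d t"]])
  qed
  also have "\<dots> = 2 * qf c + 2 * qf d"
    unfolding qf_def
    by (subst Bochner_Integration.integral_add) (intro integrable_mult_right qf_integrable, intro integrable_mult_right qf_integrable, simp only: integral_mult_right_zero)
  finally show ?thesis .
qed

lemma qf_half: "fin_supp c \<Longrightarrow> qf (\<lambda>k. 1/2 * c k) = qf c / 4"
proof -
  assume c: "fin_supp c"
  have eq: "wq (\<lambda>k. 1/2 * c k) t = (\<lambda>s. 1/2 * wq c t s)" "n1 (\<lambda>k. 1/2 * c k) t = 1/2 * n1 c t"
    "n2 (\<lambda>k. 1/2 * c k) t = 1/2 * n2 c t" for t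
    using wq_linear [OF c c, of "1/2" 0] by (auto simp: fun_eq_iff)
  have "qf (\<lambda>k. 1/2 * c k) = (LINT t|MT. ((nrm (wq c t))\<^sup>2 + (n1 c t)\<^sup>2 + (n2 c t)\<^sup>2) / 4)"
    unfolding qf_def eq L2_norm_on_cmult
    by (intro Bochner_Integration.integral_cong refl) (simp add: power_mult_distrib power2_eq_square)
  then show ?thesis by (simp add: qf_def)
qed

lemma qf_unit: "qf (\<lambda>k. of_bool (k = n)) \<le> 2 * E + 2 * \<Lambda>\<^sup>2 * T"
proof -
  have supp: "{k. of_bool (k = n) \<noteq> (0::real)} = {n}" by auto
  have eq: "wq (\<lambda>k. of_bool (k = n)) t = dq n t" "n1 (\<lambda>k. of_bool (k = n)) t = m1 n t"
    "n2 (\<lambda>k. of_bool (k = n)) t = m2 n t" for t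
    unfolding wq_def [abs_def] n1_def n2_def supp by simp_all
  have i: "integrable MT (\<lambda>t. (nrm (dq n t))\<^sup>2)" by (rule integrable_simple_MT [OF simple_function_compose1 [OF simple_dq]])
  have "qf (\<lambda>k. of_bool (k = n)) \<le> (LINT t|MT. (nrm (dq n t))\<^sup>2 + 2 * \<Lambda>\<^sup>2)"
    unfolding qf_def
  proof (rule integral_mono [OF qf_integrable])
    fix t assume "t \<in> space MT"
    then have k: "cell n t < 2 ^ n" using cell_less [of t n] by simp
    have "(m1 n t)\<^sup>2 \<le> \<Lambda>\<^sup>2" "(m2 n t)\<^sup>2 \<le> \<Lambda>\<^sup>2"
      using scheme_l [OF sch k] \<Lambda>_nonneg unfolding m1_def m2_def
      by (metis abs_ge_zero power2_abs power_mono)+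
    then show "(nrm (wq (\<lambda>k. of_bool (k = n)) t))\<^sup>2 + (n1 (\<lambda>k. of_bool (k = n)) t)\<^sup>2 + (n2 (\<lambda>k. of_bool (k = n)) t)\<^sup>2 \<le>
        (nrm (dq n t))\<^sup>2 + 2 * \<Lambda>\<^sup>2"
      unfolding eq by linarith
  qed (use i in auto)
  also have "\<dots> = (LINT t|MT. (nrm (dq n t))\<^sup>2) + 2 * \<Lambda>\<^sup>2 * T"
    using i time.integral_const_M [of "2 * \<Lambda>\<^sup>2"] by (simp del: lebesgue_integral_const)
  also have "\<dots> \<le> 2 * E + 2 * \<Lambda>\<^sup>2 * T" using dq_energy by simp
  finally show ?thesis .
qed

text \<open>Fixed once and for all, so that the limits built from these weights become plain
  definitions.\<close>

definition cc :: "nat \<Rightarrow> nat \<Rightarrow> real" where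
  "cc = (SOME c. (\<forall>n. c n \<in> tail_convex n) \<and> (\<forall>n. qf (\<lambda>k. c (Suc n) k - c n k) \<le> (1/4) ^ n))"

lemma cc: "cc n \<in> tail_convex n" "qf (\<lambda>k. cc (Suc n) k - cc n k) \<le> (1/4) ^ n"
proof -
  have nonneg: "qf c \<ge> 0" for c unfolding qf_def by (intro Bochner_Integration.integral_nonneg) simp
  have ex: "\<exists>c. (\<forall>n. c n \<in> tail_convex n) \<and> (\<forall>n. qf (\<lambda>k. c (Suc n) k - c n k) \<le> (1/4) ^ n)"
    by (rule convex_combinations_Cauchy [of qf, OF nonneg qf_parallelogram qf_half qf_unit]) (assumption | (intro exI conjI allI; assumption))+
  have "(\<forall>n. cc n \<in> tail_convex n) \<and> (\<forall>n. qf (\<lambda>k. cc (Suc n) k - cc n k) \<le> (1/4) ^ n)"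
    unfolding cc_def by (rule someI_ex [OF ex])
  then show "cc n \<in> tail_convex n" "qf (\<lambda>k. cc (Suc n) k - cc n k) \<le> (1/4) ^ n" by simp_all
qed

end

text \<open>Completeness of Lebesgue measure, reached on the interval through extension by zero. It
  supplies measurability of limits that exist only almost everywhere and of unspecified
  representatives.\<close>

lemma (in interval) borel_measurable_AE_M:
  fixes f g :: "real \<Rightarrow> real"
  assumes f: "f \<in> borel_measurable M" and ae: "AE x in M. f x = g x"
  shows "g \<in> borel_measurable M"
proof -
  have "(\<lambda>x. if x \<in> {0<..<L} then f x else 0) \<in> borel_measurable lebesgue"
    using f by (simp add: borel_measurable_if del: greaterThanLessThan_iff)
  moreover have "AE x in lebesgue. (if x \<in> {0<..<L} then f x else 0) = (if x \<in> {0<..<L} then g x else 0)"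
    using ae unfolding AE_M_iff by eventually_elim auto
  ultimately have "(\<lambda>x. if x \<in> {0<..<L} then g x else 0) \<in> borel_measurable lebesgue"
    by (rule borel_measurable_AE)
  then show ?thesis by (simp add: borel_measurable_if del: greaterThanLessThan_iff)
qed

lemma (in interval) borel_measurable_AE_limit_M:
  fixes f :: "nat \<Rightarrow> real \<Rightarrow> real"
  assumes f: "\<And>n. f n \<in> borel_measurable M" and lim: "AE x in M. (\<lambda>n. f n x) \<longlonglongrightarrow> g x"
  shows "g \<in> borel_measurable M"
proof (rule borel_measurable_AE_M)
  show "(\<lambda>x. lim (\<lambda>n. f n x)) \<in> borel_measurable M" by (rule borel_measurable_lim_metric [OF f])
  show "AE x in M. lim (\<lambda>n. f n x) = g x" using lim by eventually_elim (rule limI)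
qed

section \<open>Limits of the averages at almost every time\<close>

context discrete_flow
begin

abbreviation w :: "nat \<Rightarrow> real \<Rightarrow> real \<Rightarrow> real" where "w n \<equiv> wq (cc n)"

definition v :: "real \<Rightarrow> real \<Rightarrow> real" where "v t s = lim (\<lambda>n. w n t s)"

definition mu1 :: "real \<Rightarrow> real" where "mu1 t = lim (\<lambda>n. n1 (cc n) t)"

definition mu2 :: "real \<Rightarrow> real" where "mu2 t = lim (\<lambda>n. n2 (cc n) t)"

definition conv_at :: "real \<Rightarrow> bool" where
  "conv_at t \<longleftrightarrow> sq_int M (v t) \<and> (\<lambda>n. nrm (\<lambda>s. w n t s - v t s)) \<longlonglongrightarrow> 0 \<and>
    (\<lambda>n. n1 (cc n) t) \<longlonglongrightarrow> mu1 t \<and> (\<lambda>n. n2 (cc n) t) \<longlonglongrightarrow> mu2 t"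

lemma cc_fin_supp: "fin_supp (cc n)"
  by (rule tail_convex_fin_supp [OF cc(1)])

definition incr :: "nat \<Rightarrow> real \<Rightarrow> real" where
  "incr n t = (nrm (\<lambda>s. w (Suc n) t s - w n t s))\<^sup>2 + (n1 (cc (Suc n)) t - n1 (cc n) t)\<^sup>2 +
    (n2 (cc (Suc n)) t - n2 (cc n) t)\<^sup>2"

lemma incr_eq: "incr n = (\<lambda>t. (nrm (wq (\<lambda>k. cc (Suc n) k - cc n k) t))\<^sup>2 + (n1 (\<lambda>k. cc (Suc n) k - cc n k) t)\<^sup>2 +
    (n2 (\<lambda>k. cc (Suc n) k - cc n k) t)\<^sup>2)"
proof
  fix t
  note l = wq_linear [OF cc_fin_supp [of "Suc n"] cc_fin_supp [of n], of 1 "-1"]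
  have "wq (\<lambda>k. cc (Suc n) k - cc n k) t = (\<lambda>s. w (Suc n) t s - w n t s)"
    using l(1) by (auto simp: fun_eq_iff)
  then show "incr n t = (nrm (wq (\<lambda>k. cc (Suc n) k - cc n k) t))\<^sup>2 + (n1 (\<lambda>k. cc (Suc n) k - cc n k) t)\<^sup>2 +
    (n2 (\<lambda>k. cc (Suc n) k - cc n k) t)\<^sup>2"
    using l(2,3) [of t] by (simp add: incr_def)
qed

lemma incr_integrable: "integrable MT (incr n)"
  unfolding incr_eq by (rule qf_integrable)

lemma incr_le: "(LINT t|MT. incr n t) \<le> (1/4) ^ n"
  using cc(2) [of n] unfolding incr_eq qf_def .

lemma sqrt_incr_ge:
  "nrm (\<lambda>s. w (Suc n) t s - w n t s) \<le> sqrt (incr n t)"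
  "\<bar>n1 (cc (Suc n)) t - n1 (cc n) t\<bar> \<le> sqrt (incr n t)"
  "\<bar>n2 (cc (Suc n)) t - n2 (cc n) t\<bar> \<le> sqrt (incr n t)"
  by (intro real_le_rsqrt, simp add: incr_def)+

lemma convergent_of_summable_increments:
  fixes a :: "nat \<Rightarrow> real"
  assumes b: "summable b" and le: "\<And>n. \<bar>a (Suc n) - a n\<bar> \<le> b n"
  shows "a \<longlonglongrightarrow> lim a"
proof -
  have "summable (\<lambda>n. a (Suc n) - a n)" by (rule summable_comparison_test' [OF b]) (use le in simp)
  then have "convergent (\<lambda>n. \<Sum>k<n. a (Suc k) - a k)" by (simp add: summable_iff_convergent)
  then have "convergent (\<lambda>n. a n - a 0)" by (simp only: sum_lessThan_telescope)
  then have "convergent (\<lambda>n. (a n - a 0) + a 0)" by (intro convergent_add convergent_const)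
  then show ?thesis by (simp add: convergent_LIMSEQ_iff)
qed

lemma AE_conv_at: "AE t in MT. conv_at t"
proof -
  have "AE t in MT. summable (\<lambda>n. sqrt (incr n t))"
  proof (rule time.AE_summable_sqrt [OF incr_integrable, where K=1 and r="1/2"])
    show "0 \<le> incr n t" for n t by (simp add: incr_def)
    show "(LINT t|MT. incr n t) \<le> 1 * ((1/2)\<^sup>2) ^ n" for n using incr_le [of n] by (simp add: power2_eq_square)
  qed auto
  then show ?thesis
  proof (rule AE_mp, intro AE_I2 impI)
    fix t assume sm: "summable (\<lambda>n. sqrt (incr n t))"
    have "summable (\<lambda>n. nrm (\<lambda>s. w (Suc n) t s - w n t s))"
      by (rule summable_comparison_test' [OF sm]) (use sqrt_incr_ge(1) in simp)
    from Riesz_Fischer [OF sq_wq this, folded v_def]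
    have "sq_int M (v t)" "(\<lambda>n. nrm (\<lambda>s. w n t s - v t s)) \<longlonglongrightarrow> 0" by blast+
    then show "conv_at t" unfolding conv_at_def mu1_def mu2_def
      by (intro conjI convergent_of_summable_increments [OF sm] sqrt_incr_ge)
  qed
qed

lemma n_bound:
  assumes "t \<in> space MT"
  shows "\<bar>n1 (cc n) t\<bar> \<le> \<Lambda>" "\<bar>n2 (cc n) t\<bar> \<le> \<Lambda>"
proof -
  have c: "cc n k \<ge> 0" for k using cc(1) [of n] by (simp add: tail_convex_def)
  have k: "cell k t < 2 ^ k" for k using cell_less [of t k] assms by simp
  have *: "\<bar>\<Sum>k | cc n k \<noteq> 0. cc n k * a k\<bar> \<le> \<Lambda>" if a: "\<And>k. \<bar>a k\<bar> \<le> \<Lambda>" for a :: "nat \<Rightarrow> real"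
  proof -
    have "\<bar>\<Sum>k | cc n k \<noteq> 0. cc n k * a k\<bar> \<le> (\<Sum>k | cc n k \<noteq> 0. cc n k * \<Lambda>)"
      by (rule order_trans [OF sum_abs], rule sum_mono) (simp add: abs_mult c a mult_left_mono)
    also have "\<dots> = \<Lambda>" by (simp only: sum_distrib_right [symmetric] tail_convex_sum_1 [OF cc(1)] mult_1_left)
    finally show ?thesis .
  qed
  show "\<bar>n1 (cc n) t\<bar> \<le> \<Lambda>" unfolding n1_def m1_def by (rule *) (rule scheme_l(1) [OF sch k])
  show "\<bar>n2 (cc n) t\<bar> \<le> \<Lambda>" unfolding n2_def m2_def by (rule *) (rule scheme_l(2) [OF sch k])
qed

lemma mu_L2: "mu1 \<in> Lp_space 2 0 T" "mu2 \<in> Lp_space 2 0 T"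
proof -
  have meas: "n1 c \<in> borel_measurable MT" "n2 c \<in> borel_measurable MT" for c
    by (rule borel_measurable_simple_function simple_n)+
  have "mu1 \<in> borel_measurable MT" "mu2 \<in> borel_measurable MT"
    unfolding mu1_def [abs_def] mu2_def [abs_def] by (rule borel_measurable_lim_metric meas)+
  moreover have "AE t in MT. \<bar>mu1 t\<bar> \<le> \<Lambda> \<and> \<bar>mu2 t\<bar> \<le> \<Lambda>"
    using AE_conv_at AE_space
  proof eventually_elim
    case (elim t)
    then have lim: "(\<lambda>n. \<bar>n1 (cc n) t\<bar>) \<longlonglongrightarrow> \<bar>mu1 t\<bar>" "(\<lambda>n. \<bar>n2 (cc n) t\<bar>) \<longlonglongrightarrow> \<bar>mu2 t\<bar>"
      unfolding conv_at_def by (simp_all only: tendsto_rabs)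
    have "\<bar>mu1 t\<bar> \<le> \<Lambda>" by (rule LIMSEQ_le_const2 [OF lim(1)]) (simp add: n_bound [OF elim(2)])
    moreover have "\<bar>mu2 t\<bar> \<le> \<Lambda>" by (rule LIMSEQ_le_const2 [OF lim(2)]) (simp add: n_bound [OF elim(2)])
    ultimately show ?case ..
  qed
  ultimately show "mu1 \<in> Lp_space 2 0 T" "mu2 \<in> Lp_space 2 0 T"
    unfolding Lp_space_2_iff by (auto simp: AE_conj_iff intro: time.sq_int_bounded [where B=\<Lambda>])
qed

text \<open>Riesz-Fischer in time for the scalar functions \<open>nrm (w n t)\<close>, whose
  increments are bounded by those of \<open>w n\<close>. The majorant makes dominated convergence
  available for the vector-valued averages.\<close>

lemma w_dominated:
  obtains H where "sq_int MT H" "AE t in MT. \<forall>n. nrm (w n t) \<le> H t" "sq_int MT (\<lambda>t. nrm (v t))"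
proof -
  have simple: "simple_function MT (\<lambda>t. nrm (w n t))" for n by (rule simple_function_compose1 [OF simple_wq])
  have sq: "sq_int MT (\<lambda>t. nrm (w n t))" for n
    unfolding sq_int_def
    by (intro conjI borel_measurable_simple_function simple integrable_simple_MT simple_function_compose1 [OF simple])
  have sm: "summable (\<lambda>n. L2_norm_on MT (\<lambda>t. nrm (w (Suc n) t) - nrm (w n t)))"
  proof (rule summable_comparison_test')
    show "summable (\<lambda>n. (1/2 :: real) ^ n)" by (rule summable_geometric) simp
    fix n
    have "(LINT t|MT. (nrm (w (Suc n) t) - nrm (w n t))\<^sup>2) \<le> (LINT t|MT. incr n t)"
    proof (rule integral_mono [OF sq_int_integrable [OF sq_int_diff [OF sq sq]] incr_integrable])
      fix t
      have "\<bar>nrm (w (Suc n) t) - nrm (w n t)\<bar> \<le> sqrt (incr n t)"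
        by (rule order_trans [OF L2_norm_on_reverse_triangle sqrt_incr_ge(1)]) (rule sq_wq)+
      then have "\<bar>nrm (w (Suc n) t) - nrm (w n t)\<bar>\<^sup>2 \<le> (sqrt (incr n t))\<^sup>2" by (intro power_mono) auto
      also have "\<dots> = incr n t" by (intro real_sqrt_pow2) (simp add: incr_def)
      finally show "(nrm (w (Suc n) t) - nrm (w n t))\<^sup>2 \<le> incr n t" by (simp only: power2_abs)
    qed
    also have "\<dots> \<le> ((1/2) ^ n)\<^sup>2"
    proof -
      have "((1/2) ^ n)\<^sup>2 = (1/2 * (1/2) :: real) ^ n" by (simp only: power2_eq_square power_mult_distrib)
      then show ?thesis using incr_le [of n] by simp
    qed
    finally have "L2_norm_on MT (\<lambda>t. nrm (w (Suc n) t) - nrm (w n t)) \<le> (1/2) ^ n"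
      unfolding L2_norm_on_def by (intro real_le_lsqrt) auto
    then show "norm (L2_norm_on MT (\<lambda>t. nrm (w (Suc n) t) - nrm (w n t))) \<le> (1/2) ^ n" by simp
  qed
  have lim: "AE t in MT. lim (\<lambda>n. nrm (w n t)) = nrm (v t)"
    using AE_conv_at
  proof eventually_elim
    case (elim t)
    then have c: "sq_int M (v t)" "(\<lambda>n. nrm (\<lambda>s. w n t s - v t s)) \<longlonglongrightarrow> 0" by (auto simp: conv_at_def)
    then show ?case by (intro limI L2_norm_on_tendsto sq_wq)
  qed
  show ?thesis
  proof (rule Riesz_Fischer [OF sq sm])
    fix H
    assume H: "sq_int MT H" "AE t in MT. \<forall>n. \<bar>nrm (w n t)\<bar> \<le> H t"
      and F: "sq_int MT (\<lambda>t. lim (\<lambda>n. nrm (w n t)))"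
    have "(\<lambda>t. nrm (v t)) \<in> borel_measurable MT"
      by (rule time.borel_measurable_AE_M [OF sq_int_measurable [OF F] lim])
    then have "sq_int MT (\<lambda>t. nrm (v t))"
      by (rule sq_int_bound [OF F]) (use lim in \<open>eventually_elim, simp\<close>)
    moreover have "AE t in MT. \<forall>n. nrm (w n t) \<le> H t" using H(2) by simp
    ultimately show ?thesis by (intro that [OF H(1)])
  qed
qed

section \<open>The limit equation and the time derivative\<close>

lemma ip_wq: "sq_int M e \<Longrightarrow> ip (wq c t) e = (\<Sum>k | c k \<noteq> 0. c k * ip (dq k t) e)"
proof -
  assume e: "sq_int M e"
  have "ip (wq c t) e = (LINT s|M. (\<Sum>k | c k \<noteq> 0. c k * (dq k t s * e s)))"
    by (simp only: wq_def sum_distrib_right mult.assoc)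
  also have "\<dots> = (\<Sum>k | c k \<noteq> 0. LINT s|M. c k * (dq k t s * e s))"
    by (intro Bochner_Integration.integral_sum integrable_mult_right sq_int_mult_integrable sq_dq e)
  finally show ?thesis by simp
qed

lemma ip_tendsto:
  assumes "\<And>n. sq_int M (f n)" "sq_int M g" "sq_int M e" "(\<lambda>n. nrm (\<lambda>s. f n s - g s)) \<longlonglongrightarrow> 0"
  shows "(\<lambda>n. ip (f n) e) \<longlonglongrightarrow> ip g e"
proof -
  have "(\<lambda>n. ip (f n) e - ip g e) \<longlonglongrightarrow> 0"
  proof (rule Lim_null_comparison)
    show "(\<lambda>n. nrm (\<lambda>s. f n s - g s) * nrm e) \<longlonglongrightarrow> 0" using tendsto_mult_right [OF assms(4), of "nrm e"] by simp
    have "ip (f n) e - ip g e = ip (\<lambda>s. f n s - g s) e" for n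
      using ip_linear [OF assms(1,2,3), of 1 n "-1"] by simp
    then show "\<forall>\<^sub>F n in sequentially. norm (ip (f n) e - ip g e) \<le> nrm (\<lambda>s. f n s - g s) * nrm e"
      by (auto intro!: always_eventually L2_Cauchy_Schwarz sq_int_diff assms)
  qed
  then show ?thesis by (simp add: LIM_zero_iff)
qed

text \<open>The multiplier terms live at the left end of the time cell while \<open>ub\<close>
  converges at the right end; a single step is \<open>O(\<tau>\<^sup>1\<^sup>/\<^sup>2)\<close> in
  \<open>L\<^sup>2\<close>, so the lag disappears in the limit.\<close>

lemma lag_tendsto:
  assumes "0 < t" "t \<le> T"
  shows "(\<lambda>n. nrm (\<lambda>s. U n (cell n t) s - u t s)) \<longlonglongrightarrow> 0"
proof (rule Lim_null_comparison)
  have t0: "0 \<le> t" using assms by simp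
  note c = ub_converges [OF t0 assms(2)]
  have "(\<lambda>n. sqrt (2 * tau n * E) + nrm (\<lambda>s. ub n t s - u t s)) \<longlonglongrightarrow> sqrt (2 * 0 * E) + 0"
    by (intro tendsto_intros c tau_tendsto)
  then show "(\<lambda>n. sqrt (2 * tau n * E) + nrm (\<lambda>s. ub n t s - u t s)) \<longlonglongrightarrow> 0" by simp
  have "nrm (\<lambda>s. U n (cell n t) s - u t s) \<le> sqrt (2 * tau n * E) + nrm (\<lambda>s. ub n t s - u t s)" for n
  proof -
    have "nrm (\<lambda>s. U n (Suc (cell n t)) s - U n (cell n t) s) \<le> sqrt (2 * tau n * E)"
      by (intro real_le_rsqrt scheme_step_le [OF sch])
    then have "nrm (\<lambda>s. U n (cell n t) s - ub n t s) \<le> sqrt (2 * tau n * E)"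
      unfolding ub_def ix_eq_Suc_cell [OF assms(1)] by (subst L2_norm_on_commute)
    moreover have "nrm (\<lambda>s. U n (cell n t) s - u t s) \<le> nrm (\<lambda>s. U n (cell n t) s - ub n t s) + nrm (\<lambda>s. ub n t s - u t s)"
      by (intro L2_norm_on_triangle3 sq_U ub_sq c)
    ultimately show ?thesis by linarith
  qed
  then show "\<forall>\<^sub>F n in sequentially. norm (nrm (\<lambda>s. U n (cell n t) s - u t s)) \<le> sqrt (2 * tau n * E) + nrm (\<lambda>s. ub n t s - u t s)"
    by (auto intro: always_eventually)
qed

text \<open>Neither the difference quotients nor the multipliers are known to converge at t. The
  residual of the limit equation formed with them does tend to zero, and it is affine in them;
  averaging it with weights of total 1 replaces them by averages that converge.\<close>

lemma limit_equation:
  assumes t: "t \<in> space MT" and g: "limit_at t g" and c: "conv_at t" and \<phi>: "W_rep \<phi> \<phi>'"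
  shows "ip (v t) \<phi> - mu1 t * ip (sn (u t)) \<phi> + mu2 t * ip (cs (u t)) \<phi> +
    (LINT x|M. pflux p (g x + phi_deriv) * \<phi>' x) = 0"
proof -
  have t': "0 < t" "t \<le> T" using t by auto
  have W: "W_rep (u t) g" using g by (simp add: limit_at_def)
  have k: "cell n t < 2 ^ n" for n by (rule cell_less [OF t'])
  note \<phi>_sq = W_rep_sq_int [OF \<phi>]
  note u_sq = W_rep_sq_int [OF W]
  define P where "P = (LINT x|M. pflux p (g x + phi_deriv) * \<phi>' x)"
  define Pn where "Pn n = (LINT x|M. pflux p (gb n t x + phi_deriv) * \<phi>' x)" for n
  define S where "S = ip (sn (u t)) \<phi>"
  define C where "C = ip (cs (u t)) \<phi>"
  define Sn where "Sn n = ip (sn (U n (cell n t))) \<phi>" for n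
  define Cn where "Cn n = ip (cs (U n (cell n t))) \<phi>" for n
  have Pn: "Pn \<longlonglongrightarrow> P" using g W_rep_p_int [OF \<phi>] by (simp add: limit_at_def P_def Pn_def [abs_def])
  have lip: "(\<lambda>n. nrm (\<lambda>s. F (U n (cell n t) s + ph s) - F (u t s + ph s))) \<longlonglongrightarrow> 0"
    if F: "\<And>x y. \<bar>F x - F y\<bar> \<le> \<bar>x - y\<bar>" "\<And>w h. W_rep w h \<Longrightarrow> sq_int M (\<lambda>x. F (w x + ph x))" for F :: "real \<Rightarrow> real"
  proof (rule Lim_null_comparison [OF _ lag_tendsto [OF t']])
    have "nrm (\<lambda>s. F (U n (cell n t) s + ph s) - F (u t s + ph s)) \<le> nrm (\<lambda>s. U n (cell n t) s - u t s)" for n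
      unfolding L2_norm_on_def
    proof (intro real_sqrt_le_mono integral_mono sq_int_integrable sq_int_diff sq_U u_sq F(2) [OF W] F(2) [OF W_U])
      fix s
      have "\<bar>F (U n (cell n t) s + ph s) - F (u t s + ph s)\<bar> \<le> \<bar>U n (cell n t) s - u t s\<bar>"
        using F(1) [of "U n (cell n t) s + ph s" "u t s + ph s"] by simp
      then show "(F (U n (cell n t) s + ph s) - F (u t s + ph s))\<^sup>2 \<le> (U n (cell n t) s - u t s)\<^sup>2"
        by (simp only: abs_le_square_iff)
    qed
    then show "\<forall>\<^sub>F n in sequentially. norm (nrm (\<lambda>s. F (U n (cell n t) s + ph s) - F (u t s + ph s))) \<le> nrm (\<lambda>s. U n (cell n t) s - u t s)"
      by (auto intro: always_eventually)
  qed
  have Sn: "Sn \<longlonglongrightarrow> S" unfolding Sn_def [abs_def] S_def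
    by (rule ip_tendsto [OF sn_sq_int [OF W_U] sn_sq_int [OF W] \<phi>_sq lip]) (rule sin_lipschitz sn_sq_int; assumption)+
  have Cn: "Cn \<longlonglongrightarrow> C" unfolding Cn_def [abs_def] C_def
    by (rule ip_tendsto [OF cs_sq_int [OF W_U] cs_sq_int [OF W] \<phi>_sq lip]) (rule cos_lipschitz cs_sq_int; assumption)+
  \<comment> \<open>S, C and P are already the limits, so z is affine in the three quantities that
    lack a limit and commutes with convex combinations.\<close>
  define z where "z n = ip (dq n t) \<phi> - m1 n t * S + m2 n t * C + P" for n
  have z_eq: "z n = (P - Pn n) + m1 n t * (Sn n - S) - m2 n t * (Cn n - C)" for n
  proof -
    have "ip (dq n t) \<phi> = ip (\<lambda>x. U n (Suc (cell n t)) x - U n (cell n t) x) \<phi> / tau n"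
      by (simp only: dq_eq mult.assoc integral_mult_right_zero integral_divide_zero times_divide_eq_left mult_1_left)
    then have "Pn n + ip (dq n t) \<phi> = m1 n t * Sn n - m2 n t * Cn n"
      using scheme_EL [OF sch k \<phi>, of n]
      unfolding EL_def Pn_def Sn_def Cn_def m1_def m2_def gb_def ix_eq_Suc_cell [OF t'(1)] by simp
    then show ?thesis by (simp add: z_def algebra_simps)
  qed
  have bounded_null: "(\<lambda>n. b n * a n) \<longlonglongrightarrow> 0" if "\<And>n. \<bar>b n\<bar> \<le> \<Lambda>" "a \<longlonglongrightarrow> 0" for a b :: "nat \<Rightarrow> real"
  proof (rule Lim_null_comparison)
    show "(\<lambda>n. \<Lambda> * \<bar>a n\<bar>) \<longlonglongrightarrow> 0"
      using tendsto_mult_left [OF tendsto_rabs_zero [OF that(2)], of \<Lambda>] by simp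
    show "\<forall>\<^sub>F n in sequentially. norm (b n * a n) \<le> \<Lambda> * \<bar>a n\<bar>"
      using that(1) by (auto intro!: always_eventually mult_right_mono simp: abs_mult)
  qed
  have "z \<longlonglongrightarrow> 0"
  proof -
    have "(\<lambda>n. (P - Pn n) + m1 n t * (Sn n - S) - m2 n t * (Cn n - C)) \<longlonglongrightarrow> (P - P) + 0 - 0"
      using Pn Sn Cn scheme_l [OF sch k]
      by (intro tendsto_intros bounded_null) (auto simp: m1_def m2_def LIM_zero_iff)
    then show ?thesis unfolding z_eq [abs_def] by simp
  qed
  then have "(\<lambda>n. \<Sum>k | cc n k \<noteq> 0. cc n k * z k) \<longlonglongrightarrow> 0" by (rule tail_convex_tendsto_0 [OF cc(1)])
  moreover have "(\<Sum>k | cc n k \<noteq> 0. cc n k * z k) = ip (w n t) \<phi> - n1 (cc n) t * S + n2 (cc n) t * C + P" for n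
  proof -
    have "(\<Sum>k | cc n k \<noteq> 0. cc n k * z k) = (\<Sum>k | cc n k \<noteq> 0. cc n k * ip (dq k t) \<phi>) -
        (\<Sum>k | cc n k \<noteq> 0. cc n k * m1 k t) * S + (\<Sum>k | cc n k \<noteq> 0. cc n k * m2 k t) * C + (\<Sum>k | cc n k \<noteq> 0. cc n k) * P"
      unfolding sum_distrib_right sum_subtractf [symmetric] sum.distrib [symmetric]
      by (intro sum.cong refl) (simp add: z_def algebra_simps)
    then show ?thesis by (simp add: ip_wq [OF \<phi>_sq] n1_def n2_def tail_convex_sum_1 [OF cc(1)])
  qed
  moreover have "(\<lambda>n. ip (w n t) \<phi> - n1 (cc n) t * S + n2 (cc n) t * C + P) \<longlonglongrightarrow> ip (v t) \<phi> - mu1 t * S + mu2 t * C + P"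
    using c unfolding conv_at_def
    by (intro tendsto_intros ip_tendsto [OF sq_wq _ \<phi>_sq]) auto
  ultimately have "ip (v t) \<phi> - mu1 t * S + mu2 t * C + P = 0"
    using LIMSEQ_unique by fastforce
  then show ?thesis by (simp add: S_def C_def P_def)
qed

text \<open>Up to the right end of the cell containing t the integral telescopes exactly to the step
  function. The part of that cell beyond t is the only discrepancy, and it costs at most one
  increment.\<close>

lemma step_primitive:
  assumes e: "sq_int M e" and t: "0 \<le> t" "t \<le> T"
  shows "\<bar>(LINT r|MT. indicator {..t} r * ip (dq k r) e) - ip (\<lambda>s. ub k t s - u0 s) e\<bar> \<le> sqrt (2 * tau k * E) * nrm e"
proof -
  define F where "F j = ip (\<lambda>s. 1 / tau k * (U k (Suc j) s - U k j s)) e" for j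
  define K where "K = ix k t"
  have Fc: "ip (dq k r) e = F (cell k r)" for r by (simp add: dq_eq F_def)
  have F_eq: "F j = 1 / tau k * ip (\<lambda>s. U k (Suc j) s - U k j s) e" for j
    by (simp only: F_def mult.assoc integral_mult_right_zero)
  have K_le: "K \<le> 2 ^ k"
  proof (cases "t = 0")
    case False
    then have "t > 0" using t by simp
    then show ?thesis using cell_less [OF _ t(2), of k] by (simp add: K_def ix_eq_Suc_cell)
  qed (simp add: K_def)
  have Kt: "t * 2 ^ k / T \<le> real K" "real K < t * 2 ^ k / T + 1" unfolding K_def by (rule ix_bounds [OF t(1)])+
  have tel: "tau k * (\<Sum>j<2 ^ k. of_bool (j < K) * F j) = ip (\<lambda>s. ub k t s - u0 s) e"
  proof -
    have "(\<Sum>j<2 ^ k. of_bool (j < K) * F j) = (\<Sum>j<K. F j)"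
      using K_le by (intro sum.mono_neutral_cong_right) (auto split: if_splits)
    moreover have "tau k * (\<Sum>j<m. F j) = ip (\<lambda>s. U k m s - U k 0 s) e" for m
    proof (induction m)
      case (Suc m)
      have "ip (\<lambda>s. U k (Suc m) s - U k 0 s) e =
          ip (\<lambda>s. 1 * (U k m s - U k 0 s) + 1 * (U k (Suc m) s - U k m s)) e" by simp
      also have "\<dots> = ip (\<lambda>s. U k m s - U k 0 s) e + ip (\<lambda>s. U k (Suc m) s - U k m s) e"
        by (subst ip_linear) (simp_all add: sq_int_diff sq_U e)
      also have "\<dots> = tau k * (\<Sum>j<Suc m. F j)" using Suc T_pos by (simp add: F_eq distrib_left)
      finally show ?case ..
    qed simp
    ultimately show ?thesis by (simp add: ub_def K_def U_0)
  qed
  have meas: "(\<lambda>r. indicator {..t} r * F (cell k r)) \<in> borel_measurable MT"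
    by (intro borel_measurable_times time.indicator_measurable_M borel_measurable_simple_function [OF simple_fun_cell]) simp
  have i0: "integrable MT (\<lambda>r. F (cell k r))" by (rule integrable_simple_MT [OF simple_fun_cell])
  have i1: "integrable MT (\<lambda>r. indicator {..t} r * F (cell k r))"
    by (rule time.integrable_indicator_mult [OF i0]) simp
  have i2: "integrable MT (\<lambda>r. of_bool (cell k r < K) * F (cell k r))"
    by (rule integrable_simple_MT [OF simple_fun_cell])
  have i3: "integrable MT (\<lambda>r. of_bool (Suc (cell k r) = K) * \<bar>F (cell k r)\<bar>)"
    by (rule integrable_simple_MT [OF simple_fun_cell])
  have "(LINT r|MT. indicator {..t} r * F (cell k r)) - ip (\<lambda>s. ub k t s - u0 s) e =
      (LINT r|MT. indicator {..t} r * F (cell k r) - of_bool (cell k r < K) * F (cell k r))"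
    unfolding Bochner_Integration.integral_diff [OF i1 i2] integral_cell [of "\<lambda>j. of_bool (j < K) * F j"] tel
    by (rule refl)
  also have "\<bar>\<dots>\<bar> \<le> (LINT r|MT. \<bar>indicator {..t} r * F (cell k r) - of_bool (cell k r < K) * F (cell k r)\<bar>)"
    by (rule integral_abs_bound)
  also have "\<dots> \<le> (LINT r|MT. of_bool (Suc (cell k r) = K) * \<bar>F (cell k r)\<bar>)"
  proof (rule integral_mono)
    fix r assume "r \<in> space MT"
    then have r: "r > 0" by simp
    have 1: "cell k r < K" if "r \<le> t"
    proof -
      have "r * 2 ^ k / T \<le> t * 2 ^ k / T" using that T_pos by (intro divide_right_mono mult_right_mono) auto
      then show ?thesis using cell_bounds(1) [OF r, of k] Kt(1) by linarith
    qed
    have 2: "K \<le> Suc (cell k r)" if "r > t"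
    proof -
      have "t * 2 ^ k / T \<le> r * 2 ^ k / T" using that T_pos by (intro divide_right_mono mult_right_mono) auto
      then have "real K < real (cell k r) + 2" using cell_bounds(2) [OF r, of k] Kt(2) by linarith
      then show ?thesis by linarith
    qed
    show "\<bar>indicator {..t} r * F (cell k r) - of_bool (cell k r < K) * F (cell k r)\<bar> \<le> of_bool (Suc (cell k r) = K) * \<bar>F (cell k r)\<bar>"
      using 1 2 by (cases "r \<le> t") (auto simp: indicator_def)
  qed (use i1 i2 i3 in auto)
  also have "\<dots> = tau k * (\<Sum>j<2 ^ k. of_bool (Suc j = K) * \<bar>F j\<bar>)" by (rule integral_cell)
  also have "\<dots> \<le> sqrt (2 * tau k * E) * nrm e"
  proof (cases K)
    case 0
    then show ?thesis using E_nonneg T_pos by simp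
  next
    case (Suc j)
    have "(\<Sum>i<2 ^ k. of_bool (Suc i = K) * \<bar>F i\<bar>) = (\<Sum>i<2 ^ k. if i = j then \<bar>F i\<bar> else 0)"
      using Suc by (intro sum.cong) auto
    also have "\<dots> = \<bar>F j\<bar>" using Suc K_le by simp
    finally have "tau k * (\<Sum>i<2 ^ k. of_bool (Suc i = K) * \<bar>F i\<bar>) = \<bar>ip (\<lambda>s. U k (Suc j) s - U k j s) e\<bar>"
      using T_pos by (simp add: F_eq abs_mult)
    also have "\<dots> \<le> nrm (\<lambda>s. U k (Suc j) s - U k j s) * nrm e"
      by (intro L2_Cauchy_Schwarz sq_int_diff sq_U e)
    also have "\<dots> \<le> sqrt (2 * tau k * E) * nrm e"
      by (intro mult_right_mono real_le_rsqrt scheme_step_le [OF sch]) simp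
    finally show ?thesis .
  qed
  finally show ?thesis by (simp only: Fc)
qed

text \<open>Convex combinations of a convergent scalar sequence keep its limit, so the averages w
  have the same primitives in the limit as the difference quotients; dominated convergence then
  brings in v. Testing with a fixed e keeps the argument scalar.\<close>

lemma u_primitive:
  assumes e: "sq_int M e"
  shows "time.prim_on (\<lambda>t. ip (u t) e) (\<lambda>t. ip (v t) e)"
proof (rule w_dominated)
  fix H assume H: "sq_int MT H" "AE t in MT. \<forall>n. nrm (w n t) \<le> H t"
  have lim: "AE r in MT. (\<lambda>n. ip (w n r) e) \<longlonglongrightarrow> ip (v r) e"
    using AE_conv_at by eventually_elim (rule ip_tendsto [OF sq_wq _ e], auto simp: conv_at_def)
  have wm: "(\<lambda>r. ip (w n r) e) \<in> borel_measurable MT" for n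
    by (rule borel_measurable_simple_function [OF simple_function_compose1 [OF simple_wq]])
  have vm: "(\<lambda>r. ip (v r) e) \<in> borel_measurable MT" by (rule time.borel_measurable_AE_limit_M [OF wm lim])
  have Hi: "integrable MT (\<lambda>r. H r * nrm e)" using time.sq_int_imp_integrable [OF H(1)] by simp
  have dom: "AE r in MT. norm (indicator A r * ip (w n r) e) \<le> H r * nrm e" for n and A :: "real set"
    using H(2)
  proof eventually_elim
    case (elim r)
    have "\<bar>indicator A r * ip (w n r) e\<bar> \<le> \<bar>ip (w n r) e\<bar>" by (simp add: indicator_def)
    also have "\<dots> \<le> nrm (w n r) * nrm e" by (rule L2_Cauchy_Schwarz [OF sq_wq e])
    also have "\<dots> \<le> H r * nrm e" using elim by (intro mult_right_mono) auto
    finally show ?case by simp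
  qed
  have lim': "AE r in MT. (\<lambda>n. indicator A r * ip (w n r) e) \<longlonglongrightarrow> indicator A r * ip (v r) e" for A :: "real set"
    using lim by eventually_elim (intro tendsto_intros)
  have ind: "A \<in> sets borel \<Longrightarrow> (indicator A :: real \<Rightarrow> real) \<in> borel_measurable MT" for A
    by (rule time.indicator_measurable_M)
  have vi: "integrable MT (\<lambda>r. ip (v r) e)"
    using integrable_dominated_convergence [OF _ _ Hi lim' [of UNIV] dom [of UNIV]] vm wm by simp
  have "ip (u t) e = ip (u 0) e + (LINT r|MT. indicator {..t} r * ip (v r) e)" if t: "t \<in> {0..T}" for t
  proof -
    have t': "0 \<le> t" "t \<le> T" using t by auto
    have 0: "sq_int M u0" "sq_int M (u t)" using ub_converges(1) [of 0] ub_converges(1) [OF t'] T_pos by (simp_all add: u_0)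
    define D where "D k = (LINT r|MT. indicator {..t} r * ip (dq k r) e)" for k
    have "(\<lambda>k. D k - ip (\<lambda>s. ub k t s - u0 s) e) \<longlonglongrightarrow> 0"
    proof (rule Lim_null_comparison)
      have "(\<lambda>k. sqrt (2 * tau k * E) * nrm e) \<longlonglongrightarrow> sqrt (2 * 0 * E) * nrm e" by (intro tendsto_intros tau_tendsto)
      then show "(\<lambda>k. sqrt (2 * tau k * E) * nrm e) \<longlonglongrightarrow> 0" by simp
      show "\<forall>\<^sub>F k in sequentially. norm (D k - ip (\<lambda>s. ub k t s - u0 s) e) \<le> sqrt (2 * tau k * E) * nrm e"
        using step_primitive [OF e t'] by (simp add: D_def)
    qed
    moreover have "(\<lambda>k. ip (\<lambda>s. ub k t s - u0 s) e) \<longlonglongrightarrow> ip (\<lambda>s. u t s - u0 s) e"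
      by (rule ip_tendsto) (use ub_converges(2) [OF t'] 0 e ub_sq in \<open>auto simp: sq_int_diff\<close>)
    ultimately have "D \<longlonglongrightarrow> ip (\<lambda>s. u t s - u0 s) e" using tendsto_add by fastforce
    then have "(\<lambda>n. \<Sum>k | cc n k \<noteq> 0. cc n k * D k) \<longlonglongrightarrow> ip (\<lambda>s. u t s - u0 s) e"
      by (rule tail_convex_tendsto [OF cc(1)])
    moreover have "(\<Sum>k | cc n k \<noteq> 0. cc n k * D k) = (LINT r|MT. indicator {..t} r * ip (w n r) e)" for n
    proof -
      have i: "integrable MT (\<lambda>r. indicator {..t} r * ip (dq k r) e)" for k
        by (intro time.integrable_indicator_mult integrable_simple_MT simple_function_compose1 [OF simple_dq]) simp
      have "(LINT r|MT. indicator {..t} r * ip (w n r) e) =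
          (LINT r|MT. (\<Sum>k | cc n k \<noteq> 0. cc n k * (indicator {..t} r * ip (dq k r) e)))"
        by (simp only: ip_wq [OF e] sum_distrib_left mult.left_commute)
      also have "\<dots> = (\<Sum>k | cc n k \<noteq> 0. LINT r|MT. cc n k * (indicator {..t} r * ip (dq k r) e))"
        by (intro Bochner_Integration.integral_sum integrable_mult_right i)
      finally show ?thesis by (simp add: D_def)
    qed
    moreover have "(\<lambda>n. LINT r|MT. indicator {..t} r * ip (w n r) e) \<longlonglongrightarrow> (LINT r|MT. indicator {..t} r * ip (v r) e)"
      by (rule integral_dominated_convergence [OF _ _ Hi lim' dom]) (intro borel_measurable_times ind vm wm, simp)+
    ultimately have "(LINT r|MT. indicator {..t} r * ip (v r) e) = ip (\<lambda>s. u t s - u0 s) e"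
      using LIMSEQ_unique by fastforce
    also have "\<dots> = ip (u t) e - ip (u 0) e"
      using ip_linear [OF 0(2,1) e, of 1 "-1"] by (simp add: u_0)
    finally show ?thesis by simp
  qed
  then show ?thesis unfolding time.prim_on_def using vi by blast
qed

end

section \<open>Bochner integrals of square integrable functions\<close>

text \<open>A Cauchy condition without a rate, in the form met by approximations of a common object.
  A subsequence with errors below 2^-k satisfies the summability asked for by
  \<open>Riesz_Fischer\<close>.\<close>

lemma L2_complete:
  fixes y :: "nat \<Rightarrow> 'a \<Rightarrow> real"
  assumes y: "\<And>n. sq_int M (y n)" and le: "\<And>n m. L2_norm_on M (\<lambda>x. y n x - y m x) \<le> e n + e m"
    and e: "e \<longlonglongrightarrow> 0"
  obtains z where "sq_int M z" "(\<lambda>n. L2_norm_on M (\<lambda>x. y n x - z x)) \<longlonglongrightarrow> 0"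
proof -
  have e_nonneg: "e n \<ge> 0" for n using le [of n n] order_trans [OF L2_norm_on_nonneg le [of n n]] by simp
  have "\<exists>N. \<forall>n\<ge>N. e n < (1/2) ^ k" for k :: nat
    using order_tendstoD(2) [OF e, of "(1/2) ^ k"] by (simp add: eventually_sequentially)
  then obtain r where r: "\<And>k n. n \<ge> r k \<Longrightarrow> e n < (1/2) ^ k" by metis
  define R where "R k = (\<Sum>i\<le>k. r i)" for k
  have "r k \<le> R k" for k unfolding R_def by (intro member_le_sum) auto
  then have eR: "e (R k) < (1/2) ^ k" for k by (rule r)
  have "summable (\<lambda>k. L2_norm_on M (\<lambda>x. y (R (Suc k)) x - y (R k) x))"
  proof (rule summable_comparison_test')
    show "summable (\<lambda>k. 2 * (1/2 :: real) ^ k)" by (intro summable_mult summable_geometric) simp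
    fix k
    have "(1/2 :: real) ^ Suc k \<le> (1/2) ^ k" by simp
    then have "L2_norm_on M (\<lambda>x. y (R (Suc k)) x - y (R k) x) \<le> 2 * (1/2) ^ k"
      using le [of "R (Suc k)" "R k"] eR [of k] eR [of "Suc k"] by linarith
    then show "norm (L2_norm_on M (\<lambda>x. y (R (Suc k)) x - y (R k) x)) \<le> 2 * (1/2) ^ k" by simp
  qed
  then show ?thesis
  proof (rule Riesz_Fischer [OF y])
    define z where "z x = lim (\<lambda>k. y (R k) x)" for x
    assume "sq_int M (\<lambda>x. lim (\<lambda>k. y (R k) x))" "(\<lambda>k. L2_norm_on M (\<lambda>x. y (R k) x - lim (\<lambda>k. y (R k) x))) \<longlonglongrightarrow> 0"
    then have z: "sq_int M z" "(\<lambda>k. L2_norm_on M (\<lambda>x. y (R k) x - z x)) \<longlonglongrightarrow> 0" by (simp_all add: z_def [abs_def])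
    have eR0: "(\<lambda>k. e (R k)) \<longlonglongrightarrow> 0"
      by (rule Lim_null_comparison [where g="\<lambda>k. (1/2) ^ k"])
        (use eR e_nonneg in \<open>auto intro!: always_eventually less_imp_le LIMSEQ_power_zero\<close>)
    have yz: "L2_norm_on M (\<lambda>x. y n x - z x) \<le> e n" for n
    proof (rule LIMSEQ_le_const)
      have "(\<lambda>k. e n + e (R k) + L2_norm_on M (\<lambda>x. y (R k) x - z x)) \<longlonglongrightarrow> e n + 0 + 0"
        by (intro tendsto_intros eR0 z)
      then show "(\<lambda>k. e n + e (R k) + L2_norm_on M (\<lambda>x. y (R k) x - z x)) \<longlonglongrightarrow> e n" by simp
      have "L2_norm_on M (\<lambda>x. y n x - z x) \<le> e n + e (R k) + L2_norm_on M (\<lambda>x. y (R k) x - z x)" for k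
        using L2_norm_on_triangle3 [OF y [of n] y [of "R k"] z(1)] le [of n "R k"] by linarith
      then show "\<exists>N. \<forall>k\<ge>N. L2_norm_on M (\<lambda>x. y n x - z x) \<le> e n + e (R k) + L2_norm_on M (\<lambda>x. y (R k) x - z x)"
        by blast
    qed
    have "(\<lambda>n. L2_norm_on M (\<lambda>x. y n x - z x)) \<longlonglongrightarrow> 0"
      by (rule Lim_null_comparison [OF always_eventually e]) (use yz in simp)
    with z(1) show ?thesis by (rule that)
  qed
qed

text \<open>The primitive is continuous and vanishes at a dense set, hence on all of
  \<open>{0..L}\<close>, and the weak derivative of 0 is unique. Countably many conditions matter
  because each of them will hold only outside a null set of times.\<close>

lemma (in interval) AE_zero_if_rational_primitives_zero:
  fixes f :: "real \<Rightarrow> real"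
  assumes f: "integrable M f" and zero: "\<And>q. q \<in> \<rat> \<Longrightarrow> (LINT s|M. indicator {..q} s * f s) = 0"
  shows "AE s in M. f s = 0"
proof -
  define F where "F x = (LINT s|M. indicator {..x} s * f s)" for x
  have cont: "continuous_on {0..L} F" unfolding F_def by (rule continuous_on_primitive [OF f])
  have F0: "F x = 0" if x: "x \<in> {0..L}" for x
  proof (rule ccontr)
    assume "F x \<noteq> 0"
    then obtain d where d: "d > 0" "\<And>y. y \<in> {0..L} \<Longrightarrow> dist y x < d \<Longrightarrow> dist (F y) (F x) < \<bar>F x\<bar>"
      using cont x unfolding continuous_on_iff by (metis zero_less_abs_iff)
    have "max 0 (x - d) < min L (x + d)" using d(1) x L_pos by auto
    then obtain q where q: "q \<in> \<rat>" "max 0 (x - d) < q" "q < min L (x + d)" by (rule Rats_dense_in_real [THEN bexE]) auto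
    then have "dist (F q) (F x) < \<bar>F x\<bar>" by (intro d) (auto simp: dist_real_def)
    moreover have "F q = 0" unfolding F_def by (rule zero [OF q(1)])
    ultimately show False by (simp add: dist_real_def)
  qed
  have "prim_on (\<lambda>_. 0) f" unfolding prim_on_def using f F0 by (simp add: F_def)
  moreover have "prim_on (\<lambda>_. 0) (\<lambda>_. 0)" unfolding prim_on_def by simp
  ultimately show ?thesis by (intro has_weak_deriv_unique prim_on_has_weak_deriv)
qed

locale space_time = interval L + time: interval T for L T :: real
begin

abbreviation MT :: "real measure" where "MT \<equiv> lebesgue_on {0<..<T}"

abbreviation nrm :: "(real \<Rightarrow> real) \<Rightarrow> real" where "nrm \<equiv> L2_norm_on M"

abbreviation ip :: "(real \<Rightarrow> real) \<Rightarrow> (real \<Rightarrow> real) \<Rightarrow> real" where "ip f g \<equiv> (LINT x|M. f x * g x)"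

abbreviation X :: "(real \<Rightarrow> real) set" where "X \<equiv> Lp_space 2 0 L"

abbreviation N :: "(real \<Rightarrow> real) \<Rightarrow> real" where "N \<equiv> Lp_norm 2 0 L"

lemma N_eq: "N = nrm"
  by (rule ext) (rule Lp_norm_2_eq)

lemma ip_diff: "sq_int M f \<Longrightarrow> sq_int M g \<Longrightarrow> sq_int M e \<Longrightarrow> ip (\<lambda>s. f s - g s) e = ip f e - ip g e"
  by (simp add: left_diff_distrib sq_int_mult_integrable)

text \<open>The finite sum that occurs in \<open>has_Bochner_integral_in\<close>.\<close>

definition simple_int :: "(real \<Rightarrow> real \<Rightarrow> real) \<Rightarrow> real \<Rightarrow> real" where
  "simple_int g s = (\<Sum>w\<in>g ` {0<..<T}. measure lebesgue {t \<in> {0<..<T}. g t = w} * w s)"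

lemma simple_inD:
  assumes "simple_in X T g"
  shows "simple_function MT g" "t \<in> {0<..<T} \<Longrightarrow> sq_int M (g t)"
  using assms by (auto simp: simple_in_def Lp_space_2_iff)

lemma integral_simple:
  fixes F :: "(real \<Rightarrow> real) \<Rightarrow> real"
  assumes g: "simple_function MT g"
  shows "integrable MT (\<lambda>t. F (g t))"
    and "(LINT t|MT. F (g t)) = (\<Sum>w\<in>g ` {0<..<T}. measure lebesgue {t \<in> {0<..<T}. g t = w} * F w)"
proof -
  define S where "S w = {t \<in> {0<..<T}. g t = w}" for w
  have fin: "finite (g ` {0<..<T})" using simple_functionD(1) [OF g] by simp
  have "g -` {w} \<inter> space MT = S w" for w by (auto simp: S_def)
  then have S: "S w \<in> sets MT" for w using simple_functionD(2) [OF g, of "{w}"] by simp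
  have eq: "F (g t) = (\<Sum>w\<in>g ` {0<..<T}. F w * indicator (S w) t)" if "t \<in> space MT" for t
  proof -
    have t: "t \<in> {0<..<T}" using that by simp
    have "(\<Sum>w\<in>g ` {0<..<T}. F w * indicator (S w) t) = (\<Sum>w\<in>g ` {0<..<T}. if w = g t then F w else 0)"
      using t by (intro sum.cong) (auto simp: S_def)
    also have "\<dots> = F (g t)" using fin t by simp
    finally show ?thesis ..
  qed
  have i: "integrable MT (\<lambda>t. F w * indicator (S w) t)" for w
    using S [of w] by (intro integrable_mult_right integrable_real_indicator time.finite_measure_axioms) (auto simp: less_top [symmetric])
  show "integrable MT (\<lambda>t. F (g t))"
    by (subst Bochner_Integration.integrable_cong [OF refl eq]) (auto intro: i)
  have "(LINT t|MT. F (g t)) = (LINT t|MT. (\<Sum>w\<in>g ` {0<..<T}. F w * indicator (S w) t))"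
    by (rule Bochner_Integration.integral_cong [OF refl eq])
  also have "\<dots> = (\<Sum>w\<in>g ` {0<..<T}. LINT t|MT. F w * indicator (S w) t)"
    by (rule Bochner_Integration.integral_sum) (rule i)
  also have "\<dots> = (\<Sum>w\<in>g ` {0<..<T}. measure lebesgue (S w) * F w)"
  proof (rule sum.cong [OF refl])
    fix w
    have "measure MT (S w) = measure lebesgue (S w)" by (rule measure_restrict_space) (auto simp: S_def)
    moreover have "S w \<inter> space MT = S w" by (auto simp: S_def)
    ultimately show "(LINT t|MT. F w * indicator (S w) t) = measure lebesgue (S w) * F w" by simp
  qed
  finally show "(LINT t|MT. F (g t)) = (\<Sum>w\<in>g ` {0<..<T}. measure lebesgue {t \<in> {0<..<T}. g t = w} * F w)"
    unfolding S_def .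
qed

lemma integrable_simple2:
  fixes F :: "(real \<Rightarrow> real) \<Rightarrow> (real \<Rightarrow> real) \<Rightarrow> real"
  assumes "simple_function MT g" "simple_function MT h"
  shows "integrable MT (\<lambda>t. F (g t) (h t))"
proof -
  have f: "simple_function MT (\<lambda>t. F (g t) (h t))" by (rule simple_function_compose2 [OF assms])
  \<comment> \<open>The real value is wrapped as a constant function of s, since
    \<open>integral_simple\<close> expects function values; it is read off again at 0.\<close>
  then have "simple_function MT (\<lambda>t s. F (g t) (h t))" for s :: real by (rule simple_function_compose1)
  from integral_simple(1) [OF this, of "\<lambda>f. f 0"] show ?thesis .
qed

lemma simple_int_sq:
  assumes "simple_in X T g"
  shows "sq_int M (simple_int g)"
  unfolding simple_int_def [abs_def] using simple_inD(2) [OF assms] by (intro sq_int_sum sq_int_cmult) auto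

lemma ip_simple_int:
  assumes g: "simple_in X T g" and e: "sq_int M e"
  shows "ip (simple_int g) e = (LINT t|MT. ip (g t) e)"
proof -
  have "ip (simple_int g) e = (LINT s|M. (\<Sum>w\<in>g ` {0<..<T}. measure lebesgue {t \<in> {0<..<T}. g t = w} * (w s * e s)))"
    by (simp only: simple_int_def sum_distrib_right mult.assoc)
  also have "\<dots> = (\<Sum>w\<in>g ` {0<..<T}. LINT s|M. measure lebesgue {t \<in> {0<..<T}. g t = w} * (w s * e s))"
    using simple_inD(2) [OF g] e
    by (intro Bochner_Integration.integral_sum integrable_mult_right sq_int_mult_integrable) auto
  also have "\<dots> = (LINT t|MT. ip (g t) e)"
    by (simp only: integral_mult_right_zero integral_simple(2) [OF simple_inD(1) [OF g], of "\<lambda>f. ip f e"])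
  finally show ?thesis .
qed

text \<open>Pairing the difference D with itself turns the sums into scalar time integrals of
  pairings with D, and Cauchy-Schwarz leaves one factor \<open>nrm D\<close> to cancel. This avoids
  a common refinement of the two partitions.\<close>

lemma simple_int_diff_le:
  assumes g: "simple_in X T g" and h: "simple_in X T h"
  shows "nrm (\<lambda>s. simple_int g s - simple_int h s) \<le> (LINT t|MT. nrm (\<lambda>s. g t s - h t s))"
proof -
  define D where "D s = simple_int g s - simple_int h s" for s
  define K where "K = (LINT t|MT. nrm (\<lambda>s. g t s - h t s))"
  have sq: "sq_int M (simple_int g)" "sq_int M (simple_int h)" by (rule simple_int_sq g h)+
  have D: "sq_int M D" unfolding D_def by (intro sq_int_diff sq)
  note s = simple_inD(1) [OF g] simple_inD(1) [OF h]
  have i: "integrable MT (\<lambda>t. ip (g t) D)" "integrable MT (\<lambda>t. ip (h t) D)"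
    by (rule integral_simple(1) [OF s(1), of "\<lambda>f. ip f D"], rule integral_simple(1) [OF s(2), of "\<lambda>f. ip f D"])
  have "(nrm D)\<^sup>2 = ip D D" using L2_norm_on_power2 [of M D] by (simp only: power2_eq_square)
  also have "\<dots> = ip (simple_int g) D - ip (simple_int h) D"
    by (subst (1) D_def) (rule ip_diff [OF sq D])
  also have "\<dots> = (LINT t|MT. ip (g t) D - ip (h t) D)"
    using i by (simp add: ip_simple_int [OF g D] ip_simple_int [OF h D])
  also have "\<dots> \<le> (LINT t|MT. nrm (\<lambda>s. g t s - h t s) * nrm D)"
  proof (rule integral_mono)
    show "integrable MT (\<lambda>t. ip (g t) D - ip (h t) D)" using i by simp
    show "integrable MT (\<lambda>t. nrm (\<lambda>s. g t s - h t s) * nrm D)"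
      by (rule integrable_simple2 [OF s, of "\<lambda>f k. nrm (\<lambda>s. f s - k s) * nrm D"])
    fix t assume "t \<in> space MT"
    then have gh: "sq_int M (g t)" "sq_int M (h t)" using simple_inD(2) [OF g] simple_inD(2) [OF h] by auto
    have "ip (g t) D - ip (h t) D = ip (\<lambda>s. g t s - h t s) D" by (rule ip_diff [OF gh D, symmetric])
    also have "\<dots> \<le> nrm (\<lambda>s. g t s - h t s) * nrm D"
      by (rule order_trans [OF abs_ge_self L2_Cauchy_Schwarz]) (intro sq_int_diff gh D)+
    finally show "ip (g t) D - ip (h t) D \<le> nrm (\<lambda>s. g t s - h t s) * nrm D" .
  qed
  also have "\<dots> = K * nrm D" by (simp add: K_def)
  finally have "nrm D * nrm D \<le> K * nrm D" by (simp only: power2_eq_square)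
  moreover have "K \<ge> 0" unfolding K_def by (intro Bochner_Integration.integral_nonneg) simp
  ultimately have "nrm D \<le> K"
  proof (cases "nrm D = 0")
    case False
    then have "nrm D > 0" using L2_norm_on_nonneg [of M D] by linarith
    with \<open>nrm D * nrm D \<le> K * nrm D\<close> show ?thesis by (rule mult_right_le_imp_le)
  qed simp
  then show ?thesis by (simp add: K_def D_def [abs_def])
qed

section \<open>Strong measurability and existence of Bochner integrals\<close>

lemma strongly_measurableI:
  assumes "AE t in MT. sq_int M (f t)" "\<And>n. simple_in X T (g n)" "AE t in MT. (\<lambda>n. nrm (\<lambda>s. f t s - g n t s)) \<longlonglongrightarrow> 0"
  shows "strongly_measurable_in X N T f"
  unfolding strongly_measurable_in_def N_eq Lp_space_2_iff using assms by blast

lemma strongly_measurableE: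
  assumes "strongly_measurable_in X N T f"
  obtains g where "AE t in MT. sq_int M (f t)" "\<And>n. simple_in X T (g n)" "AE t in MT. (\<lambda>n. nrm (\<lambda>s. f t s - g n t s)) \<longlonglongrightarrow> 0"
  using assms unfolding strongly_measurable_in_def N_eq Lp_space_2_iff by blast

lemma strongly_measurable_nrm:
  assumes f: "strongly_measurable_in X N T f" and h: "simple_in X T h"
  shows "(\<lambda>t. nrm (\<lambda>s. f t s - h t s)) \<in> borel_measurable MT"
proof (rule strongly_measurableE [OF f])
  fix g assume sq: "AE t in MT. sq_int M (f t)" and g: "\<And>n. simple_in X T (g n)"
    and lim: "AE t in MT. (\<lambda>n. nrm (\<lambda>s. f t s - g n t s)) \<longlonglongrightarrow> 0"
  show ?thesis
  proof (rule time.borel_measurable_AE_limit_M)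
    show "(\<lambda>t. nrm (\<lambda>s. g n t s - h t s)) \<in> borel_measurable MT" for n
      by (rule borel_measurable_integrable [OF integrable_simple2 [OF simple_inD(1) [OF g] simple_inD(1) [OF h],
            of "\<lambda>f k. nrm (\<lambda>s. f s - k s)"]])
    show "AE t in MT. (\<lambda>n. nrm (\<lambda>s. g n t s - h t s)) \<longlonglongrightarrow> nrm (\<lambda>s. f t s - h t s)"
      using sq lim AE_space
    proof eventually_elim
      case (elim t)
      then have "sq_int M (h t)" "\<And>n. sq_int M (g n t)" using simple_inD(2) [OF h] simple_inD(2) [OF g] by auto
      moreover have "(\<lambda>n. nrm (\<lambda>s. (g n t s - h t s) - (f t s - h t s))) \<longlonglongrightarrow> 0"
        using elim(2) by (subst L2_norm_on_commute) simp
      ultimately show ?case using elim(1) by (intro L2_norm_on_tendsto sq_int_diff)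
    qed
  qed
qed

lemma strongly_measurable_ip:
  assumes f: "strongly_measurable_in X N T f" and e: "sq_int M e"
  shows "(\<lambda>t. ip (f t) e) \<in> borel_measurable MT"
proof (rule strongly_measurableE [OF f])
  fix g assume sq: "AE t in MT. sq_int M (f t)" and g: "\<And>n. simple_in X T (g n)"
    and lim: "AE t in MT. (\<lambda>n. nrm (\<lambda>s. f t s - g n t s)) \<longlonglongrightarrow> 0"
  show ?thesis
  proof (rule time.borel_measurable_AE_limit_M)
    show "(\<lambda>t. ip (g n t) e) \<in> borel_measurable MT" for n
      by (rule borel_measurable_integrable [OF integral_simple(1) [OF simple_inD(1) [OF g], of "\<lambda>f. ip f e"]])
    show "AE t in MT. (\<lambda>n. ip (g n t) e) \<longlonglongrightarrow> ip (f t) e"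
      using sq lim AE_space
    proof eventually_elim
      case (elim t)
      then have gt: "sq_int M (g n t)" for n using simple_inD(2) [OF g] by auto
      have "(\<lambda>n. ip (f t) e - ip (g n t) e) \<longlonglongrightarrow> 0"
      proof (rule Lim_null_comparison [OF always_eventually])
        show "(\<lambda>n. nrm (\<lambda>s. f t s - g n t s) * nrm e) \<longlonglongrightarrow> 0" using tendsto_mult_right [OF elim(2), of "nrm e"] by simp
        show "\<forall>n. norm (ip (f t) e - ip (g n t) e) \<le> nrm (\<lambda>s. f t s - g n t s) * nrm e"
          unfolding ip_diff [OF elim(1) gt e, symmetric] real_norm_def
          by (intro allI L2_Cauchy_Schwarz sq_int_diff elim(1) gt e)
      qed
      from tendsto_diff [OF tendsto_const this, of "ip (f t) e"] show ?case by simp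
    qed
  qed
qed

text \<open>The majorant of the approximants upgrades pointwise convergence to convergence of the
  integrated distances. The integrals of the simple functions are then Cauchy, and y is their
  limit.\<close>

theorem Bochner_integral_exists:
  assumes f: "AE t in MT. sq_int M (f t)" and g: "\<And>n. simple_in X T (g n)"
    and lim: "AE t in MT. (\<lambda>n. nrm (\<lambda>s. f t s - g n t s)) \<longlonglongrightarrow> 0"
    and H: "integrable MT H" "AE t in MT. \<forall>n. nrm (g n t) \<le> H t"
  obtains y where "has_Bochner_integral_in X N T f y"
proof -
  have sm: "strongly_measurable_in X N T f" by (rule strongly_measurableI [OF f g lim])
  define d where "d n t = nrm (\<lambda>s. f t s - g n t s)" for n t
  have d_meas: "d n \<in> borel_measurable MT" for n
    unfolding d_def [abs_def] by (rule strongly_measurable_nrm [OF sm g])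
  have d_le: "AE t in MT. norm (d n t) \<le> 2 * H t" for n
    using f lim H(2) AE_space
  proof eventually_elim
    case (elim t)
    then have gt: "sq_int M (g n t)" for n using simple_inD(2) [OF g] by auto
    have "(\<lambda>n. nrm (\<lambda>s. g n t s - f t s)) \<longlonglongrightarrow> 0" using elim(2) by (subst L2_norm_on_commute)
    then have "(\<lambda>n. nrm (g n t)) \<longlonglongrightarrow> nrm (f t)" by (intro L2_norm_on_tendsto gt elim)
    then have "nrm (f t) \<le> H t" by (rule LIMSEQ_le_const2) (use elim(3) in simp)
    moreover have "d n t \<le> nrm (f t) + nrm (g n t)" unfolding d_def
      by (rule L2_norm_on_triangle_diff [OF elim(1) gt])
    moreover have "nrm (g n t) \<le> H t" using elim(3) by simp
    moreover have "d n t \<ge> 0" by (simp add: d_def)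
    ultimately show ?case by simp
  qed
  have H2: "integrable MT (\<lambda>t. 2 * H t)" using H(1) by simp
  have d_int: "integrable MT (d n)" for n
  proof (rule Bochner_Integration.integrable_bound [OF H2 d_meas])
    show "AE t in MT. norm (d n t) \<le> norm (2 * H t)" using d_le [of n] by eventually_elim simp
  qed
  have d_lim: "(\<lambda>n. LINT t|MT. d n t) \<longlonglongrightarrow> (LINT t|MT. 0)"
    by (rule integral_dominated_convergence [OF _ d_meas H2 _ d_le]) (use lim in \<open>simp_all add: d_def\<close>)
  then have d_lim: "(\<lambda>n. LINT t|MT. d n t) \<longlonglongrightarrow> 0" by simp
  have Cauchy: "nrm (\<lambda>s. simple_int (g n) s - simple_int (g m) s) \<le> (LINT t|MT. d n t) + (LINT t|MT. d m t)" for n m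
  proof -
    have "nrm (\<lambda>s. simple_int (g n) s - simple_int (g m) s) \<le> (LINT t|MT. nrm (\<lambda>s. g n t s - g m t s))"
      by (rule simple_int_diff_le [OF g g])
    also have "\<dots> \<le> (LINT t|MT. d n t + d m t)"
    proof (rule integral_mono_AE)
      show "integrable MT (\<lambda>t. nrm (\<lambda>s. g n t s - g m t s))" 
        by (rule integrable_simple2 [OF simple_inD(1) [OF g] simple_inD(1) [OF g], of "\<lambda>f k. nrm (\<lambda>s. f s - k s)"])
      show "integrable MT (\<lambda>t. d n t + d m t)" using d_int by simp
      show "AE t in MT. nrm (\<lambda>s. g n t s - g m t s) \<le> d n t + d m t"
        using f AE_space
      proof eventually_elim
        case (elim t)
        then have gt: "sq_int M (g n t)" for n using simple_inD(2) [OF g] by auto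
        show ?case
          using L2_norm_on_triangle3 [OF gt [of n] elim(1) gt [of m]]
          unfolding d_def L2_norm_on_commute [of M "f t" "g n t"] .
      qed
    qed
    also have "\<dots> = (LINT t|MT. d n t) + (LINT t|MT. d m t)" using d_int by simp
    finally show ?thesis .
  qed
  show ?thesis
  proof (rule L2_complete [OF simple_int_sq [OF g] Cauchy d_lim])
    fix y assume y: "sq_int M y" "(\<lambda>n. nrm (\<lambda>s. simple_int (g n) s - y s)) \<longlonglongrightarrow> 0"
    have "(\<integral>\<^sup>+t. ennreal (d n t) \<partial>MT) = ennreal (LINT t|MT. d n t)" for n
      by (rule nn_integral_eq_integral [OF d_int]) (simp add: d_def)
    then have nn: "(\<lambda>n. \<integral>\<^sup>+t. ennreal (d n t) \<partial>MT) \<longlonglongrightarrow> 0"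
      using tendsto_ennrealI [OF d_lim] by simp
    have yl: "(\<lambda>n. nrm (\<lambda>s. y s - simple_int (g n) s)) \<longlonglongrightarrow> 0" using y(2) by (subst L2_norm_on_commute)
    have "has_Bochner_integral_in X N T f y"
      unfolding has_Bochner_integral_in_def N_eq
      using sm y(1) g nn yl unfolding d_def simple_int_def N_eq Lp_space_2_iff by blast
    then show ?thesis by (rule that)
  qed
qed

text \<open>Pairing with a fixed e reduces identities between Bochner integrals to scalar ones, to
  which the theory of weak derivatives on an interval applies.\<close>

theorem Bochner_integral_pairing:
  assumes f: "has_Bochner_integral_in X N T f y" and e: "sq_int M e"
  shows "integrable MT (\<lambda>t. ip (f t) e)" and "(LINT t|MT. ip (f t) e) = ip y e"
proof -
  have sm: "strongly_measurable_in X N T f" and y: "sq_int M y"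
    using f by (simp_all add: has_Bochner_integral_in_def Lp_space_2_iff)
  obtain g where g: "\<And>n. simple_in X T (g n)"
    and nn: "(\<lambda>n. \<integral>\<^sup>+t. ennreal (nrm (\<lambda>s. f t s - g n t s)) \<partial>MT) \<longlonglongrightarrow> 0"
    and yl: "(\<lambda>n. nrm (\<lambda>s. y s - simple_int (g n) s)) \<longlonglongrightarrow> 0"
    using f unfolding has_Bochner_integral_in_def N_eq simple_int_def by blast
  define d where "d n t = nrm (\<lambda>s. f t s - g n t s)" for n t
  have d_meas: "d n \<in> borel_measurable MT" for n
    unfolding d_def [abs_def] by (rule strongly_measurable_nrm [OF sm g])
  have d_int: "integrable MT (d n)" if "(\<integral>\<^sup>+t. ennreal (d n t) \<partial>MT) < 1" for n
  proof (rule integrableI_bounded [OF d_meas])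
    have "(\<integral>\<^sup>+t. ennreal (norm (d n t)) \<partial>MT) < 1" using that by (simp add: d_def)
    then show "(\<integral>\<^sup>+t. ennreal (norm (d n t)) \<partial>MT) < \<infinity>" using less_trans by fastforce
  qed
  \<comment> \<open>The definition allows infinite distances for finitely many n; finiteness holds
    eventually, and one such n already gives integrability of the pairing.\<close>
  have ev: "\<forall>\<^sub>F n in sequentially. (\<integral>\<^sup>+t. ennreal (d n t) \<partial>MT) < 1"
    using order_tendstoD(2) [OF nn, of 1] by (simp add: d_def)
  have sq: "AE t in MT. sq_int M (f t)" using sm by (simp add: strongly_measurable_in_def Lp_space_2_iff)
  have gi: "integrable MT (\<lambda>t. ip (g n t) e)" for n
    by (rule integral_simple(1) [OF simple_inD(1) [OF g], of "\<lambda>f. ip f e"])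
  have le: "AE t in MT. \<bar>ip (f t) e - ip (g n t) e\<bar> \<le> d n t * nrm e" for n
    using sq AE_space
  proof eventually_elim
    case (elim t)
    then have gt: "sq_int M (g n t)" using simple_inD(2) [OF g] by auto
    show ?case unfolding ip_diff [OF elim(1) gt e, symmetric] d_def
      by (intro L2_Cauchy_Schwarz sq_int_diff elim(1) gt e)
  qed
  have diff_int: "integrable MT (\<lambda>t. ip (f t) e - ip (g n t) e)" if "(\<integral>\<^sup>+t. ennreal (d n t) \<partial>MT) < 1" for n
  proof (rule Bochner_Integration.integrable_bound)
    show "integrable MT (\<lambda>t. d n t * nrm e)" using d_int [OF that] by simp
    show "(\<lambda>t. ip (f t) e - ip (g n t) e) \<in> borel_measurable MT"
      by (intro borel_measurable_diff strongly_measurable_ip [OF sm e] borel_measurable_integrable [OF gi])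
    show "AE t in MT. norm (ip (f t) e - ip (g n t) e) \<le> norm (d n t * nrm e)"
      using le [of n] by eventually_elim (simp add: d_def)
  qed
  obtain n0 where "(\<integral>\<^sup>+t. ennreal (d n0 t) \<partial>MT) < 1"
    using eventually_happens [OF ev] by auto
  from Bochner_Integration.integrable_add [OF diff_int [OF this] gi [of n0]]
  show fi: "integrable MT (\<lambda>t. ip (f t) e)" by simp
  have "(\<lambda>n. (LINT t|MT. ip (f t) e) - (LINT t|MT. ip (g n t) e)) \<longlonglongrightarrow> 0"
  proof (rule Lim_null_comparison)
    have "(\<lambda>n. enn2real (\<integral>\<^sup>+t. ennreal (d n t) \<partial>MT)) \<longlonglongrightarrow> 0"
      using tendsto_enn2real [of _ 0] nn by (simp add: d_def)
    from tendsto_mult_right [OF this, of "nrm e"]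
    show "(\<lambda>n. enn2real (\<integral>\<^sup>+t. ennreal (d n t) \<partial>MT) * nrm e) \<longlonglongrightarrow> 0" by simp
    show "\<forall>\<^sub>F n in sequentially. norm ((LINT t|MT. ip (f t) e) - (LINT t|MT. ip (g n t) e)) \<le> enn2real (\<integral>\<^sup>+t. ennreal (d n t) \<partial>MT) * nrm e"
      using ev
    proof eventually_elim
      case (elim n)
      have "norm ((LINT t|MT. ip (f t) e) - (LINT t|MT. ip (g n t) e)) = \<bar>LINT t|MT. ip (f t) e - ip (g n t) e\<bar>"
        using fi gi by simp
      also have "\<dots> \<le> (LINT t|MT. \<bar>ip (f t) e - ip (g n t) e\<bar>)" by (rule integral_abs_bound)
      also have "\<dots> \<le> (LINT t|MT. d n t * nrm e)"
        using diff_int [OF elim] d_int [OF elim] le by (intro integral_mono_AE) auto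
      also have "\<dots> = (LINT t|MT. d n t) * nrm e" by simp
      also have "(LINT t|MT. d n t) = enn2real (\<integral>\<^sup>+t. ennreal (d n t) \<partial>MT)"
        by (rule integral_eq_nn_integral [OF d_meas]) (simp add: d_def)
      finally show ?case .
    qed
  qed
  then have "(\<lambda>n. (LINT t|MT. ip (f t) e) - ip (simple_int (g n)) e) \<longlonglongrightarrow> 0"
    by (simp only: ip_simple_int [OF g e])
  moreover have "(\<lambda>n. ip y e - ip (simple_int (g n)) e) \<longlonglongrightarrow> 0"
  proof (rule Lim_null_comparison [OF always_eventually])
    show "(\<lambda>n. nrm (\<lambda>s. y s - simple_int (g n) s) * nrm e) \<longlonglongrightarrow> 0" using tendsto_mult_right [OF yl, of "nrm e"] by simp
    show "\<forall>n. norm (ip y e - ip (simple_int (g n)) e) \<le> nrm (\<lambda>s. y s - simple_int (g n) s) * nrm e"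
      unfolding ip_diff [OF y simple_int_sq [OF g] e, symmetric] real_norm_def
      by (intro allI L2_Cauchy_Schwarz sq_int_diff y simple_int_sq g e)
  qed
  ultimately have "(\<lambda>n. ((LINT t|MT. ip (f t) e) - ip (simple_int (g n)) e) - (ip y e - ip (simple_int (g n)) e)) \<longlonglongrightarrow> 0 - 0"
    by (rule tendsto_diff)
  then show "(LINT t|MT. ip (f t) e) = ip y e" by (simp add: LIMSEQ_const_iff)
qed

section \<open>Uniqueness of the weak time derivative\<close>

lemma weak_time_deriv_pairing:
  assumes v: "has_weak_time_deriv X N T u v" and \<psi>: "test_function 0 T \<psi>" and e: "sq_int M e"
  shows "integrable MT (\<lambda>t. ip (v t) e * \<psi> t)"
    and "(LINT t|MT. ip (v t) e * \<psi> t) = - (LINT t|MT. deriv \<psi> t * ip (u t) e)"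
proof -
  obtain y z where yz: "has_Bochner_integral_in X N T (\<lambda>t s. deriv \<psi> t * u t s) y"
    "has_Bochner_integral_in X N T (\<lambda>t s. \<psi> t * v t s) z" "nrm (\<lambda>s. y s + z s) = 0"
    using v \<psi> unfolding has_weak_time_deriv_def N_eq by blast
  have sq: "sq_int M y" "sq_int M z"
    using yz by (simp_all add: has_Bochner_integral_in_def Lp_space_2_iff)
  have pull: "ip (\<lambda>s. c * f s) e = c * ip f e" for c f by (simp only: mult.assoc integral_mult_right_zero)
  have z: "integrable MT (\<lambda>t. \<psi> t * ip (v t) e)" "(LINT t|MT. \<psi> t * ip (v t) e) = ip z e"
    using Bochner_integral_pairing [OF yz(2) e] unfolding pull by blast+
  have y: "(LINT t|MT. deriv \<psi> t * ip (u t) e) = ip y e"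
    using Bochner_integral_pairing(2) [OF yz(1) e] unfolding pull by blast
  have "ip y e + ip z e = ip (\<lambda>s. y s + z s) e"
    using sq e by (simp add: distrib_right sq_int_mult_integrable)
  moreover have "\<bar>ip (\<lambda>s. y s + z s) e\<bar> \<le> nrm (\<lambda>s. y s + z s) * nrm e"
    by (intro L2_Cauchy_Schwarz sq_int_add sq e)
  ultimately have "ip y e + ip z e = 0" using yz(3) by simp
  then show "(LINT t|MT. ip (v t) e * \<psi> t) = - (LINT t|MT. deriv \<psi> t * ip (u t) e)"
    using y z(2) by (simp add: mult.commute)
  show "integrable MT (\<lambda>t. ip (v t) e * \<psi> t)" using z(1) by (simp add: mult.commute)
qed

text \<open>The definition constrains only the products \<open>\<psi> t * v t\<close>. Cutoffs that
  equal 1 on larger and larger compact intervals recover \<open>v t\<close> itself.\<close>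

lemma weak_time_deriv_sq_int:
  assumes v: "has_weak_time_deriv X N T u v"
  shows "AE t in MT. sq_int M (v t)"
proof -
  \<comment> \<open>With ramps of width \<open>T / real (n + 4)\<close>, at most
    \<open>T / 4\<close>, the four break points of the cutoff stay in order inside
    \<open>{0<..<T}\<close>.\<close>
  define r where "r n = real (n + 4) / T" for n
  have r: "r n > 0" "1 / r n = T / real (n + 4)" for n using time.L_pos by (simp_all add: r_def)
  define \<psi> where "\<psi> n = smooth_cutoff (r n) (1 / r n) (T - 2 / r n)" for n
  have "T / real (n + 4) \<le> T / 4" for n using time.L_pos by (intro divide_left_mono) auto
  then have r4: "1 / r n \<le> T / 4" for n unfolding r(2) .
  have two: "2 / r n = 2 * (1 / r n)" for n by simp
  have r_pos: "1 / r n > 0" for n using r(1) by simp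
  have arith: "c \<le> T - 2 * c" "0 < c" "T - 2 * c + c < T" if "0 < c" "c \<le> T / 4" for c
    using that time.L_pos by linarith+
  have test: "test_function 0 T (\<psi> n)" for n
    unfolding \<psi>_def
    unfolding two by (intro smooth_cutoff_test_function r(1) arith [OF r_pos r4])
  have "AE t in MT. sq_int M (\<lambda>s. \<psi> n t * v t s)" for n
    using v test [of n] unfolding has_weak_time_deriv_def has_Bochner_integral_in_def strongly_measurable_in_def Lp_space_2_iff
    by blast
  then have "AE t in MT. \<forall>n. sq_int M (\<lambda>s. \<psi> n t * v t s)" by (simp add: AE_all_countable)
  then show ?thesis using AE_space
  proof eventually_elim
    case (elim t)
    then have t: "0 < t" "t < T" by auto
    have "(\<lambda>n. T / real (n + 4)) \<longlonglongrightarrow> 0"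
      by (rule LIMSEQ_ignore_initial_segment [OF lim_const_over_n])
    then have "\<forall>\<^sub>F n in sequentially. T / real (n + 4) < min t (T - t) / 2"
      using t by (intro order_tendstoD(2)) auto
    then obtain n where "T / real (n + 4) < min t (T - t) / 2" by (auto dest: eventually_happens)
    moreover have "2 * c < t \<and> 2 * c < T - t" if "c < min t (T - t) / 2" for c using that by auto
    ultimately have "2 * (1 / r n) < t" "2 * (1 / r n) < T - t" unfolding r(2) by blast+
    then have "\<psi> n t = 1" unfolding \<psi>_def by (intro smooth_cutoff_eq_1 r(1)) (unfold two, simp_all)
    with elim(1) have "sq_int M (\<lambda>s. 1 * v t s)" by metis
    then show ?case by simp
  qed
qed

text \<open>The equation of a weak solution mentions an unspecified choice of the time derivative,
  which has to be compared with a known one at almost every (t, s). Testing against indicators of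
  rational rays merges countably many null sets of times into one.\<close>

theorem weak_time_deriv_unique:
  assumes v: "has_weak_time_deriv X N T u v" and w: "has_weak_time_deriv X N T u w"
  shows "AE t in MT. AE s in M. w t s = v t s"
proof -
  have ip_eq: "AE t in MT. ip (w t) e - ip (v t) e = 0" if e: "sq_int M e" for e
  proof (rule AE_zero_if_test_zero)
    fix \<psi> assume \<psi>: "test_function 0 T \<psi>"
    show "integrable MT (\<lambda>t. (ip (w t) e - ip (v t) e) * \<psi> t)"
      using weak_time_deriv_pairing(1) [OF v \<psi> e] weak_time_deriv_pairing(1) [OF w \<psi> e] by (simp add: left_diff_distrib)
    show "(LINT t|MT. (ip (w t) e - ip (v t) e) * \<psi> t) = 0"
      using weak_time_deriv_pairing [OF v \<psi> e] weak_time_deriv_pairing [OF w \<psi> e] by (simp add: left_diff_distrib)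
  qed
  have ind: "sq_int M (indicator {..q})" for q :: real
    by (rule sq_int_bounded [where B=1]) (auto intro!: indicator_measurable_M)
  have "AE t in MT. \<forall>q\<in>\<rat>. ip (w t) (indicator {..q}) - ip (v t) (indicator {..q}) = 0"
    by (subst AE_ball_countable [OF countable_rat]) (intro ballI ip_eq ind)
  then show ?thesis using weak_time_deriv_sq_int [OF v] weak_time_deriv_sq_int [OF w]
  proof eventually_elim
    case (elim t)
    have "AE s in M. w t s - v t s = 0"
    proof (rule AE_zero_if_rational_primitives_zero)
      show "integrable M (\<lambda>s. w t s - v t s)" by (intro sq_int_imp_integrable sq_int_diff elim)
      fix q :: real assume "q \<in> \<rat>"
      then have "ip (\<lambda>s. w t s - v t s) (indicator {..q}) = 0" using elim(1) ip_diff [OF elim(3,2) ind] by simp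
      then show "(LINT s|M. indicator {..q} s * (w t s - v t s)) = 0" by (simp only: mult.commute)
    qed
    then show ?case by simp
  qed
qed

end

section \<open>The weak solution\<close>

text \<open>The scalar factor and the function are approximated simultaneously by simple functions,
  and the products of the approximants remain simple.\<close>

lemma (in space_time) scaled_Bochner_integral_exists:
  assumes \<psi>: "\<psi> \<in> borel_measurable MT" "\<And>t. t \<in> space MT \<Longrightarrow> \<bar>\<psi> t\<bar> \<le> B"
    and f: "AE t in MT. sq_int M (f t)" and g: "\<And>n. simple_in X T (g n)"
    and lim: "AE t in MT. (\<lambda>n. nrm (\<lambda>s. f t s - g n t s)) \<longlonglongrightarrow> 0"
    and H: "integrable MT H" "AE t in MT. \<forall>n. nrm (g n t) \<le> H t"
  obtains y where "has_Bochner_integral_in X N T (\<lambda>t s. \<psi> t * f t s) y"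
proof -
  \<comment> \<open>These approximants are bounded by twice the function, which is where the factor
    2 in the majorant originates.\<close>
  obtain F where F: "\<And>n. simple_function MT (F n)" "\<And>t. t \<in> space MT \<Longrightarrow> (\<lambda>n. F n t) \<longlonglongrightarrow> \<psi> t"
    "\<And>n t. t \<in> space MT \<Longrightarrow> dist (F n t) 0 \<le> 2 * dist (\<psi> t) 0"
    using borel_measurable_implies_sequence_metric [OF \<psi>(1), of 0] by blast
  have FB: "\<bar>F n t\<bar> \<le> 2 * B" if "t \<in> space MT" for n t
    using F(3) [OF that, of n] \<psi>(2) [OF that] by simp
  define k where "k n t s = F n t * g n t s" for n t s
  show ?thesis
  proof (rule Bochner_integral_exists [where f="\<lambda>t s. \<psi> t * f t s" and g=k and H="\<lambda>t. 2 * B * H t"])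
    show "AE t in MT. sq_int M (\<lambda>s. \<psi> t * f t s)" using f by eventually_elim (rule sq_int_cmult)
    show "simple_in X T (k n)" for n
    proof -
      have "simple_function MT (\<lambda>t. (\<lambda>a h s. a * h s) (F n t) (g n t))"
        by (rule simple_function_compose2 [OF F(1) simple_inD(1) [OF g]])
      then have "simple_function MT (k n)" by (simp add: k_def [abs_def])
      moreover have "sq_int M (k n t)" if "t \<in> {0<..<T}" for t
        unfolding k_def by (rule sq_int_cmult [OF simple_inD(2) [OF g that]])
      ultimately show ?thesis by (simp add: simple_in_def Lp_space_2_iff)
    qed
    show "integrable MT (\<lambda>t. 2 * B * H t)" using H(1) by simp
    show "AE t in MT. \<forall>n. nrm (k n t) \<le> 2 * B * H t"
      using H(2) AE_space
    proof eventually_elim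
      case (elim t)
      have "nrm (k n t) \<le> 2 * B * H t" for n
      proof -
        have "nrm (k n t) = \<bar>F n t\<bar> * nrm (g n t)" unfolding k_def by (rule L2_norm_on_cmult)
        also have "\<dots> \<le> 2 * B * H t" using elim FB [OF elim(2), of n] by (intro mult_mono) auto
        finally show ?thesis .
      qed
      then show ?case ..
    qed
    show "AE t in MT. (\<lambda>n. nrm (\<lambda>s. \<psi> t * f t s - k n t s)) \<longlonglongrightarrow> 0"
      using f lim AE_space
    proof eventually_elim
      case (elim t)
      then have gt: "sq_int M (g n t)" for n using simple_inD(2) [OF g] by auto
      have le: "nrm (\<lambda>s. \<psi> t * f t s - k n t s) \<le> \<bar>\<psi> t - F n t\<bar> * nrm (f t) + 2 * B * nrm (\<lambda>s. f t s - g n t s)" for n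
      proof -
        have "nrm (\<lambda>s. \<psi> t * f t s - k n t s) = nrm (\<lambda>s. (\<psi> t - F n t) * f t s + F n t * (f t s - g n t s))"
          by (simp add: k_def algebra_simps)
        also have "\<dots> \<le> nrm (\<lambda>s. (\<psi> t - F n t) * f t s) + nrm (\<lambda>s. F n t * (f t s - g n t s))"
          by (intro L2_norm_on_triangle sq_int_cmult sq_int_diff elim(1) gt)
        also have "\<dots> = \<bar>\<psi> t - F n t\<bar> * nrm (f t) + \<bar>F n t\<bar> * nrm (\<lambda>s. f t s - g n t s)"
          by (simp only: L2_norm_on_cmult)
        also have "\<dots> \<le> \<bar>\<psi> t - F n t\<bar> * nrm (f t) + 2 * B * nrm (\<lambda>s. f t s - g n t s)"
          by (intro add_left_mono mult_right_mono FB [OF elim(3)]) simp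
        finally show ?thesis .
      qed
      have "(\<lambda>n. \<bar>\<psi> t - F n t\<bar> * nrm (f t) + 2 * B * nrm (\<lambda>s. f t s - g n t s)) \<longlonglongrightarrow> \<bar>\<psi> t - \<psi> t\<bar> * nrm (f t) + 2 * B * 0"
        by (intro tendsto_intros F(2) elim)
      then have "(\<lambda>n. \<bar>\<psi> t - F n t\<bar> * nrm (f t) + 2 * B * nrm (\<lambda>s. f t s - g n t s)) \<longlonglongrightarrow> 0" by simp
      then show ?case
        by (rule Lim_null_comparison [rotated]) (use le in \<open>simp add: always_eventually\<close>)
    qed
  qed (rule that)
qed

section \<open>Estimates in the Sobolev norm\<close>

context periodic_interval
begin

lemma Lp_norm_bounded:
  assumes f: "f \<in> borel_measurable M" and B: "\<And>x. \<bar>f x\<bar> \<le> B"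
  shows "Lp_norm p 0 L f \<le> B * L powr (1 / p)"
proof -
  have B0: "B \<ge> 0" using B [of 0] by linarith
  have p: "p > 0" using p_gt_1 by simp
  have "(LINT x|M. \<bar>f x\<bar> powr p) \<le> (LINT x|M. B powr p)"
  proof (rule integral_mono)
    show "integrable M (\<lambda>x. \<bar>f x\<bar> powr p)"
      by (rule integrable_const_bound [where B="B powr p"])
        (use f B p in \<open>auto intro!: AE_I2 powr_mono2\<close>)
  qed (use B p in \<open>auto intro!: powr_mono2\<close>)
  also have "\<dots> = B powr p * L" by (rule integral_const_M)
  finally have "(LINT x|M. \<bar>f x\<bar> powr p) powr (1 / p) \<le> (B powr p * L) powr (1 / p)"
    using p by (intro powr_mono2) (auto intro!: Bochner_Integration.integral_nonneg)
  also have "\<dots> = B * L powr (1 / p)"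
    using B0 p L_pos by (simp add: powr_mult powr_powr)
  finally show ?thesis by (simp add: Lp_norm_def)
qed

text \<open>The value part is bounded through the supremum, so convergence in
  \<open>L\<^sup>2\<close> suffices for it; in the derivative part the chosen
  \<open>weak_deriv\<close> is exchanged for h under the integral.\<close>

lemma W1p_norm_le:
  assumes W: "W_rep f h"
  shows "W1p_norm p 0 L f \<le> (nrm f / sqrt L + (LINT x|M. \<bar>h x\<bar>)) * L powr (1 / p) + (LINT x|M. \<bar>h x\<bar> powr p) powr (1 / p)"
proof -
  have h: "h \<in> borel_measurable M" by (rule p_int_measurable [OF W_rep_p_int [OF W]])
  have ae: "AE x in M. weak_deriv 0 L f x = h x" by (rule prim_on_weak_deriv [OF W_rep_prim_on [OF W]])
  then have ae': "AE x in M. h x = weak_deriv 0 L f x" by eventually_elim simp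
  have wm: "weak_deriv 0 L f \<in> borel_measurable M" by (rule borel_measurable_AE_M [OF h ae'])
  have "(LINT x|M. \<bar>weak_deriv 0 L f x\<bar> powr p) = (LINT x|M. \<bar>h x\<bar> powr p)"
    by (rule integral_cong_AE) (use ae h wm in auto)
  moreover have "Lp_norm p 0 L f \<le> (nrm f / sqrt L + (LINT x|M. \<bar>h x\<bar>)) * L powr (1 / p)"
    by (rule Lp_norm_bounded [OF sq_int_measurable [OF W_rep_sq_int [OF W]] sup_le_L2_plus_L1 [OF W]])
  ultimately show ?thesis by (simp add: W1p_norm_def Lp_norm_def)
qed

end

section \<open>The limit belongs to the required function spaces\<close>

context discrete_flow
begin

sublocale st: space_time L T
  by unfold_locales

definition C0 :: real where "C0 = nrm u0 + sqrt (2 * T * E)"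

lemma ub_bound:
  assumes "0 \<le> t" "t \<le> T"
  shows "nrm (ub n t) \<le> C0"
proof -
  have le: "ix n t \<le> 2 ^ n"
  proof (cases "t = 0")
    case False
    then have "t > 0" using assms by simp
    then show ?thesis using cell_less [OF _ assms(2), of n] by (simp add: ix_eq_Suc_cell)
  qed simp
  have "real (ix n t) * (2 * tau n * E) \<le> real (2 ^ n) * (2 * tau n * E)"
    using le T_pos E_nonneg by (intro mult_right_mono) (auto simp flip: of_nat_le_iff)
  also have "\<dots> = 2 * T * E" by simp
  finally have "(nrm (\<lambda>x. ub n t x - u0 x))\<^sup>2 \<le> 2 * T * E"
    using scheme_Hoelder [OF sch, of n 0 "ix n t"] by (simp add: ub_def U_0)
  then have "nrm (\<lambda>x. ub n t x - u0 x) \<le> sqrt (2 * T * E)" by (rule real_le_rsqrt)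
  moreover have "nrm (\<lambda>x. (ub n t x - u0 x) + u0 x) \<le> nrm (\<lambda>x. ub n t x - u0 x) + nrm u0"
    using sq_U [of 0 0] unfolding U_0 by (intro L2_norm_on_triangle sq_int_diff ub_sq)
  ultimately show ?thesis by (simp add: C0_def)
qed

lemma u_bound:
  assumes "0 \<le> t" "t \<le> T"
  shows "nrm (u t) \<le> C0"
  by (rule LIMSEQ_le_const2 [OF L2_norm_on_tendsto [OF ub_sq ub_converges [OF assms]]]) (use ub_bound [OF assms] in simp)

lemma simple_ub: "simple_function MT (ub n)"
proof -
  have "simple_function MT (\<lambda>t. U n (Suc (cell n t)))" by (rule simple_fun_cell)
  then show ?thesis
    by (subst simple_function_cong [where g="\<lambda>t. U n (Suc (cell n t))"]) (simp_all add: ub_def ix_eq_Suc_cell)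
qed

lemma u_approx:
  shows "AE t in MT. sq_int M (u t)" "simple_in st.X T (ub n)"
    "AE t in MT. (\<lambda>n. nrm (\<lambda>s. u t s - ub n t s)) \<longlonglongrightarrow> 0"
    "AE t in MT. \<forall>n. nrm (ub n t) \<le> C0"
proof -
  show "AE t in MT. sq_int M (u t)" using ub_converges(1) by (intro AE_I2) auto
  show "simple_in st.X T (ub n)" using simple_ub ub_sq by (simp add: simple_in_def Lp_space_2_iff)
  show "AE t in MT. (\<lambda>n. nrm (\<lambda>s. u t s - ub n t s)) \<longlonglongrightarrow> 0"
  proof (rule AE_I2)
    fix t assume "t \<in> space MT"
    then show "(\<lambda>n. nrm (\<lambda>s. u t s - ub n t s)) \<longlonglongrightarrow> 0"
      using ub_converges(2) [of t] by (subst L2_norm_on_commute) auto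
  qed
  show "AE t in MT. \<forall>n. nrm (ub n t) \<le> C0" using ub_bound by (intro AE_I2) auto
qed

lemma v_approx:
  shows "AE t in MT. sq_int M (v t)" "simple_in st.X T (w n)"
    "AE t in MT. (\<lambda>n. nrm (\<lambda>s. v t s - w n t s)) \<longlonglongrightarrow> 0"
proof -
  show "AE t in MT. sq_int M (v t)" using AE_conv_at by eventually_elim (simp add: conv_at_def)
  show "simple_in st.X T (w n)" using simple_wq sq_wq by (simp add: simple_in_def Lp_space_2_iff)
  show "AE t in MT. (\<lambda>n. nrm (\<lambda>s. v t s - w n t s)) \<longlonglongrightarrow> 0"
    using AE_conv_at by eventually_elim (subst L2_norm_on_commute, simp add: conv_at_def)
qed

text \<open>The two Bochner integrals y and z exist by domination. Choosing the test element
  \<open>e = y + z\<close> only afterwards makes the scalar integration by parts for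
  \<open>ip (u t) e\<close> say that e has norm zero.\<close>

lemma u_weak_time_deriv: "has_weak_time_deriv st.X st.N T u v"
  unfolding has_weak_time_deriv_def
proof (intro allI impI)
  fix \<psi> assume \<psi>: "test_function 0 T \<psi>"
  note c = time.test_function_deriv_cont [OF \<psi>]
  have "\<exists>B. \<forall>t\<in>{0..T}. \<bar>f t\<bar> \<le> B" if "continuous_on {0..T} f" for f :: "real \<Rightarrow> real"
    by (rule time.continuous_bounded_M [OF that]) blast
  from this [OF c(2)] this [OF c(3)] obtain B1 B2 where
    B1: "\<And>t. t \<in> {0..T} \<Longrightarrow> \<bar>deriv \<psi> t\<bar> \<le> B1" and B2: "\<And>t. t \<in> {0..T} \<Longrightarrow> \<bar>\<psi> t\<bar> \<le> B2"
    by metis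
  have b: "\<bar>deriv \<psi> t\<bar> \<le> B1" "\<bar>\<psi> t\<bar> \<le> B2" if "t \<in> space MT" for t
    using B1 [of t] B2 [of t] that by auto
  have C0: "integrable MT (\<lambda>t. C0)" by simp
  show "\<exists>y z. has_Bochner_integral_in st.X st.N T (\<lambda>t s. deriv \<psi> t * u t s) y \<and>
    has_Bochner_integral_in st.X st.N T (\<lambda>t s. \<psi> t * v t s) z \<and> st.N (\<lambda>s. y s + z s) = 0"
  proof (rule st.scaled_Bochner_integral_exists [OF time.continuous_measurable_M [OF c(2)] b(1) u_approx(1,2,3) C0 u_approx(4)])
    fix y assume y: "has_Bochner_integral_in st.X st.N T (\<lambda>t s. deriv \<psi> t * u t s) y"
    show ?thesis
    proof (rule w_dominated)
      fix H assume H: "sq_int MT H" "AE t in MT. \<forall>n. nrm (w n t) \<le> H t"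
      show ?thesis
      proof (rule st.scaled_Bochner_integral_exists [OF time.continuous_measurable_M [OF c(3)] b(2) v_approx
            time.sq_int_imp_integrable [OF H(1)] H(2)])
        fix z assume z: "has_Bochner_integral_in st.X st.N T (\<lambda>t s. \<psi> t * v t s) z"
        have sq: "sq_int M y" "sq_int M z"
          using y z by (simp_all add: has_Bochner_integral_in_def Lp_space_2_iff)
        define e where "e s = y s + z s" for s
        have e: "sq_int M e" unfolding e_def by (intro sq_int_add sq)
        have pull: "ip (\<lambda>s. a * f s) e = a * ip f e" for a f by (simp only: mult.assoc integral_mult_right_zero)
        have "ip y e = (LINT t|MT. ip (u t) e * deriv \<psi> t)"
          unfolding st.Bochner_integral_pairing(2) [OF y e, symmetric] pull by (simp only: mult.commute)
        moreover have "ip z e = (LINT t|MT. ip (v t) e * \<psi> t)"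
          unfolding st.Bochner_integral_pairing(2) [OF z e, symmetric] pull by (simp only: mult.commute)
        moreover have "(LINT t|MT. ip (u t) e * deriv \<psi> t) = - (LINT t|MT. ip (v t) e * \<psi> t)"
          using time.prim_on_has_weak_deriv [OF u_primitive [OF e]] \<psi> by (simp add: has_weak_deriv_def)
        ultimately have "ip y e + ip z e = 0" by simp
        moreover have "ip e e = ip y e + ip z e"
          using sq e by (subst (1) e_def) (simp add: distrib_right sq_int_mult_integrable)
        ultimately have "nrm e = 0" by (simp add: L2_norm_on_def power2_eq_square)
        then have "st.N (\<lambda>s. y s + z s) = 0" by (simp add: st.N_eq e_def [abs_def])
        with y z show ?thesis by blast
      qed
    qed
  qed
qed

lemma u_H1: "u \<in> H1_L2 L T"
proof -
  have "strongly_measurable_in st.X st.N T u" by (rule st.strongly_measurableI [OF u_approx(1,2,3)])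
  moreover have "integrable MT (\<lambda>t. (nrm (u t))\<^sup>2)"
  proof (rule time.integrable_const_bound [where B="C0\<^sup>2"])
    have zero: "simple_in st.X T (\<lambda>t s. 0)" by (simp add: simple_in_def Lp_space_2_iff)
    have "(\<lambda>t. nrm (\<lambda>s. u t s - 0)) \<in> borel_measurable MT"
      by (rule st.strongly_measurable_nrm [OF st.strongly_measurableI [OF u_approx(1,2,3)] zero])
    then show "(\<lambda>t. (nrm (u t))\<^sup>2) \<in> borel_measurable MT" by simp
    show "AE t in MT. norm ((nrm (u t))\<^sup>2) \<le> C0\<^sup>2"
      using u_bound by (intro AE_I2) (auto intro: power_mono)
  qed
  moreover have "strongly_measurable_in st.X st.N T v" by (rule st.strongly_measurableI [OF v_approx])
  moreover have "integrable MT (\<lambda>t. (nrm (v t))\<^sup>2)" by (rule w_dominated) (rule sq_int_integrable)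
  ultimately show ?thesis
    using u_weak_time_deriv unfolding Bochner_H1_def Bochner_L2_def st.N_eq by blast
qed

lemma u_continuous: "continuous_in st.X st.N T u"
  unfolding continuous_in_def st.N_eq Lp_space_2_iff
proof (intro ballI conjI)
  fix t assume t: "t \<in> {0..<T}"
  then show "sq_int M (u t)" by (intro ub_converges) auto
  show "((\<lambda>r. nrm (\<lambda>s. u r s - u t s)) \<longlongrightarrow> 0) (at t within {0..<T})"
  proof (rule Lim_null_comparison)
    have "((\<lambda>r. sqrt (2 * E * \<bar>r - t\<bar>)) \<longlongrightarrow> sqrt (2 * E * \<bar>t - t\<bar>)) (at t within {0..<T})" by (intro tendsto_intros)
    then show "((\<lambda>r. sqrt (2 * E * \<bar>r - t\<bar>)) \<longlongrightarrow> 0) (at t within {0..<T})" by simp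
    have "nrm (\<lambda>s. u r s - u t s) \<le> sqrt (2 * E * \<bar>r - t\<bar>)" if "r \<in> {0..<T}" for r
    proof (cases "t \<le> r")
      case True
      then show ?thesis using u_Hoelder [of t r] t that by simp
    next
      case False
      then show ?thesis using u_Hoelder [of r t] t that by (subst L2_norm_on_commute) simp
    qed
    then show "\<forall>\<^sub>F r in at t within {0..<T}. norm (nrm (\<lambda>s. u r s - u t s)) \<le> sqrt (2 * E * \<bar>r - t\<bar>)"
      by (simp add: eventually_at_filter always_eventually)
  qed
qed

lemma W1p_norm_tendsto:
  assumes t: "t \<in> space MT" and g: "limit_at t g"
  shows "(\<lambda>n. W1p_norm p 0 L (\<lambda>s. u t s - ub n t s)) \<longlonglongrightarrow> 0"
proof -
  have t': "0 \<le> t" "t \<le> T" using t by auto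
  have W: "W_rep (u t) g" and gp: "(\<lambda>n. LINT x|M. \<bar>gb n t x - g x\<bar> powr p) \<longlonglongrightarrow> 0"
    using g by (simp_all add: limit_at_def)
  have p0: "p > 0" using p_gt_1 by simp
  have g1: "(\<lambda>n. LINT x|M. \<bar>gb n t x - g x\<bar>) \<longlonglongrightarrow> 0"
    by (rule Lp_conv_imp_L1_conv [OF p_gt_1 W_rep_p_int [OF W_rep_diff [OF ub_W W]] gp])
  have le: "W1p_norm p 0 L (\<lambda>s. u t s - ub n t s) \<le>
      (nrm (\<lambda>s. ub n t s - u t s) / sqrt L + (LINT x|M. \<bar>gb n t x - g x\<bar>)) * L powr (1 / p) +
      (LINT x|M. \<bar>gb n t x - g x\<bar> powr p) powr (1 / p)" for n
    using W1p_norm_le [OF W_rep_diff [OF W ub_W], of n t]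
    unfolding abs_minus_commute [of "g _"] L2_norm_on_commute [of M "u t"] .
  have "(\<lambda>n. (nrm (\<lambda>s. ub n t s - u t s) / sqrt L + (LINT x|M. \<bar>gb n t x - g x\<bar>)) * L powr (1 / p) +
      (LINT x|M. \<bar>gb n t x - g x\<bar> powr p) powr (1 / p)) \<longlonglongrightarrow> (0 / sqrt L + 0) * L powr (1 / p) + 0"
  proof (intro tendsto_add tendsto_mult tendsto_divide tendsto_const ub_converges(2) [OF t'] g1)
    show "sqrt L \<noteq> 0" using L_pos by simp
    show "(\<lambda>n. (LINT x|M. \<bar>gb n t x - g x\<bar> powr p) powr (1 / p)) \<longlonglongrightarrow> 0"
      using tendsto_powr' [OF gp tendsto_const [of "1 / p"]] p0 by (simp add: Bochner_Integration.integral_nonneg)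
  qed
  then have lim: "(\<lambda>n. (nrm (\<lambda>s. ub n t s - u t s) / sqrt L + (LINT x|M. \<bar>gb n t x - g x\<bar>)) * L powr (1 / p) +
      (LINT x|M. \<bar>gb n t x - g x\<bar> powr p) powr (1 / p)) \<longlonglongrightarrow> 0" by simp
  have "W1p_norm p 0 L f \<ge> 0" for f by (simp add: W1p_norm_def Lp_norm_def)
  with le show ?thesis by (intro Lim_null_comparison [OF always_eventually lim]) simp
qed

lemma W1p_norm_u_le:
  assumes t: "t \<in> space MT" and g: "limit_at t g"
  shows "W1p_norm p 0 L (u t) \<le> (C0 / sqrt L + (L + 2 powr p * (p * E + \<bar>phi_deriv\<bar> powr p * L))) * L powr (1 / p) +
    (2 powr p * (p * E + \<bar>phi_deriv\<bar> powr p * L)) powr (1 / p)"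
proof -
  have t': "0 \<le> t" "t \<le> T" using t by auto
  have p1: "p \<ge> 1" using p_gt_1 by simp
  have W: "W_rep (u t) g" and en: "energy g \<le> p * E" using g by (simp_all add: limit_at_def)
  note gp = W_rep_p_int [OF W]
  have gpi: "integrable M (\<lambda>x. \<bar>g x\<bar> powr p)" using gp by (simp add: p_int_def)
  have g_p: "(LINT x|M. \<bar>g x\<bar> powr p) \<le> 2 powr p * (p * E + \<bar>phi_deriv\<bar> powr p * L)"
  proof -
    have "(LINT x|M. \<bar>g x\<bar> powr p) \<le> (LINT x|M. 2 powr p * (\<bar>g x + phi_deriv\<bar> powr p + \<bar>- phi_deriv\<bar> powr p))"
    proof (rule integral_mono [OF gpi])
      show "integrable M (\<lambda>x. 2 powr p * (\<bar>g x + phi_deriv\<bar> powr p + \<bar>- phi_deriv\<bar> powr p))"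
        using energy_integrable [OF W] by simp
      show "\<bar>g x\<bar> powr p \<le> 2 powr p * (\<bar>g x + phi_deriv\<bar> powr p + \<bar>- phi_deriv\<bar> powr p)" for x
        using powr_abs_add_le [OF p1, of "g x + phi_deriv" "- phi_deriv"] by simp
    qed
    also have "\<dots> = 2 powr p * (energy g + \<bar>phi_deriv\<bar> powr p * L)"
      using energy_integrable [OF W] integral_const_M [of "\<bar>phi_deriv\<bar> powr p"]
      by (simp add: energy_def del: lebesgue_integral_const)
    also have "\<dots> \<le> 2 powr p * (p * E + \<bar>phi_deriv\<bar> powr p * L)" using en by (intro mult_left_mono) auto
    finally show ?thesis .
  qed
  have "(LINT x|M. \<bar>g x\<bar>) \<le> (LINT x|M. 1 + \<bar>g x\<bar> powr p)"
    by (rule integral_mono) (use p_int_imp_integrable [OF p1 gp] gpi abs_le_1_plus_powr [OF p1] in auto)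
  also have "\<dots> = L + (LINT x|M. \<bar>g x\<bar> powr p)"
    using gpi integral_const_M [of 1] by (simp del: lebesgue_integral_const)
  finally have g_1: "(LINT x|M. \<bar>g x\<bar>) \<le> L + 2 powr p * (p * E + \<bar>phi_deriv\<bar> powr p * L)" using g_p by linarith
  have "W1p_norm p 0 L (u t) \<le> (nrm (u t) / sqrt L + (LINT x|M. \<bar>g x\<bar>)) * L powr (1 / p) + (LINT x|M. \<bar>g x\<bar> powr p) powr (1 / p)"
    by (rule W1p_norm_le [OF W])
  also have "\<dots> \<le> (C0 / sqrt L + (L + 2 powr p * (p * E + \<bar>phi_deriv\<bar> powr p * L))) * L powr (1 / p) +
      (2 powr p * (p * E + \<bar>phi_deriv\<bar> powr p * L)) powr (1 / p)"
    using g_p g_1 p1 L_pos u_bound [OF t']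
    by (intro add_mono mult_right_mono divide_right_mono powr_mono2) (auto intro: Bochner_Integration.integral_nonneg)
  finally show ?thesis .
qed

text \<open>The iterates themselves, as step functions of time, serve as simple approximants in the
  Sobolev norm.\<close>

lemma u_Linf: "u \<in> Linf_W1p_per p L T"
proof -
  have "AE t in MT. u t \<in> W1p_per p L"
    using AE_limit_at by eventually_elim (auto simp: limit_at_def intro: W_rep_in_W1p_per)
  moreover have "simple_in (W1p_per p L) T (ub n)" for n
    using simple_ub W_rep_in_W1p_per [OF ub_W] by (simp add: simple_in_def)
  moreover have "AE t in MT. (\<lambda>n. W1p_norm p 0 L (\<lambda>s. u t s - ub n t s)) \<longlonglongrightarrow> 0"
    using AE_limit_at AE_space by eventually_elim (auto intro: W1p_norm_tendsto)
  ultimately have "strongly_measurable_in (W1p_per p L) (W1p_norm p 0 L) T u"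
    unfolding strongly_measurable_in_def by blast
  moreover have "AE t in MT. W1p_norm p 0 L (u t) \<le>
      (C0 / sqrt L + (L + 2 powr p * (p * E + \<bar>phi_deriv\<bar> powr p * L))) * L powr (1 / p) +
      (2 powr p * (p * E + \<bar>phi_deriv\<bar> powr p * L)) powr (1 / p)"
    using AE_limit_at AE_space
  proof eventually_elim
    case (elim t)
    then show ?case using W1p_norm_u_le by blast
  qed
  ultimately show ?thesis unfolding Bochner_Linf_def by blast
qed

text \<open>Formulated for any d that agrees with \<open>v t\<close> almost everywhere, because the
  time derivative in the definition of a weak solution is such a representative; the two weak space
  derivatives are exchanged in the same way.\<close>

lemma inner_integral_zero:
  assumes t: "t \<in> space MT" and g: "limit_at t g" and c: "conv_at t" and \<phi>: "\<phi> \<in> W1p_per p L"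
    and d: "AE s in M. d s = v t s"
  shows "(LINT s|M. (d s - mu1 t * sin (u t s + ph s) + mu2 t * cos (u t s + ph s)) * \<phi> s
    + \<bar>weak_deriv 0 L (\<lambda>x. u t x + ph x) s\<bar> powr (p - 2) * weak_deriv 0 L (\<lambda>x. u t x + ph x) s * weak_deriv 0 L \<phi> s) = 0"
    (is "(LINT s|M. ?I s) = 0")
proof (rule W1p_per_imp_W_rep [OF \<phi>])
  fix \<phi>' assume W\<phi>: "W_rep \<phi> \<phi>'"
  have W: "W_rep (u t) g" using g by (simp add: limit_at_def)
  have sq: "sq_int M (v t)" "sq_int M (sn (u t))" "sq_int M (cs (u t))" "sq_int M \<phi>"
    using c sn_sq_int [OF W] cs_sq_int [OF W] W_rep_sq_int [OF W\<phi>] by (simp_all add: conv_at_def)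
  define J where "J s = (v t s * \<phi> s - mu1 t * (sn (u t) s * \<phi> s) + mu2 t * (cs (u t) s * \<phi> s)) + pflux p (g s + phi_deriv) * \<phi>' s" for s
  have i: "integrable M (\<lambda>s. v t s * \<phi> s)" "integrable M (\<lambda>s. sn (u t) s * \<phi> s)" "integrable M (\<lambda>s. cs (u t) s * \<phi> s)"
    "integrable M (\<lambda>s. pflux p (g s + phi_deriv) * \<phi>' s)"
    by (intro sq_int_mult_integrable pflux_mult_integrable p_gt_1 p_int_theta [OF W] W_rep_p_int [OF W\<phi>] sq)+
  have J: "J \<in> borel_measurable M"
    unfolding J_def [abs_def]
    by (intro borel_measurable_integrable Bochner_Integration.integrable_add Bochner_Integration.integrable_diff integrable_mult_right i)
  have "AE s in M. J s = ?I s"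
    using d prim_on_weak_deriv [OF prim_on_theta [OF W]] prim_on_weak_deriv [OF W_rep_prim_on [OF W\<phi>]]
    by eventually_elim (simp add: J_def pflux_def algebra_simps)
  then have "(LINT s|M. J s) = (LINT s|M. ?I s)"
    by (intro integral_cong_AE J borel_measurable_AE_M [OF J])
  moreover have "(LINT s|M. J s) = ip (v t) \<phi> - mu1 t * ip (sn (u t)) \<phi> + mu2 t * ip (cs (u t)) \<phi> +
      (LINT x|M. pflux p (g x + phi_deriv) * \<phi>' x)"
    unfolding J_def using i by simp
  ultimately show ?thesis using limit_equation [OF t g c W\<phi>] by simp
qed

theorem weak_solution_u: "weak_solution p L \<eta> u0 T u"
proof -
  have "has_weak_time_deriv st.X st.N T u (time_deriv_L2 L T u)"
    unfolding weak_time_deriv_def by (rule someI [of _ v]) (rule u_weak_time_deriv)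
  then have d: "AE t in MT. AE s in M. time_deriv_L2 L T u t s = v t s"
    by (rule st.weak_time_deriv_unique [OF u_weak_time_deriv])
  have eq: "(LINT t|MT. LINT s|M.
      (time_deriv_L2 L T u t s - mu1 t * sin (u t s + ph s) + mu2 t * cos (u t s + ph s)) * \<phi> t s
      + \<bar>weak_deriv 0 L (\<lambda>x. u t x + ph x) s\<bar> powr (p - 2) * weak_deriv 0 L (\<lambda>x. u t x + ph x) s * weak_deriv 0 L (\<phi> t) s) = 0"
    if \<phi>: "\<phi> \<in> Linf_W1p_per p L T" for \<phi>
  \<comment> \<open>The equation holds at almost every time separately, so the outer integral is
    that of a function vanishing almost everywhere.\<close>
  proof (rule integral_eq_zero_AE)
    have "AE t in MT. \<phi> t \<in> W1p_per p L" using \<phi> by (simp add: Bochner_Linf_def strongly_measurable_in_def)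
    then show "AE t in MT. (LINT s|M.
        (time_deriv_L2 L T u t s - mu1 t * sin (u t s + ph s) + mu2 t * cos (u t s + ph s)) * \<phi> t s
        + \<bar>weak_deriv 0 L (\<lambda>x. u t x + ph x) s\<bar> powr (p - 2) * weak_deriv 0 L (\<lambda>x. u t x + ph x) s * weak_deriv 0 L (\<phi> t) s) = 0"
      using AE_limit_at AE_conv_at d AE_space
    proof eventually_elim
      case (elim t)
      obtain g where "limit_at t g" using elim(2) ..
      then show ?case by (rule inner_integral_zero [OF elim(5) _ elim(3) elim(1) elim(4)])
    qed
  qed
  have "u 0 \<in> W1p_per p L" unfolding u_0 using W_rep_in_W1p_per [OF W_U [of 0 0]] by (simp only: U_0)
  moreover have "\<forall>t\<in>{0..<T}. (LINT s|M. cos (u t s + ph s)) = 0 \<and> (LINT s|M. sin (u t s + ph s)) = 0"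
    using u_constraint by simp
  moreover have "\<exists>\<mu>1 \<in> Lp_space 2 0 T. \<exists>\<mu>2 \<in> Lp_space 2 0 T. \<forall>\<phi> \<in> Linf_W1p_per p L T. (LINT t|MT. LINT s|M.
      (time_deriv_L2 L T u t s - \<mu>1 t * sin (u t s + ph s) + \<mu>2 t * cos (u t s + ph s)) * \<phi> t s
      + \<bar>weak_deriv 0 L (\<lambda>x. u t x + ph x) s\<bar> powr (p - 2) * weak_deriv 0 L (\<lambda>x. u t x + ph x) s * weak_deriv 0 L (\<phi> t) s) = 0"
    by (rule bexI [OF _ mu_L2(1)], rule bexI [OF _ mu_L2(2)], rule ballI, rule eq)
  ultimately show ?thesis unfolding weak_solution_def using u_Linf u_H1 u_continuous u_0 by blast
qed

end

theorem theorem1p1: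
  fixes L p :: real and \<eta> :: nat and u0 :: "real \<Rightarrow> real"
  assumes "L > 0" and "\<eta> \<ge> 1" and "1 < p"
    and "u0 \<in> W1p_per p L"
    and "(LINT s|lebesgue_on {0<..<L}. cos (u0 s + phi L \<eta> s)) = 0"
    and "(LINT s|lebesgue_on {0<..<L}. sin (u0 s + phi L \<eta> s)) = 0"
  shows "\<exists>T>0. \<exists>u. weak_solution p L \<eta> u0 T u"
  proof -
  interpret periodic_interval L p \<eta>
    by unfold_locales (fact assms)+
  have init: "(LINT x|M. sn u0 x) = 0" "(LINT x|M. cs u0 x) = 0" by (fact assms)+
  obtain g0 where "W_rep u0 g0" by (rule W1p_per_imp_W_rep [OF assms(4)])
  then show ?thesis
  proof (rule scheme_exists [OF _ init])
    fix T0 \<Lambda> E :: real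
    assume pos: "T0 > 0" "\<Lambda> \<ge> 0" "E \<ge> 0"
      and ex: "\<And>N \<tau>. \<tau> > 0 \<Longrightarrow> real N * \<tau> \<le> T0 \<Longrightarrow> \<exists>U G l1 l2. scheme E \<Lambda> N \<tau> U G l1 l2 \<and> U 0 = u0"
    \<comment> \<open>\<open>T0\<close> guards the Gram determinant; the second entry secures the
      absorption in the comparison of schemes, with an added 1 to cover
      \<open>\<Lambda> = 0\<close>.\<close>
    define T where "T = min T0 (1 / (32 * \<Lambda> + 1))"
    have T: "T > 0" using pos by (simp add: T_def)
    have "32 * \<Lambda> * T \<le> 32 * \<Lambda> * (1 / (32 * \<Lambda> + 1))" using pos by (intro mult_left_mono) (auto simp: T_def)
    also have "\<dots> \<le> 1" using pos by simp
    finally have small: "32 * \<Lambda> * T \<le> 1" .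
    have "\<exists>U G l1 l2. scheme E \<Lambda> (2 ^ n) (T / 2 ^ n) U G l1 l2 \<and> U 0 = u0" for n
      by (rule ex) (use T in \<open>simp_all add: T_def\<close>)
    then obtain U G l1 l2 where sch: "\<And>n. scheme E \<Lambda> (2 ^ n) (T / 2 ^ n) (U n) (G n) (l1 n) (l2 n)"
      "\<And>n. U n 0 = u0" by metis
    interpret discrete_flow L p \<eta> T E \<Lambda> u0 U G l1 l2
      by unfold_locales (fact T pos small sch)+
    show ?thesis using T weak_solution_u by blast
  qed
qed

end
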